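(* There is a sentence in the language $\{\in\}$ which is provable in $\mathrm{ZC} + \mathrm{GC}$ and not provable in $\mathrm{ZC}$.
   Context: $\mathrm{Z}$ denotes the theory consisting of the axioms of Extensionality, Pairing, Union, Comprehension (as a schema), Power Set, and Infinity. Foundation is not included. $\mathrm{ZC}$ is $\mathrm{Z}$ plus the Axiom of Choice. $\mathrm{ZC} + \mathrm{GC}$ (Global Choice) is the theory in the language $\{\in, j\}$, with $j$ a new unary function symbol, consisting of $\mathrm{ZC}$, the axiom that $j$ is a class choice function on all nonempty sets (i.e. $j(x) \in x$ for every nonempty $x$), and the Comprehension schema extended to formulas that mention $j$. The result is proved with $\mathrm{ZF}$ as the metatheory. *)

theory Defs
  imports Main
begin

section \<open>Syntax of the language \<open>{\<in>, j}\<close>\<close>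

text \<open>Variables are de Bruijn indices: \<open>Var n\<close> refers to the \<open>n\<close>-th enclosing quantifier, counted
  from the innermost one, and is free if there are at most \<open>n\<close> enclosing quantifiers.\<close>

datatype tm = Var nat | J tm

datatype fm =
    Eq tm tm (infix \<open>\<^bold>=\<close> 55)
  | Mem tm tm (infix \<open>\<^bold>\<in>\<close> 55)
  | Bot (\<open>\<^bold>\<bottom>\<close>)
  | Imp fm fm (infixr \<open>\<^bold>\<longrightarrow>\<close> 40)
  | Forall fm

abbreviation Neg :: "fm \<Rightarrow> fm" (\<open>\<^bold>\<not> _\<close> [52] 52) where
  "\<^bold>\<not> p \<equiv> p \<^bold>\<longrightarrow> \<^bold>\<bottom>"

abbreviation Conj :: "fm \<Rightarrow> fm \<Rightarrow> fm" (infixr \<open>\<^bold>\<and>\<close> 50) where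
  "p \<^bold>\<and> q \<equiv> \<^bold>\<not> (p \<^bold>\<longrightarrow> \<^bold>\<not> q)"

abbreviation Disj :: "fm \<Rightarrow> fm \<Rightarrow> fm" (infixr \<open>\<^bold>\<or>\<close> 45) where
  "p \<^bold>\<or> q \<equiv> \<^bold>\<not> p \<^bold>\<longrightarrow> q"

abbreviation Iff :: "fm \<Rightarrow> fm \<Rightarrow> fm" (infix \<open>\<^bold>\<longleftrightarrow>\<close> 38) where
  "p \<^bold>\<longleftrightarrow> q \<equiv> (p \<^bold>\<longrightarrow> q) \<^bold>\<and> (q \<^bold>\<longrightarrow> p)"

abbreviation Exists :: "fm \<Rightarrow> fm" where
  "Exists p \<equiv> \<^bold>\<not> Forall (\<^bold>\<not> p)"

text \<open>The language \<open>{\<in>}\<close>, as a set of formulas; the language \<open>{\<in>, j}\<close> consists of all formulas.\<close>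

primrec jfree_tm :: "tm \<Rightarrow> bool" where
  "jfree_tm (Var n) = True"
| "jfree_tm (J t) = False"

primrec jfree :: "fm \<Rightarrow> bool" where
  "jfree (s \<^bold>= t) = (jfree_tm s \<and> jfree_tm t)"
| "jfree (s \<^bold>\<in> t) = (jfree_tm s \<and> jfree_tm t)"
| "jfree \<^bold>\<bottom> = True"
| "jfree (p \<^bold>\<longrightarrow> q) = (jfree p \<and> jfree q)"
| "jfree (Forall p) = jfree p"

definition L_mem :: "fm set" where
  "L_mem = {p. jfree p}"

definition L_mem_j :: "fm set" where
  "L_mem_j = UNIV"

text \<open>Strict upper bound on the indices of the free variables.\<close>

primrec free_bound_tm :: "tm \<Rightarrow> nat" where
  "free_bound_tm (Var n) = Suc n"
| "free_bound_tm (J t) = free_bound_tm t"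

primrec free_bound :: "fm \<Rightarrow> nat" where
  "free_bound (s \<^bold>= t) = max (free_bound_tm s) (free_bound_tm t)"
| "free_bound (s \<^bold>\<in> t) = max (free_bound_tm s) (free_bound_tm t)"
| "free_bound \<^bold>\<bottom> = 0"
| "free_bound (p \<^bold>\<longrightarrow> q) = max (free_bound p) (free_bound q)"
| "free_bound (Forall p) = free_bound p - 1"

definition sentence :: "fm \<Rightarrow> bool" where
  "sentence p \<longleftrightarrow> free_bound p = 0"

definition univ_closure :: "fm \<Rightarrow> fm" where
  "univ_closure p = (Forall ^^ free_bound p) p"

primrec subst_tm :: "(nat \<Rightarrow> tm) \<Rightarrow> tm \<Rightarrow> tm" where
  "subst_tm \<sigma> (Var n) = \<sigma> n"
| "subst_tm \<sigma> (J t) = J (subst_tm \<sigma> t)"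

definition lift_subst :: "(nat \<Rightarrow> tm) \<Rightarrow> nat \<Rightarrow> tm" where
  "lift_subst \<sigma> = case_nat (Var 0) (\<lambda>n. subst_tm (\<lambda>k. Var (Suc k)) (\<sigma> n))"

primrec subst :: "(nat \<Rightarrow> tm) \<Rightarrow> fm \<Rightarrow> fm" where
  "subst \<sigma> (s \<^bold>= t) = (subst_tm \<sigma> s \<^bold>= subst_tm \<sigma> t)"
| "subst \<sigma> (s \<^bold>\<in> t) = (subst_tm \<sigma> s \<^bold>\<in> subst_tm \<sigma> t)"
| "subst \<sigma> \<^bold>\<bottom> = \<^bold>\<bottom>"
| "subst \<sigma> (p \<^bold>\<longrightarrow> q) = (subst \<sigma> p \<^bold>\<longrightarrow> subst \<sigma> q)"
| "subst \<sigma> (Forall p) = Forall (subst (lift_subst \<sigma>) p)"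

definition rename :: "(nat \<Rightarrow> nat) \<Rightarrow> fm \<Rightarrow> fm" where
  "rename r = subst (\<lambda>n. Var (r n))"

definition inst :: "fm \<Rightarrow> tm \<Rightarrow> fm" where
  "inst p t = subst (case_nat t Var) p"


section \<open>Provability\<close>

text \<open>A Hilbert calculus for classical first-order logic with equality. Every formula of a
  derivation belongs to the language \<open>L\<close>, so that derivations in a theory over \<open>{\<in>}\<close> do not
  mention \<open>j\<close>. The theories \<open>T\<close> below consist of sentences, for which generalization is
  unrestricted.\<close>

inductive provable :: "fm set \<Rightarrow> fm set \<Rightarrow> fm \<Rightarrow> bool" for L T where
  axiom: "p \<in> T \<Longrightarrow> p \<in> L \<Longrightarrow> provable L T p"
| imp_K: "(p \<^bold>\<longrightarrow> q \<^bold>\<longrightarrow> p) \<in> L \<Longrightarrow> provable L T (p \<^bold>\<longrightarrow> q \<^bold>\<longrightarrow> p)"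
| imp_S: "((p \<^bold>\<longrightarrow> q \<^bold>\<longrightarrow> r) \<^bold>\<longrightarrow> (p \<^bold>\<longrightarrow> q) \<^bold>\<longrightarrow> p \<^bold>\<longrightarrow> r) \<in> L \<Longrightarrow>
    provable L T ((p \<^bold>\<longrightarrow> q \<^bold>\<longrightarrow> r) \<^bold>\<longrightarrow> (p \<^bold>\<longrightarrow> q) \<^bold>\<longrightarrow> p \<^bold>\<longrightarrow> r)"
| neg_neg: "(\<^bold>\<not> \<^bold>\<not> p \<^bold>\<longrightarrow> p) \<in> L \<Longrightarrow> provable L T (\<^bold>\<not> \<^bold>\<not> p \<^bold>\<longrightarrow> p)"
| all_inst: "(Forall p \<^bold>\<longrightarrow> inst p t) \<in> L \<Longrightarrow> provable L T (Forall p \<^bold>\<longrightarrow> inst p t)"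
| all_imp: "(Forall (p \<^bold>\<longrightarrow> q) \<^bold>\<longrightarrow> Forall p \<^bold>\<longrightarrow> Forall q) \<in> L \<Longrightarrow>
    provable L T (Forall (p \<^bold>\<longrightarrow> q) \<^bold>\<longrightarrow> Forall p \<^bold>\<longrightarrow> Forall q)"
| all_vacuous: "(p \<^bold>\<longrightarrow> Forall (rename Suc p)) \<in> L \<Longrightarrow> provable L T (p \<^bold>\<longrightarrow> Forall (rename Suc p))"
| eq_refl: "(t \<^bold>= t) \<in> L \<Longrightarrow> provable L T (t \<^bold>= t)"
| eq_subst: "(s \<^bold>= t \<^bold>\<longrightarrow> inst p s \<^bold>\<longrightarrow> inst p t) \<in> L \<Longrightarrow>
    provable L T (s \<^bold>= t \<^bold>\<longrightarrow> inst p s \<^bold>\<longrightarrow> inst p t)"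
| modus_ponens: "provable L T (p \<^bold>\<longrightarrow> q) \<Longrightarrow> provable L T p \<Longrightarrow> provable L T q"
| generalization: "provable L T p \<Longrightarrow> provable L T (Forall p)"

definition consistent :: "fm set \<Rightarrow> fm set \<Rightarrow> bool" where
  "consistent L T \<longleftrightarrow> \<not> provable L T \<^bold>\<bottom>"


section \<open>Axioms of set theory\<close>

(* \<forall>x y. (\<forall>z. z \<in> x \<longleftrightarrow> z \<in> y) \<longrightarrow> x = y *)
definition Ax_Extensionality :: fm where
  "Ax_Extensionality =
    Forall (Forall (Forall (Var 0 \<^bold>\<in> Var 2 \<^bold>\<longleftrightarrow> Var 0 \<^bold>\<in> Var 1) \<^bold>\<longrightarrow> Var 1 \<^bold>= Var 0))"

(* \<forall>x y. \<exists>u. \<forall>z. z \<in> u \<longleftrightarrow> z = x \<or> z = y *)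
definition Ax_Pairing :: fm where
  "Ax_Pairing =
    Forall (Forall (Exists (Forall (Var 0 \<^bold>\<in> Var 1 \<^bold>\<longleftrightarrow> Var 0 \<^bold>= Var 3 \<^bold>\<or> Var 0 \<^bold>= Var 2))))"

(* \<forall>x. \<exists>u. \<forall>z. z \<in> u \<longleftrightarrow> (\<exists>y. y \<in> x \<and> z \<in> y) *)
definition Ax_Union :: fm where
  "Ax_Union =
    Forall (Exists (Forall (Var 0 \<^bold>\<in> Var 1 \<^bold>\<longleftrightarrow> Exists (Var 0 \<^bold>\<in> Var 3 \<^bold>\<and> Var 1 \<^bold>\<in> Var 0))))"

(* \<forall>x. \<exists>u. \<forall>z. z \<in> u \<longleftrightarrow> (\<forall>w. w \<in> z \<longrightarrow> w \<in> x) *)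
definition Ax_Power_Set :: fm where
  "Ax_Power_Set =
    Forall (Exists (Forall (Var 0 \<^bold>\<in> Var 1 \<^bold>\<longleftrightarrow> Forall (Var 0 \<^bold>\<in> Var 1 \<^bold>\<longrightarrow> Var 0 \<^bold>\<in> Var 3))))"

(* \<exists>x. (\<exists>e. e \<in> x \<and> (\<forall>z. z \<notin> e)) \<and>
       (\<forall>y. y \<in> x \<longrightarrow> (\<exists>s. s \<in> x \<and> (\<forall>w. w \<in> s \<longleftrightarrow> w \<in> y \<or> w = y))) *)
definition Ax_Infinity :: fm where
  "Ax_Infinity =
    Exists (Exists (Var 0 \<^bold>\<in> Var 1 \<^bold>\<and> Forall (\<^bold>\<not> Var 0 \<^bold>\<in> Var 1)) \<^bold>\<and>
        Forall (Var 0 \<^bold>\<in> Var 1 \<^bold>\<longrightarrow>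
          Exists (Var 0 \<^bold>\<in> Var 2 \<^bold>\<and>
              Forall (Var 0 \<^bold>\<in> Var 1 \<^bold>\<longleftrightarrow> Var 0 \<^bold>\<in> Var 2 \<^bold>\<or> Var 0 \<^bold>= Var 2))))"

(* \<forall>x. \<exists>u. \<forall>z. z \<in> u \<longleftrightarrow> z \<in> x \<and> p(z, x, params),
   where the free variables of p are numbered in this order; u is not free in p *)
definition Comprehension_instance :: "fm \<Rightarrow> fm" where
  "Comprehension_instance p = univ_closure
    (Forall (Exists (Forall (Var 0 \<^bold>\<in> Var 1 \<^bold>\<longleftrightarrow>
      Var 0 \<^bold>\<in> Var 2 \<^bold>\<and> rename (case_nat 0 (\<lambda>n. n + 2)) p))))"

definition Comprehension :: "fm set \<Rightarrow> fm set" where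
  "Comprehension L = Comprehension_instance ` L"

(* p = {a, b} *)
definition is_upair :: "nat \<Rightarrow> nat \<Rightarrow> nat \<Rightarrow> fm" where
  "is_upair p a b =
    Forall (Var 0 \<^bold>\<in> Var (p + 1) \<^bold>\<longleftrightarrow> Var 0 \<^bold>= Var (a + 1) \<^bold>\<or> Var 0 \<^bold>= Var (b + 1))"

(* p = {{a}, {a, b}} *)
definition is_pair :: "nat \<Rightarrow> nat \<Rightarrow> nat \<Rightarrow> fm" where
  "is_pair p a b =
    Exists (Exists (is_upair 1 (a + 2) (a + 2) \<^bold>\<and> is_upair 0 (a + 2) (b + 2) \<^bold>\<and> is_upair (p + 2) 1 0))"

(* Every set x of nonempty sets has a choice function f:
   \<forall>x. (\<forall>y. y \<in> x \<longrightarrow> (\<exists>z. z \<in> y)) \<longrightarrow>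
       (\<exists>f. (\<forall>p. p \<in> f \<longrightarrow> (\<exists>y z. y \<in> x \<and> z \<in> y \<and> p = (y, z))) \<and>
            (\<forall>y. y \<in> x \<longrightarrow> (\<exists>z. \<forall>w. (\<exists>p. p \<in> f \<and> p = (y, w)) \<longleftrightarrow> w = z))) *)
definition Ax_Choice :: fm where
  "Ax_Choice =
    Forall (Forall (Var 0 \<^bold>\<in> Var 1 \<^bold>\<longrightarrow> Exists (Var 0 \<^bold>\<in> Var 1)) \<^bold>\<longrightarrow>
      Exists (Forall (Var 0 \<^bold>\<in> Var 1 \<^bold>\<longrightarrow>
              Exists (Exists (Var 1 \<^bold>\<in> Var 4 \<^bold>\<and> Var 0 \<^bold>\<in> Var 1 \<^bold>\<and> is_pair 2 1 0))) \<^bold>\<and>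
          Forall (Var 0 \<^bold>\<in> Var 2 \<^bold>\<longrightarrow>
              Exists (Forall (Exists (Var 0 \<^bold>\<in> Var 4 \<^bold>\<and> is_pair 0 3 1) \<^bold>\<longleftrightarrow> Var 0 \<^bold>= Var 1)))))"

(* \<forall>x. (\<exists>y. y \<in> x) \<longrightarrow> j(x) \<in> x *)
definition Ax_Global_Choice :: fm where
  "Ax_Global_Choice = Forall (Exists (Var 0 \<^bold>\<in> Var 1) \<^bold>\<longrightarrow> J (Var 0) \<^bold>\<in> Var 0)"

(* \<forall>x. (\<exists>y. y \<in> x) \<longrightarrow> (\<exists>y. y \<in> x \<and> (\<forall>z. z \<in> x \<longrightarrow> z \<notin> y)) *)
definition Ax_Foundation :: fm where
  "Ax_Foundation =
    Forall (Exists (Var 0 \<^bold>\<in> Var 1) \<^bold>\<longrightarrow>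
      Exists (Var 0 \<^bold>\<in> Var 1 \<^bold>\<and> Forall (Var 0 \<^bold>\<in> Var 2 \<^bold>\<longrightarrow> \<^bold>\<not> Var 0 \<^bold>\<in> Var 1)))"

(* \<forall>a. (\<forall>x. x \<in> a \<longrightarrow> (\<forall>y y'. p(y, x, a, params) \<and> p(y', x, a, params) \<longrightarrow> y = y')) \<longrightarrow>
       (\<exists>b. \<forall>y. y \<in> b \<longleftrightarrow> (\<exists>x. x \<in> a \<and> p(y, x, a, params))),
   where the free variables of p are numbered in this order; b is not free in p *)
definition Replacement_instance :: "fm \<Rightarrow> fm" where
  "Replacement_instance p = univ_closure
    (Forall (Forall (Var 0 \<^bold>\<in> Var 1 \<^bold>\<longrightarrow>
        Forall (Forall (rename (case_nat 1 (\<lambda>n. n + 2)) p \<^bold>\<and> rename (case_nat 0 (\<lambda>n. n + 2)) p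
          \<^bold>\<longrightarrow> Var 1 \<^bold>= Var 0))) \<^bold>\<longrightarrow>
      Exists (Forall (Var 0 \<^bold>\<in> Var 1 \<^bold>\<longleftrightarrow>
        Exists (Var 0 \<^bold>\<in> Var 3 \<^bold>\<and> rename (case_nat 1 (case_nat 0 (\<lambda>n. n + 3))) p)))))"

definition Replacement :: "fm set \<Rightarrow> fm set" where
  "Replacement L = Replacement_instance ` L"


section \<open>Theories\<close>

definition Z :: "fm set" where
  "Z = {Ax_Extensionality, Ax_Pairing, Ax_Union, Ax_Power_Set, Ax_Infinity} \<union> Comprehension L_mem"

definition ZC :: "fm set" where
  "ZC = Z \<union> {Ax_Choice}"

definition ZC_GC :: "fm set" where
  "ZC_GC = ZC \<union> {Ax_Global_Choice} \<union> Comprehension L_mem_j"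

text \<open>\<open>ZF\<close> serves only to express that the metatheory is \<open>ZF\<close>. That some sentence is unprovable in
  \<open>ZC\<close> entails the consistency of \<open>ZC\<close>, which is a theorem of \<open>ZF\<close> but exceeds the strength of HOL,
  so the consistency of \<open>ZF\<close> has to appear as a hypothesis.\<close>

definition ZF :: "fm set" where
  "ZF = Z \<union> {Ax_Foundation} \<union> Replacement L_mem"

end

theory Submission
  imports Defs "HOL-Library.Countable_Set"
begin

text \<open>
  The separating sentence speaks about two sets \<open>I\<close> and \<open>Y\<close> of labels. Every \<open>y \<in> Y\<close> labels a pair of
  socks, and every \<open>x \<in> I\<close> labels a set of goods, each of which contains one sock for every \<open>y\<close> in a
  certain set \<open>X x \<subseteq> Y\<close>. A global choice function picks a good for every \<open>x\<close> and a sock for every \<open>y\<close>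
  simultaneously, so a single relation on \<open>I \<times> Y\<close> records which socks the goods contain.

  Without global choice such a relation may fail to exist. Socks and goods are realised by
  self-membered atoms, and a world contains the goods for finitely many labels \<open>x\<close> only. The
  differences between the goods for \<open>x\<close> and \<open>x'\<close> are prescribed almost everywhere on \<open>X x \<inter> X x'\<close>, in
  such a way that the prescription can be met for finitely many \<open>x\<close>, whereas a diagonal argument along
  a tower of iterated power sets shows that it cannot be met for all \<open>x\<close> at once. Any two
  extensions of a world can be amalgamated after exchanging socks, and hence truth in the universe
  built over the atoms of a world does not depend on the world. This yields Comprehension for the
  union of these universes, which is thus a model of \<open>ZC\<close> in which no recording relation exists.

  As a ground model one needs a universe with choice in which sets can be closed under definable
  operations. It is obtained by compactness: in a model of \<open>ZF\<close>, membership relations are defined on the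
  ordinals by recursion, in the manner of the constructible hierarchy but for finitely many
  formulas at a time.
\<close>

section \<open>Semantics and soundness\<close>

text \<open>This is not a symmetric submodel: the universe over one world contains every subset that
  the ground model sees, so Choice is inherited from the ground model. Only uniformity across worlds
  is lost. Two extensions of a world may hold goods for the same label that no single world can hold
  together, so worlds are not directed and no limit structure is formed. Formulas are evaluated by
  letting quantifiers run through larger worlds; as truth is the same at all extensions of a world,
  this evaluation obeys classical logic.

  The missing axiom of Foundation is what makes the atoms visible to a formula in \<in> alone:
  self-membership marks an object, and its label is one of its other members.

  HOL has no universe of the required strength, so every model is a relation on the naturals
  delivered by the completeness theorem, possibly a nonstandard one. Separation then holds only for
  classes definable with parameters. Hence definability is tracked everywhere, and finiteness,
  ordinals, iteration and recursion are always meant in the sense of the model.\<close>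

primrec tmv :: "('a \<Rightarrow> 'a) \<Rightarrow> (nat \<Rightarrow> 'a) \<Rightarrow> tm \<Rightarrow> 'a" where
  "tmv j e (Var n) = e n"
| "tmv j e (J t) = j (tmv j e t)"

primrec sat :: "'a set \<Rightarrow> ('a \<Rightarrow> 'a \<Rightarrow> bool) \<Rightarrow> ('a \<Rightarrow> 'a) \<Rightarrow> (nat \<Rightarrow> 'a) \<Rightarrow> fm \<Rightarrow> bool" where
  "sat D R j e (s \<^bold>= t) = (tmv j e s = tmv j e t)"
| "sat D R j e (s \<^bold>\<in> t) = R (tmv j e s) (tmv j e t)"
| "sat D R j e \<^bold>\<bottom> = False"
| "sat D R j e (p \<^bold>\<longrightarrow> q) = (sat D R j e p \<longrightarrow> sat D R j e q)"
| "sat D R j e (Forall p) = (\<forall>x\<in>D. sat D R j (case_nat x e) p)"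

text \<open>Kripke-style forcing. Implication is interpreted locally, which is sound because it is only
  used when truth does not depend on the world.\<close>

primrec ksat :: "('w \<Rightarrow> 'w \<Rightarrow> bool) \<Rightarrow> ('w \<Rightarrow> 'a \<Rightarrow> bool) \<Rightarrow> ('a \<Rightarrow> 'a \<Rightarrow> bool) \<Rightarrow> ('a \<Rightarrow> 'a) \<Rightarrow>
    'w \<Rightarrow> (nat \<Rightarrow> 'a) \<Rightarrow> fm \<Rightarrow> bool" where
  "ksat le D R j w e (s \<^bold>= t) = (tmv j e s = tmv j e t)"
| "ksat le D R j w e (s \<^bold>\<in> t) = R (tmv j e s) (tmv j e t)"
| "ksat le D R j w e \<^bold>\<bottom> = False"
| "ksat le D R j w e (p \<^bold>\<longrightarrow> q) = (ksat le D R j w e p \<longrightarrow> ksat le D R j w e q)"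
| "ksat le D R j w e (Forall p) =
    (\<forall>w'. le w w' \<longrightarrow> (\<forall>x. D w' x \<longrightarrow> ksat le D R j w' (case_nat x e) p))"

lemma sat_eq_ksat: "sat D R j e p = ksat (\<lambda>_ _. True) (\<lambda>_ x. x \<in> D) R j () e p"
  by (induction p arbitrary: e) auto

lemma tmv_subst: "tmv j e (subst_tm \<sigma> t) = tmv j (\<lambda>n. tmv j e (\<sigma> n)) t"
  by (induction t) auto

lemma tmv_lift: "tmv j (case_nat x e) (lift_subst \<sigma> n) = case_nat x (\<lambda>n. tmv j e (\<sigma> n)) n"
  by (cases n) (auto simp: lift_subst_def tmv_subst)

lemma ksat_subst: "ksat le D R j w e (subst \<sigma> p) = ksat le D R j w (\<lambda>n. tmv j e (\<sigma> n)) p"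
  by (induction p arbitrary: e w \<sigma>) (auto simp: tmv_subst tmv_lift)

lemma ksat_inst: "ksat le D R j w e (inst p t) = ksat le D R j w (case_nat (tmv j e t) e) p"
proof -
  have "(\<lambda>n. tmv j e (case_nat t Var n)) = case_nat (tmv j e t) e"
    by (auto split: nat.splits)
  then show ?thesis by (simp add: inst_def ksat_subst)
qed

lemma ksat_rename: "ksat le D R j w e (rename r p) = ksat le D R j w (\<lambda>n. e (r n)) p"
  by (simp add: rename_def ksat_subst)

lemma sat_rename: "sat D R j e (rename r p) = sat D R j (\<lambda>n. e (r n)) p"
  by (simp add: sat_eq_ksat ksat_rename)

text \<open>\<open>le w w\<close> doubles as the statement that \<open>w\<close> is a world, so
  reflexivity is asked only at the upper end of a pair. \<open>invariance\<close> is what makes the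
  local reading of implication sound: a premise established at one world may be used at a larger
  one.\<close>

locale kripke =
  fixes le :: "'w \<Rightarrow> 'w \<Rightarrow> bool" and D :: "'w \<Rightarrow> 'a \<Rightarrow> bool"
    and R :: "'a \<Rightarrow> 'a \<Rightarrow> bool" and j :: "'a \<Rightarrow> 'a"
  assumes le_refl: "le w w' \<Longrightarrow> le w' w'"
    and D_mono: "le w w' \<Longrightarrow> D w x \<Longrightarrow> D w' x"
    and j_closed: "D w x \<Longrightarrow> D w (j x)"
    and invariance: "le w w' \<Longrightarrow> (\<And>n. D w (e n)) \<Longrightarrow> ksat le D R j w' e p = ksat le D R j w e p"
begin

lemma tmv_closed: "(\<And>n. D w (e n)) \<Longrightarrow> D w (tmv j e t)"
  by (induction t) (auto intro: j_closed)

lemma case_nat_closed: "D w x \<Longrightarrow> (\<And>n. D w (e n)) \<Longrightarrow> D w (case_nat x e n)"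
  by (cases n) auto

theorem soundness:
  assumes "provable L T p"
    and "\<And>q w e. q \<in> T \<Longrightarrow> le w w \<Longrightarrow> (\<And>n. D w (e n)) \<Longrightarrow> ksat le D R j w e q"
    and "le w w" "\<And>n. D w (e n)"
  shows "ksat le D R j w e p"
  using assms(1,3,4)
proof (induction arbitrary: w e)
  case (axiom p)
  then show ?case using assms(2) by blast
next
  case (all_inst p t)
  then show ?case using tmv_closed by (auto simp: ksat_inst)
next
  case (all_vacuous p)
  \<comment> \<open>The only axiom scheme that compares the truth of one formula at two worlds;
    here, and only here, soundness rests on invariance.\<close>
  have "ksat le D R j w' e p = ksat le D R j w e p" if "le w w'" for w'
    using invariance[OF that, of e p] all_vacuous.prems(2) by blast
  then show ?case by (simp add: ksat_rename)
next
  case (eq_subst s t p)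
  then show ?case by (auto simp: ksat_inst)
next
  case (generalization p)
  have "ksat le D R j w' (case_nat x e) p" if "le w w'" "D w' x" for w' x
    by (rule generalization.IH) (use that generalization.prems le_refl case_nat_closed D_mono in blast)+
  then show ?case by simp
qed auto

end

lemma sat_soundness:
  assumes "provable L T p" "\<And>q e. q \<in> T \<Longrightarrow> (\<And>n. e n \<in> D) \<Longrightarrow> sat D R j e q"
    "\<And>x. x \<in> D \<Longrightarrow> j x \<in> D" "\<And>n. e n \<in> D"
  shows "sat D R j e p"
proof -
  interpret kripke "\<lambda>(_::unit) (_::unit). True" "\<lambda>_ x. x \<in> D" R j
    using assms(3) by unfold_locales (auto simp: unit_eq)
  show ?thesis
    unfolding sat_eq_ksat
    using soundness[OF assms(1), where w = "()" and e = e] assms(2,4) by (auto simp: sat_eq_ksat)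
qed

lemma free_bound_tm_cong:
  "(\<And>n. n < free_bound_tm t \<Longrightarrow> e n = e' n) \<Longrightarrow> tmv j e t = tmv j e' t"
  by (induction t) auto

lemma ksat_cong:
  "(\<And>n. n < free_bound p \<Longrightarrow> e n = e' n) \<Longrightarrow> ksat le D R j w e p = ksat le D R j w e' p"
proof (induction p arbitrary: e e' w)
  case (Eq s t)
  then show ?case using free_bound_tm_cong[of s e e' j] free_bound_tm_cong[of t e e' j] by simp
next
  case (Mem s t)
  then show ?case using free_bound_tm_cong[of s e e' j] free_bound_tm_cong[of t e e' j] by simp
next
  case (Imp p q)
  then show ?case
    by (metis free_bound.simps(4) ksat.simps(4) less_max_iff_disj)
next
  case (Forall p)
  have "ksat le D R j w' (case_nat x e) p = ksat le D R j w' (case_nat x e') p" for w' x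
    by (rule Forall.IH) (use Forall.prems in \<open>auto split: nat.splits\<close>)
  then show ?case by simp
qed auto

lemma sat_cong:
  "(\<And>n. n < free_bound p \<Longrightarrow> e n = e' n) \<Longrightarrow> sat D R j e p = sat D R j e' p"
  unfolding sat_eq_ksat by (rule ksat_cong)

lemma free_bound_foralls: "free_bound ((Forall ^^ n) p) = free_bound p - n"
  by (induction n) auto

lemma sentence_univ_closure: "sentence (univ_closure p)"
  by (simp add: sentence_def univ_closure_def free_bound_foralls)

lemma sat_foralls:
  "sat UNIV R j e ((Forall ^^ n) p) \<longleftrightarrow> (\<forall>e'. (\<forall>k. e' (n + k) = e k) \<longrightarrow> sat UNIV R j e' p)"
proof (induction n arbitrary: p)
  case 0
  have "(\<forall>k. e' k = e k) \<longleftrightarrow> e' = e" for e' :: "nat \<Rightarrow> 'a" by auto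
  then show ?case by auto
next
  case (Suc n)
  have "sat UNIV R j e ((Forall ^^ Suc n) p) \<longleftrightarrow> sat UNIV R j e ((Forall ^^ n) (Forall p))"
    by (simp add: funpow_swap1)
  also have "\<dots> \<longleftrightarrow> (\<forall>e'. (\<forall>k. e' (n + k) = e k) \<longrightarrow> (\<forall>x. sat UNIV R j (case_nat x e') p))"
    by (simp add: Suc.IH)
  also have "\<dots> \<longleftrightarrow> (\<forall>e'. (\<forall>k. e' (Suc n + k) = e k) \<longrightarrow> sat UNIV R j e' p)"
  proof safe
    fix e' assume *: "\<forall>e'. (\<forall>k. e' (n + k) = e k) \<longrightarrow> (\<forall>x. sat UNIV R j (case_nat x e') p)"
      and "\<forall>k. e' (Suc n + k) = e k"
    then have "sat UNIV R j (case_nat (e' 0) (\<lambda>n. e' (Suc n))) p" by simp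
    moreover have "case_nat (e' 0) (\<lambda>n. e' (Suc n)) = e'" by (auto split: nat.splits)
    ultimately show "sat UNIV R j e' p" by simp
  qed auto
  finally show ?case .
qed

lemma sat_univ_closure: "sat UNIV R j e (univ_closure p) \<longleftrightarrow> (\<forall>e'. sat UNIV R j e' p)"
proof
  assume *: "sat UNIV R j e (univ_closure p)"
  show "\<forall>e'. sat UNIV R j e' p"
  proof
    fix e'
    \<comment> \<open>Values beyond \<open>free_bound p\<close> do not matter, so \<open>e'\<close>
      may continue there as the shifted \<open>e\<close>, which is the shape that
      \<open>sat_foralls\<close> asks for.\<close>
    define e'' where "e'' = (\<lambda>n. if n < free_bound p then e' n else e (n - free_bound p))"
    have "sat UNIV R j e'' p"
      using * unfolding univ_closure_def sat_foralls by (simp add: e''_def)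
    then show "sat UNIV R j e' p" using sat_cong[of p e'' e'] by (auto simp: e''_def)
  qed
qed (simp add: univ_closure_def sat_foralls)

lemma ksat_foralls:
  assumes "kripke le D R j" and "\<And>w e. le w w \<Longrightarrow> (\<And>n. D w (e n)) \<Longrightarrow> ksat le D R j w e p"
    and "le w w" "\<And>n. D w (e n)"
  shows "ksat le D R j w e ((Forall ^^ k) p)"
  using assms(3,4)
proof (induction k arbitrary: w e)
  case 0
  then show ?case using assms(2) by simp
next
  case (Suc k)
  interpret kripke le D R j by fact
  have "ksat le D R j w' (case_nat x e) ((Forall ^^ k) p)" if "le w w'" "D w' x" for w' x
    by (rule Suc.IH) (use that Suc.prems le_refl case_nat_closed D_mono in blast)+
  then show ?case by simp
qed


section \<open>Completeness\<close>

lemma subst_tm_cong: "(\<And>n. n < free_bound_tm t \<Longrightarrow> \<sigma> n = \<tau> n) \<Longrightarrow> subst_tm \<sigma> t = subst_tm \<tau> t"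
  by (induction t) auto

lemma subst_cong: "(\<And>n. n < free_bound p \<Longrightarrow> \<sigma> n = \<tau> n) \<Longrightarrow> subst \<sigma> p = subst \<tau> p"
proof (induction p arbitrary: \<sigma> \<tau>)
  case (Forall p)
  have "subst (lift_subst \<sigma>) p = subst (lift_subst \<tau>) p"
    by (rule Forall.IH) (use Forall.prems in \<open>auto simp: lift_subst_def split: nat.splits\<close>)
  then show ?case by simp
next
  case (Eq s t)
  then show ?case using subst_tm_cong[of s \<sigma> \<tau>] subst_tm_cong[of t \<sigma> \<tau>] by simp
next
  case (Mem s t)
  then show ?case using subst_tm_cong[of s \<sigma> \<tau>] subst_tm_cong[of t \<sigma> \<tau>] by simp
next
  case (Imp p q)
  then show ?case by (metis free_bound.simps(4) less_max_iff_disj subst.simps(4))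
qed auto

lemma subst_tm_Var: "subst_tm Var t = t"
  by (induction t) auto

lemma lift_subst_Var: "lift_subst Var = Var"
  by (auto simp: lift_subst_def split: nat.splits)

lemma subst_Var: "subst Var p = p"
  by (induction p) (auto simp: subst_tm_Var lift_subst_Var)

lemma subst_tm_comp: "subst_tm \<sigma> (subst_tm \<tau> t) = subst_tm (\<lambda>n. subst_tm \<sigma> (\<tau> n)) t"
  by (induction t) auto

lemma lift_subst_comp:
  "(\<lambda>n. subst_tm (lift_subst \<sigma>) (lift_subst \<tau> n)) = lift_subst (\<lambda>n. subst_tm \<sigma> (\<tau> n))"
  by (rule ext) (auto simp: lift_subst_def subst_tm_comp split: nat.splits)

lemma subst_comp: "subst \<sigma> (subst \<tau> p) = subst (\<lambda>n. subst_tm \<sigma> (\<tau> n)) p"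
  by (induction p arbitrary: \<sigma> \<tau>) (auto simp: subst_tm_comp lift_subst_comp)

lemma subst_inst: "subst \<sigma> (inst p t) = inst (subst (lift_subst \<sigma>) p) (subst_tm \<sigma> t)"
proof -
  have "(\<lambda>n. subst_tm \<sigma> (case_nat t Var n)) =
      (\<lambda>n. subst_tm (case_nat (subst_tm \<sigma> t) Var) (lift_subst \<sigma> n))"
    by (rule ext) (auto simp: lift_subst_def subst_tm_comp subst_tm_Var split: nat.splits)
  then show ?thesis by (simp add: inst_def subst_comp)
qed

lemma subst_rename_Suc: "subst (lift_subst \<sigma>) (rename Suc p) = rename Suc (subst \<sigma> p)"
  by (simp add: rename_def subst_comp lift_subst_def)

lemma subst_sentence: "sentence p \<Longrightarrow> subst \<sigma> p = p"
  using subst_cong[of p \<sigma> Var] by (simp add: sentence_def subst_Var)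

lemma inst_lift: "inst (subst (lift_subst \<sigma>) p) t = subst (case_nat t \<sigma>) p"
proof -
  have "(\<lambda>n. subst_tm (case_nat t Var) (lift_subst \<sigma> n)) = case_nat t \<sigma>"
    by (rule ext) (auto simp: lift_subst_def subst_tm_comp subst_tm_Var split: nat.splits)
  then show ?thesis by (simp add: inst_def subst_comp)
qed

section \<open>Derivations from open assumptions and the deduction theorem\<close>

abbreviation prov :: "fm set \<Rightarrow> fm \<Rightarrow> bool" where
  "prov T \<equiv> provable UNIV T"

text \<open>Substitution leaves the axioms alone because they are sentences, and every scheme is
  closed under it. This lets a variable that is free nowhere else act as a generic constant.\<close>

lemma prov_subst:
  assumes "\<And>p. p \<in> T \<Longrightarrow> sentence p"
  shows "prov T p \<Longrightarrow> prov T (subst \<sigma> p)"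
proof (induction arbitrary: \<sigma> rule: provable.induct)
  case (axiom p)
  then show ?case using assms subst_sentence by (simp add: provable.axiom)
next
  case (modus_ponens p q)
  then show ?case using provable.modus_ponens by (metis subst.simps(4))
qed (auto simp: subst_inst subst_rename_Suc intro: provable.intros)

primrec imps :: "fm list \<Rightarrow> fm \<Rightarrow> fm" where
  "imps [] q = q"
| "imps (g # \<Gamma>) q = (g \<^bold>\<longrightarrow> imps \<Gamma> q)"

lemma imps_append: "imps (\<Gamma> @ \<Delta>) q = imps \<Gamma> (imps \<Delta> q)"
  by (induction \<Gamma>) auto

lemma prov_K: "prov T (p \<^bold>\<longrightarrow> q \<^bold>\<longrightarrow> p)"
  and prov_S: "prov T ((p \<^bold>\<longrightarrow> q \<^bold>\<longrightarrow> r) \<^bold>\<longrightarrow> (p \<^bold>\<longrightarrow> q) \<^bold>\<longrightarrow> p \<^bold>\<longrightarrow> r)"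
  and prov_DN: "prov T (\<^bold>\<not> \<^bold>\<not> p \<^bold>\<longrightarrow> p)"
  by (auto intro: provable.intros)

lemma prov_weaken: "prov T q \<Longrightarrow> prov T (p \<^bold>\<longrightarrow> q)"
  using prov_K provable.modus_ponens by blast

lemma prov_under: "prov T (p \<^bold>\<longrightarrow> q \<^bold>\<longrightarrow> r) \<Longrightarrow> prov T (p \<^bold>\<longrightarrow> q) \<Longrightarrow> prov T (p \<^bold>\<longrightarrow> r)"
  using prov_S provable.modus_ponens by blast

lemma prov_id: "prov T (p \<^bold>\<longrightarrow> p)"
  using prov_under[OF prov_K prov_K] .

lemma prov_trans: "prov T (p \<^bold>\<longrightarrow> q) \<Longrightarrow> prov T (q \<^bold>\<longrightarrow> r) \<Longrightarrow> prov T (p \<^bold>\<longrightarrow> r)"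
  using prov_under prov_weaken by blast

lemma imps_weaken: "prov T q \<Longrightarrow> prov T (imps \<Gamma> q)"
  by (induction \<Gamma>) (auto intro: prov_weaken)

lemma imps_dist: "prov T (imps \<Gamma> (p \<^bold>\<longrightarrow> q) \<^bold>\<longrightarrow> imps \<Gamma> p \<^bold>\<longrightarrow> imps \<Gamma> q)"
proof (induction \<Gamma>)
  case (Cons g \<Gamma>)
  have "prov T ((g \<^bold>\<longrightarrow> imps \<Gamma> (p \<^bold>\<longrightarrow> q)) \<^bold>\<longrightarrow> g \<^bold>\<longrightarrow> imps \<Gamma> p \<^bold>\<longrightarrow> imps \<Gamma> q)"
    using Cons prov_S prov_weaken provable.modus_ponens by blast
  then show ?case using prov_S prov_trans by (metis imps.simps(2))
qed (simp add: prov_id)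

lemma imps_mp: "prov T (imps \<Gamma> (p \<^bold>\<longrightarrow> q)) \<Longrightarrow> prov T (imps \<Gamma> p) \<Longrightarrow> prov T (imps \<Gamma> q)"
  using imps_dist provable.modus_ponens by blast

lemma imps_assm: "q \<in> set \<Gamma> \<Longrightarrow> prov T (imps \<Gamma> q)"
proof (induction \<Gamma>)
  case (Cons g \<Gamma>)
  show ?case
  proof (cases "q \<in> set \<Gamma>")
    case False
    then have "g = q" using Cons by auto
    moreover have "prov T (q \<^bold>\<longrightarrow> imps \<Gamma> q)"
      by (induction \<Gamma>) (auto intro: prov_id prov_K prov_trans)
    ultimately show ?thesis by simp
  qed (use Cons prov_weaken in auto)
qed simp

lemma imps_absorb: "prov T (imps \<Delta> (imps \<Gamma> q)) \<Longrightarrow> set \<Gamma> \<subseteq> set \<Delta> \<Longrightarrow> prov T (imps \<Delta> q)"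
proof (induction \<Gamma>)
  case (Cons g \<Gamma>)
  then show ?case using imps_mp[of T \<Delta> g "imps \<Gamma> q"] imps_assm[of g \<Delta> T] by simp
qed simp

lemma imps_mono: "prov T (imps \<Gamma> q) \<Longrightarrow> set \<Gamma> \<subseteq> set \<Delta> \<Longrightarrow> prov T (imps \<Delta> q)"
  using imps_absorb imps_weaken by blast

text \<open>The assumptions in \<open>S\<close> may have free variables, over which generalization
  would be wrong. They are therefore kept as premises of an implication instead of being added to
  the axioms \<open>T\<close>.\<close>

definition entails :: "fm set \<Rightarrow> fm set \<Rightarrow> fm \<Rightarrow> bool" where
  "entails T S q \<longleftrightarrow> (\<exists>\<Gamma>. set \<Gamma> \<subseteq> S \<and> prov T (imps \<Gamma> q))"

lemma entails_assm: "q \<in> S \<Longrightarrow> entails T S q"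
  unfolding entails_def using imps_assm[of q "[q]"] by (intro exI[of _ "[q]"]) auto

lemma entails_prov: "prov T q \<Longrightarrow> entails T S q"
  unfolding entails_def by (intro exI[of _ "[]"]) auto

lemma entails_mp: "entails T S (p \<^bold>\<longrightarrow> q) \<Longrightarrow> entails T S p \<Longrightarrow> entails T S q"
proof -
  assume "entails T S (p \<^bold>\<longrightarrow> q)" "entails T S p"
  then obtain \<Gamma> \<Delta> where "set \<Gamma> \<subseteq> S" "prov T (imps \<Gamma> (p \<^bold>\<longrightarrow> q))" "set \<Delta> \<subseteq> S" "prov T (imps \<Delta> p)"
    by (auto simp: entails_def)
  then have "prov T (imps (\<Gamma> @ \<Delta>) q)"
    using imps_mp imps_mono[of T \<Gamma> _ "\<Gamma> @ \<Delta>"] imps_mono[of T \<Delta> _ "\<Gamma> @ \<Delta>"] by fastforce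
  then show ?thesis
    unfolding entails_def using \<open>set \<Gamma> \<subseteq> S\<close> \<open>set \<Delta> \<subseteq> S\<close> by (intro exI[of _ "\<Gamma> @ \<Delta>"]) auto
qed

lemma entails_deduct: "entails T (insert p S) q \<Longrightarrow> entails T S (p \<^bold>\<longrightarrow> q)"
proof -
  assume "entails T (insert p S) q"
  then obtain \<Gamma> where \<Gamma>: "set \<Gamma> \<subseteq> insert p S" "prov T (imps \<Gamma> q)" by (auto simp: entails_def)
  let ?\<Delta> = "filter (\<lambda>r. r \<noteq> p) \<Gamma>"
  have "prov T (imps (?\<Delta> @ [p]) q)" by (rule imps_mono[OF \<Gamma>(2)]) auto
  then show ?thesis unfolding entails_def using \<Gamma>(1) by (intro exI[of _ ?\<Delta>]) (auto simp: imps_append)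
qed

lemma entails_mono: "entails T S q \<Longrightarrow> S \<subseteq> S' \<Longrightarrow> entails T S' q"
  by (auto simp: entails_def)

lemma entails_contr: "entails T (insert (\<^bold>\<not> p) S) \<^bold>\<bottom> \<Longrightarrow> entails T S p"
  using entails_deduct entails_mp entails_prov prov_DN by metis

lemma forall_imps: "prov T (Forall (imps (map (rename Suc) \<Gamma>) q) \<^bold>\<longrightarrow> imps \<Gamma> (Forall q))"
proof (induction \<Gamma>)
  case (Cons g \<Gamma>)
  let ?X = "imps (map (rename Suc) \<Gamma>) q"
  have 1: "prov T (Forall (rename Suc g \<^bold>\<longrightarrow> ?X) \<^bold>\<longrightarrow> Forall (rename Suc g) \<^bold>\<longrightarrow> Forall ?X)"
    and 2: "prov T (g \<^bold>\<longrightarrow> Forall (rename Suc g))"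
    by (auto intro: provable.intros)
  let ?S = "{Forall (rename Suc g \<^bold>\<longrightarrow> ?X), g}"
  have "entails T ?S (imps \<Gamma> (Forall q))"
    using entails_mp entails_prov[of T _ ?S] 1 2 Cons entails_assm[of _ ?S T]
    by (meson insertI1 insert_subset subset_insertI)
  then have "entails T {} (Forall (rename Suc g \<^bold>\<longrightarrow> ?X) \<^bold>\<longrightarrow> g \<^bold>\<longrightarrow> imps \<Gamma> (Forall q))"
    using entails_deduct by (metis insert_commute)
  then show ?case by (auto simp: entails_def)
qed (simp add: prov_id)

text \<open>The substitution \<sigma> sends \<open>m\<close> to 0 and shifts every other variable.
  It thus turns the instance back into \<open>q\<close> and acts on the assumptions as the shift
  that lets a quantifier pass them.\<close>

lemma fresh_generalization:
  assumes T: "\<And>p. p \<in> T \<Longrightarrow> sentence p"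
    and "prov T (imps \<Gamma> (inst q (Var m)))" "free_bound q \<le> m" "\<And>g. g \<in> set \<Gamma> \<Longrightarrow> free_bound g \<le> m"
  shows "prov T (imps \<Gamma> (Forall q))"
proof -
  define \<sigma> where "\<sigma> n = (if n = m then Var 0 else Var (Suc n))" for n
  have imps: "subst \<sigma> (imps \<Delta> r) = imps (map (subst \<sigma>) \<Delta>) (subst \<sigma> r)" for \<Delta> r
    by (induction \<Delta>) auto
  have 1: "subst \<sigma> g = rename Suc g" if "free_bound g \<le> m" for g
    unfolding rename_def using that by (intro subst_cong) (auto simp: \<sigma>_def)
  have "subst \<sigma> (inst q (Var m)) = subst Var q"
    unfolding inst_def subst_comp using assms(3)
    by (intro subst_cong) (auto simp: \<sigma>_def split: nat.splits)
  then have "prov T (imps (map (rename Suc) \<Gamma>) q)"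
    using prov_subst[OF T assms(2), of \<sigma>] 1 assms(4) by (simp add: imps subst_Var cong: map_cong)
  then show ?thesis using forall_imps provable.generalization provable.modus_ponens by blast
qed

section \<open>Henkin construction with variables as witnesses\<close>

instance tm :: countable by countable_datatype
instance fm :: countable by countable_datatype

locale henkin =
  fixes T :: "fm set" and \<phi> :: fm
  assumes T: "\<And>p. p \<in> T \<Longrightarrow> sentence p" and unprov: "\<not> prov T \<phi>"
begin

definition fresh :: "fm set \<Rightarrow> fm \<Rightarrow> nat" where
  "fresh S q = Max (insert (free_bound q) (free_bound ` S))"

text \<open>Each stage is a finite set of formulas and so leaves almost all variables free for use
  as witnesses; the language does not have to grow. A counterexample to a universal formula is
  supplied as soon as the negation of the formula is accepted.\<close>

definition step :: "fm set \<Rightarrow> fm \<Rightarrow> fm set" where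
  "step S p = (if entails T (insert p S) \<^bold>\<bottom> then insert (\<^bold>\<not> p) S
    else insert p S \<union> {\<^bold>\<not> inst q (Var (fresh (insert p S) q)) | q. p = \<^bold>\<not> Forall q})"

primrec chain :: "nat \<Rightarrow> fm set" where
  "chain 0 = {\<^bold>\<not> \<phi>}"
| "chain (Suc n) = step (chain n) (from_nat n)"

definition H :: "fm set" where
  "H = (\<Union>n. chain n)"

lemma finite_step: "finite S \<Longrightarrow> finite (step S p)"
proof -
  have "{\<^bold>\<not> inst q (Var (fresh (insert p S) q)) | q. p = \<^bold>\<not> Forall q} \<subseteq>
      (\<lambda>q. \<^bold>\<not> inst q (Var (fresh (insert p S) q))) ` {q. p = \<^bold>\<not> Forall q}" by auto
  moreover have "{q. p = \<^bold>\<not> Forall q} \<subseteq> {case p of Imp (Forall q) _ \<Rightarrow> q}" by auto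
  ultimately have "finite {\<^bold>\<not> inst q (Var (fresh (insert p S) q)) | q. p = \<^bold>\<not> Forall q}"
    by (meson finite.emptyI finite.insertI finite_imageI finite_subset)
  then show "finite S \<Longrightarrow> finite (step S p)" by (simp add: step_def)
qed

lemma step_consistent:
  assumes fin: "finite S" and con: "\<not> entails T S \<^bold>\<bottom>"
  shows "\<not> entails T (step S p) \<^bold>\<bottom>"
proof (cases "entails T (insert p S) \<^bold>\<bottom>")
  case True
  have "\<not> entails T (insert (\<^bold>\<not> p) S) \<^bold>\<bottom>"
    using entails_contr[of T p S] entails_deduct[OF True] entails_mp con by blast
  then show ?thesis using True by (simp add: step_def)
next
  case False
  show ?thesis
  proof (cases "\<exists>q. p = \<^bold>\<not> Forall q")
    case False
    then show ?thesis using \<open>\<not> entails T (insert p S) \<^bold>\<bottom>\<close> by (simp add: step_def)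
  next
    case True
    then obtain q where q: "p = \<^bold>\<not> Forall q" by blast
    let ?m = "fresh (insert p S) q"
    have bound: "free_bound g \<le> ?m" if "g \<in> insert q (insert p S)" for g
      using that fin unfolding fresh_def by (intro Max_ge) auto
    have "\<not> entails T (insert (\<^bold>\<not> inst q (Var ?m)) (insert p S)) \<^bold>\<bottom>"
    proof
      assume "entails T (insert (\<^bold>\<not> inst q (Var ?m)) (insert p S)) \<^bold>\<bottom>"
      then obtain \<Gamma> where \<Gamma>: "set \<Gamma> \<subseteq> insert p S" "prov T (imps \<Gamma> (inst q (Var ?m)))"
        using entails_contr unfolding entails_def by meson
      then have "prov T (imps \<Gamma> (Forall q))"
        using fresh_generalization[OF T \<Gamma>(2)] bound by blast
      then have "entails T (insert p S) (Forall q)" using \<Gamma>(1) by (auto simp: entails_def)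
      moreover have "entails T (insert p S) (\<^bold>\<not> Forall q)" using q entails_assm by auto
      ultimately show False using False entails_mp by blast
    qed
    then show ?thesis using False q by (simp add: step_def)
  qed
qed

lemma chain_finite: "finite (chain n)"
  by (induction n) (auto intro: finite_step)

lemma chain_consistent: "\<not> entails T (chain n) \<^bold>\<bottom>"
proof (induction n)
  case 0
  have "entails T {} \<phi>" if "entails T {\<^bold>\<not> \<phi>} \<^bold>\<bottom>" using entails_contr that by blast
  then show ?case using unprov by (auto simp: entails_def)
qed (simp add: step_consistent chain_finite)

lemma chain_mono: "m \<le> n \<Longrightarrow> chain m \<subseteq> chain n"
  by (rule lift_Suc_mono_le[of chain]) (auto simp: step_def)

lemma H_consistent: "\<not> entails T H \<^bold>\<bottom>"
proof
  assume "entails T H \<^bold>\<bottom>"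
  then obtain \<Gamma> where \<Gamma>: "set \<Gamma> \<subseteq> H" "prov T (imps \<Gamma> \<^bold>\<bottom>)" by (auto simp: entails_def)
  have "\<exists>n. set \<Gamma> \<subseteq> chain n" using \<Gamma>(1)
  proof (induction \<Gamma>)
    case (Cons g \<Gamma>)
    then obtain n m where "set \<Gamma> \<subseteq> chain n" "g \<in> chain m" by (auto simp: H_def)
    then show ?case using chain_mono[of n "max n m"] chain_mono[of m "max n m"]
      by (intro exI[of _ "max n m"]) auto
  qed auto
  then show False using \<Gamma>(2) chain_consistent by (auto simp: entails_def)
qed

lemma H_complete: "p \<in> H \<or> (\<^bold>\<not> p) \<in> H"
proof -
  have "p \<in> chain (Suc (to_nat p)) \<or> (\<^bold>\<not> p) \<in> chain (Suc (to_nat p))" by (auto simp: step_def)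
  then show ?thesis by (auto simp: H_def simp del: chain.simps)
qed

lemma H_closed: "entails T H p \<longleftrightarrow> p \<in> H"
  using H_complete H_consistent entails_assm entails_mp by blast

lemma H_prov: "prov T p \<Longrightarrow> p \<in> H"
  using H_closed entails_prov by blast

lemma H_mp: "(p \<^bold>\<longrightarrow> q) \<in> H \<Longrightarrow> p \<in> H \<Longrightarrow> q \<in> H"
  using H_closed entails_mp by blast

lemma H_imp: "(p \<^bold>\<longrightarrow> q) \<in> H \<longleftrightarrow> (p \<in> H \<longrightarrow> q \<in> H)"
proof
  assume r: "p \<in> H \<longrightarrow> q \<in> H"
  show "(p \<^bold>\<longrightarrow> q) \<in> H"
  proof (cases "p \<in> H")
    case True
    then show ?thesis using r H_prov[OF prov_K] H_mp by blast
  next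
    case False
    then have "entails T (insert p H) \<^bold>\<bottom>"
      using H_complete[of p] entails_mp entails_assm[of _ "insert p H" T] by blast
    then have "entails T (insert p H) q"
      using entails_mono[of T "insert p H" _ "insert (\<^bold>\<not> q) (insert p H)"] entails_contr by blast
    then show ?thesis using entails_deduct H_closed by blast
  qed
qed (use H_mp in blast)

lemma H_bot: "\<^bold>\<bottom> \<notin> H"
  using H_consistent H_closed by blast

lemma H_forall: "Forall q \<in> H \<longleftrightarrow> (\<forall>t. inst q t \<in> H)"
proof
  assume r: "\<forall>t. inst q t \<in> H"
  show "Forall q \<in> H"
  proof (rule ccontr)
    assume "Forall q \<notin> H"
    then have n: "(\<^bold>\<not> Forall q) \<in> H" using H_complete by blast
    let ?p = "\<^bold>\<not> Forall q" and ?S = "chain (to_nat (\<^bold>\<not> Forall q))"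
    have "?p \<in> H \<or> \<^bold>\<not> ?p \<in> H" using H_complete by blast
    have "\<not> entails T (insert ?p ?S) \<^bold>\<bottom>"
      using entails_mono[of T "insert ?p ?S" "\<^bold>\<bottom>" H] n H_consistent by (auto simp: H_def)
    then have "(\<^bold>\<not> inst q (Var (fresh (insert ?p ?S) q))) \<in> chain (Suc (to_nat ?p))"
      by (auto simp: step_def)
    then have "(\<^bold>\<not> inst q (Var (fresh (insert ?p ?S) q))) \<in> H" unfolding H_def by blast
    then show False using r H_imp H_bot by blast
  qed
next
  assume "Forall q \<in> H"
  moreover have "(Forall q \<^bold>\<longrightarrow> inst q t) \<in> H" for t by (rule H_prov) (auto intro: provable.intros)
  ultimately show "\<forall>t. inst q t \<in> H" using H_mp by blast
qed

lemma H_refl: "(t \<^bold>= t) \<in> H"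
  by (rule H_prov) (auto intro: provable.intros)

lemma H_subst: "(s \<^bold>= t) \<in> H \<Longrightarrow> inst p s \<in> H \<Longrightarrow> inst p t \<in> H"
  using H_prov[of "s \<^bold>= t \<^bold>\<longrightarrow> inst p s \<^bold>\<longrightarrow> inst p t"] H_mp provable.eq_subst[of s t p UNIV T] by blast

lemma inst_simps:
  "inst (p \<^bold>= q) t = (subst_tm (case_nat t Var) p \<^bold>= subst_tm (case_nat t Var) q)"
  "inst (p \<^bold>\<in> q) t = (subst_tm (case_nat t Var) p \<^bold>\<in> subst_tm (case_nat t Var) q)"
  "subst_tm (case_nat t Var) (subst_tm (\<lambda>n. Var (Suc n)) s) = s"
  by (simp_all add: inst_def subst_tm_comp subst_tm_Var)

abbreviation (input) up :: "tm \<Rightarrow> tm" where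
  "up \<equiv> subst_tm (\<lambda>n. Var (Suc n))"

text \<open>Each congruence law is the substitution axiom for a formula in which variable 0 marks
  the place to be exchanged and \<open>up\<close> moves the term to be kept out of its way.\<close>

lemma H_sym: "(s \<^bold>= t) \<in> H \<Longrightarrow> (t \<^bold>= s) \<in> H"
  using H_subst[of s t "Var 0 \<^bold>= up s"] H_refl by (simp add: inst_simps)

lemma H_trans: "(s \<^bold>= t) \<in> H \<Longrightarrow> (t \<^bold>= u) \<in> H \<Longrightarrow> (s \<^bold>= u) \<in> H"
  using H_subst[of t u "up s \<^bold>= Var 0"] by (simp add: inst_simps)

lemma H_J: "(s \<^bold>= t) \<in> H \<Longrightarrow> (J s \<^bold>= J t) \<in> H"
  using H_subst[of s t "up (J s) \<^bold>= J (Var 0)"] H_refl by (simp add: inst_simps)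

lemma H_Mem: "(s \<^bold>= t) \<in> H \<Longrightarrow> (s' \<^bold>= t') \<in> H \<Longrightarrow> (s \<^bold>\<in> s') \<in> H \<Longrightarrow> (t \<^bold>\<in> t') \<in> H"
  using H_subst[of s t "Var 0 \<^bold>\<in> up s'"] H_subst[of s' t' "up t \<^bold>\<in> Var 0"] by (simp add: inst_simps)

definition cls :: "tm \<Rightarrow> tm set" where
  "cls t = {s. (t \<^bold>= s) \<in> H}"

lemma cls_eq: "cls s = cls t \<longleftrightarrow> (s \<^bold>= t) \<in> H"
  unfolding cls_def using H_refl H_sym H_trans by blast

definition mR :: "tm set \<Rightarrow> tm set \<Rightarrow> bool" where
  "mR X Y \<longleftrightarrow> (\<exists>s t. X = cls s \<and> Y = cls t \<and> (s \<^bold>\<in> t) \<in> H)"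

definition mj :: "tm set \<Rightarrow> tm set" where
  "mj X = cls (J (SOME t. X = cls t))"

lemma mR_cls: "mR (cls s) (cls t) \<longleftrightarrow> (s \<^bold>\<in> t) \<in> H"
  unfolding mR_def cls_eq using H_Mem H_sym H_refl by blast

lemma mj_cls: "mj (cls s) = cls (J s)"
proof -
  have "cls s = cls (SOME t. cls s = cls t)" by (rule someI) simp
  then show ?thesis unfolding mj_def cls_eq using H_J H_sym by (meson cls_eq)
qed

lemma tmv_cls: "tmv mj (\<lambda>n. cls (\<sigma> n)) t = cls (subst_tm \<sigma> t)"
  by (induction t) (auto simp: mj_cls)

lemma truth: "sat (range cls) mR mj (\<lambda>n. cls (\<sigma> n)) p \<longleftrightarrow> subst \<sigma> p \<in> H"
proof (induction p arbitrary: \<sigma>)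
  case (Forall p)
  have *: "case_nat (cls t) (\<lambda>n. cls (\<sigma> n)) = (\<lambda>n. cls (case_nat t \<sigma> n))" for t
    by (auto split: nat.splits)
  show ?case by (simp add: H_forall inst_lift * Forall)
qed (auto simp: tmv_cls cls_eq mR_cls H_bot H_imp)

lemma model_T: "p \<in> T \<Longrightarrow> sat (range cls) mR mj (\<lambda>n. cls (Var n)) p"
  by (simp add: truth subst_Var H_prov provable.axiom)

lemma model_phi: "\<not> sat (range cls) mR mj (\<lambda>n. cls (Var n)) \<phi>"
proof -
  have "(\<^bold>\<not> \<phi>) \<in> H" unfolding H_def by (rule UN_I[of 0]) auto
  then show ?thesis by (auto simp: truth subst_Var H_imp H_bot)
qed

end

lemma tmv_bij:
  assumes "\<And>x. x \<in> D \<Longrightarrow> j x \<in> D" "\<And>x. x \<in> D \<Longrightarrow> h' (h x) = x" "\<And>n. e n \<in> D"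
  shows "tmv j e t \<in> D \<and> tmv (\<lambda>a. h (j (h' a))) (\<lambda>n. h (e n)) t = h (tmv j e t)"
  by (induction t) (use assms in auto)

lemma sat_bij:
  assumes "\<And>x. x \<in> D \<Longrightarrow> j x \<in> D" "\<And>x. x \<in> D \<Longrightarrow> h' (h x) = x" "h ` D = UNIV" "\<And>n. e n \<in> D"
  shows "sat UNIV (\<lambda>a b. R (h' a) (h' b)) (\<lambda>a. h (j (h' a))) (\<lambda>n. h (e n)) p \<longleftrightarrow> sat D R j e p"
  using assms(4)
proof (induction p arbitrary: e)
  case (Forall p)
  have *: "(\<lambda>n. h (case_nat x e n)) = case_nat (h x) (\<lambda>n. h (e n))" for x
    by (auto split: nat.splits)
  have IH: "sat UNIV (\<lambda>a b. R (h' a) (h' b)) (\<lambda>a. h (j (h' a))) (case_nat (h x) (\<lambda>n. h (e n))) p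
      \<longleftrightarrow> sat D R j (case_nat x e) p" if "x \<in> D" for x
    unfolding *[symmetric]
    by (rule Forall.IH) (use that Forall.prems in \<open>auto split: nat.splits\<close>)
  have "(\<forall>a. P a) \<longleftrightarrow> (\<forall>x\<in>D. P (h x))" for P
    using assms(3) by (metis UNIV_I image_iff)
  then show ?case using IH by simp
next
  case (Eq s t)
  then show ?case using tmv_bij[of D j h' h e, OF assms(1,2) Eq] assms(2) by (metis sat.simps(1))
next
  case (Mem s t)
  then show ?case using tmv_bij[of D j h' h e, OF assms(1,2) Mem] assms(2) by (metis sat.simps(2))
qed auto

text \<open>Together with \<open>adjoining\<close> this excludes finite models: adjoining the
  elements one after the other would end in an element that has all elements as members.\<close>

definition no_universal :: fm where
  "no_universal = Forall (Exists (\<^bold>\<not> Var 0 \<^bold>\<in> Var 1))"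

definition adjoining :: fm where
  "adjoining = Forall (Forall (Exists
    (Forall (Var 0 \<^bold>\<in> Var 3 \<^bold>\<longrightarrow> Var 0 \<^bold>\<in> Var 1) \<^bold>\<and> Var 1 \<^bold>\<in> Var 0)))"

text \<open>The assumption \<open>inf\<close> only serves to exclude finite models, so that the model
  can be carried by the natural numbers; each element of a model is then also a name for itself.\<close>

theorem completeness:
  assumes T: "\<And>p. p \<in> T \<Longrightarrow> sentence p" and \<phi>: "\<not> prov T \<phi>" "sentence \<phi>"
    and inf: "\<And>D (R::tm set \<Rightarrow> tm set \<Rightarrow> bool) j e. (\<And>p. p \<in> T \<Longrightarrow> sat D R j e p) \<Longrightarrow>
      (\<And>n. e n \<in> D) \<Longrightarrow> (\<And>x. x \<in> D \<Longrightarrow> j x \<in> D) \<Longrightarrow> sat D R j e no_universal \<and> sat D R j e adjoining"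
  shows "\<exists>(R::nat \<Rightarrow> nat \<Rightarrow> bool) j. (\<forall>p\<in>T. \<forall>e. sat UNIV R j e p) \<and> (\<forall>e. \<not> sat UNIV R j e \<phi>)"
proof -
  interpret henkin T \<phi> using T \<phi>(1) by unfold_locales auto
  define D where "D = range cls"
  let ?e = "\<lambda>n. cls (Var n)"
  have jD: "mj x \<in> D" for x by (auto simp: mj_def D_def)
  have inf': "sat D mR mj ?e no_universal" "sat D mR mj ?e adjoining"
    using inf[of D mR mj ?e] model_T jD by (auto simp: D_def)
  have nu: "\<exists>y\<in>D. \<not> mR y x" if "x \<in> D" for x
    using inf'(1) that by (auto simp: no_universal_def)
  have adj: "\<exists>u\<in>D. (\<forall>z\<in>D. mR z x \<longrightarrow> mR z u) \<and> mR y u" if "x \<in> D" "y \<in> D" for x y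
    using inf'(2) that by (auto simp: adjoining_def numeral_3_eq_3)
  have "infinite D"
  proof
    assume "finite D"
    have "\<exists>u\<in>D. \<forall>z\<in>F. mR z u" if "finite F" "F \<subseteq> D" for F
      using that
    proof (induction F)
      case empty
      show ?case by (auto simp: D_def)
    next
      case (insert x F)
      then obtain u where "u \<in> D" "\<forall>z\<in>F. mR z u" by auto
      then show ?case using adj[of u x] insert.prems by (metis insert_iff subsetD)
    qed
    from this[of D] obtain u where "u \<in> D" "\<forall>z\<in>D. mR z u" using \<open>finite D\<close> by auto
    then show False using nu by auto
  qed
  moreover have "countable D" by (simp add: D_def)
  ultimately have bij: "bij_betw (to_nat_on D) D UNIV" using to_nat_on_infinite by blast
  let ?h = "to_nat_on D" and ?h' = "inv_into D (to_nat_on D)"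
  let ?R = "\<lambda>a b. mR (?h' a) (?h' b)" and ?j = "\<lambda>a. ?h (mj (?h' a))"
  have eq: "sat UNIV ?R ?j (\<lambda>n. ?h (cls (Var n))) p \<longleftrightarrow> sat D mR mj ?e p" for p
    by (rule sat_bij) (use bij jD in \<open>auto simp: D_def bij_betw_def\<close>)
  have any: "sat UNIV ?R ?j e p \<longleftrightarrow> sat D mR mj ?e p" if "sentence p" for e p
    unfolding eq[symmetric] by (rule sat_cong) (use that in \<open>auto simp: sentence_def\<close>)
  show ?thesis
    using any T \<phi>(2) model_T model_phi
    by (intro exI[of _ ?R] exI[of _ ?j]) (auto simp: D_def)
qed

lemma provable_finite_axioms:
  "provable L T p \<Longrightarrow> \<exists>F. finite F \<and> F \<subseteq> T \<and> provable L F p"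
proof (induction rule: provable.induct)
  case (axiom p)
  then show ?case by (intro exI[of _ "{p}"]) (auto intro: provable.axiom)
next
  case (modus_ponens p q)
  then obtain F G where FG: "finite F" "F \<subseteq> T" "provable L F (p \<^bold>\<longrightarrow> q)" "finite G" "G \<subseteq> T" "provable L G p"
    by blast
  have mono: "provable L F q \<Longrightarrow> F \<subseteq> F' \<Longrightarrow> provable L F' q" for F F' q
    by (induction rule: provable.induct) (auto intro: provable.intros)
  show ?case
    using FG mono[of F _ "F \<union> G"] mono[of G _ "F \<union> G"] provable.modus_ponens
    by (intro exI[of _ "F \<union> G"]) (meson Un_least finite_UnI sup_ge1 sup_ge2)
qed (auto intro: provable.intros)


subsection \<open>Erasing \<open>j\<close>\<close>

primrec var_of :: "tm \<Rightarrow> nat" where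
  "var_of (Var n) = n"
| "var_of (J t) = var_of t"

primrec strip :: "fm \<Rightarrow> fm" where
  "strip (s \<^bold>= t) = (Var (var_of s) \<^bold>= Var (var_of t))"
| "strip (s \<^bold>\<in> t) = (Var (var_of s) \<^bold>\<in> Var (var_of t))"
| "strip \<^bold>\<bottom> = \<^bold>\<bottom>"
| "strip (p \<^bold>\<longrightarrow> q) = (strip p \<^bold>\<longrightarrow> strip q)"
| "strip (Forall p) = Forall (strip p)"

lemma jfree_strip: "jfree (strip p)"
  by (induction p) auto

lemma strip_jfree: "jfree p \<Longrightarrow> strip p = p"
proof (induction p)
  case (Eq s t) then show ?case by (cases s; cases t) auto
next
  case (Mem s t) then show ?case by (cases s; cases t) auto
qed auto

lemma var_of_subst: "var_of (subst_tm \<sigma> t) = var_of (\<sigma> (var_of t))"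
  by (induction t) auto

lemma strip_subst: "strip (subst \<sigma> p) = subst (\<lambda>n. Var (var_of (\<sigma> n))) (strip p)"
proof (induction p arbitrary: \<sigma>)
  case (Forall p)
  have "(\<lambda>n. Var (var_of (lift_subst \<sigma> n))) = lift_subst (\<lambda>n. Var (var_of (\<sigma> n)))"
    by (auto simp: lift_subst_def var_of_subst split: nat.splits)
  then show ?case by (simp add: Forall)
qed (auto simp: var_of_subst)

lemma strip_inst: "strip (inst p t) = inst (strip p) (Var (var_of t))"
proof -
  have "(\<lambda>n. Var (var_of (case_nat t Var n))) = case_nat (Var (var_of t)) Var"
    by (auto split: nat.splits)
  then show ?thesis by (simp add: inst_def strip_subst)
qed

lemma strip_rename: "strip (rename r p) = rename r (strip p)"
  by (simp add: rename_def strip_subst)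

text \<open>Replacing each term by its variable is the syntactic side of reading \<open>j\<close> as
  the identity; it maps every axiom scheme into itself. Consistency stated for derivations without
  \<open>j\<close> thereby carries over to the full calculus, for which completeness is
  proved.\<close>

lemma provable_strip:
  assumes "\<And>p. p \<in> T \<Longrightarrow> jfree p"
  shows "provable L T p \<Longrightarrow> provable L_mem T (strip p)"
proof (induction rule: provable.induct)
  case (axiom p)
  then show ?case using assms by (simp add: strip_jfree provable.axiom L_mem_def)
next
  case (all_inst p t)
  have "(Forall (strip p) \<^bold>\<longrightarrow> inst (strip p) (Var (var_of t))) \<in> L_mem"
    using jfree_strip[of "Forall p \<^bold>\<longrightarrow> inst p t"] by (simp add: strip_inst L_mem_def)
  then show ?case by (simp add: strip_inst provable.all_inst)
next
  case (all_vacuous p)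
  have "(strip p \<^bold>\<longrightarrow> Forall (rename Suc (strip p))) \<in> L_mem"
    using jfree_strip[of "p \<^bold>\<longrightarrow> Forall (rename Suc p)"] by (simp add: strip_rename L_mem_def)
  then show ?case by (simp add: strip_rename provable.all_vacuous)
next
  case (eq_subst s t p)
  have "(Var (var_of s) \<^bold>= Var (var_of t) \<^bold>\<longrightarrow> inst (strip p) (Var (var_of s)) \<^bold>\<longrightarrow>
      inst (strip p) (Var (var_of t))) \<in> L_mem"
    using jfree_strip[of "s \<^bold>= t \<^bold>\<longrightarrow> inst p s \<^bold>\<longrightarrow> inst p t"] by (simp add: strip_inst L_mem_def)
  then show ?case by (simp add: strip_inst provable.eq_subst)
next
  case (modus_ponens p q)
  then show ?case using provable.modus_ponens by simp
qed (auto simp: L_mem_def jfree_strip intro: provable.intros)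

lemma sat_strip: "sat D R id e (strip p) = sat D R id e p"
proof -
  have "tmv id e t = e (var_of t)" for e :: "nat \<Rightarrow> 'a" and t by (induction t) auto
  then show ?thesis by (induction p arbitrary: e) auto
qed

lemma sat_jfree: "jfree p \<Longrightarrow> sat D R j e p = sat D R j' e p"
proof (induction p arbitrary: e)
  case (Eq s t) then show ?case by (cases s; cases t) auto
next
  case (Mem s t) then show ?case by (cases s; cases t) auto
qed auto

section \<open>Definable predicates over a structure on the natural numbers\<close>

locale struct =
  fixes E :: "nat \<Rightarrow> nat \<Rightarrow> bool" and jf :: "nat \<Rightarrow> nat"
begin

abbreviation (input) satE :: "(nat \<Rightarrow> nat) \<Rightarrow> fm \<Rightarrow> bool" where
  "satE \<equiv> sat UNIV E jf"

text \<open>Definability with parameters: the variables below \<open>M\<close> are the arguments, and the variable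
  \<open>M + c\<close> is a name for the element \<open>c\<close>.\<close>

definition dfn :: "((nat \<Rightarrow> nat) \<Rightarrow> bool) \<Rightarrow> bool" where
  "dfn P \<longleftrightarrow> (\<exists>N p. \<forall>M\<ge>N. \<forall>e. P e \<longleftrightarrow> satE (\<lambda>n. if n < M then e n else n - M) (p M))"

definition dfnf :: "((nat \<Rightarrow> nat) \<Rightarrow> nat) \<Rightarrow> bool" where
  "dfnf t \<longleftrightarrow> dfn (\<lambda>e. e 0 = t (\<lambda>n. e (Suc n)))"

text \<open>Constants are named by variables, so an environment whose entries are arguments or
  constants is reached by a mere renaming of the formula.\<close>

lemma dfn_subst:
  assumes "dfn P" and s: "\<And>n. (\<exists>k. \<forall>e. s e n = e k) \<or> (\<exists>c. \<forall>e. s e n = c)"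
  shows "dfn (\<lambda>e. P (s e))"
proof -
  obtain N p where p: "\<And>M e. M \<ge> N \<Longrightarrow> P e \<longleftrightarrow> satE (\<lambda>n. if n < M then e n else n - M) (p M)"
    using assms(1) unfolding dfn_def by blast
  have "\<exists>i. case i of Inl k \<Rightarrow> (\<forall>e. s e n = e k) | Inr c \<Rightarrow> (\<forall>e. s e n = c)" for n
    using s[of n] by (auto intro: exI[of _ "Inl _"] exI[of _ "Inr _"])
  then have "\<exists>f. \<forall>n. case f n of Inl k \<Rightarrow> (\<forall>e. s e n = e k) | Inr c \<Rightarrow> (\<forall>e. s e n = c)"
    by (intro choice allI)
  then obtain f where f: "\<And>n. case f n of Inl k \<Rightarrow> (\<forall>e. s e n = e k) | Inr c \<Rightarrow> (\<forall>e. s e n = c)"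
    by blast
  \<comment> \<open>Only the first \<open>N\<close> entries are arguments of the given formula. An
    offset above all argument positions that they refer to keeps these positions apart from the
    names of constants.\<close>
  define N' where "N' = Suc (\<Sum>n<N. case f n of Inl k \<Rightarrow> k | Inr c \<Rightarrow> 0)"
  define \<rho> where "\<rho> M n = (if n < N then (case f n of Inl k \<Rightarrow> k | Inr c \<Rightarrow> M + c) else M + (n - N))" for M n
  have small: "k < N'" if "f n = Inl k" "n < N" for n k
  proof -
    have "(case f n of Inl k \<Rightarrow> k | Inr c \<Rightarrow> 0) \<le> (\<Sum>n<N. case f n of Inl k \<Rightarrow> k | Inr c \<Rightarrow> 0)"
      by (rule member_le_sum) (use that in auto)
    then show ?thesis using that by (simp add: N'_def)
  qed
  have "P (s e) \<longleftrightarrow> satE (\<lambda>n. if n < M then e n else n - M) (rename (\<rho> M) (p N))" if M: "M \<ge> N'" for M e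
  proof -
    have "(if \<rho> M n < M then e (\<rho> M n) else \<rho> M n - M) = (if n < N then s e n else n - N)" for n
      using f[of n] small[of n] M by (auto simp: \<rho>_def split: sum.splits dest: order_less_le_trans)
    then show ?thesis using p[of N "s e"] by (simp add: sat_rename)
  qed
  then show ?thesis unfolding dfn_def by (intro exI[of _ N'] exI[of _ "\<lambda>M. rename (\<rho> M) (p N)"]) blast
qed

lemma dfn_const: "dfn (\<lambda>e. b)"
  unfolding dfn_def by (rule exI[of _ 0], cases b)
    (auto intro: exI[of _ "\<lambda>_. \<^bold>\<bottom> \<^bold>\<longrightarrow> \<^bold>\<bottom>"] exI[of _ "\<lambda>_. \<^bold>\<bottom>"])

lemma dfn_imp:
  assumes "dfn P" "dfn Q"
  shows "dfn (\<lambda>e. P e \<longrightarrow> Q e)"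
proof -
  from assms obtain N p N' q where
    p: "\<And>M e. M \<ge> N \<Longrightarrow> P e \<longleftrightarrow> satE (\<lambda>n. if n < M then e n else n - M) (p M)" and
    q: "\<And>M e. M \<ge> N' \<Longrightarrow> Q e \<longleftrightarrow> satE (\<lambda>n. if n < M then e n else n - M) (q M)"
    unfolding dfn_def by blast
  show ?thesis
    unfolding dfn_def
  proof (intro exI[of _ "max N N'"] exI[of _ "\<lambda>M. p M \<^bold>\<longrightarrow> q M"] allI impI)
    fix M e assume "max N N' \<le> M"
    then show "(P e \<longrightarrow> Q e) \<longleftrightarrow> satE (\<lambda>n. if n < M then e n else n - M) (p M \<^bold>\<longrightarrow> q M)"
      using p[of M e] q[of M e] by simp
  qed
qed

text \<open>The bound variable is one more argument, so the formula for offset \<open>Suc M\<close>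
  is used under the quantifier at offset \<open>M\<close>. This is why \<open>dfn\<close> asks for a
  formula at every large offset and not for a single one.\<close>

lemma dfn_all:
  assumes "dfn (\<lambda>e. P (e 0) (\<lambda>n. e (Suc n)))"
  shows "dfn (\<lambda>e. \<forall>x. P x e)"
proof -
  from assms obtain N p where p: "\<And>M e. M \<ge> N \<Longrightarrow>
      P (e 0) (\<lambda>n. e (Suc n)) \<longleftrightarrow> satE (\<lambda>n. if n < M then e n else n - M) (p M)"
    unfolding dfn_def by blast
  have "P x e \<longleftrightarrow> satE (case_nat x (\<lambda>n. if n < M then e n else n - M)) (p (Suc M))" if "M \<ge> N" for M e x
  proof -
    have "(\<lambda>n. if n < Suc M then case_nat x e n else n - Suc M) =
        case_nat x (\<lambda>n. if n < M then e n else n - M)"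
      by (auto split: nat.splits)
    then show ?thesis using p[of "Suc M" "case_nat x e"] that by simp
  qed
  then show ?thesis unfolding dfn_def by (intro exI[of _ N] exI[of _ "\<lambda>M. Forall (p (Suc M))"]) simp
qed

lemma dfn_not: "dfn P \<Longrightarrow> dfn (\<lambda>e. \<not> P e)"
  using dfn_imp[OF _ dfn_const[of False], of P] by simp

lemma dfn_disj: "dfn P \<Longrightarrow> dfn Q \<Longrightarrow> dfn (\<lambda>e. P e \<or> Q e)"
  using dfn_imp[OF dfn_not[of P], of Q] by (simp add: disj_imp)

lemma dfn_conj: "dfn P \<Longrightarrow> dfn Q \<Longrightarrow> dfn (\<lambda>e. P e \<and> Q e)"
  using dfn_not[OF dfn_imp[OF _ dfn_not[of Q]], of P] by simp

lemma dfn_iff: "dfn P \<Longrightarrow> dfn Q \<Longrightarrow> dfn (\<lambda>e. P e = Q e)"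
  using dfn_conj[OF dfn_imp[of P Q] dfn_imp[of Q P]] by (simp add: iff_conv_conj_imp)

lemma dfn_ex: "dfn (\<lambda>e. P (e 0) (\<lambda>n. e (Suc n))) \<Longrightarrow> dfn (\<lambda>e. \<exists>x. P x e)"
  using dfn_not[OF dfn_all[OF dfn_not], of P] by simp

lemma dfn_atom: "dfn (\<lambda>e. E (e m) (e n))" "dfn (\<lambda>e. e m = e n)" "dfn (\<lambda>e. e m = jf (e n))"
proof -
  have *: "dfn P" if "\<And>e. P e \<longleftrightarrow> satE e p" "free_bound p \<le> Suc (max m n)" for P p
    unfolding dfn_def
  proof (intro exI[of _ "Suc (max m n)"] exI[of _ "\<lambda>_. p"] allI impI)
    fix M e assume "Suc (max m n) \<le> M"
    then show "P e \<longleftrightarrow> satE (\<lambda>n. if n < M then e n else n - M) p"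
      unfolding that(1) using that(2) by (intro sat_cong) auto
  qed
  show "dfn (\<lambda>e. E (e m) (e n))" by (rule *[where p = "Var m \<^bold>\<in> Var n"]) auto
  show "dfn (\<lambda>e. e m = e n)" by (rule *[where p = "Var m \<^bold>= Var n"]) auto
  show "dfn (\<lambda>e. e m = jf (e n))" by (rule *[where p = "Var m \<^bold>= J (Var n)"]) auto
qed

lemma dfnf_var: "dfnf (\<lambda>e. e n)"
  unfolding dfnf_def by (rule dfn_atom)

lemma dfnf_const: "dfnf (\<lambda>e. c)"
  unfolding dfnf_def
  by (rule dfn_subst[OF dfn_atom(2)[of 0 1], where s = "\<lambda>e. case_nat (e 0) (\<lambda>_. c)", simplified])
    (auto split: nat.splits)

lemma dfn_shift: "dfn P \<Longrightarrow> dfn (\<lambda>e. P (\<lambda>n. e (Suc n)))"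
  by (erule dfn_subst) blast

lemma dfnf_shift: "dfnf t \<Longrightarrow> dfnf (\<lambda>e. t (\<lambda>n. e (Suc n)))"
proof -
  assume "dfnf t"
  then have "dfn (\<lambda>e. e 0 = t (\<lambda>n. e (Suc n)))" by (simp add: dfnf_def)
  then have "dfn (\<lambda>e. (\<lambda>e. e 0 = t (\<lambda>n. e (Suc n))) (\<lambda>n. e (case n of 0 \<Rightarrow> 0 | Suc m \<Rightarrow> Suc (Suc m))))"
    by (rule dfn_subst) blast
  then show ?thesis by (simp add: dfnf_def)
qed

lemma dfn_app: "dfn (\<lambda>e. R (e 0) (\<lambda>n. e (Suc n))) \<Longrightarrow> dfnf f \<Longrightarrow> dfn (\<lambda>e. R (f e) e)"
proof -
  assume "dfn (\<lambda>e. R (e 0) (\<lambda>n. e (Suc n)))" "dfnf f"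
  then have "dfn (\<lambda>e. \<exists>x. x = f e \<and> R x e)"
    unfolding dfnf_def by (intro dfn_ex dfn_conj)
  then show ?thesis by simp
qed

lemma dfn_app1: "dfn (\<lambda>e. R (e 0)) \<Longrightarrow> dfnf f \<Longrightarrow> dfn (\<lambda>e. R (f e))"
  by (rule dfn_app)

lemma dfn_perm:
  "dfn (\<lambda>e. R2 (e 0) (e (Suc 0))) \<Longrightarrow> dfn (\<lambda>e. R2 (e a) (e b))"
  "dfn (\<lambda>e. R3 (e 0) (e (Suc 0)) (e (Suc (Suc 0)))) \<Longrightarrow> dfn (\<lambda>e. R3 (e a) (e b) (e c))"
  "dfn (\<lambda>e. R4 (e 0) (e (Suc 0)) (e (Suc (Suc 0))) (e (Suc (Suc (Suc 0))))) \<Longrightarrow>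
    dfn (\<lambda>e. R4 (e a) (e b) (e c) (e d))"
proof -
  define k where "k n = (if n = 0 then a else if n = Suc 0 then b else if n = Suc (Suc 0) then c else d)" for n
  note * = dfn_subst[where s = "\<lambda>e n. e (k n)"]
  show "dfn (\<lambda>e. R2 (e 0) (e (Suc 0))) \<Longrightarrow> dfn (\<lambda>e. R2 (e a) (e b))"
    by (drule *) (auto simp: k_def)
  show "dfn (\<lambda>e. R3 (e 0) (e (Suc 0)) (e (Suc (Suc 0)))) \<Longrightarrow> dfn (\<lambda>e. R3 (e a) (e b) (e c))"
    by (drule *) (auto simp: k_def)
  show "dfn (\<lambda>e. R4 (e 0) (e (Suc 0)) (e (Suc (Suc 0))) (e (Suc (Suc (Suc 0))))) \<Longrightarrow>
    dfn (\<lambda>e. R4 (e a) (e b) (e c) (e d))"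
    by (drule *) (auto simp: k_def)
qed

lemma dfn_app2:
  assumes "dfn (\<lambda>e. R (e 0) (e (Suc 0)))" "dfnf f" "dfnf g"
  shows "dfn (\<lambda>e. R (f e) (g e))"
proof (rule dfn_app[where R = "\<lambda>x e. R x (g e)", OF _ assms(2)])
  show "dfn (\<lambda>e. R (e 0) (g (\<lambda>n. e (Suc n))))"
    by (rule dfn_app[where R = "\<lambda>y e. R (e 0) y", OF dfn_perm(1)[OF assms(1)] dfnf_shift[OF assms(3)]])
qed

lemma dfn_app3:
  assumes "dfn (\<lambda>e. R (e 0) (e (Suc 0)) (e (Suc (Suc 0))))" "dfnf f" "dfnf g" "dfnf h"
  shows "dfn (\<lambda>e. R (f e) (g e) (h e))"
proof (rule dfn_app[where R = "\<lambda>x e. R x (g e) (h e)", OF _ assms(2)])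
  show "dfn (\<lambda>e. R (e 0) (g (\<lambda>n. e (Suc n))) (h (\<lambda>n. e (Suc n))))"
  proof (rule dfn_app[where R = "\<lambda>y e. R (e 0) y (h (\<lambda>n. e (Suc n)))", OF _ dfnf_shift[OF assms(3)]])
    show "dfn (\<lambda>e. R (e (Suc 0)) (e 0) (h (\<lambda>n. e (Suc (Suc n)))))"
      by (rule dfn_app[where R = "\<lambda>z e. R (e (Suc 0)) (e 0) z",
        OF dfn_perm(2)[OF assms(1)] dfnf_shift[OF dfnf_shift[OF assms(4)]]])
  qed
qed

lemma dfn_app4:
  assumes "dfn (\<lambda>e. R (e 0) (e (Suc 0)) (e (Suc (Suc 0))) (e (Suc (Suc (Suc 0)))))"
    "dfnf f" "dfnf g" "dfnf h" "dfnf k"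
  shows "dfn (\<lambda>e. R (f e) (g e) (h e) (k e))"
proof (rule dfn_app[where R = "\<lambda>x e. R x (g e) (h e) (k e)", OF _ assms(2)])
  show "dfn (\<lambda>e. R (e 0) (g (\<lambda>n. e (Suc n))) (h (\<lambda>n. e (Suc n))) (k (\<lambda>n. e (Suc n))))"
  proof (rule dfn_app[where R = "\<lambda>y e. R (e 0) y (h (\<lambda>n. e (Suc n))) (k (\<lambda>n. e (Suc n)))",
        OF _ dfnf_shift[OF assms(3)]])
    show "dfn (\<lambda>e. R (e (Suc 0)) (e 0) (h (\<lambda>n. e (Suc (Suc n)))) (k (\<lambda>n. e (Suc (Suc n)))))"
    proof (rule dfn_app[where R = "\<lambda>z e. R (e (Suc 0)) (e 0) z (k (\<lambda>n. e (Suc (Suc n))))",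
        OF _ dfnf_shift[OF dfnf_shift[OF assms(4)]]])
      show "dfn (\<lambda>e. R (e (Suc (Suc 0))) (e (Suc 0)) (e 0) (k (\<lambda>n. e (Suc (Suc (Suc n))))))"
        by (rule dfn_app[where R = "\<lambda>u e. R (e (Suc (Suc 0))) (e (Suc 0)) (e 0) u",
          OF dfn_perm(3)[OF assms(1)] dfnf_shift[OF dfnf_shift[OF dfnf_shift[OF assms(5)]]]])
    qed
  qed
qed

lemma dfnf_app1:
  "dfn (\<lambda>e. e 0 = F (e (Suc 0))) \<Longrightarrow> dfnf f \<Longrightarrow> dfnf (\<lambda>e. F (f e))"
  unfolding dfnf_def[of "\<lambda>e. F (f e)"]
  by (rule dfn_app2[where R = "\<lambda>x y. x = F y"]) (auto intro: dfnf_var dfnf_shift)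

lemma dfnf_app2:
  "dfn (\<lambda>e. e 0 = F (e (Suc 0)) (e (Suc (Suc 0)))) \<Longrightarrow> dfnf f \<Longrightarrow> dfnf g \<Longrightarrow> dfnf (\<lambda>e. F (f e) (g e))"
  unfolding dfnf_def[of "\<lambda>e. F (f e) (g e)"]
  by (rule dfn_app3[where R = "\<lambda>x y z. x = F y z"]) (auto intro: dfnf_var dfnf_shift)

named_theorems dfns

lemmas [dfns] = dfn_const dfn_imp dfn_all dfn_not dfn_disj dfn_conj dfn_iff dfn_ex dfnf_var dfnf_const

lemma dfn_E [dfns]: "dfnf f \<Longrightarrow> dfnf g \<Longrightarrow> dfn (\<lambda>e. E (f e) (g e))"
  by (rule dfn_app2[where R = E, OF dfn_atom(1)])

lemma dfn_eq [dfns]: "dfnf f \<Longrightarrow> dfnf g \<Longrightarrow> dfn (\<lambda>e. f e = g e)"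
  by (rule dfn_app2[where R = "(=)", OF dfn_atom(2)])

lemma dfnf_jf [dfns]: "dfnf f \<Longrightarrow> dfnf (\<lambda>e. jf (f e))"
  by (rule dfnf_app1[where F = jf, OF dfn_atom(3)])

lemma dfn_Ball [dfns]: "dfn (\<lambda>e. \<forall>x. x \<in> A e \<longrightarrow> P x e) \<Longrightarrow> dfn (\<lambda>e. \<forall>x\<in>A e. P x e)"
  by (simp add: Ball_def)

lemma dfn_Bex [dfns]: "dfn (\<lambda>e. \<exists>x. x \<in> A e \<and> P x e) \<Longrightarrow> dfn (\<lambda>e. \<exists>x\<in>A e. P x e)"
  by (simp add: Bex_def)

lemma dfn_Collect [dfns]: "dfn (\<lambda>e. P (f e) e) \<Longrightarrow> dfn (\<lambda>e. f e \<in> {x. P x e})"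
  by simp

lemma dfn_bexnat: "(\<And>k. dfn (P k)) \<Longrightarrow> dfn (\<lambda>e. \<exists>k<(m::nat). P k e)"
proof (induction m)
  case (Suc m)
  then show ?case using dfn_disj[of "P m" "\<lambda>e. \<exists>k<m. P k e"] by (simp add: Ex_less_Suc disj_commute)
qed (simp add: dfn_const)

end


section \<open>Models of Zermelo set theory\<close>

locale Zmodel = struct +
  assumes extensional: "(\<And>z. E z x \<longleftrightarrow> E z y) \<Longrightarrow> x = y"
    and pairing: "\<exists>u. \<forall>z. E z u \<longleftrightarrow> z = x \<or> z = y"
    and union: "\<exists>u. \<forall>z. E z u \<longleftrightarrow> (\<exists>y. E y x \<and> E z y)"
    and power: "\<exists>u. \<forall>z. E z u \<longleftrightarrow> (\<forall>w. E w z \<longrightarrow> E w x)"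
    and comprehension: "dfn (\<lambda>e. P (e 0)) \<Longrightarrow> \<exists>u. \<forall>z. E z u \<longleftrightarrow> E z a \<and> P z"
begin

definition elts :: "nat \<Rightarrow> nat set" where "elts x = {z. E z x}"

text \<open>HOL sets of naturals play the role of the classes of the model. \<open>sm\<close>
  singles out those that are sets of the model, and \<open>st\<close> returns the element with that
  extension.\<close>

definition sm :: "nat set \<Rightarrow> bool" where "sm S \<longleftrightarrow> (\<exists>x. elts x = S)"

definition st :: "nat set \<Rightarrow> nat" where "st S = (THE x. elts x = S)"

lemma elts_inj: "elts x = elts y \<Longrightarrow> x = y"
  by (rule extensional) (auto simp: elts_def)

lemma st_elts [simp]: "st (elts x) = x"
  unfolding st_def by (rule the_equality) (simp, rule elts_inj)

lemma sm_elts [simp, intro!]: "sm (elts x)"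
  by (auto simp: sm_def)

lemma elts_st: "sm S \<Longrightarrow> elts (st S) = S"
  by (auto simp: sm_def)

lemma in_elts [dfns]: "dfnf f \<Longrightarrow> dfnf g \<Longrightarrow> dfn (\<lambda>e. f e \<in> elts (g e))"
  unfolding elts_def by (simp add: dfn_E)

lemma sm_sep: "sm A \<Longrightarrow> dfn (\<lambda>e. P (e 0)) \<Longrightarrow> sm {z \<in> A. P z}"
proof -
  assume A: "sm A" "dfn (\<lambda>e. P (e 0))"
  obtain a where "A = elts a" using A(1) by (auto simp: sm_def)
  moreover obtain u where "\<forall>z. E z u \<longleftrightarrow> E z a \<and> P z" using comprehension[OF A(2)] by blast
  ultimately have "elts u = {z \<in> A. P z}" by (auto simp: elts_def)
  then show ?thesis by (auto simp: sm_def)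
qed

lemma sm_sub: "dfn (\<lambda>e. e 0 \<in> B) \<Longrightarrow> sm A \<Longrightarrow> B \<subseteq> A \<Longrightarrow> sm B"
  using sm_sep[of A "\<lambda>z. z \<in> B"] by (simp add: Collect_conj_eq Int_absorb1)

lemma sm_Collect_sub: "dfn (\<lambda>e. P (e 0)) \<Longrightarrow> sm A \<Longrightarrow> (\<And>z. P z \<Longrightarrow> z \<in> A) \<Longrightarrow> sm {z. P z}"
  by (rule sm_sub) auto

lemma sm_dfn: "sm A \<Longrightarrow> dfnf f \<Longrightarrow> dfn (\<lambda>e. f e \<in> A)"
  using in_elts[OF _ dfnf_const] by (auto simp: sm_def)

lemma sm_pair: "sm {x, y}"
  using pairing[of x y] by (auto simp: sm_def elts_def)

lemma sm_sing: "sm {x}"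
  using sm_pair[of x x] by simp

lemma sm_empty: "sm {}"
  using sm_sep[OF sm_sing[of 0], of "\<lambda>_. False"] dfn_const by simp

lemma sm_Union: "sm (\<Union>(elts ` elts x))"
proof -
  obtain u where "\<forall>z. E z u \<longleftrightarrow> (\<exists>y. E y x \<and> E z y)" using union by blast
  then have "elts u = \<Union>(elts ` elts x)" by (auto simp: elts_def)
  then show ?thesis by (auto simp: sm_def)
qed

lemma sm_Un: "sm A \<Longrightarrow> sm B \<Longrightarrow> sm (A \<union> B)"
proof -
  assume "sm A" "sm B"
  then obtain a b where "A = elts a" "B = elts b" by (auto simp: sm_def)
  then show ?thesis using sm_Union[of "st {a, b}"] by (simp add: elts_st sm_pair)
qed

lemma sm_insert: "sm A \<Longrightarrow> sm (insert x A)"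
  using sm_Un[OF sm_sing] by simp

lemma sm_Pow: "sm {z. elts z \<subseteq> elts x}"
proof -
  obtain u where "\<forall>z. E z u \<longleftrightarrow> (\<forall>w. E w z \<longrightarrow> E w x)" using power by blast
  then have "elts u = {z. elts z \<subseteq> elts x}" by (auto simp: elts_def)
  then show ?thesis by (auto simp: sm_def)
qed

lemma dfn_subset [dfns]: "dfnf f \<Longrightarrow> dfnf g \<Longrightarrow> dfn (\<lambda>e. elts (f e) \<subseteq> elts (g e))"
  by (rule dfn_app2) (simp add: subset_iff, intro dfns)

definition emp :: nat where "emp = st {}"

definition ins :: "nat \<Rightarrow> nat \<Rightarrow> nat" where "ins x y = st (insert x (elts y))"

definition un :: "nat \<Rightarrow> nat \<Rightarrow> nat" where "un x y = st (elts x \<union> elts y)"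

definition Un1 :: "nat \<Rightarrow> nat" where "Un1 x = st (\<Union>(elts ` elts x))"

definition Pw :: "nat \<Rightarrow> nat" where "Pw x = st {z. elts z \<subseteq> elts x}"

definition up :: "nat \<Rightarrow> nat \<Rightarrow> nat" where "up x y = st {x, y}"

definition pr :: "nat \<Rightarrow> nat \<Rightarrow> nat" where "pr x y = up (up x x) (up x y)"

lemma elts_emp [simp]: "elts emp = {}"
  and elts_ins [simp]: "elts (ins x y) = insert x (elts y)"
  and elts_un [simp]: "elts (un x y) = elts x \<union> elts y"
  and elts_Un1 [simp]: "elts (Un1 x) = \<Union>(elts ` elts x)"
  and elts_Pw [simp]: "elts (Pw x) = {z. elts z \<subseteq> elts x}"
  and elts_up [simp]: "elts (up x y) = {x, y}"
  by (simp_all add: emp_def ins_def un_def Un1_def Pw_def up_def elts_st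
      sm_empty sm_insert sm_Un sm_Union sm_Pow sm_pair)

lemma pr_inj [simp]: "pr x y = pr x' y' \<longleftrightarrow> x = x' \<and> y = y'"
proof
  assume "pr x y = pr x' y'"
  then have "elts (pr x y) = elts (pr x' y')" by simp
  then have *: "{up x x, up x y} = {up x' x', up x' y'}" unfolding pr_def by simp
  have up: "up a b = up c d \<longleftrightarrow> {a, b} = {c, d}" for a b c d
    using elts_up elts_inj by metis
  show "x = x' \<and> y = y'" using * unfolding doubleton_eq_iff up by auto
qed auto

lemma eq_iff_elts: "x = y \<longleftrightarrow> (\<forall>z. E z x \<longleftrightarrow> z \<in> elts y)"
  using extensional by (auto simp: elts_def)

lemma dfnf_sets [dfns]:
  "dfnf f \<Longrightarrow> dfnf (\<lambda>e. Un1 (f e))"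
  "dfnf f \<Longrightarrow> dfnf (\<lambda>e. Pw (f e))"
  by ((rule dfnf_app1, subst eq_iff_elts, simp, intro dfns, assumption)+)

lemma dfnf_sets2 [dfns]:
  "dfnf f \<Longrightarrow> dfnf g \<Longrightarrow> dfnf (\<lambda>e. ins (f e) (g e))"
  "dfnf f \<Longrightarrow> dfnf g \<Longrightarrow> dfnf (\<lambda>e. un (f e) (g e))"
  "dfnf f \<Longrightarrow> dfnf g \<Longrightarrow> dfnf (\<lambda>e. up (f e) (g e))"
  by ((rule dfnf_app2, subst eq_iff_elts, simp, intro dfns, assumption, assumption)+)

lemma dfnf_pr [dfns]: "dfnf f \<Longrightarrow> dfnf g \<Longrightarrow> dfnf (\<lambda>e. pr (f e) (g e))"
  unfolding pr_def by (intro dfns)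

lemma pr_in_Pw: "x \<in> elts a \<Longrightarrow> y \<in> elts a \<Longrightarrow> pr x y \<in> elts (Pw (Pw a))"
  by (auto simp: pr_def)

lemma sm_prod: "sm A \<Longrightarrow> sm B \<Longrightarrow> sm {pr x y | x y. x \<in> A \<and> y \<in> B}"
proof -
  assume "sm A" "sm B"
  then obtain a b where ab: "A = elts a" "B = elts b" by (auto simp: sm_def)
  show ?thesis
    by (rule sm_sub[OF _ sm_elts[of "Pw (Pw (un a b))"]])
      (unfold ab, intro dfns, auto simp: pr_def)
qed

end

lemma sat_conn:
  "sat D R j e (p \<^bold>\<or> q) \<longleftrightarrow> sat D R j e p \<or> sat D R j e q"
  "sat D R j e (p \<^bold>\<and> q) \<longleftrightarrow> sat D R j e p \<and> sat D R j e q"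
  "sat D R j e (p \<^bold>\<longleftrightarrow> q) \<longleftrightarrow> (sat D R j e p \<longleftrightarrow> sat D R j e q)"
  "sat D R j e (Exists p) \<longleftrightarrow> (\<exists>x\<in>D. sat D R j (case_nat x e) p)"
  by auto

lemma sat_axioms:
  "sat D R j e Ax_Extensionality \<longleftrightarrow> (\<forall>x\<in>D. \<forall>y\<in>D. (\<forall>z\<in>D. R z x \<longleftrightarrow> R z y) \<longrightarrow> x = y)"
  "sat D R j e Ax_Pairing \<longleftrightarrow> (\<forall>x\<in>D. \<forall>y\<in>D. \<exists>u\<in>D. \<forall>z\<in>D. R z u \<longleftrightarrow> z = x \<or> z = y)"
  "sat D R j e Ax_Union \<longleftrightarrow> (\<forall>x\<in>D. \<exists>u\<in>D. \<forall>z\<in>D. R z u \<longleftrightarrow> (\<exists>y\<in>D. R y x \<and> R z y))"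
  "sat D R j e Ax_Power_Set \<longleftrightarrow>
    (\<forall>x\<in>D. \<exists>u\<in>D. \<forall>z\<in>D. R z u \<longleftrightarrow> (\<forall>w\<in>D. R w z \<longrightarrow> R w x))"
  "sat D R j e (Comprehension_instance (\<^bold>\<not> Var 0 \<^bold>\<in> Var 0)) \<longleftrightarrow>
    (\<forall>x\<in>D. \<exists>u\<in>D. \<forall>z\<in>D. R z u \<longleftrightarrow> R z x \<and> \<not> R z z)"
  unfolding Ax_Extensionality_def Ax_Pairing_def Ax_Union_def Ax_Power_Set_def
    Comprehension_instance_def univ_closure_def rename_def
  by (simp_all add: sat.simps(5) sat_conn numeral_3_eq_3 numeral_2_eq_2 iff_conv_conj_imp disj_imp
      del: sat.simps(4) cong: conj_cong) (simp_all add: imp_conjL)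

lemma finite_models_excluded:
  assumes "sat D R j e Ax_Pairing" "sat D R j e Ax_Union"
    "sat D R j e (Comprehension_instance (\<^bold>\<not> Var 0 \<^bold>\<in> Var 0))"
  shows "sat D R j e no_universal \<and> sat D R j e adjoining"
proof
  note p = assms(1)[unfolded sat_axioms] and un = assms(2)[unfolded sat_axioms]
    and c = assms(3)[unfolded sat_axioms]
  have "\<exists>u\<in>D. \<not> R u x" if "x \<in> D" for x using c that by blast
  then show "sat D R j e no_universal" by (auto simp: no_universal_def)
  have "\<exists>u\<in>D. (\<forall>z\<in>D. R z x \<longrightarrow> R z u) \<and> R y u" if xy: "x \<in> D" "y \<in> D" for x y
  proof -
    obtain s where s: "s \<in> D" "\<forall>z\<in>D. R z s \<longleftrightarrow> z = y" using bspec[OF bspec[OF p xy(2)] xy(2)] by auto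
    obtain q where q: "q \<in> D" "\<forall>z\<in>D. R z q \<longleftrightarrow> z = x \<or> z = s" using bspec[OF bspec[OF p xy(1)] s(1)] by auto
    obtain u where "u \<in> D" "\<forall>z\<in>D. R z u \<longleftrightarrow> (\<exists>y\<in>D. R y q \<and> R z y)" using bspec[OF un q(1)] by auto
    then show ?thesis using s q xy by (intro bexI[of _ u]) auto
  qed
  then show "sat D R j e adjoining"
    by (simp add: adjoining_def numeral_3_eq_3 numeral_2_eq_2)
qed

lemma Zmodel_intro:
  assumes "\<And>p e. p \<in> {Ax_Extensionality, Ax_Pairing, Ax_Union, Ax_Power_Set} \<Longrightarrow> sat UNIV E jf e p"
    and "\<And>p e. sat UNIV E jf e (Comprehension_instance p)"
  shows "Zmodel E jf"
proof
  interpret struct E jf .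
  have *: "sat UNIV E jf (\<lambda>_. 0) Ax_Extensionality" "sat UNIV E jf (\<lambda>_. 0) Ax_Pairing"
    "sat UNIV E jf (\<lambda>_. 0) Ax_Union" "sat UNIV E jf (\<lambda>_. 0) Ax_Power_Set"
    by (rule assms(1), simp)+
  note ax = *[unfolded sat_axioms]
  fix x y a :: nat
  show "(\<And>z. E z x \<longleftrightarrow> E z y) \<Longrightarrow> x = y"
    using ax(1) by simp
  show "\<exists>u. \<forall>z. E z u \<longleftrightarrow> z = x \<or> z = y"
    using ax(2) by simp
  show "\<exists>u. \<forall>z. E z u \<longleftrightarrow> (\<exists>y. E y x \<and> E z y)"
    using ax(3) by simp
  show "\<exists>u. \<forall>z. E z u \<longleftrightarrow> (\<forall>w. E w z \<longrightarrow> E w x)"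
    using ax(4) by simp
  fix P assume "dfn (\<lambda>e. P (e 0))"
  then obtain N p where p: "\<And>M e. M \<ge> N \<Longrightarrow>
      P (e 0) \<longleftrightarrow> satE (\<lambda>n. if n < M then e n else n - M) (p M)"
    unfolding dfn_def by blast
  \<comment> \<open>The offset leaves room for at least two arguments, the element \<open>z\<close>
    and the bounding set \<open>a\<close>; the remaining argument places receive 0, and the names of
    constants follow after them.\<close>
  define M where "M = Suc (Suc N)"
  define e' where "e' n = (if Suc (Suc n) < M then 0 else Suc (Suc n) - M)" for n
  define q where "q = rename (case_nat 0 (\<lambda>n. n + 2)) (p M)"
  have "satE e' (Forall (Exists (Forall (Var 0 \<^bold>\<in> Var 1 \<^bold>\<longleftrightarrow> Var 0 \<^bold>\<in> Var 2 \<^bold>\<and> q))))"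
    using assms(2)[of e' "p M"] unfolding Comprehension_instance_def sat_univ_closure q_def by blast
  then have "\<exists>u. \<forall>z. E z u \<longleftrightarrow> E z a \<and> satE (case_nat z (case_nat u (case_nat a e'))) q"
    unfolding sat.simps(5) sat_conn by (simp add: numeral_2_eq_2 iff_conv_conj_imp imp_conjL)
  moreover have "satE (case_nat z (case_nat u (case_nat a e'))) q \<longleftrightarrow> P z" for z u
  proof -
    have *: "(\<lambda>n. case_nat z (case_nat u (case_nat a e')) (case_nat 0 (\<lambda>n. n + 2) n)) =
        (\<lambda>n. if n < M then (case_nat z (case_nat a (\<lambda>_. 0))) n else n - M)"
      by (rule ext) (auto simp: e'_def M_def split: nat.splits)
    have "N \<le> M" by (simp add: M_def)
    from p[OF this, of "case_nat z (case_nat a (\<lambda>_. 0))"] show ?thesis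
      unfolding q_def sat_rename * by simp
  qed
  ultimately show "\<exists>u. \<forall>z. E z u \<longleftrightarrow> E z a \<and> P z" by simp
qed

lemma Comprehension_strip:
  "sat UNIV E id e (Comprehension_instance (strip p)) = sat UNIV E id e (Comprehension_instance p)"
  unfolding Comprehension_instance_def sat_univ_closure by (simp add: sat_rename sat_strip)

context Zmodel
begin

lemma pr_comps:
  assumes "pr x y \<in> elts r"
  shows "x \<in> elts (Un1 (Un1 r))" "y \<in> elts (Un1 (Un1 r))"
proof -
  have "up x y \<in> elts (pr x y)" by (simp add: pr_def)
  then have "up x y \<in> elts (Un1 r)" using assms unfolding elts_Un1 by blast
  then have "elts (up x y) \<subseteq> elts (Un1 (Un1 r))" unfolding elts_Un1[of "Un1 r"] by blast
  then show "x \<in> elts (Un1 (Un1 r))" "y \<in> elts (Un1 (Un1 r))" by simp_all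
qed

end

section \<open>Ordinals and recursion in a model of \<open>ZF\<close>\<close>

locale ZFmodel = Zmodel E id for E +
  assumes replacement: "dfn (\<lambda>e. P (e 0) (e (Suc 0))) \<Longrightarrow>
      (\<And>x y y'. x \<in> elts a \<Longrightarrow> P y x \<Longrightarrow> P y' x \<Longrightarrow> y = y') \<Longrightarrow> sm {y. \<exists>x\<in>elts a. P y x}"
    and foundation: "elts x \<noteq> {} \<Longrightarrow> \<exists>y\<in>elts x. elts y \<inter> elts x = {}"
    and infinity: "\<exists>x. emp \<in> elts x \<and> (\<forall>y\<in>elts x. ins y y \<in> elts x)"
begin

definition Ord :: "nat \<Rightarrow> bool" where
  "Ord x \<longleftrightarrow> (\<forall>y\<in>elts x. elts y \<subseteq> elts x) \<and> (\<forall>y\<in>elts x. \<forall>z\<in>elts y. elts z \<subseteq> elts y)"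

lemma Ord_dfn [dfns]: "dfnf f \<Longrightarrow> dfn (\<lambda>e. Ord (f e))"
  by (rule dfn_app1) (unfold Ord_def, intro dfns)

lemma Ord_trans: "Ord x \<Longrightarrow> y \<in> elts x \<Longrightarrow> z \<in> elts y \<Longrightarrow> z \<in> elts x"
  unfolding Ord_def by blast

lemma Ord_elt: "Ord x \<Longrightarrow> y \<in> elts x \<Longrightarrow> Ord y"
  unfolding Ord_def by blast

lemma irrefl: "x \<notin> elts x"
  using foundation[of "up x x"] by auto

lemma least:
  assumes "dfn (\<lambda>e. P (e 0))" "Ord a" "P a"
  shows "\<exists>b. Ord b \<and> P b \<and> (\<forall>c\<in>elts b. \<not> P c)"
proof -
  define S where "S = {z \<in> insert a (elts a). P z}"
  have "sm S" unfolding S_def by (rule sm_sep[OF sm_insert[OF sm_elts] assms(1)])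
  moreover have "a \<in> S" using assms(3) by (simp add: S_def)
  ultimately obtain y where y: "y \<in> S" "elts y \<inter> S = {}"
    using foundation[of "st S"] by (auto simp: elts_st)
  have "c \<in> insert a (elts a)" if "c \<in> elts y" for c
    using y(1) that assms(2) Ord_trans by (auto simp: S_def)
  moreover have "Ord y" "P y" using y(1) assms(2) Ord_elt by (auto simp: S_def)
  ultimately show ?thesis using y(2) by (intro exI[of _ y]) (auto simp: S_def)
qed

lemma leastE:
  assumes "dfn (\<lambda>e. P (e 0))" "Ord a" "P a"
  obtains b where "Ord b" "P b" "\<forall>c\<in>elts b. \<not> P c"
  using least[where P = P, OF assms] by blast

text \<open>Choose a least \<open>a'\<close> incomparable with some ordinal and then a least
  \<open>b'\<close> incomparable with \<open>a'\<close>. Minimality makes each of them a subset of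
  the other.\<close>

lemma Ord_linear:
  assumes "Ord a" "Ord b"
  shows "a \<in> elts b \<or> a = b \<or> b \<in> elts a"
proof (rule ccontr)
  let ?cmp = "\<lambda>a b. a \<in> elts b \<or> a = b \<or> b \<in> elts a"
  assume "\<not> ?thesis"
  then have ex: "\<exists>b. Ord b \<and> \<not> ?cmp a b" using assms(2) by blast
  have d: "dfn (\<lambda>e. \<exists>b. Ord b \<and> \<not> ?cmp (e 0) b)" by (intro dfns)
  obtain a' where a':
    "Ord a'" "\<exists>b. Ord b \<and> \<not> ?cmp a' b" "\<forall>c\<in>elts a'. \<not> (\<exists>b. Ord b \<and> \<not> ?cmp c b)"
    by (rule leastE[where P = "\<lambda>a. \<exists>b. Ord b \<and> \<not> ?cmp a b", OF d assms(1) ex], rule that)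
  then obtain b0 where b0: "Ord b0" "\<not> ?cmp a' b0" by blast
  have d: "dfn (\<lambda>e. \<not> ?cmp a' (e 0))" by (intro dfns)
  obtain b' where b':
    "Ord b'" "\<not> ?cmp a' b'" "\<forall>c\<in>elts b'. \<not> \<not> ?cmp a' c"
    by (rule leastE[where P = "\<lambda>b. \<not> ?cmp a' b", OF d b0], rule that)
  have "z \<in> elts b'" if z: "z \<in> elts a'" for z
    using bspec[OF a'(3) z] b'(1,2) z Ord_trans[OF a'(1) z] by blast
  moreover have "z \<in> elts a'" if z: "z \<in> elts b'" for z
    using bspec[OF b'(3) z] b'(2) z Ord_trans[OF b'(1) z] by blast
  ultimately have "elts a' = elts b'" by blast
  then show False using b'(2) elts_inj by blast
qed

lemma Ord_subset: "Ord a \<Longrightarrow> Ord b \<Longrightarrow> elts a \<subseteq> elts b \<longleftrightarrow> a = b \<or> a \<in> elts b"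
proof
  assume "Ord a" "Ord b" "elts a \<subseteq> elts b"
  then show "a = b \<or> a \<in> elts b" using Ord_linear[of a b] irrefl[of b] by blast
next
  assume "Ord b" "a = b \<or> a \<in> elts b"
  then show "elts a \<subseteq> elts b" unfolding Ord_def by blast
qed

abbreviation sc :: "nat \<Rightarrow> nat" where "sc a \<equiv> ins a a"

lemma Ord_sc: "Ord a \<Longrightarrow> Ord (sc a)"
  unfolding Ord_def by auto

lemma Ord_Un1: "(\<And>x. x \<in> elts A \<Longrightarrow> Ord x) \<Longrightarrow> Ord (Un1 A)"
  unfolding Ord_def by (simp, blast)

lemma Ord_bound:
  assumes "sm A" "\<And>x. x \<in> A \<Longrightarrow> Ord x"
  shows "\<exists>b. Ord b \<and> A \<subseteq> elts b"
proof -
  let ?u = "Un1 (st A)"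
  have A: "elts (st A) = A" by (rule elts_st[OF assms(1)])
  have u: "Ord ?u" by (rule Ord_Un1) (use A assms(2) in simp)
  have "x \<in> elts (sc ?u)" if x: "x \<in> A" for x
  proof -
    have "elts x \<subseteq> elts ?u" using A x by auto
    then show ?thesis using Ord_subset[OF assms(2)[OF x] u] by auto
  qed
  then show ?thesis using Ord_sc[OF u] by (intro exI[of _ "sc ?u"]) blast
qed

lemma not_sm_Ord: "\<not> sm {x. Ord x}"
proof
  assume "sm {x. Ord x}"
  then have "\<exists>b. Ord b \<and> {x. Ord x} \<subseteq> elts b" by (rule Ord_bound) simp
  then obtain b where "Ord b" "{x. Ord x} \<subseteq> elts b" by blast
  then have "b \<in> elts b" by blast
  then show False using irrefl by blast
qed

text \<open>Passing to the least witness makes the relation functional, so Replacement yields this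
  form of Collection for witnesses that are ordinals.\<close>

lemma bounding:
  assumes "dfn (\<lambda>e. P (e 0) (e (Suc 0)))" "\<And>x. x \<in> elts a \<Longrightarrow> \<exists>g. Ord g \<and> P x g"
  shows "\<exists>b. Ord b \<and> (\<forall>x\<in>elts a. \<exists>g\<in>elts b. Ord g \<and> P x g)"
proof -
  define Q where "Q g x \<longleftrightarrow> Ord g \<and> P x g \<and> (\<forall>c\<in>elts g. \<not> P x c)" for g x
  have "sm {g. \<exists>x\<in>elts a. Q g x}"
  proof (rule replacement)
    show "dfn (\<lambda>e. Q (e 0) (e (Suc 0)))"
      unfolding Q_def by (intro dfns dfn_perm(1)[OF assms(1)])
    show "y = y'" if "Q y x" "Q y' x" for x y y'
      using that Ord_linear[of y y'] unfolding Q_def by blast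
  qed
  then have "\<exists>b. Ord b \<and> {g. \<exists>x\<in>elts a. Q g x} \<subseteq> elts b"
    by (rule Ord_bound) (auto simp: Q_def)
  then obtain b where b: "Ord b" "{g. \<exists>x\<in>elts a. Q g x} \<subseteq> elts b" by blast
  have "\<exists>g\<in>elts b. Ord g \<and> P x g" if x: "x \<in> elts a" for x
  proof -
    obtain g where g: "Ord g" "P x g" using assms(2)[OF x] by blast
    have "dfn (\<lambda>e. P x (e 0))" by (rule dfn_app2[OF assms(1)]) (intro dfns)+
    then have "\<exists>g'. Q g' x" unfolding Q_def by (rule least[where P = "P x", OF _ g])
    then obtain g' where g': "Q g' x" by blast
    then have "g' \<in> elts b" using b(2) x by blast
    then show ?thesis using g' unfolding Q_def by blast
  qed
  then show ?thesis using b(1) by blast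
qed

text \<open>The inductive set from Infinity may contain other things than ordinals and may fail to
  be transitive; the union of its ordinals is an ordinal, and it has no largest element because
  these ordinals are closed under successor.\<close>

lemma limit_exists: "\<exists>l. Ord l \<and> emp \<in> elts l \<and> (\<forall>b\<in>elts l. sc b \<in> elts l)"
proof -
  obtain I where I: "emp \<in> elts I" "\<And>y. y \<in> elts I \<Longrightarrow> sc y \<in> elts I" using infinity by blast
  define X where "X = {x \<in> elts I. Ord x}"
  have "sm X" unfolding X_def by (rule sm_sep[OF sm_elts]) (intro dfns)
  then have X: "elts (st X) = X" by (rule elts_st)
  have l: "Ord (Un1 (st X))" by (rule Ord_Un1) (simp add: X, simp add: X_def)
  have emp: "emp \<in> X" using I(1) by (simp add: X_def Ord_def)
  have sc: "sc x \<in> X" if "x \<in> X" for x using that I(2) Ord_sc by (simp add: X_def)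
  have in_l: "x \<in> elts (Un1 (st X))" if "x \<in> X" for x
    using sc[OF that] unfolding elts_Un1 X by (intro UN_I[of "sc x"]) auto
  have "sc b \<in> elts (Un1 (st X))" if "b \<in> elts (Un1 (st X))" for b
  proof -
    obtain x where x: "x \<in> X" "b \<in> elts x" using \<open>b \<in> elts (Un1 (st X))\<close> by (auto simp: X)
    have "Ord x" using x(1) by (simp add: X_def)
    then have "elts (sc b) \<subseteq> elts x" using x(2) unfolding Ord_def by simp
    then have "sc b = x \<or> sc b \<in> elts x"
      using Ord_subset[of "sc b" x] \<open>Ord x\<close> Ord_sc[OF Ord_elt[OF \<open>Ord x\<close> x(2)]] by blast
    then show ?thesis using in_l[OF x(1)] Ord_trans[OF l in_l[OF x(1)]] by blast
  qed
  then show ?thesis using l in_l[OF emp] by (intro exI[of _ "Un1 (st X)"]) blast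
qed

end

text \<open>\<open>N R a\<close> is the extension to be given to the ordinal \<open>a\<close> once
  the ordinals below \<open>a\<close> have the extensions recorded by \<open>R\<close>. The
  parameter of \<open>R\<close> in the last two assumptions is needed to apply \<open>N\<close>
  uniformly to relations that are coded by elements of the model.\<close>

locale recursion = ZFmodel +
  fixes N :: "(nat \<Rightarrow> nat \<Rightarrow> bool) \<Rightarrow> nat \<Rightarrow> nat \<Rightarrow> bool"
  assumes N_cong: "\<And>R R' a x. Ord a \<Longrightarrow> (\<And>b y. b \<in> elts a \<Longrightarrow> R y b = R' y b) \<Longrightarrow> N R a x = N R' a x"
    and N_sm: "\<And>R r a. (\<And>b. b \<in> elts a \<Longrightarrow> sm {y. R r y b}) \<Longrightarrow>
      dfn (\<lambda>e. R (e 0) (e (Suc 0)) (e (Suc (Suc 0)))) \<Longrightarrow> Ord a \<Longrightarrow> sm {x. N (R r) a x}"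
    and N_dfn: "\<And>R. dfn (\<lambda>e. R (e 0) (e (Suc 0)) (e (Suc (Suc 0)))) \<Longrightarrow>
      dfn (\<lambda>e. N (R (e 0)) (e (Suc 0)) (e (Suc (Suc 0))))"
begin

definition code :: "nat \<Rightarrow> nat \<Rightarrow> nat \<Rightarrow> bool" where
  "code r x y \<longleftrightarrow> pr x y \<in> elts r"

lemma code_dfn: "dfn (\<lambda>e. code (e a) (e b) (e c))"
  unfolding code_def by (intro dfns)

definition approx :: "nat \<Rightarrow> nat \<Rightarrow> bool" where
  "approx \<alpha> r \<longleftrightarrow> Ord \<alpha> \<and> (\<forall>a\<in>elts \<alpha>. \<forall>x. code r x a \<longleftrightarrow> N (code r) a x)"

lemma approx_dfn: "dfn (\<lambda>e. approx (e a) (e b))"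
  unfolding approx_def
  by (intro dfns code_dfn dfn_perm(2)[where ?R3.0 = "\<lambda>r. N (code r)", OF N_dfn[where R = code, OF code_dfn]])

definition EE :: "nat \<Rightarrow> nat \<Rightarrow> bool" where
  "EE x a \<longleftrightarrow> (\<exists>\<alpha> r. approx \<alpha> r \<and> a \<in> elts \<alpha> \<and> code r x a)"

lemma EE_dfn [dfns]: "dfnf f \<Longrightarrow> dfnf g \<Longrightarrow> dfn (\<lambda>e. EE (f e) (g e))"
  by (rule dfn_app2) (unfold EE_def, intro dfns code_dfn approx_dfn)

lemma NEE_dfn: "dfn (\<lambda>e. N EE (e a) (e b))"
  by (rule dfn_perm(2)[where ?R3.0 = "\<lambda>r. N EE" and a = 0])
    (rule N_dfn[where R = "\<lambda>_. EE"], intro dfns)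

lemma approx_unique:
  assumes "approx \<alpha> r" "approx \<alpha>' r'" "a \<in> elts \<alpha>" "a \<in> elts \<alpha>'"
  shows "code r x a = code r' x a"
proof (rule ccontr)
  assume "code r x a \<noteq> code r' x a"
  let ?P = "\<lambda>a. a \<in> elts \<alpha> \<and> a \<in> elts \<alpha>' \<and> (\<exists>x. code r x a \<noteq> code r' x a)"
  have O: "Ord \<alpha>" "Ord \<alpha>'" using assms by (auto simp: approx_def)
  have P: "?P a" using assms(3,4) \<open>code r x a \<noteq> code r' x a\<close> by blast
  have d: "dfn (\<lambda>e. ?P (e 0))" unfolding code_def by (intro dfns)
  obtain b where
    b: "Ord b" "?P b" "\<forall>c\<in>elts b. \<not> ?P c"
    by (rule leastE[where P = ?P, OF d Ord_elt[OF O(1) assms(3)] P], rule that)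
  have "code r y c = code r' y c" if "c \<in> elts b" for c y
    using b(2) bspec[OF b(3) that] Ord_trans[OF O(1) _ that] Ord_trans[OF O(2) _ that] by blast
  then have "N (code r) b = N (code r') b" using N_cong[OF b(1), of "code r" "code r'"] by blast
  then show False using assms(1,2) b(2) by (auto simp: approx_def)
qed

lemma EE_approx: "approx \<alpha> r \<Longrightarrow> a \<in> elts \<alpha> \<Longrightarrow> EE x a \<longleftrightarrow> code r x a"
  unfolding EE_def using approx_unique by blast

lemma approx_step: "approx \<alpha> r \<Longrightarrow> a \<in> elts \<alpha> \<Longrightarrow> EE x a \<longleftrightarrow> N EE a x"
proof -
  assume r: "approx \<alpha> r" "a \<in> elts \<alpha>"
  then have "Ord \<alpha>" by (simp add: approx_def)
  have "N (code r) a x = N EE a x"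
    by (rule N_cong[OF Ord_elt[OF \<open>Ord \<alpha>\<close> r(2)]])
      (use EE_approx[OF r(1)] Ord_trans[OF \<open>Ord \<alpha>\<close> r(2)] in auto)
  then show ?thesis using EE_approx[OF r] r by (simp add: approx_def)
qed

text \<open>At a least counterexample \<open>b\<close>, the approximations below \<open>b\<close>
  agree with each other and hence with \<open>EE\<close>. The sections \<open>N EE c\<close> are
  then sets, Replacement collects them, and their union codes an approximation for
  \<open>b\<close>.\<close>

lemma approx_exists: "Ord a \<Longrightarrow> \<exists>r. approx a r"
proof (rule ccontr)
  assume "Ord a" "\<not> (\<exists>r. approx a r)"
  have d: "dfn (\<lambda>e. \<not> (\<exists>r. approx (e 0) r))" by (intro dfns approx_dfn)
  obtain b where
    b: "Ord b" "\<not> (\<exists>r. approx b r)" "\<forall>c\<in>elts b. \<not> \<not> (\<exists>r. approx c r)"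
    by (rule leastE[where P = "\<lambda>a. \<not> (\<exists>r. approx a r)", OF d \<open>Ord a\<close> \<open>\<not> (\<exists>r. approx a r)\<close>], rule that)
  have step: "EE y d \<longleftrightarrow> N EE d y" if "c \<in> elts b" "d \<in> elts c" for c d y
    using bspec[OF b(3) that(1)] approx_step that(2) by blast
  have small: "sm {x. N EE c x}" if c: "c \<in> elts b" for c
  proof (rule N_sm[where R = "\<lambda>_. EE"])
    obtain r where r: "approx c r" using bspec[OF b(3) c] by blast
    fix d assume d: "d \<in> elts c"
    have "{y. EE y d} = {y. code r y d}" using EE_approx[OF r d] by simp
    moreover have "sm {y. code r y d}"
    proof (rule sm_Collect_sub)
      show "dfn (\<lambda>e. code r (e 0) d)" unfolding code_def by (intro dfns)
      show "y \<in> elts (Un1 (Un1 r))" if "code r y d" for y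
        using that pr_comps(1) unfolding code_def by blast
    qed (rule sm_elts)
    ultimately show "sm {y. EE y d}" by simp
  qed (intro dfns, use Ord_elt b(1) c in blast)
  define t where "t c = st {pr x c | x. N EE c x}" for c
  have t_sm: "sm {pr x c | x. N EE c x}" if c: "c \<in> elts b" for c
  proof (rule sm_sub[OF _ sm_prod[OF small[OF c] sm_sing[of c]]])
    show "dfn (\<lambda>e. e 0 \<in> {pr x c | x. N EE c x})"
      by (intro dfns dfn_app2[where R = "N EE", OF NEE_dfn])
  qed auto
  have "sm {y. \<exists>c\<in>elts b. \<forall>u. u \<in> elts y \<longleftrightarrow> (\<exists>x. u = pr x c \<and> N EE c x)}"
    by (rule replacement[where P = "\<lambda>y c. \<forall>u. u \<in> elts y \<longleftrightarrow> (\<exists>x. u = pr x c \<and> N EE c x)"])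
      (intro dfns NEE_dfn, rule elts_inj, blast)
  then have T: "sm (\<Union>(elts ` {y. \<exists>c\<in>elts b. \<forall>u. u \<in> elts y \<longleftrightarrow> (\<exists>x. u = pr x c \<and> N EE c x)}))"
    using sm_Union[of "st {y. \<exists>c\<in>elts b. \<forall>u. u \<in> elts y \<longleftrightarrow> (\<exists>x. u = pr x c \<and> N EE c x)}"]
    by (simp only: elts_st)
  define r where "r = st (\<Union>(elts ` {y. \<exists>c\<in>elts b. \<forall>u. u \<in> elts y \<longleftrightarrow> (\<exists>x. u = pr x c \<and> N EE c x)}))"
  have code: "code r x c \<longleftrightarrow> N EE c x" if c: "c \<in> elts b" for x c
  proof -
    have "pr x c \<in> elts (t c) \<longleftrightarrow> N EE c x" unfolding t_def by (simp add: elts_st[OF t_sm[OF c]])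
    moreover have "\<forall>u. u \<in> elts (t c) \<longleftrightarrow> (\<exists>x. u = pr x c \<and> N EE c x)"
      unfolding t_def by (simp add: elts_st[OF t_sm[OF c]])
    ultimately show ?thesis unfolding code_def r_def elts_st[OF T] using c by auto
  qed
  have "approx b r"
    unfolding approx_def
  proof (intro conjI ballI allI b(1))
    fix c x assume c: "c \<in> elts b"
    have "N (code r) c x = N EE c x"
    proof (rule N_cong[OF Ord_elt[OF b(1) c]])
      fix d y assume d: "d \<in> elts c"
      show "code r y d = EE y d" using step[OF c d] code[OF Ord_trans[OF b(1) c d]] by simp
    qed
    then show "code r x c \<longleftrightarrow> N (code r) c x" using code[OF c] by simp
  qed
  then show False using b(2) by blast
qed

theorem EE_rec: "Ord a \<Longrightarrow> EE x a \<longleftrightarrow> N EE a x"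
  using approx_exists[OF Ord_sc] approx_step[of "sc a" _ a x] by auto

lemma EE_Ord: "EE x a \<Longrightarrow> Ord a"
  unfolding EE_def approx_def using Ord_elt by blast

end

context struct
begin

text \<open>The environments to which \<open>dfn_subst\<close> applies, packaged so that a binder
  can be pushed through with \<open>simple_case\<close>.\<close>

definition simple :: "((nat \<Rightarrow> nat) \<Rightarrow> nat \<Rightarrow> nat) \<Rightarrow> bool" where
  "simple s \<longleftrightarrow> (\<forall>n. (\<exists>k. \<forall>e. s e n = e k) \<or> (\<exists>c. \<forall>e. s e n = c))"

lemma simple_var: "simple (\<lambda>e n. e (k n))" and simple_const: "simple (\<lambda>e. f)"
  unfolding simple_def by blast+

lemma simple_case:
  assumes "simple s"
  shows "simple (\<lambda>e. case_nat (e k) (s e))" "simple (\<lambda>e. case_nat c (s e))"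
proof -
  show "simple (\<lambda>e. case_nat (e k) (s e))" unfolding simple_def
  proof
    fix n show "(\<exists>k'. \<forall>e. case_nat (e k) (s e) n = e k') \<or> (\<exists>c. \<forall>e. case_nat (e k) (s e) n = c)"
      using assms unfolding simple_def by (cases n) auto
  qed
  show "simple (\<lambda>e. case_nat c (s e))" unfolding simple_def
  proof
    fix n show "(\<exists>k. \<forall>e. case_nat c (s e) n = e k) \<or> (\<exists>d. \<forall>e. case_nat c (s e) n = d)"
      using assms unfolding simple_def by (cases n) auto
  qed
qed

lemma dfn_simple: "dfn P \<Longrightarrow> simple s \<Longrightarrow> dfn (\<lambda>e. P (s e))"
  unfolding simple_def by (rule dfn_subst) auto

lemma dfn_ball_list: "(\<And>p. dfn (Q p)) \<Longrightarrow> dfn (\<lambda>e. \<forall>p\<in>set ps. Q p e)"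
  by (induction ps) (auto intro: dfn_conj dfn_const)

end

lemma tmv_id: "tmv id e t = e (var_of t)"
  by (induction t) auto

lemma sat_rel_cong:
  assumes "\<And>u v. v \<in> C \<Longrightarrow> R u v = R' u v" "D \<subseteq> C" "\<And>n. e n \<in> C"
  shows "sat D R id e p = sat D R' id e p"
  using assms(3)
proof (induction p arbitrary: e)
  case (Forall p)
  have "sat D R id (case_nat x e) p = sat D R' id (case_nat x e) p" if "x \<in> D" for x
    by (rule Forall.IH) (use that assms(2) Forall.prems in \<open>auto split: nat.splits\<close>)
  then show ?case by (simp only: sat.simps cong: ball_cong)
qed (auto simp: tmv_id assms(1))


section \<open>A well-ordered model of a finite set of rules\<close>

text \<open>Given finitely many formulas \<open>\<Phi>\<close>, a membership relation on the ordinals is defined by recursion: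
  every ordinal receives as extension the first set that is not yet represented, among the sets
  defined by a formula of \<open>\<Phi>\<close> over an initial segment and the sets of least elements of the members
  of a represented set. As \<open>\<Phi>\<close> is finite, no internal truth predicate is needed, and as the elements
  are ordinals, choice comes for free.\<close>

locale rules = ZFmodel +
  fixes \<Phi> :: "fm list"
  assumes \<Phi>0: "\<Phi> \<noteq> []" "\<Phi> ! 0 = (Var 0 \<^bold>= Var 0)"
begin

text \<open>An ordinal is its own initial segment, so \<open>elts d\<close> serves as the domain.
  Variable 0 is the candidate, variable 1 is \<open>p\<close>, and \<open>q\<close> fills all
  further variables. The number \<open>length \<Phi>\<close> belongs to the rule for least elements,
  the source of choice.\<close>

definition Dfs :: "(nat \<Rightarrow> nat \<Rightarrow> bool) \<Rightarrow> nat \<Rightarrow> nat \<Rightarrow> nat \<Rightarrow> nat \<Rightarrow> nat \<Rightarrow> bool" where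
  "Dfs R k d p q x \<longleftrightarrow> x \<in> elts d \<and>
    (if k < length \<Phi> then sat (elts d) R id (case_nat x (case_nat p (\<lambda>_. q))) (\<Phi> ! k)
     else \<exists>y\<in>elts d. R y p \<and> R x y \<and> (\<forall>z\<in>elts x. \<not> R z y))"

definition New :: "(nat \<Rightarrow> nat \<Rightarrow> bool) \<Rightarrow> nat \<Rightarrow> nat \<Rightarrow> nat \<Rightarrow> nat \<Rightarrow> nat \<Rightarrow> bool" where
  "New R a k d p q \<longleftrightarrow> (d = a \<or> d \<in> elts a) \<and> p \<in> elts a \<and> q \<in> elts a \<and>
    \<not> (\<exists>b\<in>elts a. \<forall>x. R x b \<longleftrightarrow> Dfs R k d p q x)"

definition anyN :: "(nat \<Rightarrow> nat \<Rightarrow> bool) \<Rightarrow> nat \<Rightarrow> nat \<Rightarrow> nat \<Rightarrow> nat \<Rightarrow> bool" where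
  "anyN R a d p q \<longleftrightarrow> (\<exists>k<Suc (length \<Phi>). New R a k d p q)"

text \<open>The first missing set in the lexicographic order of \<open>(d, p, q, k)\<close>. The
  domain weighs most, so as long as something over \<open>d\<close> is missing, no set over a larger
  domain is handed out; \<open>EE_complete\<close> depends on this.\<close>

definition minN :: "(nat \<Rightarrow> nat \<Rightarrow> bool) \<Rightarrow> nat \<Rightarrow> nat \<Rightarrow> nat \<Rightarrow> nat \<Rightarrow> nat \<Rightarrow> bool" where
  "minN R a k d p q \<longleftrightarrow> New R a k d p q \<and> \<not> (\<exists>k'<k. New R a k' d p q) \<and>
    (\<forall>q'\<in>elts q. \<not> anyN R a d p q') \<and> (\<forall>p'\<in>elts p. \<forall>q. \<not> anyN R a d p' q) \<and>
    (\<forall>d'\<in>elts d. \<forall>p q. \<not> anyN R a d' p q)"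

definition Nx :: "(nat \<Rightarrow> nat \<Rightarrow> bool) \<Rightarrow> nat \<Rightarrow> nat \<Rightarrow> bool" where
  "Nx R a x \<longleftrightarrow> (\<exists>k<Suc (length \<Phi>). \<exists>d p q. minN R a k d p q \<and> Dfs R k d p q x)"

lemma Dfs_cong:
  assumes "Ord a" "\<And>b y. b \<in> elts a \<Longrightarrow> R y b = R' y b" "d = a \<or> d \<in> elts a" "p \<in> elts a" "q \<in> elts a"
  shows "Dfs R k d p q x = Dfs R' k d p q x"
proof -
  have da: "elts d \<subseteq> elts a" using assms(1,3) unfolding Ord_def by blast
  have "sat (elts d) R id (case_nat x (case_nat p (\<lambda>_. q))) (\<Phi> ! k) =
      sat (elts d) R' id (case_nat x (case_nat p (\<lambda>_. q))) (\<Phi> ! k)" if "x \<in> elts d"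
    by (rule sat_rel_cong[of "elts a"]) (use assms(2,4,5) da that in \<open>auto split: nat.splits\<close>)
  moreover have "(\<exists>y\<in>elts d. R y p \<and> R x y \<and> (\<forall>z\<in>elts x. \<not> R z y)) \<longleftrightarrow>
      (\<exists>y\<in>elts d. R' y p \<and> R' x y \<and> (\<forall>z\<in>elts x. \<not> R' z y))"
    using assms(2)[OF assms(4)] assms(2) da by (metis subsetD)
  ultimately show ?thesis unfolding Dfs_def by (auto split: if_splits)
qed

lemma New_cong:
  assumes "Ord a" "\<And>b y. b \<in> elts a \<Longrightarrow> R y b = R' y b"
  shows "New R a k d p q = New R' a k d p q"
proof (cases "(d = a \<or> d \<in> elts a) \<and> p \<in> elts a \<and> q \<in> elts a")
  case True
  then have "Dfs R k d p q x = Dfs R' k d p q x" for x using Dfs_cong[where R = R and R' = R', OF assms] by blast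
  moreover have "(\<exists>b\<in>elts a. \<forall>x. R x b = P x) = (\<exists>b\<in>elts a. \<forall>x. R' x b = P x)" for P
    by (rule bex_cong[OF refl]) (simp add: assms(2))
  ultimately show ?thesis unfolding New_def by simp
next
  case False
  then show ?thesis unfolding New_def by blast
qed

lemma Nx_cong:
  assumes "Ord a" "\<And>b y. b \<in> elts a \<Longrightarrow> R y b = R' y b"
  shows "Nx R a x = Nx R' a x"
proof -
  have N: "New R a = New R' a" by (intro ext New_cong[OF assms])
  have m: "minN R a = minN R' a" unfolding minN_def anyN_def N by simp
  have "minN R' a k d p q \<and> Dfs R k d p q x \<longleftrightarrow> minN R' a k d p q \<and> Dfs R' k d p q x" for k d p q
  proof (cases "minN R' a k d p q")
    case True
    then have "d = a \<or> d \<in> elts a" "p \<in> elts a" "q \<in> elts a" unfolding minN_def New_def by blast+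
    then show ?thesis using Dfs_cong[where R = R and R' = R', OF assms] by blast
  qed simp
  then show ?thesis unfolding Nx_def m by simp
qed

lemma Nx_lt: "Ord a \<Longrightarrow> Nx R a x \<Longrightarrow> x \<in> elts a"
proof -
  assume "Ord a" "Nx R a x"
  then obtain k d p q where "New R a k d p q" "Dfs R k d p q x" unfolding Nx_def minN_def by blast
  then have "d = a \<or> d \<in> elts a" "x \<in> elts d" unfolding New_def Dfs_def by blast+
  then show ?thesis using Ord_trans[OF \<open>Ord a\<close>] by blast
qed

context
  fixes R :: "nat \<Rightarrow> nat \<Rightarrow> nat \<Rightarrow> bool"
  assumes R: "dfn (\<lambda>e. R (e 0) (e (Suc 0)) (e (Suc (Suc 0))))"
begin

lemma R_dfn: "dfn (\<lambda>e. R (e r) (e m) (e n))"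
  by (rule dfn_perm(2)[OF R])

text \<open>The induction runs over the given formula outside of the model. Satisfaction of one
  fixed formula is definable, uniformly in the domain and in the coded relation.\<close>

lemma sat_dfn: "dfn (\<lambda>e. sat (elts (e 0)) (R (e (Suc 0))) id (\<lambda>n. e (Suc (Suc n))) p)"
proof (induction p)
  case (Forall p)
  let ?s = "\<lambda>e. case_nat (e (Suc 0)) (case_nat (e (Suc (Suc 0))) (case_nat (e 0) (\<lambda>n. e (Suc (Suc (Suc n))))))"
  have "simple ?s" by (intro simple_case simple_var)
  from dfn_simple[OF Forall this] have "dfn (\<lambda>e. sat (elts (e (Suc 0))) (R (e (Suc (Suc 0)))) id
      (case_nat (e 0) (\<lambda>n. e (Suc (Suc (Suc n))))) p)" by (simp only: nat.case)
  then show ?case unfolding sat.simps by (intro dfns)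
qed (unfold sat.simps tmv_id, (intro dfns R_dfn; assumption)+)

lemma Dfs_dfn: "dfn (\<lambda>e. Dfs (R (e r)) k (e d) (e p) (e q) (e x))"
proof -
  let ?s = "\<lambda>e. case_nat (e d) (case_nat (e r) (case_nat (e x) (case_nat (e p) (\<lambda>_. e q))))"
  have "simple ?s" by (intro simple_case simple_var[where k = "\<lambda>_. q"])
  from dfn_simple[OF sat_dfn this]
  have "dfn (\<lambda>e. sat (elts (e d)) (R (e r)) id (case_nat (e x) (case_nat (e p) (\<lambda>_. e q))) (\<Phi> ! k))" by (simp only: nat.case)
  then show ?thesis
    by (cases "k < length \<Phi>") (simp_all only: Dfs_def if_True if_False, (intro dfns R_dfn; assumption)+)
qed

lemma New_dfn: "dfn (\<lambda>e. New (R (e r)) (e a) k (e d) (e p) (e q))"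
  unfolding New_def by (intro dfns R_dfn Dfs_dfn)

lemma anyN_dfn: "dfn (\<lambda>e. anyN (R (e r)) (e a) (e d) (e p) (e q))"
  unfolding anyN_def by (intro dfn_bexnat New_dfn)

lemma Nx_dfn: "dfn (\<lambda>e. Nx (R (e r)) (e a) (e x))"
  unfolding Nx_def minN_def by (intro dfns dfn_bexnat New_dfn anyN_dfn Dfs_dfn)

end

lemma recursion_Nx: "recursion E Nx"
proof
  show "Ord a \<Longrightarrow> (\<And>b y. b \<in> elts a \<Longrightarrow> R y b = R' y b) \<Longrightarrow> Nx R a x = Nx R' a x" for R R' a x
    by (rule Nx_cong)
  show "dfn (\<lambda>e. Nx (R (e 0)) (e (Suc 0)) (e (Suc (Suc 0))))"
    if "dfn (\<lambda>e. R (e 0) (e (Suc 0)) (e (Suc (Suc 0))))" for R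
    by (rule Nx_dfn[OF that])
  show "sm {x. Nx (R r) a x}"
    if "dfn (\<lambda>e. R (e 0) (e (Suc 0)) (e (Suc (Suc 0))))" "Ord a" for R r a
  proof (rule sm_Collect_sub[OF _ sm_elts[of a] Nx_lt[OF that(2)]])
    show "dfn (\<lambda>e. Nx (R r) a (e 0))"
      by (rule dfn_app3[where R = "\<lambda>r. Nx (R r)", OF Nx_dfn[OF that(1)]]) (intro dfns)+
  qed
qed

end

sublocale rules \<subseteq> recursion E Nx
  by (rule recursion_Nx)

context rules
begin

lemma EE_lt: "EE x a \<Longrightarrow> x \<in> elts a"
  using EE_rec EE_Ord Nx_lt by blast

lemma R_EE: "dfn (\<lambda>e. (\<lambda>_. EE) (e 0) (e (Suc 0)) (e (Suc (Suc 0))))"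
  by (intro dfns)

lemmas EE_dfns = New_dfn[OF R_EE] anyN_dfn[OF R_EE] Dfs_dfn[OF R_EE]

lemma minN_unique:
  assumes "Ord a" "minN R a k d p q" "minN R a k' d' p' q'" "k < Suc (length \<Phi>)" "k' < Suc (length \<Phi>)"
  shows "k = k' \<and> d = d' \<and> p = p' \<and> q = q'"
proof -
  have any: "anyN R a d p q" "anyN R a d' p' q'" using assms unfolding minN_def anyN_def by blast+
  have O: "Ord d" "Ord d'" "Ord p" "Ord p'" "Ord q" "Ord q'"
    using assms(1-3) Ord_elt[OF assms(1)] unfolding minN_def New_def by blast+
  have d: "d = d'" using Ord_linear[OF O(1,2)] any assms(2,3) unfolding minN_def by blast
  have p: "p = p'" using Ord_linear[OF O(3,4)] any assms(2,3) unfolding minN_def d by blast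
  have q: "q = q'" using Ord_linear[OF O(5,6)] any assms(2,3) unfolding minN_def d p by blast
  have "\<not> k < k'" "\<not> k' < k" using assms(2,3) unfolding minN_def d p q by blast+
  then show ?thesis using d p q by simp
qed

lemma EE_min:
  assumes "Ord a" "anyN EE a d p q"
  shows "\<exists>k d p q. minN EE a k d p q \<and> (\<forall>x. EE x a \<longleftrightarrow> Dfs EE k d p q x)"
proof -
  have O: "Ord d" "Ord p" "Ord q" if "anyN EE a d p q" for d p q
    using that assms(1) Ord_elt[OF assms(1)] unfolding anyN_def New_def by blast+
  have dd: "dfn (\<lambda>e. \<exists>p q. anyN EE a (e 0) p q)"
    by (rule dfn_app2[where R = "\<lambda>a d. \<exists>p q. anyN EE a d p q"]) (intro dfns EE_dfns)+
  have "\<exists>p q. anyN EE a d p q" using assms(2) by blast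
  from least[where P = "\<lambda>d. \<exists>p q. anyN EE a d p q", OF dd O(1)[OF assms(2)] this]
  obtain d1 where d1: "\<exists>p q. anyN EE a d1 p q" "\<forall>c\<in>elts d1. \<not> (\<exists>p q. anyN EE a c p q)" by blast
  then obtain p0 where p0: "\<exists>q. anyN EE a d1 p0 q" by blast
  then have Op: "Ord p0" using O(2) by blast
  have dp: "dfn (\<lambda>e. \<exists>q. anyN EE a d1 (e 0) q)"
    by (rule dfn_app3[where R = "\<lambda>a d p. \<exists>q. anyN EE a d p q"]) (intro dfns EE_dfns)+
  from least[where P = "\<lambda>p. \<exists>q. anyN EE a d1 p q", OF dp Op p0]
  obtain p1 where p1: "\<exists>q. anyN EE a d1 p1 q" "\<forall>c\<in>elts p1. \<not> (\<exists>q. anyN EE a d1 c q)" by blast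
  then obtain q0 where q0: "anyN EE a d1 p1 q0" by blast
  have dq: "dfn (\<lambda>e. anyN EE a d1 p1 (e 0))"
    by (rule dfn_app4[where R = "\<lambda>a d p q. anyN EE a d p q"]) (intro dfns EE_dfns)+
  from least[where P = "\<lambda>q. anyN EE a d1 p1 q", OF dq O(3)[OF q0] q0]
  obtain q1 where q1: "anyN EE a d1 p1 q1" "\<forall>c\<in>elts q1. \<not> anyN EE a d1 p1 c" by blast
  define k where "k = (LEAST k. k < Suc (length \<Phi>) \<and> New EE a k d1 p1 q1)"
  have k: "k < Suc (length \<Phi>) \<and> New EE a k d1 p1 q1"
    unfolding k_def by (rule LeastI_ex) (use q1(1) in \<open>simp add: anyN_def\<close>)
  have "\<not> New EE a k' d1 p1 q1" if "k' < k" for k'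
    using not_less_Least[of k' "\<lambda>k. k < Suc (length \<Phi>) \<and> New EE a k d1 p1 q1"] that k
    unfolding k_def by auto
  then have m: "minN EE a k d1 p1 q1" unfolding minN_def using k d1(2) p1(2) q1(2) by blast
  have "EE x a \<longleftrightarrow> Dfs EE k d1 p1 q1 x" for x
  proof -
    have "Nx EE a x \<longleftrightarrow> Dfs EE k d1 p1 q1 x"
    proof
      assume "Nx EE a x"
      then obtain k' d' p' q' where "k' < Suc (length \<Phi>)" "minN EE a k' d' p' q'" "Dfs EE k' d' p' q' x"
        unfolding Nx_def by blast
      then show "Dfs EE k d1 p1 q1 x" using minN_unique[OF assms(1) m, of k' d' p' q'] k by blast
    qed (use m k in \<open>unfold Nx_def, blast\<close>)
    then show ?thesis using EE_rec[OF assms(1)] by blast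
  qed
  then show ?thesis using m by blast
qed

text \<open>Extensions stay strictly below their ordinal, so no \<open>c \<in> elts a\<close> has
  the extension \<open>elts a\<close>. Rule 0 over the domain \<open>a\<close> therefore always
  offers a missing set, and what \<open>a\<close> receives is new.\<close>

lemma EE_distinct:
  assumes "Ord a" "b \<in> elts a"
  shows "\<exists>x. EE x a \<noteq> EE x b"
proof -
  have "Dfs EE 0 a b b x \<longleftrightarrow> x \<in> elts a" for x using \<Phi>0 unfolding Dfs_def by simp
  moreover have "\<exists>x. EE x c \<noteq> (x \<in> elts a)" if "c \<in> elts a" for c
    using EE_lt[of c c] irrefl[of c] that by blast
  ultimately have "New EE a 0 a b b" unfolding New_def using assms(2) by blast
  then have "anyN EE a a b b" unfolding anyN_def by blast
  from EE_min[OF assms(1) this] obtain k d p q where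
    "minN EE a k d p q" "\<forall>x. EE x a \<longleftrightarrow> Dfs EE k d p q x" by blast
  then show ?thesis unfolding minN_def New_def using assms(2) by blast
qed

lemma EE_ext:
  assumes "Ord a" "Ord b" "\<And>x. EE x a = EE x b"
  shows "a = b"
  using Ord_linear[OF assms(1,2)] EE_distinct[of a b] EE_distinct[of b a] assms by blast

text \<open>A definable set that never showed up would remain missing at every \<open>a\<close>
  above \<open>d\<close>. The least missing set would then always have a domain of at most
  \<open>d\<close>, and all later extensions would be subsets of \<open>d\<close>. As distinct
  ordinals have distinct extensions, Replacement would make the ordinals a set.\<close>

lemma EE_complete:
  assumes "Ord d" "p \<in> elts d" "q \<in> elts d" "k < Suc (length \<Phi>)"
  shows "\<exists>a. Ord a \<and> (\<forall>x. EE x a \<longleftrightarrow> Dfs EE k d p q x)"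
proof (rule ccontr)
  assume none: "\<not> ?thesis"
  have sub: "{x. EE x a} \<subseteq> elts d" if a: "Ord a" "d \<in> elts a" for a
  proof -
    have "New EE a k d p q"
      unfolding New_def
      using none a Ord_elt[OF a(1)] Ord_trans[OF a] assms(2,3) by blast
    then have any: "anyN EE a d p q" unfolding anyN_def using assms(4) by blast
    from EE_min[OF a(1) this] obtain k' d' p' q' where
      m: "minN EE a k' d' p' q'" "\<forall>x. EE x a \<longleftrightarrow> Dfs EE k' d' p' q' x" by blast
    then have "d \<notin> elts d'" using any unfolding minN_def by blast
    moreover have "Ord d'" using m(1) a(1) Ord_elt[OF a(1)] unfolding minN_def New_def by blast
    ultimately have "elts d' \<subseteq> elts d" using Ord_linear[of d' d] Ord_subset[of d' d] assms(1) by blast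
    then show ?thesis using m(2) unfolding Dfs_def by blast
  qed
  have dd: "dfn (\<lambda>e. Ord (e 0) \<and> d \<in> elts (e 0))" by (intro dfns)
  define P where "P a s \<longleftrightarrow> Ord a \<and> d \<in> elts a \<and> (\<forall>x. x \<in> elts s \<longleftrightarrow> EE x a)" for a s
  have "sm {a. \<exists>s\<in>elts (Pw d). P a s}"
  proof (rule replacement)
    show "dfn (\<lambda>e. P (e 0) (e (Suc 0)))" unfolding P_def by (intro dfns)
    show "y = y'" if "P y x" "P y' x" for x y y' using that EE_ext[of y y'] unfolding P_def by blast
  qed
  moreover have "\<exists>s\<in>elts (Pw d). P a s" if a: "Ord a" "d \<in> elts a" for a
  proof -
    have "sm {x. EE x a}" by (rule sm_sub[OF _ sm_elts sub[OF a]]) (simp, intro dfns)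
    from elts_st[OF this] have "elts (st {x. EE x a}) = {x. EE x a}" .
    then show ?thesis using sub[OF a] a unfolding P_def by (intro bexI[of _ "st {x. EE x a}"]) auto
  qed
  ultimately have "sm {a. Ord a \<and> d \<in> elts a}"
    using sm_Collect_sub[where P = "\<lambda>a. Ord a \<and> d \<in> elts a" and A = "{a. \<exists>s\<in>elts (Pw d). P a s}"] dd by blast
  from sm_Un[OF sm_insert[OF sm_elts[of d], of d] this]
  have "sm (insert d (elts d) \<union> {a. Ord a \<and> d \<in> elts a})" .
  then have "sm {x. Ord x}"
    by (rule sm_Collect_sub[rotated]) (use Ord_linear[OF assms(1)] in blast, intro dfns)
  then show False using not_sm_Ord by blast
qed

end

subsection \<open>Reflection\<close>

text \<open>Reflection needs counterexamples below the reflecting ordinal exactly for these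
  formulas.\<close>

primrec bodies :: "fm \<Rightarrow> fm list" where
  "bodies (s \<^bold>= t) = []"
| "bodies (s \<^bold>\<in> t) = []"
| "bodies \<^bold>\<bottom> = []"
| "bodies (p \<^bold>\<longrightarrow> q) = bodies p @ bodies q"
| "bodies (Forall p) = p # bodies p"

context ZFmodel
begin

text \<open>Environments are not elements of the model, so quantification over their first
  \<open>m\<close> entries is expressed by \<open>m\<close> bounded quantifiers. The index
  \<open>k\<close> of the bound moves up with each binder.\<close>

primrec all_env :: "nat \<Rightarrow> nat \<Rightarrow> ((nat \<Rightarrow> nat) \<Rightarrow> bool) \<Rightarrow> (nat \<Rightarrow> nat) \<Rightarrow> bool" where
  "all_env 0 k P e = P e"
| "all_env (Suc m) k P e = (\<forall>x\<in>elts (e k). all_env m (Suc k) P (case_nat x e))"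

lemma all_env_iff:
  "all_env m k P e \<longleftrightarrow> (\<forall>e'. (\<forall>i<m. e' i \<in> elts (e k)) \<longrightarrow> (\<forall>i. e' (m + i) = e i) \<longrightarrow> P e')"
proof (induction m arbitrary: k e)
  case 0
  have "(\<forall>i. e' i = e i) \<longleftrightarrow> e' = e" for e' by auto
  then show ?case by simp
next
  case (Suc m)
  have *: "(\<forall>i. e' (m + i) = case_nat x e i) \<longleftrightarrow> e' m = x \<and> (\<forall>i. e' (Suc m + i) = e i)" for e' x
  proof -
    have all: "(\<forall>i. Q i) \<longleftrightarrow> Q 0 \<and> (\<forall>i. Q (Suc i))" for Q :: "nat \<Rightarrow> bool"
      by (metis not0_implies_Suc)
    show ?thesis by (subst all) simp
  qed
  have "all_env (Suc m) k P e \<longleftrightarrow> (\<forall>x\<in>elts (e k). \<forall>e'. (\<forall>i<m. e' i \<in> elts (e k)) \<longrightarrow>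
      e' m = x \<and> (\<forall>i. e' (Suc m + i) = e i) \<longrightarrow> P e')"
    by (simp only: all_env.simps Suc * nat.case)
  also have "\<dots> \<longleftrightarrow> (\<forall>e'. (\<forall>i<Suc m. e' i \<in> elts (e k)) \<longrightarrow> (\<forall>i. e' (Suc m + i) = e i) \<longrightarrow> P e')"
    unfolding All_less_Suc by blast
  finally show ?case .
qed

lemma all_env_dfn: "dfn P \<Longrightarrow> dfn (all_env m k P)"
proof (induction m arbitrary: k)
  case 0
  moreover have "all_env 0 k P = P" by (rule ext) (rule all_env.simps(1))
  ultimately show ?case by (simp only:)
next
  case (Suc m)
  have "simple (\<lambda>e. case_nat (e 0) (\<lambda>n. e (Suc n)))" by (intro simple_case simple_var)
  from dfn_simple[OF Suc.IH[OF Suc.prems, of "Suc k"] this]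
  have "dfn (\<lambda>e. \<forall>x\<in>elts (e k). all_env m (Suc k) P (case_nat x e))" by (intro dfns)
  moreover have "all_env (Suc m) k P = (\<lambda>e. \<forall>x\<in>elts (e k). all_env m (Suc k) P (case_nat x e))"
    by (rule ext) (rule all_env.simps(2))
  ultimately show ?case by (simp only:)
qed

text \<open>One variable at a time is bounded by \<open>bounding\<close>, with the others as
  parameters; monotonicity in the bound replaces the individual bounds by a common one.\<close>

lemma bound_env:
  assumes "dfn (\<lambda>e. G (\<lambda>n. e (Suc n)) (e 0))"
    and "\<And>e g g'. G e g \<Longrightarrow> Ord g \<Longrightarrow> Ord g' \<Longrightarrow> elts g \<subseteq> elts g' \<Longrightarrow> G e g'"
    and "\<And>e e' g. (\<And>n. n < m \<Longrightarrow> e n = e' n) \<Longrightarrow> G e g = G e' g"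
    and "\<And>e. (\<And>n. Ord (e n)) \<Longrightarrow> \<exists>g. Ord g \<and> G e g"
    and b: "Ord b"
  shows "\<exists>g. Ord g \<and> (\<forall>e. (\<forall>n<m. e n \<in> elts b) \<longrightarrow> G e g)"
  using assms(1-4)
proof (induction m arbitrary: G)
  case 0
  have "Ord emp" by (simp add: Ord_def)
  then obtain g where g: "Ord g" "G (\<lambda>_. emp) g" using "0.prems"(4)[of "\<lambda>_. emp"] by blast
  have "G e g" for e using "0.prems"(3)[of "\<lambda>_. emp" e g] g(2) by blast
  then show ?case using g(1) by blast
next
  case (Suc m)
  define G' where "G' e g \<longleftrightarrow> (\<forall>x\<in>elts b. G (case_nat x e) g)" for e g
  have "\<exists>g. Ord g \<and> (\<forall>e. (\<forall>n<m. e n \<in> elts b) \<longrightarrow> G' e g)"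
  proof (rule Suc.IH)
    have "simple (\<lambda>e. case_nat (e (Suc 0)) (case_nat (e 0) (\<lambda>n. e (Suc (Suc n)))))"
      by (intro simple_case simple_var)
    from dfn_simple[OF Suc.prems(1) this]
    have "dfn (\<lambda>e. G (case_nat (e 0) (\<lambda>n. e (Suc (Suc n)))) (e (Suc 0)))" by (simp only: nat.case)
    then show "dfn (\<lambda>e. G' (\<lambda>n. e (Suc n)) (e 0))" unfolding G'_def by (intro dfns)
    show "G' e g'" if "G' e g" "Ord g" "Ord g'" "elts g \<subseteq> elts g'" for e g g'
      using that Suc.prems(2) unfolding G'_def by blast
    show "G' e g = G' e' g" if "\<And>n. n < m \<Longrightarrow> e n = e' n" for e e' g
    proof -
      have "G (case_nat x e) g = G (case_nat x e') g" for x
        by (rule Suc.prems(3)) (use that in \<open>auto split: nat.splits\<close>)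
      then show ?thesis unfolding G'_def by simp
    qed
    show "\<exists>g. Ord g \<and> G' e g" if e: "\<And>n. Ord (e n)" for e
    proof -
      have "simple (\<lambda>e'. case_nat (e' (Suc 0)) (case_nat (e' 0) e))"
        by (intro simple_case simple_const)
      from dfn_simple[OF Suc.prems(1) this]
      have d: "dfn (\<lambda>e'. G (case_nat (e' 0) e) (e' (Suc 0)))" by (simp only: nat.case)
      have ex: "\<exists>g. Ord g \<and> G (case_nat x e) g" if "x \<in> elts b" for x
      proof (rule Suc.prems(4))
        show "Ord (case_nat x e n)" for n using e Ord_elt[OF b that] by (cases n) auto
      qed
      obtain c where c: "Ord c" "\<forall>x\<in>elts b. \<exists>g\<in>elts c. Ord g \<and> G (case_nat x e) g"
        using bounding[where P = "\<lambda>x g. G (case_nat x e) g" and a = b, OF d ex] by blast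
      have "G (case_nat x e) c" if "x \<in> elts b" for x
      proof -
        obtain g where g: "g \<in> elts c" "Ord g" "G (case_nat x e) g" using c(2) \<open>x \<in> elts b\<close> by blast
        have "elts g \<subseteq> elts c" using g(1) c(1) unfolding Ord_def by blast
        then show ?thesis using Suc.prems(2)[OF g(3,2) c(1)] by blast
      qed
      then show ?thesis using c(1) unfolding G'_def by blast
    qed
  qed
  then obtain g where g: "Ord g" "\<And>e. (\<forall>n<m. e n \<in> elts b) \<Longrightarrow> G' e g" by blast
  have "G e g" if e: "\<forall>n<Suc m. e n \<in> elts b" for e
  proof -
    have "G' (\<lambda>n. e (Suc n)) g" using g(2)[of "\<lambda>n. e (Suc n)"] e by simp
    then have "G (case_nat (e 0) (\<lambda>n. e (Suc n))) g" using e unfolding G'_def by simp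
    moreover have "case_nat (e 0) (\<lambda>n. e (Suc n)) = e" by (auto split: nat.splits)
    ultimately show ?thesis by simp
  qed
  then show ?case using g(1) by blast
qed

end

section \<open>Closing an ordinal under a bounding operation\<close>

locale iteration = ZFmodel +
  fixes H :: "nat \<Rightarrow> nat \<Rightarrow> bool" and \<alpha> :: nat
  assumes \<alpha>: "Ord \<alpha>" and H_dfn: "dfn (\<lambda>e. H (e 0) (e (Suc 0)))"
    and H_ex: "Ord f \<Longrightarrow> \<exists>g. Ord g \<and> H g f"
begin

definition Hl :: "nat \<Rightarrow> nat \<Rightarrow> bool" where
  "Hl g f \<longleftrightarrow> Ord g \<and> H g f \<and> (\<forall>c\<in>elts g. \<not> H c f)"

lemma Hl_unique: "Hl g f \<Longrightarrow> Hl g' f \<Longrightarrow> g = g'"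
  unfolding Hl_def using Ord_linear[of g g'] by blast

lemma Hl_ex: "Ord f \<Longrightarrow> \<exists>g. Hl g f"
proof -
  assume "Ord f"
  then obtain g where g: "Ord g" "H g f" using H_ex by blast
  have "dfn (\<lambda>e. H (e 0) f)" by (rule dfn_app2[OF H_dfn]) (intro dfns)+
  from least[where P = "\<lambda>g. H g f", OF this g] show ?thesis unfolding Hl_def by blast
qed

lemma Hl_dfn: "dfn (\<lambda>e. Hl (e a) (e b))"
  unfolding Hl_def by (intro dfns dfn_perm(1)[OF H_dfn])

definition nxt :: "(nat \<Rightarrow> nat \<Rightarrow> bool) \<Rightarrow> nat \<Rightarrow> nat \<Rightarrow> bool" where
  "nxt R b g \<longleftrightarrow> (\<exists>f. (\<forall>y. y \<in> elts f \<longleftrightarrow> R y b) \<and> Hl g f)"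

text \<open>Stage \<open>a\<close> is the union of \<open>sc \<alpha>\<close> and the least
  \<open>H\<close>-bounds of all earlier stages. The stages increase, and the bound of each one is
  contained in the next.\<close>

definition It :: "(nat \<Rightarrow> nat \<Rightarrow> bool) \<Rightarrow> nat \<Rightarrow> nat \<Rightarrow> bool" where
  "It R a x \<longleftrightarrow> x \<in> elts (sc \<alpha>) \<or> (\<exists>b\<in>elts a. \<exists>g. nxt R b g \<and> x \<in> elts g)"

lemma nxt_unique: "nxt R b g \<Longrightarrow> nxt R b g' \<Longrightarrow> g = g'"
proof -
  assume "nxt R b g" "nxt R b g'"
  then obtain f f' where f: "\<forall>y. y \<in> elts f \<longleftrightarrow> R y b" "Hl g f" "\<forall>y. y \<in> elts f' \<longleftrightarrow> R y b" "Hl g' f'"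
    unfolding nxt_def by blast
  then have "elts f = elts f'" by blast
  then have "f = f'" by (rule elts_inj)
  then show ?thesis using f Hl_unique by blast
qed

lemma It_sm:
  assumes "dfn (\<lambda>e. R (e 0) (e (Suc 0)) (e (Suc (Suc 0))))"
  shows "\<exists>A. (\<forall>g\<in>elts A. Ord g) \<and> {x. It (R r) a x} = elts (Un1 A)"
proof -
  have "dfn (\<lambda>e. \<exists>f. (\<forall>y. y \<in> elts f \<longleftrightarrow> R (e (Suc (Suc 0))) y (e (Suc 0))) \<and> Hl (e 0) f)"
    by (intro dfns dfn_perm(2)[OF assms] Hl_dfn)
  then have "dfn (\<lambda>e. nxt (R (e (Suc (Suc 0)))) (e (Suc 0)) (e 0))" unfolding nxt_def .
  from dfn_app3[where R = "\<lambda>g b r. nxt (R r) b g", OF this dfnf_var[of 0] dfnf_var[of "Suc 0"] dfnf_const[of r]]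
  have "sm {g. \<exists>b\<in>elts a. nxt (R r) b g}"
    by (rule replacement[where P = "\<lambda>g b. nxt (R r) b g"]) (rule nxt_unique)
  from sm_insert[OF this, of "sc \<alpha>"] elts_st
  have A: "elts (st (insert (sc \<alpha>) {g. \<exists>b\<in>elts a. nxt (R r) b g})) =
    insert (sc \<alpha>) {g. \<exists>b\<in>elts a. nxt (R r) b g}" by blast
  have "Ord g" if "nxt (R r) b g" for b g using that unfolding nxt_def Hl_def by blast
  then have "\<forall>g\<in>elts (st (insert (sc \<alpha>) {g. \<exists>b\<in>elts a. nxt (R r) b g})). Ord g"
    unfolding A using Ord_sc[OF \<alpha>] by blast
  moreover have "{x. It (R r) a x} = elts (Un1 (st (insert (sc \<alpha>) {g. \<exists>b\<in>elts a. nxt (R r) b g})))"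
    unfolding elts_Un1 A It_def by blast
  ultimately show ?thesis by blast
qed

lemma recursion_It: "recursion E It"
proof
  fix R R' :: "nat \<Rightarrow> nat \<Rightarrow> bool" and a x
  assume *: "Ord a" "\<And>b y. b \<in> elts a \<Longrightarrow> R y b = R' y b"
  have "nxt R b = nxt R' b" if "b \<in> elts a" for b unfolding nxt_def using *(2)[OF that] by simp
  then show "It R a x = It R' a x" unfolding It_def by simp
next
  fix R :: "nat \<Rightarrow> nat \<Rightarrow> nat \<Rightarrow> bool" and r a
  assume R: "dfn (\<lambda>e. R (e 0) (e (Suc 0)) (e (Suc (Suc 0))))"
  show "dfn (\<lambda>e. It (R (e 0)) (e (Suc 0)) (e (Suc (Suc 0))))"
    unfolding It_def nxt_def by (intro dfns dfn_perm(2)[OF R] Hl_dfn)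
  show "sm {x. It (R r) a x}" using It_sm[OF R, of r a] sm_elts by metis
qed

end

sublocale iteration \<subseteq> F: recursion E It
  by (rule recursion_It)

context iteration
begin

definition stage :: "nat \<Rightarrow> nat \<Rightarrow> bool" where
  "stage f a \<longleftrightarrow> Ord f \<and> (\<forall>y. y \<in> elts f \<longleftrightarrow> F.EE y a)"

lemma stage_ex: "Ord a \<Longrightarrow> \<exists>f. stage f a"
proof -
  assume a: "Ord a"
  have "dfn (\<lambda>e. (\<lambda>_. F.EE) (e 0) (e (Suc 0)) (e (Suc (Suc 0))))" by (intro dfns F.EE_dfn)
  from It_sm[OF this] obtain A where A: "\<forall>g\<in>elts A. Ord g" "{x. It F.EE a x} = elts (Un1 A)" by blast
  have "Ord (Un1 A)" by (rule Ord_Un1) (use A(1) in blast)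
  moreover have "y \<in> elts (Un1 A) \<longleftrightarrow> F.EE y a" for y using F.EE_rec[OF a] A(2) by blast
  ultimately show ?thesis unfolding stage_def by blast
qed

text \<open>The union of the stages below a limit ordinal. \<open>S\<close> is the family of these
  stages; it is kept in the conclusion because \<open>H\<close> is only known to be bounded at
  stages, not at arbitrary subsets of \<delta>.\<close>

lemma closed_exists:
  "\<exists>\<delta> S. Ord \<delta> \<and> \<alpha> \<in> elts \<delta> \<and> (\<forall>\<beta>\<in>elts \<delta>. \<exists>f\<in>S. \<beta> \<in> elts f) \<and>
    (\<forall>f\<in>S. Ord f \<and> (\<exists>g. Ord g \<and> H g f \<and> elts g \<subseteq> elts \<delta>))"
proof -
  obtain l where l: "Ord l" "emp \<in> elts l" "\<forall>b\<in>elts l. sc b \<in> elts l" using limit_exists by blast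
  define S where "S = {f. \<exists>b\<in>elts l. stage f b}"
  have uniq: "f = f'" if "stage f b" "stage f' b" for f f' b
  proof -
    have "elts f = elts f'" using that unfolding stage_def by blast
    then show ?thesis by (rule elts_inj)
  qed
  have "sm S" unfolding S_def
    by (rule replacement[where P = stage])
      (unfold stage_def[abs_def], intro dfns F.EE_dfn, use uniq in \<open>unfold stage_def, blast\<close>)
  then have S: "elts (st S) = S" by (rule elts_st)
  let ?\<delta> = "Un1 (st S)"
  have \<delta>: "elts ?\<delta> = (\<Union>f\<in>S. elts f)" by (simp add: S)
  have OS: "Ord f" if "f \<in> S" for f using that unfolding S_def stage_def by blast
  have 1: "Ord ?\<delta>" by (rule Ord_Un1) (use S OS in blast)
  have 2: "\<alpha> \<in> elts ?\<delta>"
  proof -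
    have "Ord emp" using l Ord_elt by blast
    then obtain f where f: "stage f emp" using stage_ex by blast
    have "It F.EE emp \<alpha>" unfolding It_def by simp
    then have "\<alpha> \<in> elts f" using f F.EE_rec[OF \<open>Ord emp\<close>] unfolding stage_def by blast
    moreover have "f \<in> S" using f l(2) unfolding S_def by blast
    ultimately show ?thesis unfolding \<delta> by blast
  qed
  have 3: "\<exists>g. Ord g \<and> H g f \<and> elts g \<subseteq> elts ?\<delta>" if f: "f \<in> S" for f
  proof -
    obtain b where b: "b \<in> elts l" "stage f b" using f unfolding S_def by blast
    obtain g where g: "Hl g f" using Hl_ex[OF OS[OF f]] by blast
    have sb: "sc b \<in> elts l" using b(1) l(3) by blast
    obtain f' where f': "stage f' (sc b)" using stage_ex[OF Ord_elt[OF l(1) sb]] by blast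
    have "nxt F.EE b g" unfolding nxt_def using b(2) g unfolding stage_def by blast
    then have "It F.EE (sc b) x" if "x \<in> elts g" for x unfolding It_def using that by auto
    then have "elts g \<subseteq> elts f'"
      using f' F.EE_rec[OF Ord_elt[OF l(1) sb]] unfolding stage_def by blast
    moreover have "f' \<in> S" using f' sb unfolding S_def by blast
    ultimately show ?thesis using g unfolding Hl_def \<delta> by blast
  qed
  have 4: "\<exists>f\<in>S. \<beta> \<in> elts f" if "\<beta> \<in> elts ?\<delta>" for \<beta> using that unfolding \<delta> by blast
  show ?thesis
    by (rule exI[of _ ?\<delta>], rule exI[of _ S], intro conjI ballI) (rule 1, rule 2, rule 4, assumption, rule OS, assumption, rule 3)
qed

end

context rules
begin

definition Ords :: "nat set" where "Ords = {x. Ord x}"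

abbreviation satO :: "(nat \<Rightarrow> nat) \<Rightarrow> fm \<Rightarrow> bool" where
  "satO \<equiv> sat Ords EE id"

lemma satO_dfn: "dfn (\<lambda>e. satO e p)"
proof (induction p)
  case (Forall p)
  have "simple (\<lambda>e. case_nat (e 0) (\<lambda>n. e (Suc n)))" by (intro simple_case simple_var)
  from dfn_simple[OF Forall this] show ?case unfolding sat.simps Ords_def by (intro dfns)
qed (unfold sat.simps tmv_id, (intro dfns; assumption)+)

text \<open>The Tarski-Vaught condition for a single universal formula: a counterexample in the
  class of all ordinals entails one below \<open>g\<close>.\<close>

definition escapes :: "fm \<Rightarrow> nat \<Rightarrow> (nat \<Rightarrow> nat) \<Rightarrow> bool" where
  "escapes p g e \<longleftrightarrow> (\<exists>x. Ord x \<and> \<not> satO (case_nat x e) p) \<longrightarrow> (\<exists>x\<in>elts g. \<not> satO (case_nat x e) p)"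

definition bounds :: "fm \<Rightarrow> nat \<Rightarrow> nat \<Rightarrow> bool" where
  "bounds p g b \<longleftrightarrow> (\<forall>e. (\<forall>n<free_bound p. e n \<in> elts b) \<longrightarrow> escapes p g e)"

lemma escapes_cong: "(\<And>n. n < free_bound p \<Longrightarrow> e n = e' n) \<Longrightarrow> escapes p g e = escapes p g e'"
proof -
  assume *: "\<And>n. n < free_bound p \<Longrightarrow> e n = e' n"
  have "satO (case_nat x e) p = satO (case_nat x e') p" for x
    by (rule sat_cong) (use * in \<open>auto split: nat.splits\<close>)
  then show ?thesis unfolding escapes_def by simp
qed

lemma satO_case_dfn: "dfn (\<lambda>e. satO (case_nat (e 0) (\<lambda>n. e (Suc (k n)))) p)"
  by (rule dfn_simple[OF satO_dfn]) (intro simple_case simple_var[where k = "\<lambda>n. Suc (k n)"])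

lemma escapes_dfn: "dfn (\<lambda>e. escapes p (e m) (\<lambda>n. e (k n)))"
  unfolding escapes_def by (intro dfns satO_case_dfn)

text \<open>Only \<open>free_bound p\<close> entries of the environment matter, so the quantifier
  over environments becomes a block of that many quantifiers, followed by the given environment in
  shifted position.\<close>

lemma bounds_dfn: "dfn (\<lambda>e. bounds p (e 0) (e (Suc 0)))"
proof -
  let ?m = "free_bound p"
  have "bounds p (e 0) (e (Suc 0)) \<longleftrightarrow> all_env ?m (Suc 0) (\<lambda>e. escapes p (e ?m) e) e" for e
  proof
    assume "bounds p (e 0) (e (Suc 0))"
    then show "all_env ?m (Suc 0) (\<lambda>e. escapes p (e ?m) e) e"
      unfolding all_env_iff bounds_def by (metis add_0_right)
  next
    assume r: "all_env ?m (Suc 0) (\<lambda>e. escapes p (e ?m) e) e"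
    show "bounds p (e 0) (e (Suc 0))" unfolding bounds_def
    proof (intro allI impI)
      fix f assume f: "\<forall>n<?m. f n \<in> elts (e (Suc 0))"
      define f' where "f' n = (if n < ?m then f n else e (n - ?m))" for n
      have "\<forall>i<?m. f' i \<in> elts (e (Suc 0))" "\<forall>i. f' (?m + i) = e i" using f by (simp_all add: f'_def)
      then have "escapes p (f' ?m) f'" using r unfolding all_env_iff by blast
      moreover have "escapes p (e 0) f' = escapes p (e 0) f"
        by (rule escapes_cong) (simp add: f'_def)
      ultimately show "escapes p (e 0) f" by (simp add: f'_def)
    qed
  qed
  moreover have "dfn (all_env ?m (Suc 0) (\<lambda>e. escapes p (e ?m) e))"
    by (rule all_env_dfn[OF escapes_dfn])
  ultimately show ?thesis by simp
qed

lemma bounds_mono: "bounds p g b \<Longrightarrow> elts g \<subseteq> elts g' \<Longrightarrow> bounds p g' b"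
  unfolding bounds_def escapes_def by blast

lemma bounds_ex: "Ord b \<Longrightarrow> \<exists>g. Ord g \<and> bounds p g b"
  unfolding bounds_def
proof (rule bound_env)
  show "dfn (\<lambda>e. escapes p (e 0) (\<lambda>n. e (Suc n)))" by (rule escapes_dfn)
  show "escapes p g' e" if "escapes p g e" "elts g \<subseteq> elts g'" for e g g'
    using that unfolding escapes_def by blast
  show "escapes p g e = escapes p g e'" if "\<And>n. n < free_bound p \<Longrightarrow> e n = e' n" for e e' g
    by (rule escapes_cong[OF that])
  show "\<exists>g. Ord g \<and> escapes p g e" for e
  proof (cases "\<exists>x. Ord x \<and> \<not> satO (case_nat x e) p")
    case True
    then obtain x where "Ord x" "\<not> satO (case_nat x e) p" by blast
    then show ?thesis unfolding escapes_def using Ord_sc[of x] by (intro exI[of _ "sc x"]) auto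
  next
    case False
    then show ?thesis unfolding escapes_def using \<Phi>0 by (intro exI[of _ emp]) (auto simp: Ord_def)
  qed
qed

lemma bounds_list_ex: "Ord b \<Longrightarrow> \<exists>g. Ord g \<and> (\<forall>p\<in>set ps. bounds p g b)"
proof (induction ps)
  case Nil
  then show ?case by auto
next
  case (Cons p ps)
  then obtain g g' where g: "Ord g" "\<forall>p\<in>set ps. bounds p g b" "Ord g'" "bounds p g' b"
    using bounds_ex by meson
  consider "elts g \<subseteq> elts g'" | "elts g' \<subseteq> elts g"
    using Ord_linear[OF g(1,3)] g(1,3) unfolding Ord_def by blast
  then show ?case
  proof cases
    case 1
    then show ?thesis using g bounds_mono by (intro exI[of _ g']) auto
  next
    case 2
    then show ?thesis using g bounds_mono by (intro exI[of _ g]) auto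
  qed
qed

theorem reflection:
  assumes "Ord \<alpha>"
  shows "\<exists>\<delta>. Ord \<delta> \<and> \<alpha> \<in> elts \<delta> \<and> (\<forall>p e. set (bodies p) \<subseteq> set ps \<longrightarrow> (\<forall>n. e n \<in> elts \<delta>) \<longrightarrow>
    sat (elts \<delta>) EE id e p = satO e p)"
proof -
  define H where "H g f \<longleftrightarrow> (\<forall>p\<in>set ps. bounds p g f)" for g f
  interpret I: iteration E H \<alpha>
  proof
    show "Ord \<alpha>" by fact
    show "dfn (\<lambda>e. H (e 0) (e (Suc 0)))" unfolding H_def by (intro dfn_ball_list bounds_dfn)
    show "\<exists>g. Ord g \<and> H g f" if "Ord f" for f unfolding H_def using bounds_list_ex[OF that] .
  qed
  obtain \<delta> S where \<delta>: "Ord \<delta>" "\<alpha> \<in> elts \<delta>" "\<forall>\<beta>\<in>elts \<delta>. \<exists>f\<in>S. \<beta> \<in> elts f"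
    "\<forall>f\<in>S. Ord f \<and> (\<exists>g. Ord g \<and> H g f \<and> elts g \<subseteq> elts \<delta>)"
    using I.closed_exists by blast
  have dO: "elts \<delta> \<subseteq> Ords" unfolding Ords_def using Ord_elt[OF \<delta>(1)] by blast
  \<comment> \<open>A formula sees finitely many entries of its environment, and the stages are
    ordinals and thus nested, so one stage contains all these entries.\<close>
  have cover: "\<exists>f\<in>S. \<forall>n<m. e n \<in> elts f" if e: "\<And>n. e n \<in> elts \<delta>" for e and m :: nat
  proof (induction m)
    case 0
    then show ?case using \<delta>(2,3) by blast
  next
    case (Suc m)
    then obtain f where f: "f \<in> S" "\<forall>n<m. e n \<in> elts f" by blast
    obtain f' where f': "f' \<in> S" "e m \<in> elts f'" using \<delta>(3) e by blast
    have "Ord f" "Ord f'" using f(1) f'(1) \<delta>(4) by blast+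
    then consider "elts f \<subseteq> elts f'" | "elts f' \<subseteq> elts f"
      using Ord_linear[of f f'] unfolding Ord_def by blast
    then show ?case using f f' unfolding All_less_Suc by (cases; blast)
  qed
  have "sat (elts \<delta>) EE id e p = satO e p" if "set (bodies p) \<subseteq> set ps" "\<forall>n. e n \<in> elts \<delta>" for p e
    using that
  proof (induction p arbitrary: e)
    case (Forall p)
    have IH: "sat (elts \<delta>) EE id (case_nat x e) p = satO (case_nat x e) p" if "x \<in> elts \<delta>" for x
      by (rule Forall.IH) (use that Forall.prems in \<open>auto split: nat.splits\<close>)
    have "\<exists>x\<in>elts \<delta>. \<not> satO (case_nat x e) p" if x: "x \<in> Ords" "\<not> satO (case_nat x e) p" for x
    proof -
      obtain f where f: "f \<in> S" "\<forall>n<free_bound p. e n \<in> elts f" using cover Forall.prems(2) by blast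
      then obtain g where g: "H g f" "elts g \<subseteq> elts \<delta>" using \<delta>(4) by blast
      then have "escapes p g e" using f Forall.prems(1) unfolding H_def bounds_def by auto
      then show ?thesis using x g(2) unfolding escapes_def Ords_def by blast
    qed
    then show ?case using IH dO unfolding sat.simps by blast
  qed auto
  then show ?thesis using \<delta>(1,2) by blast
qed

end

section \<open>An auxiliary theory with choice and its consistency\<close>

text \<open>A set that includes the power set is enough, since Comprehension cuts it down; the model
  of rules supplies whole initial segments more easily than exact power sets.\<close>

definition Ax_Weak_Power :: fm where
  "Ax_Weak_Power = Forall (Exists (Forall (Forall (Var 0 \<^bold>\<in> Var 1 \<^bold>\<longrightarrow> Var 0 \<^bold>\<in> Var 3) \<^bold>\<longrightarrow> Var 0 \<^bold>\<in> Var 1)))"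

text \<open>Choice as the existence of a transversal for a disjoint family. In this form it needs no
  coding of functions and is literally what the rule for least elements provides.\<close>

definition Ax_Selector :: fm where
  "Ax_Selector = Forall (Forall (Var 0 \<^bold>\<in> Var 1 \<^bold>\<longrightarrow> Exists (Var 0 \<^bold>\<in> Var 1)) \<^bold>\<longrightarrow>
    Forall (Var 0 \<^bold>\<in> Var 1 \<^bold>\<longrightarrow> Forall (Var 0 \<^bold>\<in> Var 2 \<^bold>\<longrightarrow>
      Forall (Var 0 \<^bold>\<in> Var 2 \<^bold>\<longrightarrow> Var 0 \<^bold>\<in> Var 1 \<^bold>\<longrightarrow> Var 2 \<^bold>= Var 1))) \<^bold>\<longrightarrow>
    Exists (Forall (Var 0 \<^bold>\<in> Var 2 \<^bold>\<longrightarrow>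
      Exists (Forall (Var 0 \<^bold>\<in> Var 2 \<^bold>\<and> Var 0 \<^bold>\<in> Var 3 \<^bold>\<longleftrightarrow> Var 0 \<^bold>= Var 1)))))"

definition Ax_J_trivial :: fm where
  "Ax_J_trivial = Forall (J (Var 0) \<^bold>= Var 0)"

definition Compr1 :: "fm \<Rightarrow> fm" where
  "Compr1 \<psi> = Forall (Forall (Exists (Forall (Var 0 \<^bold>\<in> Var 1 \<^bold>\<longleftrightarrow>
    Var 0 \<^bold>\<in> Var 2 \<^bold>\<and> rename (case_nat 0 (\<lambda>n. n + 2)) \<psi>))))"

definition Found1 :: "fm \<Rightarrow> fm" where
  "Found1 \<psi> = Forall (Exists \<psi> \<^bold>\<longrightarrow> Exists (\<psi> \<^bold>\<and>
    Forall (Var 0 \<^bold>\<in> Var 1 \<^bold>\<longrightarrow> \<^bold>\<not> rename (case_nat 0 (\<lambda>n. n + 2)) \<psi>)))"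

text \<open>A reflection principle for one relation: a transitive set around the parameter that
  contains a witness whenever there is one. Union, Infinity and Collection are all drawn from it
  later.\<close>

definition Clos1 :: "fm \<Rightarrow> fm" where
  "Clos1 \<psi> = Forall (Exists (Var 1 \<^bold>\<in> Var 0 \<^bold>\<and>
    Forall (Var 0 \<^bold>\<in> Var 1 \<^bold>\<longrightarrow> Forall (Var 0 \<^bold>\<in> Var 1 \<^bold>\<longrightarrow> Var 0 \<^bold>\<in> Var 2)) \<^bold>\<and>
    Forall (Var 0 \<^bold>\<in> Var 1 \<^bold>\<longrightarrow>
      Exists (rename (case_nat 0 (case_nat 1 (\<lambda>n. n + 3))) \<psi>) \<^bold>\<longrightarrow>
      Exists (Var 0 \<^bold>\<in> Var 2 \<^bold>\<and> rename (case_nat 0 (case_nat 1 (\<lambda>n. n + 3))) \<psi>))))"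

definition T1_part :: "fm set \<Rightarrow> fm set" where
  "T1_part \<Psi> = {Ax_Extensionality, Ax_Pairing, Ax_Weak_Power, Ax_Selector, Ax_J_trivial} \<union> Compr1 ` \<Psi> \<union>
    Found1 ` {\<psi> \<in> \<Psi>. free_bound \<psi> \<le> 2} \<union> Clos1 ` \<Psi>"

text \<open>The schemas have a single parameter; several parameters are coded by pairs later on.\<close>

definition T1 :: "fm set" where
  "T1 = T1_part {\<psi>. free_bound \<psi> \<le> 3}"

lemma env_simps:
  "(\<lambda>n. case_nat z (case_nat u e) (case_nat 0 (\<lambda>n. n + 2) n)) = case_nat z e"
  "(\<lambda>n. case_nat y (case_nat x (case_nat w e)) (case_nat 0 (case_nat 1 (\<lambda>n. n + 3)) n)) =
    case_nat y (case_nat x e)"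
  by (auto split: nat.splits simp: numeral_3_eq_3)

lemma sat_mem_imp: "sat D R j e (s \<^bold>\<in> t \<^bold>\<longrightarrow> q) \<longleftrightarrow> (R (tmv j e s) (tmv j e t) \<longrightarrow> sat D R j e q)"
  and not_ball_not: "(\<not> (\<forall>x\<in>A. sat D R j (f x) (\<^bold>\<not> p))) \<longleftrightarrow> (\<exists>x\<in>A. sat D R j (f x) p)"
  by auto

lemma sat_Compr1: "sat D R j e (Compr1 \<psi>) \<longleftrightarrow> (\<forall>c\<in>D. \<forall>a\<in>D. \<exists>u\<in>D. \<forall>z\<in>D.
    R z u \<longleftrightarrow> R z a \<and> sat D R j (case_nat z (case_nat a (case_nat c e))) \<psi>)"
proof -
  define q where "q = rename (case_nat 0 (\<lambda>n. n + 2)) \<psi>"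
  have q: "sat D R j (case_nat z (case_nat u e)) q \<longleftrightarrow> sat D R j (case_nat z e) \<psi>" for z u e
    by (simp only: q_def sat_rename env_simps)
  show ?thesis unfolding Compr1_def q_def[symmetric]
    by (simp add: q numeral_2_eq_2 iff_conv_conj_imp imp_conjL)
qed

lemma sat_Found1: "sat D R j e (Found1 \<psi>) \<longleftrightarrow> (\<forall>c\<in>D. (\<exists>x\<in>D. sat D R j (case_nat x (case_nat c e)) \<psi>) \<longrightarrow>
    (\<exists>x\<in>D. sat D R j (case_nat x (case_nat c e)) \<psi> \<and>
      (\<forall>y\<in>D. R y x \<longrightarrow> \<not> sat D R j (case_nat y (case_nat c e)) \<psi>)))"
proof -
  define q where "q = rename (case_nat 0 (\<lambda>n. n + 2)) \<psi>"
  have q: "sat D R j (case_nat z (case_nat u e)) q \<longleftrightarrow> sat D R j (case_nat z e) \<psi>" for z u e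
    by (simp only: q_def sat_rename env_simps)
  show ?thesis unfolding Found1_def q_def[symmetric] by (simp add: q)
qed

lemma sat_Clos1: "sat D R j e (Clos1 \<psi>) \<longleftrightarrow> (\<forall>c\<in>D. \<exists>W\<in>D. R c W \<and> (\<forall>x\<in>D. R x W \<longrightarrow> (\<forall>y\<in>D. R y x \<longrightarrow> R y W)) \<and>
    (\<forall>x\<in>D. R x W \<longrightarrow> (\<exists>y\<in>D. sat D R j (case_nat y (case_nat x (case_nat c e))) \<psi>) \<longrightarrow>
      (\<exists>y\<in>D. R y W \<and> sat D R j (case_nat y (case_nat x (case_nat c e))) \<psi>)))"
proof -
  define q where "q = rename (case_nat 0 (case_nat 1 (\<lambda>n. n + 3))) \<psi>"
  have q: "sat D R j (case_nat y (case_nat x (case_nat w e))) q \<longleftrightarrow>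
      sat D R j (case_nat y (case_nat x e)) \<psi>" for y x w e
    by (simp only: q_def sat_rename env_simps)
  show ?thesis unfolding Clos1_def q_def[symmetric]
    by (simp only: sat.simps(1,2,3,5) sat_conn sat_mem_imp q tmv.simps nat.case One_nat_def numeral_2_eq_2
        disj_imp not_ball_not)
qed

lemma sat_Weak_Power: "sat D R j e Ax_Weak_Power \<longleftrightarrow>
    (\<forall>x\<in>D. \<exists>u\<in>D. \<forall>z\<in>D. (\<forall>w\<in>D. R w z \<longrightarrow> R w x) \<longrightarrow> R z u)"
proof -
  have "sat D R j e (Forall p \<^bold>\<longrightarrow> s \<^bold>\<in> t) \<longleftrightarrow> ((\<forall>x\<in>D. sat D R j (case_nat x e) p) \<longrightarrow> R (tmv j e s) (tmv j e t))"
    for e p s t by simp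
  then show ?thesis unfolding Ax_Weak_Power_def
    by (simp only: sat.simps(1,2,3,5) sat_conn sat_mem_imp tmv.simps nat.case One_nat_def numeral_3_eq_3)
qed

lemma sat_Selector: "sat D R j e Ax_Selector \<longleftrightarrow> (\<forall>p\<in>D. (\<forall>y\<in>D. R y p \<longrightarrow> (\<exists>z\<in>D. R z y)) \<longrightarrow>
    (\<forall>y\<in>D. R y p \<longrightarrow> (\<forall>y'\<in>D. R y' p \<longrightarrow> (\<forall>z\<in>D. R z y \<longrightarrow> R z y' \<longrightarrow> y = y'))) \<longrightarrow>
    (\<exists>u\<in>D. \<forall>y\<in>D. R y p \<longrightarrow> (\<exists>z\<in>D. \<forall>w\<in>D. R w y \<and> R w u \<longleftrightarrow> w = z)))"
proof -
  have all: "sat D R j e (Forall p \<^bold>\<longrightarrow> q \<^bold>\<longrightarrow> r) \<longleftrightarrow>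
      ((\<forall>x\<in>D. sat D R j (case_nat x e) p) \<longrightarrow> sat D R j e (q \<^bold>\<longrightarrow> r))" for e p q r by simp
  have conj: "sat D R j e (s \<^bold>\<in> t \<^bold>\<and> q) \<longleftrightarrow> R (tmv j e s) (tmv j e t) \<and> sat D R j e q" for e s t q by simp
  show ?thesis unfolding Ax_Selector_def
    by (simp only: sat.simps(1,2,3,5) sat_conn(1,3,4) all conj sat_mem_imp tmv.simps nat.case
        One_nat_def numeral_2_eq_2 numeral_3_eq_3)
qed

lemma free_bound_rename_tm: "(\<And>n. n < free_bound_tm t \<Longrightarrow> r n < m) \<Longrightarrow> free_bound_tm (subst_tm (\<lambda>n. Var (r n)) t) \<le> m"
  by (induction t) (auto simp: Suc_le_eq)

lemma lift_subst_rename: "lift_subst (\<lambda>n. Var (r n)) = (\<lambda>n. Var (case_nat 0 (\<lambda>n. Suc (r n)) n))"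
  by (rule ext) (auto simp: lift_subst_def split: nat.splits)

lemma free_bound_rename: "(\<And>n. n < free_bound p \<Longrightarrow> r n < m) \<Longrightarrow> free_bound (rename r p) \<le> m"
  unfolding rename_def
proof (induction p arbitrary: r m)
  case (Forall p)
  have "free_bound (subst (\<lambda>n. Var (case_nat 0 (\<lambda>n. Suc (r n)) n)) p) \<le> Suc m"
    by (rule Forall.IH) (use Forall.prems in \<open>auto split: nat.splits\<close>)
  then show ?case by (simp add: lift_subst_rename)
qed (auto simp: free_bound_rename_tm)

lemma T1_sentence: "p \<in> T1 \<Longrightarrow> sentence p"
proof -
  have a: "sentence Ax_Extensionality" "sentence Ax_Pairing" "sentence Ax_Weak_Power" "sentence Ax_Selector" "sentence Ax_J_trivial"
    by (simp_all add: sentence_def Ax_J_trivial_def Ax_Extensionality_def Ax_Pairing_def Ax_Weak_Power_def Ax_Selector_def)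
  have "sentence (Compr1 \<psi>)" if "free_bound \<psi> \<le> 3" for \<psi>
  proof -
    have "free_bound (rename (case_nat 0 (\<lambda>n. n + 2)) \<psi>) \<le> 4"
      by (rule free_bound_rename) (use that in \<open>auto split: nat.splits\<close>)
    then show ?thesis by (simp add: sentence_def Compr1_def)
  qed
  moreover have "sentence (Found1 \<psi>)" if "free_bound \<psi> \<le> 2" for \<psi>
  proof -
    have "free_bound (rename (case_nat 0 (\<lambda>n. n + 2)) \<psi>) \<le> 3"
      by (rule free_bound_rename) (use that in \<open>auto split: nat.splits\<close>)
    then show ?thesis using that by (simp add: sentence_def Found1_def)
  qed
  moreover have "sentence (Clos1 \<psi>)" if "free_bound \<psi> \<le> 3" for \<psi>
  proof -
    have "free_bound (rename (case_nat 0 (case_nat 1 (\<lambda>n. n + 3))) \<psi>) \<le> 4"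
      by (rule free_bound_rename) (use that in \<open>auto split: nat.splits\<close>)
    then show ?thesis by (simp add: sentence_def Clos1_def)
  qed
  ultimately show "p \<in> T1 \<Longrightarrow> sentence p" using a unfolding T1_def T1_part_def by blast
qed

section \<open>Finite parts of the auxiliary theory in a model of rules\<close>

context ZFmodel
begin

lemma T1_part_model:
  assumes \<Psi>: "\<And>\<psi>. \<psi> \<in> set \<Psi> \<Longrightarrow> free_bound \<psi> \<le> 3"
  shows "\<exists>D R. D \<noteq> {} \<and> (\<forall>p\<in>T1_part (set \<Psi>). \<forall>e. (\<forall>n. e n \<in> D) \<longrightarrow> sat (D :: nat set) R id e p)"
proof -
  \<comment> \<open>Rule 0 gives initial segments and rule 1 unordered pairs. In the rules for
    \<open>\<Psi>\<close> the first parameter is the set from which Comprehension selects, the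
    second one is the parameter of the formula.\<close>
  define \<Phi> where "\<Phi> = [Var 0 \<^bold>= Var 0, Var 0 \<^bold>= Var 1 \<^bold>\<or> Var 0 \<^bold>= Var 2] @ map (\<lambda>\<psi>. Var 0 \<^bold>\<in> Var 1 \<^bold>\<and> \<psi>) \<Psi>"
  have len: "length \<Phi> = Suc (Suc (length \<Psi>))" and nth: "\<Phi> ! 0 = (Var 0 \<^bold>= Var 0)"
    "\<Phi> ! 1 = (Var 0 \<^bold>= Var 1 \<^bold>\<or> Var 0 \<^bold>= Var 2)"
    "\<And>i. i < length \<Psi> \<Longrightarrow> \<Phi> ! Suc (Suc i) = (Var 0 \<^bold>\<in> Var 1 \<^bold>\<and> \<Psi> ! i)"
    by (simp_all add: \<Phi>_def)
  have len0: "0 < length \<Phi>" "1 < length \<Phi>" using len by simp_all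
  interpret rules E \<Phi> by unfold_locales (use len0(1) nth(1) in auto)
  \<comment> \<open>The existential closures are reflected as well: the closure axiom needs that the
    existence of a witness is decided correctly below the reflecting ordinal.\<close>
  define ps where "ps = concat (map bodies (\<Psi> @ map Exists \<Psi>))"
  have emp: "Ord emp" by (simp add: Ord_def)
  have inO: "x \<in> Ords \<longleftrightarrow> Ord x" for x by (simp add: Ords_def)
  have EO: "Ord x" "Ord a" if "EE x a" for x a using that EE_Ord EE_lt Ord_elt by blast+
  have reflect: "\<exists>\<delta>. Ord \<delta> \<and> c \<in> elts \<delta> \<and> d \<in> elts \<delta> \<and> (\<forall>p\<in>set (\<Psi> @ map Exists \<Psi>). \<forall>e. (\<forall>n. e n \<in> elts \<delta>) \<longrightarrow>
    sat (elts \<delta>) EE id e p = satO e p)" if cd: "Ord c" "Ord d" for c d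
  proof -
    obtain \<alpha> where \<alpha>: "Ord \<alpha>" "{c, d} \<subseteq> elts \<alpha>" using Ord_bound[OF sm_pair, of c d] cd by blast
    obtain \<delta> where \<delta>: "Ord \<delta>" "\<alpha> \<in> elts \<delta>" "\<forall>p e. set (bodies p) \<subseteq> set ps \<longrightarrow> (\<forall>n. e n \<in> elts \<delta>) \<longrightarrow>
        sat (elts \<delta>) EE id e p = satO e p" using reflection[OF \<alpha>(1), of ps] by blast
    have ps: "set (bodies p) \<subseteq> set ps" if "p \<in> set (\<Psi> @ map Exists \<Psi>)" for p
      unfolding ps_def using that by auto
    have "c \<in> elts \<delta>" "d \<in> elts \<delta>" using \<alpha>(2) Ord_trans[OF \<delta>(1,2)] by auto
    moreover have "sat (elts \<delta>) EE id e p = satO e p"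
      if "p \<in> set (\<Psi> @ map Exists \<Psi>)" "\<forall>n. e n \<in> elts \<delta>" for p e
      using \<delta>(3) ps[OF that(1)] that(2) by blast
    ultimately show ?thesis using \<delta>(1) by (intro exI[of _ \<delta>] conjI ballI allI impI)
  qed
  have whole: "\<exists>W. Ord W \<and> (\<forall>x. EE x W \<longleftrightarrow> x \<in> elts \<delta>)" if "Ord \<delta>" "c \<in> elts \<delta>" for \<delta> c
  proof -
    have "Dfs EE 0 \<delta> c c x \<longleftrightarrow> x \<in> elts \<delta>" for x unfolding Dfs_def nth(1) using len0 by simp
    then show ?thesis using EE_complete[OF that(1) that(2) that(2), of 0] by simp
  qed
  have "sat Ords EE id e p" if p: "p \<in> T1_part (set \<Psi>)" and e: "\<forall>n. e n \<in> Ords" for p e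
  proof -
    have ext: "sat Ords EE id e Ax_Extensionality"
      unfolding sat_axioms inO
    proof (intro ballI impI)
      fix x y assume xy: "x \<in> Ords" "y \<in> Ords" "\<forall>z\<in>Ords. EE z x = EE z y"
      then show "x = y" using EE_ext[of x y] EO(1) inO by blast
    qed
    have pair: "sat Ords EE id e Ax_Pairing"
      unfolding sat_axioms
    proof (intro ballI)
      fix x y assume "x \<in> Ords" "y \<in> Ords"
      then obtain \<delta> where \<delta>: "Ord \<delta>" "{x, y} \<subseteq> elts \<delta>"
        using Ord_bound[OF sm_pair, of x y] inO by blast
      have "1 < Suc (length \<Phi>)" using len by simp
      then obtain a where "Ord a" "\<forall>z. EE z a \<longleftrightarrow> Dfs EE 1 \<delta> x y z"
        using EE_complete[of \<delta> x y 1] \<delta> by blast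
      moreover have "Dfs EE 1 \<delta> x y z \<longleftrightarrow> z = x \<or> z = y" for z
        unfolding Dfs_def nth(2) sat_conn using \<delta>(2) len0(2) by (auto simp: numeral_2_eq_2)
      ultimately show "\<exists>u\<in>Ords. \<forall>z\<in>Ords. EE z u = (z = x \<or> z = y)" using inO by blast
    qed
    have pow: "sat Ords EE id e Ax_Weak_Power"
      unfolding sat_Weak_Power
    proof
      fix x assume "x \<in> Ords"
      \<comment> \<open>A subset of \<open>x\<close> in the new sense is determined by its
        extension, an element of the true power set of \<open>x\<close>; Replacement therefore
        bounds the ordinals that represent such subsets.\<close>
      define P where "P z s \<longleftrightarrow> Ord z \<and> (\<forall>w. w \<in> elts s \<longleftrightarrow> EE w z)" for z s
      have "sm {z. \<exists>s\<in>elts (Pw x). P z s}"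
      proof (rule replacement)
        show "dfn (\<lambda>e. P (e 0) (e (Suc 0)))" unfolding P_def by (intro dfns)
        show "y = y'" if "P y z" "P y' z" for y y' z using that EE_ext[of y y'] unfolding P_def by blast
      qed
      moreover have "Ord z" if "z \<in> {z. \<exists>s\<in>elts (Pw x). P z s}" for z using that unfolding P_def by blast
      ultimately obtain b where b: "Ord b" "{z. \<exists>s\<in>elts (Pw x). P z s} \<subseteq> elts b"
        using Ord_bound[of "{z. \<exists>s\<in>elts (Pw x). P z s}"] by blast
      obtain W where W: "Ord W" "\<forall>x. EE x W \<longleftrightarrow> x \<in> elts (sc b)"
        using whole[OF Ord_sc[OF b(1)], of b] by auto
      have "EE z W" if z: "z \<in> Ords" "\<forall>w\<in>Ords. EE w z \<longrightarrow> EE w x" for z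
      proof -
        have sub: "{w. EE w z} \<subseteq> elts x" using z(2) EO(1) EE_lt inO by blast
        have "sm {w. EE w z}" by (rule sm_sub[OF _ sm_elts sub]) (simp, intro dfns)
        then have "elts (st {w. EE w z}) = {w. EE w z}" by (rule elts_st)
        then have "st {w. EE w z} \<in> elts (Pw x)" "P z (st {w. EE w z})"
          using sub z(1) inO unfolding P_def by auto
        then show ?thesis using b(2) W(2) by auto
      qed
      then show "\<exists>u\<in>Ords. \<forall>z\<in>Ords. (\<forall>w\<in>Ords. EE w z \<longrightarrow> EE w x) \<longrightarrow> EE z u" using W(1) inO by blast
    qed
    have sel: "sat Ords EE id e Ax_Selector"
      unfolding sat_Selector
    proof (intro ballI impI)
      fix p assume p: "p \<in> Ords" and ne: "\<forall>y\<in>Ords. EE y p \<longrightarrow> (\<exists>z\<in>Ords. EE z y)"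
        and dj: "\<forall>y\<in>Ords. EE y p \<longrightarrow> (\<forall>y'\<in>Ords. EE y' p \<longrightarrow> (\<forall>z\<in>Ords. EE z y \<longrightarrow> EE z y' \<longrightarrow> y = y'))"
      have \<delta>: "Ord (sc p)" using Ord_sc p inO by blast
      have "p \<in> elts (sc p)" by simp
      \<comment> \<open>The rule for least elements, applied over the first initial segment that
        contains \<open>p\<close>; members of \<open>p\<close> and their members lie below
        it.\<close>
      from EE_complete[OF \<delta> this this, of "length \<Phi>"] obtain u where
        u: "Ord u" "\<forall>z. EE z u \<longleftrightarrow> Dfs EE (length \<Phi>) (sc p) p p z" by blast
      have u2: "EE z u \<longleftrightarrow> (\<exists>y. EE y p \<and> EE z y \<and> (\<forall>w\<in>elts z. \<not> EE w y))" for z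
      proof -
        have "z \<in> elts (sc p)" "y \<in> elts (sc p)" if "EE y p" "EE z y" for y
          using EE_lt[OF that(1)] EE_lt[OF that(2)] Ord_trans[of p y z] p inO by auto
        then show ?thesis using u(2) unfolding Dfs_def by (auto simp del: elts_ins)
      qed
      have "\<exists>z\<in>Ords. \<forall>w\<in>Ords. EE w y \<and> EE w u \<longleftrightarrow> w = z" if y: "y \<in> Ords" "EE y p" for y
      proof -
        obtain z0 where z0: "Ord z0" "EE z0 y" using ne y inO by blast
        have "dfn (\<lambda>e. EE (e 0) y)" by (intro dfns)
        from least[where P = "\<lambda>z. EE z y", OF this z0] obtain z where
          z: "Ord z" "EE z y" "\<forall>c\<in>elts z. \<not> EE c y" by blast
        have "EE w y \<and> EE w u \<longleftrightarrow> w = z" for w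
        proof
          assume w: "EE w y \<and> EE w u"
          then obtain y' where y': "EE y' p" "EE w y'" "\<forall>c\<in>elts w. \<not> EE c y'" using u2 by blast
          then have "y' = y" using dj w y EO inO by blast
          then show "w = z" using Ord_linear[of w z] z y'(3) w EO by blast
        next
          assume "w = z"
          then show "EE w y \<and> EE w u" using z y(2) u2 by blast
        qed
        then show ?thesis using z(1) inO by blast
      qed
      then show "\<exists>u\<in>Ords. \<forall>y\<in>Ords. EE y p \<longrightarrow> (\<exists>z\<in>Ords. \<forall>w\<in>Ords. (EE w y \<and> EE w u) = (w = z))"
        using u(1) inO by blast
    qed
    have compr: "sat Ords EE id e (Compr1 \<psi>)" if \<psi>: "\<psi> \<in> set \<Psi>" for \<psi>
      unfolding sat_Compr1
    proof (intro ballI)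
      fix c a assume "c \<in> Ords" "a \<in> Ords"
      \<comment> \<open>Rules evaluate formulas over an initial segment only. Over a segment that
        reflects the formula, the set obtained is the one defined over all ordinals.\<close>
      then obtain \<delta> where \<delta>: "Ord \<delta>" "c \<in> elts \<delta>" "a \<in> elts \<delta>" "\<forall>p\<in>set (\<Psi> @ map Exists \<Psi>). \<forall>e. (\<forall>n. e n \<in> elts \<delta>) \<longrightarrow>
          sat (elts \<delta>) EE id e p = satO e p" using reflect inO by blast
      obtain i where i: "i < length \<Psi>" "\<Psi> ! i = \<psi>" using \<psi> by (auto simp: in_set_conv_nth)
      have k: "i + 2 < length \<Phi>" "\<Phi> ! (i + 2) = (Var 0 \<^bold>\<in> Var 1 \<^bold>\<and> \<psi>)"
        using i len nth(3)[of i] by simp_all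
      have "i + 2 < Suc (length \<Phi>)" using k(1) by simp
      then obtain u where u: "Ord u" "\<forall>z. EE z u \<longleftrightarrow> Dfs EE (i + 2) \<delta> a c z"
        using EE_complete[OF \<delta>(1,3,2), of "i + 2"] by blast
      have "EE z u \<longleftrightarrow> EE z a \<and> satO (case_nat z (case_nat a (case_nat c e))) \<psi>" for z
      proof -
        let ?f = "case_nat z (case_nat a (\<lambda>_. c))"
        have zd: "z \<in> elts \<delta>" if "EE z a" using EE_lt[OF that] Ord_trans[OF \<delta>(1,3)] by blast
        have "sat (elts \<delta>) EE id ?f \<psi> = satO ?f \<psi>" if "z \<in> elts \<delta>"
        proof -
          have "\<forall>n. ?f n \<in> elts \<delta>" using that \<delta>(2,3) by (auto split: nat.splits)
          then show ?thesis using \<delta>(4) \<psi> by auto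
        qed
        moreover have "satO ?f \<psi> = satO (case_nat z (case_nat a (case_nat c e))) \<psi>"
          by (rule sat_cong) (use \<Psi>[OF \<psi>] in \<open>auto split: nat.splits\<close>)
        moreover have "Dfs EE (i + 2) \<delta> a c z \<longleftrightarrow> z \<in> elts \<delta> \<and> EE z a \<and> sat (elts \<delta>) EE id ?f \<psi>"
          unfolding Dfs_def k(2) sat_conn using k(1) by simp
        ultimately show ?thesis using u(2) zd by blast
      qed
      then show "\<exists>u\<in>Ords. \<forall>z\<in>Ords. EE z u = (EE z a \<and> satO (case_nat z (case_nat a (case_nat c e))) \<psi>)"
        using u(1) inO by blast
    qed
    have found: "sat Ords EE id e (Found1 \<psi>)" for \<psi>
      unfolding sat_Found1
    proof (intro ballI impI)
      fix c assume "\<exists>x\<in>Ords. satO (case_nat x (case_nat c e)) \<psi>"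
      then obtain x0 where x0: "Ord x0" "satO (case_nat x0 (case_nat c e)) \<psi>" using inO by blast
      have "simple (\<lambda>e'. case_nat (e' 0) (case_nat c e))" by (intro simple_case simple_const)
      from dfn_simple[OF satO_dfn this] have "dfn (\<lambda>e'. satO (case_nat (e' 0) (case_nat c e)) \<psi>)" .
      from least[where P = "\<lambda>x. satO (case_nat x (case_nat c e)) \<psi>", OF this x0] obtain b where
        b: "Ord b" "satO (case_nat b (case_nat c e)) \<psi>" "\<forall>x\<in>elts b. \<not> satO (case_nat x (case_nat c e)) \<psi>" by blast
      show "\<exists>x\<in>Ords. satO (case_nat x (case_nat c e)) \<psi> \<and>
          (\<forall>y\<in>Ords. EE y x \<longrightarrow> \<not> satO (case_nat y (case_nat c e)) \<psi>)"
        by (rule bexI[of _ b]) (use b EE_lt inO in blast)+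
    qed
    have clos: "sat Ords EE id e (Clos1 \<psi>)" if \<psi>: "\<psi> \<in> set \<Psi>" for \<psi>
      unfolding sat_Clos1
    proof
      fix c assume "c \<in> Ords"
      then obtain \<delta> where \<delta>: "Ord \<delta>" "c \<in> elts \<delta>" "\<forall>p\<in>set (\<Psi> @ map Exists \<Psi>). \<forall>e. (\<forall>n. e n \<in> elts \<delta>) \<longrightarrow>
          sat (elts \<delta>) EE id e p = satO e p" using reflect[of c c] inO by blast
      \<comment> \<open>The reflecting segment is itself the closed set: if a witness exists at all,
        the reflected existential formula finds one below \<delta>.\<close>
      obtain W where W: "Ord W" "\<forall>x. EE x W \<longleftrightarrow> x \<in> elts \<delta>" using whole[OF \<delta>(1,2)] by blast
      have cl: "\<exists>y\<in>Ords. EE y W \<and> satO (case_nat y (case_nat x (case_nat c e))) \<psi>"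
        if x: "x \<in> elts \<delta>" and ex: "\<exists>y\<in>Ords. satO (case_nat y (case_nat x (case_nat c e))) \<psi>" for x
      proof -
        let ?f = "case_nat x (\<lambda>_. c)"
        have fd: "\<forall>n. ?f n \<in> elts \<delta>" using x \<delta>(2) by (auto split: nat.splits)
        have eq: "satO (case_nat y ?f) \<psi> = satO (case_nat y (case_nat x (case_nat c e))) \<psi>" for y
          by (rule sat_cong) (use \<Psi>[OF \<psi>] in \<open>auto split: nat.splits\<close>)
        have "satO ?f (Exists \<psi>)" using ex eq unfolding sat_conn by blast
        moreover have in1: "Exists \<psi> \<in> set (\<Psi> @ map Exists \<Psi>)" and in2: "\<psi> \<in> set (\<Psi> @ map Exists \<Psi>)"
          using \<psi> by auto
        ultimately have "sat (elts \<delta>) EE id ?f (Exists \<psi>)" using bspec[OF \<delta>(3) in1] fd by blast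
        then obtain y where y: "y \<in> elts \<delta>" "sat (elts \<delta>) EE id (case_nat y ?f) \<psi>"
          unfolding sat_conn by blast
        have "\<forall>n. case_nat y ?f n \<in> elts \<delta>" using y(1) x \<delta>(2) by (auto split: nat.splits)
        then have "satO (case_nat y ?f) \<psi>" using bspec[OF \<delta>(3) in2] y(2) by blast
        then show ?thesis using eq y(1) W(2) Ord_elt[OF \<delta>(1)] inO by blast
      qed
      have tr: "EE y W" if "EE x W" "EE y x" for x y
        using that W(2) EE_lt[OF that(2)] Ord_trans[OF \<delta>(1)] by blast
      show "\<exists>W\<in>Ords. EE c W \<and> (\<forall>x\<in>Ords. EE x W \<longrightarrow> (\<forall>y\<in>Ords. EE y x \<longrightarrow> EE y W)) \<and>
          (\<forall>x\<in>Ords. EE x W \<longrightarrow> (\<exists>y\<in>Ords. satO (case_nat y (case_nat x (case_nat c e))) \<psi>) \<longrightarrow>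
            (\<exists>y\<in>Ords. EE y W \<and> satO (case_nat y (case_nat x (case_nat c e))) \<psi>))"
      proof (rule bexI[of _ W], intro conjI ballI impI)
        show "EE c W" using W(2) \<delta>(2) by blast
        show "EE y W" if "EE x W" "EE y x" for x y by (rule tr[OF that])
        show "\<exists>y\<in>Ords. EE y W \<and> satO (case_nat y (case_nat x (case_nat c e))) \<psi>"
          if "EE x W" "\<exists>y\<in>Ords. satO (case_nat y (case_nat x (case_nat c e))) \<psi>" for x
          using cl that W(2) by blast
        show "W \<in> Ords" using W(1) inO by blast
      qed
    qed
    have "sat Ords EE id e Ax_J_trivial" by (simp add: Ax_J_trivial_def)
    then show ?thesis using p ext pair pow sel compr found clos unfolding T1_part_def by blast
  qed
  moreover have "Ords \<noteq> {}" using emp inO by blast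
  ultimately show ?thesis by blast
qed

text \<open>A derivation of falsity uses finitely many axioms, hence finitely many instances of the
  schemas, and for these the list of rules can be chosen.\<close>

lemma T1_consistent: "\<not> prov T1 \<^bold>\<bottom>"
proof
  assume "prov T1 \<^bold>\<bottom>"
  from provable_finite_axioms[OF this] obtain F where F: "finite F" "F \<subseteq> T1" "prov F \<^bold>\<bottom>" by blast
  have "\<exists>\<Psi>. (\<forall>\<psi>\<in>set \<Psi>. free_bound \<psi> \<le> 3) \<and> F \<subseteq> T1_part (set \<Psi>)"
    using F(1,2)
  proof (induction F)
    case empty
    show ?case by (rule exI[of _ "[]"]) simp
  next
    case (insert p F)
    then obtain \<Psi> where \<Psi>: "\<forall>\<psi>\<in>set \<Psi>. free_bound \<psi> \<le> 3" "F \<subseteq> T1_part (set \<Psi>)" by auto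
    obtain \<psi> where \<psi>: "free_bound \<psi> \<le> 3" "p \<in> T1_part {\<psi>}"
    proof -
      have "p \<in> T1_part {\<psi>. free_bound \<psi> \<le> 3}" using insert.prems by (simp add: T1_def)
      moreover have "free_bound \<^bold>\<bottom> \<le> 3" by simp
      ultimately show ?thesis using that unfolding T1_part_def by blast
    qed
    have mono: "T1_part A \<subseteq> T1_part B" if "A \<subseteq> B" for A B using that unfolding T1_part_def by blast
    show ?case
      by (rule exI[of _ "\<psi> # \<Psi>"])
        (use \<Psi> \<psi> mono[of "{\<psi>}" "set (\<psi> # \<Psi>)"] mono[of "set \<Psi>" "set (\<psi> # \<Psi>)"] in auto)
  qed
  then obtain \<Psi> where \<Psi>: "\<forall>\<psi>\<in>set \<Psi>. free_bound \<psi> \<le> 3" "F \<subseteq> T1_part (set \<Psi>)" by blast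
  have "\<exists>D R. D \<noteq> {} \<and> (\<forall>p\<in>T1_part (set \<Psi>). \<forall>e. (\<forall>n. e n \<in> D) \<longrightarrow> sat (D :: nat set) R id e p)"
    by (rule T1_part_model) (use \<Psi>(1) in blast)
  then obtain D R where D: "D \<noteq> {}"
    "\<forall>p\<in>T1_part (set \<Psi>). \<forall>e. (\<forall>n. e n \<in> D) \<longrightarrow> sat (D :: nat set) R id e p" by blast
  obtain x where x: "x \<in> D" using D(1) by blast
  have "sat D R id (\<lambda>_. x) \<^bold>\<bottom>"
    by (rule sat_soundness[OF F(3)]) (use D(2) \<Psi>(2) x in auto)
  then show False by simp
qed

end

section \<open>From consistency of ZF to consistency of the auxiliary theory\<close>

lemma ZFmodel_intro:
  assumes sat: "\<And>p e. p \<in> ZF \<Longrightarrow> sat UNIV E id e p"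
  shows "ZFmodel E"
proof -
  have compr: "sat UNIV E id e (Comprehension_instance p)" for e p
  proof -
    have "Comprehension_instance (strip p) \<in> ZF"
      using jfree_strip[of p] by (auto simp: ZF_def Z_def Comprehension_def L_mem_def)
    then show ?thesis using sat Comprehension_strip by blast
  qed
  interpret Zmodel E id
    by (rule Zmodel_intro) (use sat compr in \<open>auto simp: ZF_def Z_def\<close>)
  show ?thesis
  proof
    fix P a assume d: "dfn (\<lambda>e. P (e 0) (e (Suc 0)))"
      and fn: "\<And>x y y'. x \<in> elts a \<Longrightarrow> P y x \<Longrightarrow> P y' x \<Longrightarrow> y = y'"
    obtain N p where p: "\<And>M e. M \<ge> N \<Longrightarrow>
        P (e 0) (e (Suc 0)) \<longleftrightarrow> sat UNIV E id (\<lambda>n. if n < M then e n else n - M) (p M)"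
      using d unfolding dfn_def by blast
    define M where "M = Suc (Suc (Suc N))"
    define q where "q = strip (p M)"
    define e' where "e' n = (if Suc (Suc (Suc n)) < M then 0 else Suc (Suc (Suc n)) - M)" for n
    have NM: "N \<le> M" by (simp add: M_def)
    have q: "sat UNIV E id (case_nat y (case_nat x (case_nat a e'))) q \<longleftrightarrow> P y x" for y x
    proof -
      have "(\<lambda>n. if n < M then (case_nat y (case_nat x (case_nat a (\<lambda>_. 0)))) n else n - M) =
          case_nat y (case_nat x (case_nat a e'))"
        by (rule ext) (auto simp: e'_def M_def split: nat.splits)
      then show ?thesis
        using p[OF NM, of "case_nat y (case_nat x (case_nat a (\<lambda>_. 0)))"]
        unfolding q_def sat_strip by (simp only: nat.case)
    qed
    have inst: "Replacement_instance q \<in> ZF"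
      unfolding q_def using jfree_strip by (auto simp: ZF_def Replacement_def L_mem_def)
    define q1 where "q1 = rename (case_nat 1 (\<lambda>n. n + 2)) q"
    define q2 where "q2 = rename (case_nat 0 (\<lambda>n. n + 2)) q"
    define q3 where "q3 = rename (case_nat 1 (case_nat 0 (\<lambda>n. n + 3))) q"
    have e1: "(\<lambda>n. case_nat y' (case_nat y f) (case_nat 1 (\<lambda>n. n + 2) n)) = case_nat y f" for y y' :: nat and f
      by (auto split: nat.splits)
    have e3: "(\<lambda>n. case_nat x (case_nat y (case_nat b f)) (case_nat 1 (case_nat 0 (\<lambda>n. n + 3)) n)) =
        case_nat y (case_nat x f)" for x y b :: nat and f
      by (auto split: nat.splits simp: numeral_3_eq_3)
    have r: "sat UNIV E id (case_nat y' (case_nat y (case_nat x (case_nat a e')))) q1 \<longleftrightarrow> P y x"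
      "sat UNIV E id (case_nat y' (case_nat y (case_nat x (case_nat a e')))) q2 \<longleftrightarrow> P y' x"
      "sat UNIV E id (case_nat x (case_nat y (case_nat b (case_nat a e')))) q3 \<longleftrightarrow> P y x" for x y y' b
      unfolding q1_def q2_def q3_def sat_rename e1 env_simps e3 q by (rule refl)+
    have "sat UNIV E id e' (Forall (Forall (Var 0 \<^bold>\<in> Var 1 \<^bold>\<longrightarrow>
        Forall (Forall (q1 \<^bold>\<and> q2 \<^bold>\<longrightarrow> Var 1 \<^bold>= Var 0))) \<^bold>\<longrightarrow>
      Exists (Forall (Var 0 \<^bold>\<in> Var 1 \<^bold>\<longleftrightarrow> Exists (Var 0 \<^bold>\<in> Var 3 \<^bold>\<and> q3)))))"
      using sat[OF inst, of e'] unfolding Replacement_instance_def sat_univ_closure q1_def q2_def q3_def by blast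
    then have "\<forall>b. sat UNIV E id (case_nat b e') (Forall (Var 0 \<^bold>\<in> Var 1 \<^bold>\<longrightarrow>
        Forall (Forall (q1 \<^bold>\<and> q2 \<^bold>\<longrightarrow> Var 1 \<^bold>= Var 0))) \<^bold>\<longrightarrow>
      Exists (Forall (Var 0 \<^bold>\<in> Var 1 \<^bold>\<longleftrightarrow> Exists (Var 0 \<^bold>\<in> Var 3 \<^bold>\<and> q3))))"
      unfolding sat.simps(5) by blast
    from spec[OF this, of a] have imp: "(\<forall>x. E x a \<longrightarrow> (\<forall>y y'. P y x \<and> P y' x \<longrightarrow> y = y')) \<longrightarrow>
        (\<exists>b. \<forall>y. (E y b \<longrightarrow> (\<exists>x. E x a \<and> P y x)) \<and> ((\<forall>x. E x a \<longrightarrow> \<not> P y x) \<or> E y b))"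
      by (simp add: r numeral_3_eq_3)
    have "\<forall>x. E x a \<longrightarrow> (\<forall>y y'. P y x \<and> P y' x \<longrightarrow> y = y')" using fn unfolding elts_def by blast
    from mp[OF imp this] obtain b where
      "\<forall>y. (E y b \<longrightarrow> (\<exists>x. E x a \<and> P y x)) \<and> ((\<forall>x. E x a \<longrightarrow> \<not> P y x) \<or> E y b)" by blast
    then have "elts b = {y. \<exists>x\<in>elts a. P y x}" unfolding elts_def by blast
    then show "sm {y. \<exists>x\<in>elts a. P y x}" unfolding sm_def by blast
  next
    fix x
    have "sat UNIV E id (\<lambda>_. 0) Ax_Foundation" by (rule sat) (simp add: ZF_def)
    then have "\<forall>x. (\<exists>y. E y x) \<longrightarrow> (\<exists>y. E y x \<and> (\<forall>z. E z x \<longrightarrow> \<not> E z y))"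
      by (simp add: Ax_Foundation_def numeral_2_eq_2)
    then show "elts x \<noteq> {} \<Longrightarrow> \<exists>y\<in>elts x. elts y \<inter> elts x = {}" unfolding elts_def by blast
  next
    have "sat UNIV E id (\<lambda>_. 0) Ax_Infinity" by (rule sat) (simp add: ZF_def Z_def)
    then have "\<exists>x. (\<exists>e. E e x \<and> (\<forall>z. \<not> E z e)) \<and>
        (\<forall>y. E y x \<longrightarrow> (\<exists>s. E s x \<and> (\<forall>w. E w s \<longleftrightarrow> E w y \<or> w = y)))"
      by (simp add: Ax_Infinity_def numeral_2_eq_2 iff_conv_conj_imp disj_imp)
    then obtain x e where x: "E e x" "\<forall>z. \<not> E z e"
      "\<forall>y. E y x \<longrightarrow> (\<exists>s. E s x \<and> (\<forall>w. E w s \<longleftrightarrow> E w y \<or> w = y))" by blast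
    have "elts e = elts emp" using x(2) by (simp add: elts_def[of e])
    then have "emp \<in> elts x" using x(1) elts_inj[of e emp] by (simp add: elts_def[of x])
    moreover have "ins y y \<in> elts x" if "y \<in> elts x" for y
    proof -
      obtain s where s: "E s x" "\<forall>w. E w s \<longleftrightarrow> E w y \<or> w = y" using x(3) \<open>y \<in> elts x\<close> unfolding elts_def by blast
      have "elts s = elts (ins y y)" using s(2) unfolding elts_ins unfolding elts_def by blast
      then show ?thesis using s(1) elts_inj[of s "ins y y"] by (simp add: elts_def[of x])
    qed
    ultimately show "\<exists>x. emp \<in> elts x \<and> (\<forall>y\<in>elts x. ins y y \<in> elts x)" by blast
  qed
qed

lemma jfree_rename: "jfree p \<Longrightarrow> jfree (rename r p)"
  by (metis jfree_strip strip_jfree strip_rename)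

lemma jfree_univ_closure: "jfree (univ_closure p) = jfree p"
proof -
  have "jfree ((Forall ^^ n) p) = jfree p" for n by (induction n) auto
  then show ?thesis by (simp add: univ_closure_def)
qed

lemma Z_jfree: "p \<in> Z \<Longrightarrow> jfree p"
  by (auto simp: Z_def Comprehension_def Comprehension_instance_def L_mem_def jfree_univ_closure
      jfree_rename Ax_Extensionality_def Ax_Pairing_def Ax_Union_def Ax_Power_Set_def Ax_Infinity_def)

lemma ZF_jfree: "p \<in> ZF \<Longrightarrow> jfree p"
  using Z_jfree by (auto simp: ZF_def Replacement_def Replacement_instance_def L_mem_def
      jfree_univ_closure jfree_rename Ax_Foundation_def)

lemma Z_sentence: "p \<in> Z \<Longrightarrow> sentence p"
  by (auto simp: Z_def Comprehension_def Comprehension_instance_def sentence_univ_closure)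
    (simp_all add: sentence_def Ax_Extensionality_def Ax_Pairing_def Ax_Union_def Ax_Power_Set_def Ax_Infinity_def)

lemma ZF_sentence: "p \<in> ZF \<Longrightarrow> sentence p"
proof -
  have "sentence Ax_Foundation" by (simp add: sentence_def Ax_Foundation_def)
  then show "p \<in> ZF \<Longrightarrow> sentence p"
    using Z_sentence by (auto simp: ZF_def Replacement_def Replacement_instance_def sentence_univ_closure)
qed

lemma Z_finite_models_excluded:
  assumes "\<And>p. p \<in> Z \<Longrightarrow> sat D R j e p"
  shows "sat D R j e no_universal \<and> sat D R j e adjoining"
proof (rule finite_models_excluded)
  show "sat D R j e Ax_Pairing" "sat D R j e Ax_Union" by (rule assms, simp add: Z_def)+
  show "sat D R j e (Comprehension_instance (\<^bold>\<not> Var 0 \<^bold>\<in> Var 0))"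
    by (rule assms) (simp add: Z_def Comprehension_def L_mem_def)
qed

theorem consistent_T1:
  assumes "consistent L_mem ZF"
  shows "\<not> prov T1 \<^bold>\<bottom>"
proof -
  have "\<not> prov ZF \<^bold>\<bottom>"
    using provable_strip[of ZF UNIV "\<^bold>\<bottom>"] ZF_jfree assms unfolding consistent_def by auto
  moreover have "sentence \<^bold>\<bottom>" by (simp add: sentence_def)
  moreover have "sat D R j e no_universal \<and> sat D R j e adjoining"
    if "\<And>p. p \<in> ZF \<Longrightarrow> sat D R j e p" for D and R :: "tm set \<Rightarrow> tm set \<Rightarrow> bool" and j e
    by (rule Z_finite_models_excluded) (use that in \<open>simp add: ZF_def\<close>)
  ultimately obtain R :: "nat \<Rightarrow> nat \<Rightarrow> bool" and j where "\<forall>p\<in>ZF. \<forall>e. sat UNIV R j e p"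
    using completeness[of ZF "\<^bold>\<bottom>"] ZF_sentence by blast
  \<comment> \<open>The completeness theorem delivers some interpretation of \<open>j\<close>. As
    the axioms of ZF do not mention \<open>j\<close>, they remain true when it is replaced by the
    identity.\<close>
  then have "ZFmodel R" using ZF_jfree sat_jfree by (intro ZFmodel_intro) blast
  then show ?thesis by (rule ZFmodel.T1_consistent)
qed

section \<open>Models of the auxiliary theory\<close>

lemma sat_is_pair: "sat UNIV R j e (is_pair p a b) \<longleftrightarrow>
  (\<exists>s t. (\<forall>z. R z s \<longleftrightarrow> z = e a \<or> z = e a) \<and> (\<forall>z. R z t \<longleftrightarrow> z = e a \<or> z = e b) \<and> (\<forall>z. R z (e p) \<longleftrightarrow> z = s \<or> z = t))"
proof -
  have up: "sat UNIV R j f (is_upair p a b) \<longleftrightarrow> (\<forall>z. R z (f p) \<longleftrightarrow> z = f a \<or> z = f b)" for f p a b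
    by (simp add: is_upair_def iff_conv_conj_imp disj_imp)
  show ?thesis unfolding is_pair_def by (simp add: up del: disj_not1)
qed

locale pairing_model =
  fixes E :: "nat \<Rightarrow> nat \<Rightarrow> bool"
  assumes extens: "(\<And>z. E z x \<longleftrightarrow> E z y) \<Longrightarrow> x = y"
    and pair: "\<exists>u. \<forall>z. E z u \<longleftrightarrow> z = x \<or> z = y"
begin

definition ispr :: "nat \<Rightarrow> nat \<Rightarrow> nat \<Rightarrow> bool" where
  "ispr d a b \<longleftrightarrow> (\<exists>s t. (\<forall>z. E z s \<longleftrightarrow> z = a \<or> z = a) \<and> (\<forall>z. E z t \<longleftrightarrow> z = a \<or> z = b) \<and>
    (\<forall>z. E z d \<longleftrightarrow> z = s \<or> z = t))"

lemma ispr_ex: "\<exists>d. ispr d a b"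
proof -
  obtain s where s: "\<forall>z. E z s \<longleftrightarrow> z = a \<or> z = a" using pair[of a a] by blast
  obtain t where t: "\<forall>z. E z t \<longleftrightarrow> z = a \<or> z = b" using pair[of a b] by blast
  obtain d where "\<forall>z. E z d \<longleftrightarrow> z = s \<or> z = t" using pair[of s t] by blast
  then show ?thesis unfolding ispr_def using s t by blast
qed

lemma ispr_inj: "ispr d a b \<Longrightarrow> ispr d a' b' \<Longrightarrow> a = a' \<and> b = b'"
proof -
  assume "ispr d a b" "ispr d a' b'"
  then obtain s t s' t' where *: "\<forall>z. E z s \<longleftrightarrow> z = a \<or> z = a" "\<forall>z. E z t \<longleftrightarrow> z = a \<or> z = b"
    "\<forall>z. E z d \<longleftrightarrow> z = s \<or> z = t" "\<forall>z. E z s' \<longleftrightarrow> z = a' \<or> z = a'" "\<forall>z. E z t' \<longleftrightarrow> z = a' \<or> z = b'"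
    "\<forall>z. E z d \<longleftrightarrow> z = s' \<or> z = t'" unfolding ispr_def by blast
  have "{z. E z s} = {a}" "{z. E z t} = {a, b}" "{z. E z s'} = {a'}" "{z. E z t'} = {a', b'}"
    using *(1,2,4,5) by auto
  moreover have "{s, t} = {s', t'}" using *(3,6) by blast
  ultimately show ?thesis unfolding doubleton_eq_iff by (auto simp: doubleton_eq_iff)
qed

text \<open>Two parameters are merged into one pair at a time.\<close>

lemma one_parameter:
  "free_bound p \<le> n + 3 \<Longrightarrow> \<exists>q c. free_bound q \<le> 3 \<and> (\<forall>x y e'. sat UNIV E id (case_nat x (case_nat y e)) p =
    sat UNIV E id (case_nat x (case_nat y (case_nat c e'))) q) \<and>
    (\<forall>W. (\<forall>x. E x W \<longrightarrow> (\<forall>y. E y x \<longrightarrow> E y W)) \<longrightarrow> E c W \<longrightarrow> E (e 0) W)"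
proof (induction n arbitrary: p e)
  case 0
  have "sat UNIV E id (case_nat x (case_nat y e)) p = sat UNIV E id (case_nat x (case_nat y (case_nat (e 0) e'))) p"
    for x y e' by (rule sat_cong) (use 0 in \<open>auto split: nat.splits\<close>)
  then show ?case using 0 by (intro exI[of _ p] exI[of _ "e 0"] conjI allI impI) (simp only: add_0_left)
next
  case (Suc n)
  \<comment> \<open>The new bound variables 1 and 0 take over the two parameters 2 and 3; the
    arguments 0 and 1 move to 2 and 3, the pair occupies 4, and all later parameters move up by
    one.\<close>
  define r where "r k = (if k = 0 then 2 else if k = 1 then 3 else if k = 2 then 1 else if k = 3 then 0 else k + 1)" for k :: nat
  define p1 where "p1 = Exists (Exists (is_pair 4 1 0 \<^bold>\<and> rename r p))"
  have "free_bound (rename r p) \<le> n + 5"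
    by (rule free_bound_rename) (use Suc.prems in \<open>auto simp: r_def\<close>)
  then have "free_bound p1 \<le> n + 3" by (simp add: p1_def is_pair_def is_upair_def)
  obtain d where d: "ispr d (e 0) (e 1)" using ispr_ex by blast
  define f where "f = case_nat d (\<lambda>k. e (k + 2))"
  have eq: "sat UNIV E id (case_nat x (case_nat y f)) p1 = sat UNIV E id (case_nat x (case_nat y e)) p" for x y
  proof -
    have env: "sat UNIV E id (case_nat c1 (case_nat c0 (case_nat x (case_nat y f)))) (rename r p) =
        sat UNIV E id (case_nat x (case_nat y (case_nat c0 (case_nat c1 (\<lambda>k. e (k + 2)))))) p" for c0 c1
      unfolding sat_rename
      by (rule arg_cong[of _ _ "\<lambda>g. sat UNIV E id g p"]) (auto simp: fun_eq_iff r_def f_def numeral_eq_Suc split: nat.splits)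
    have ip: "sat UNIV E id (case_nat c1 (case_nat c0 (case_nat x (case_nat y f)))) (is_pair 4 1 0) \<longleftrightarrow> ispr d c0 c1" for c0 c1
      unfolding sat_is_pair ispr_def by (simp add: f_def numeral_eq_Suc)
    have ev: "case_nat (e 0) (case_nat (e 1) (\<lambda>k. e (k + 2))) = e"
      by (auto simp: fun_eq_iff split: nat.splits)
    have "sat UNIV E id (case_nat x (case_nat y f)) p1 \<longleftrightarrow>
        (\<exists>c0 c1. ispr d c0 c1 \<and> sat UNIV E id (case_nat x (case_nat y (case_nat c0 (case_nat c1 (\<lambda>k. e (k + 2)))))) p)"
      unfolding p1_def sat_conn env ip by blast
    also have "\<dots> \<longleftrightarrow> sat UNIV E id (case_nat x (case_nat y (case_nat (e 0) (case_nat (e 1) (\<lambda>k. e (k + 2)))))) p"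
      using d ispr_inj by blast
    finally show ?thesis unfolding ev .
  qed
  obtain q c where q: "free_bound q \<le> 3" "\<And>x y e'. sat UNIV E id (case_nat x (case_nat y f)) p1 =
      sat UNIV E id (case_nat x (case_nat y (case_nat c e'))) q"
      "\<And>W. (\<forall>x. E x W \<longrightarrow> (\<forall>y. E y x \<longrightarrow> E y W)) \<Longrightarrow> E c W \<Longrightarrow> E (f 0) W"
    using Suc.IH[OF \<open>free_bound p1 \<le> n + 3\<close>, of f] by blast
  \<comment> \<open>The original first parameter sits in the transitive closure of its code.
    \<open>Clos1\<close> yields a set around the code, and this clause ensures that the set also
    contains the parameter itself.\<close>
  obtain s where s: "E s d" "E (e 0) s" using d unfolding ispr_def by blast
  have "E (e 0) W" if "\<forall>x. E x W \<longrightarrow> (\<forall>y. E y x \<longrightarrow> E y W)" "E c W" for W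
  proof -
    have "E d W" using q(3)[OF that] by (simp add: f_def)
    then show ?thesis using that(1) s by blast
  qed
  then show ?case using q(1,2) unfolding eq by (intro exI[of _ q] exI[of _ c]) blast
qed

end

text \<open>The ground model. Compared with the axioms of \<open>T1\<close>, the schemas have been
  extended from a single parameter to all predicates that are definable with parameters.\<close>

locale Vmodel = Zmodel E id for E +
  assumes class_foundation: "dfn (\<lambda>e. P (e 0)) \<Longrightarrow> P x \<Longrightarrow> \<exists>x. P x \<and> (\<forall>y\<in>elts x. \<not> P y)"
    and closure: "dfn (\<lambda>e. Q (e 0) (e (Suc 0))) \<Longrightarrow> \<exists>W. c \<in> elts W \<and> (\<forall>x\<in>elts W. elts x \<subseteq> elts W) \<and>
      (\<forall>x\<in>elts W. (\<exists>y. Q y x) \<longrightarrow> (\<exists>y\<in>elts W. Q y x))"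
    and selector: "(\<And>y. y \<in> elts p \<Longrightarrow> elts y \<noteq> {}) \<Longrightarrow>
      (\<And>y y'. y \<in> elts p \<Longrightarrow> y' \<in> elts p \<Longrightarrow> elts y \<inter> elts y' \<noteq> {} \<Longrightarrow> y = y') \<Longrightarrow>
      \<exists>u. \<forall>y\<in>elts p. \<exists>z. elts y \<inter> elts u = {z}"

lemma Vmodel_intro:
  assumes sat: "\<And>p e. p \<in> T1 \<Longrightarrow> sat UNIV E id e p"
  shows "Vmodel E"
proof -
  have "sat UNIV E id (\<lambda>_. 0) Ax_Extensionality" "sat UNIV E id (\<lambda>_. 0) Ax_Pairing"
    "sat UNIV E id (\<lambda>_. 0) Ax_Weak_Power" "sat UNIV E id (\<lambda>_. 0) Ax_Selector"
    by (rule sat, simp add: T1_def T1_part_def)+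
  note ax = this[unfolded sat_axioms sat_Weak_Power sat_Selector]
  interpret pairing_model E
    by unfold_locales (use ax(1,2) in auto)
  interpret struct E id .
  \<comment> \<open>Variable 2 is freed and filled with \<open>c0\<close> before the parameters are
    merged, so that every transitive set around the resulting code \<open>c\<close> contains
    \<open>c0\<close>.\<close>
  have norm: "\<exists>q c. free_bound q \<le> 3 \<and> (\<forall>x y e'. P x y = sat UNIV E id (case_nat x (case_nat y (case_nat c e'))) q) \<and>
      (\<forall>W. (\<forall>x. E x W \<longrightarrow> (\<forall>y. E y x \<longrightarrow> E y W)) \<longrightarrow> E c W \<longrightarrow> E c0 W)"
    if d: "dfn (\<lambda>e. P (e 0) (e (Suc 0)))" for P c0
  proof -
    obtain N p where p: "\<And>M e. M \<ge> N \<Longrightarrow>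
        P (e 0) (e (Suc 0)) \<longleftrightarrow> sat UNIV E id (\<lambda>n. if n < M then e n else n - M) (p M)"
      using d unfolding dfn_def by blast
    define M where "M = Suc (Suc N)"
    define e' where "e' n = (if Suc (Suc n) < M then 0 else Suc (Suc n) - M)" for n
    define p' where "p' = rename (case_nat 0 (case_nat 1 (\<lambda>n. n + 3))) (p M)"
    have NM: "N \<le> M" by (simp add: M_def)
    have q: "sat UNIV E id (case_nat x (case_nat y (case_nat c0 e'))) p' \<longleftrightarrow> P x y" for y x
    proof -
      have "(\<lambda>n. if n < M then (case_nat x (case_nat y (\<lambda>_. 0))) n else n - M) = case_nat x (case_nat y e')"
        by (rule ext) (auto simp: e'_def M_def split: nat.splits)
      then show ?thesis using p[OF NM, of "case_nat x (case_nat y (\<lambda>_. 0))"]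
        unfolding p'_def sat_rename env_simps by (simp only: nat.case)
    qed
    show ?thesis
      using one_parameter[of p' "free_bound p'" "case_nat c0 e'"] unfolding q by (simp only: nat.case le_add1 simp_thms)
  qed
  have compr: "\<exists>u. \<forall>z. E z u \<longleftrightarrow> E z a \<and> P z" if d: "dfn (\<lambda>e. P (e 0))" for P a
  proof -
    obtain q c where q: "free_bound q \<le> 3" "\<And>x y e'. P x = sat UNIV E id (case_nat x (case_nat y (case_nat c e'))) q"
      using norm[of "\<lambda>x y. P x" 0, OF d] by blast
    have "sat UNIV E id (\<lambda>_. 0) (Compr1 q)" by (rule sat) (use q(1) in \<open>simp add: T1_def T1_part_def\<close>)
    then have "\<exists>u\<in>UNIV. \<forall>z\<in>UNIV. E z u \<longleftrightarrow> E z a \<and> sat UNIV E id (case_nat z (case_nat a (case_nat c (\<lambda>_. 0)))) q"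
      unfolding sat_Compr1 by (drule_tac bspec[OF _ UNIV_I, of _ c]) (drule bspec[OF _ UNIV_I, of _ a])
    then show ?thesis unfolding q(2)[symmetric] by simp
  qed
  have clos: "\<exists>W. E c W \<and> (\<forall>x. E x W \<longrightarrow> (\<forall>y. E y x \<longrightarrow> E y W)) \<and> (\<forall>x. E x W \<longrightarrow> (\<exists>y. P y x) \<longrightarrow> (\<exists>y. E y W \<and> P y x))"
    if d: "dfn (\<lambda>e. P (e 0) (e (Suc 0)))" for P c
  proof -
    obtain q c' where q: "free_bound q \<le> 3" "\<And>x y e'. P x y = sat UNIV E id (case_nat x (case_nat y (case_nat c' e'))) q"
      "\<And>W. (\<forall>x. E x W \<longrightarrow> (\<forall>y. E y x \<longrightarrow> E y W)) \<Longrightarrow> E c' W \<Longrightarrow> E c W"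
      using norm[of P c, OF d] by blast
    have "sat UNIV E id (\<lambda>_. 0) (Clos1 q)" by (rule sat) (use q(1) in \<open>simp add: T1_def T1_part_def\<close>)
    then have cl: "\<forall>c'. \<exists>W. E c' W \<and> (\<forall>x. E x W \<longrightarrow> (\<forall>y. E y x \<longrightarrow> E y W)) \<and>
      (\<forall>x. E x W \<longrightarrow> (\<exists>y. sat UNIV E id (case_nat y (case_nat x (case_nat c' (\<lambda>_. 0)))) q) \<longrightarrow>
        (\<exists>y. E y W \<and> sat UNIV E id (case_nat y (case_nat x (case_nat c' (\<lambda>_. 0)))) q))"
      unfolding sat_Clos1 by simp
    from spec[OF cl, of c'] obtain W where W: "E c' W" "\<forall>x. E x W \<longrightarrow> (\<forall>y. E y x \<longrightarrow> E y W)"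
      "\<forall>x. E x W \<longrightarrow> (\<exists>y. P y x) \<longrightarrow> (\<exists>y. E y W \<and> P y x)" unfolding q(2)[symmetric] by blast
    then show ?thesis using q(3)[OF W(2,1)] by blast
  qed
  have found: "\<exists>x. P x \<and> (\<forall>y. E y x \<longrightarrow> \<not> P y)" if d: "dfn (\<lambda>e. P (e 0))" and x: "P x" for P x
  proof -
    obtain q c where q: "free_bound q \<le> 3" "\<And>x y e'. P x = sat UNIV E id (case_nat x (case_nat y (case_nat c e'))) q"
      using norm[of "\<lambda>x y. P x" 0, OF d] by blast
    \<comment> \<open>Here the second argument of \<open>q\<close> is a dummy, so it may be
      identified with the parameter; this brings the formula down to the two variables allowed in
      \<open>Found1\<close>.\<close>
    define q' where "q' = rename (\<lambda>k. if k = 0 then 0 else 1) q"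
    have "free_bound q' \<le> 2" unfolding q'_def by (rule free_bound_rename) auto
    then have "sat UNIV E id (\<lambda>_. 0) (Found1 q')" by (intro sat) (simp add: T1_def T1_part_def)
    moreover have q': "sat UNIV E id (case_nat x (case_nat c e')) q' \<longleftrightarrow> P x" for x e'
    proof -
      have "sat UNIV E id (case_nat x (case_nat c e')) q' = sat UNIV E id (case_nat x (case_nat c (case_nat c e'))) q"
        unfolding q'_def sat_rename by (rule sat_cong) (use q(1) in \<open>auto split: nat.splits\<close>)
      then show ?thesis using q(2) by simp
    qed
    ultimately have "(\<exists>x\<in>UNIV. P x) \<longrightarrow> (\<exists>x\<in>UNIV. P x \<and> (\<forall>y\<in>UNIV. E y x \<longrightarrow> \<not> P y))"
      unfolding sat_Found1 by (drule_tac bspec[OF _ UNIV_I, of _ c]) (simp only: q')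
    then show ?thesis using x by blast
  qed
  interpret Zmodel E id
  proof
    fix x y a :: nat and P :: "nat \<Rightarrow> bool"
    show "(\<And>z. E z x = E z y) \<Longrightarrow> x = y" by (rule extens)
    show "\<exists>u. \<forall>z. E z u = (z = x \<or> z = y)" by (rule pair)
    show "dfn (\<lambda>e. P (e 0)) \<Longrightarrow> \<exists>u. \<forall>z. E z u = (E z a \<and> P z)" by (rule compr)
    \<comment> \<open>Closure under the empty relation still gives a transitive set around
      \<open>x\<close>, and the union of \<open>x\<close> can be separated from it.\<close>
    obtain W where W: "E x W" "\<forall>x. E x W \<longrightarrow> (\<forall>y. E y x \<longrightarrow> E y W)"
      using clos[where P = "\<lambda>_ _. False" and c = x, OF dfn_const] by blast
    have "dfn (\<lambda>e. \<exists>y. E y x \<and> E (e 0) y)" by (intro dfns)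
    from compr[where P = "\<lambda>z. \<exists>y. E y x \<and> E z y" and a = W, OF this]
    obtain u where "\<forall>z. E z u = (E z W \<and> (\<exists>y. E y x \<and> E z y))" by blast
    then have "\<forall>z. E z u = (\<exists>y. E y x \<and> E z y)" using W by blast
    then show "\<exists>u. \<forall>z. E z u = (\<exists>y. E y x \<and> E z y)" by blast
    obtain v where v: "\<forall>z. (\<forall>w. E w z \<longrightarrow> E w x) \<longrightarrow> E z v" using bspec[OF ax(3) UNIV_I, of x] by auto
    have "dfn (\<lambda>e. \<forall>w. E w (e 0) \<longrightarrow> E w x)" by (intro dfns)
    from compr[where P = "\<lambda>z. \<forall>w. E w z \<longrightarrow> E w x" and a = v, OF this]
    obtain u where "\<forall>z. E z u = (E z v \<and> (\<forall>w. E w z \<longrightarrow> E w x))" by blast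
    then have "\<forall>z. E z u = (\<forall>w. E w z \<longrightarrow> E w x)" using v by blast
    then show "\<exists>u. \<forall>z. E z u = (\<forall>w. E w z \<longrightarrow> E w x)" by blast
  qed
  have inE: "z \<in> elts x \<longleftrightarrow> E z x" for z x by (simp add: elts_def)
  show ?thesis
  proof
    show "\<exists>x. P x \<and> (\<forall>y\<in>elts x. \<not> P y)" if "dfn (\<lambda>e. P (e 0))" "P x" for P x
      using found[where P = P, OF that] unfolding Ball_def inE .
    show "\<exists>W. c \<in> elts W \<and> (\<forall>x\<in>elts W. elts x \<subseteq> elts W) \<and>
        (\<forall>x\<in>elts W. (\<exists>y. P y x) \<longrightarrow> (\<exists>y\<in>elts W. P y x))"
      if "dfn (\<lambda>e. P (e 0) (e (Suc 0)))" for P c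
      using clos[where P = P and c = c, OF that] unfolding Ball_def Bex_def subset_iff inE .
    show "\<exists>u. \<forall>y\<in>elts p. \<exists>z. elts y \<inter> elts u = {z}"
      if ne: "\<And>y. y \<in> elts p \<Longrightarrow> elts y \<noteq> {}"
        and dj: "\<And>y y'. y \<in> elts p \<Longrightarrow> y' \<in> elts p \<Longrightarrow> elts y \<inter> elts y' \<noteq> {} \<Longrightarrow> y = y'" for p
    proof -
      have 1: "\<forall>y\<in>UNIV. E y p \<longrightarrow> (\<exists>z\<in>UNIV. E z y)" using ne inE by blast
      have 2: "\<forall>y\<in>UNIV. E y p \<longrightarrow> (\<forall>y'\<in>UNIV. E y' p \<longrightarrow> (\<forall>z\<in>UNIV. E z y \<longrightarrow> E z y' \<longrightarrow> y = y'))"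
        using dj inE by blast
      obtain u where u: "\<forall>y\<in>UNIV. E y p \<longrightarrow> (\<exists>z\<in>UNIV. \<forall>w\<in>UNIV. E w y \<and> E w u \<longleftrightarrow> w = z)"
        using mp[OF mp[OF bspec[OF ax(4) UNIV_I, of p] 1] 2] by blast
      have "\<exists>z. elts y \<inter> elts u = {z}" if "y \<in> elts p" for y
      proof -
        have "E y p" using that unfolding inE .
        then obtain z where z: "\<forall>w\<in>UNIV. (E w y \<and> E w u) = (w = z)" by (rule bexE[OF mp[OF bspec[OF u UNIV_I, of y]]])
        have "elts y \<inter> elts u = {w. E w y \<and> E w u}" unfolding elts_def by (rule Collect_conj_eq[symmetric])
        also have "\<dots> = {z}" using z by simp
        finally have "elts y \<inter> elts u = {z}" .
        then show ?thesis by blast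
      qed
      then show ?thesis by blast
    qed
  qed
qed

theorem Vmodel_exists:
  assumes "consistent L_mem ZF"
  shows "\<exists>E. Vmodel E"
proof -
  have excl: "sat D R j e no_universal \<and> sat D R j e adjoining"
    if T: "\<And>p. p \<in> T1 \<Longrightarrow> sat D R j e p" for D and R :: "tm set \<Rightarrow> tm set \<Rightarrow> bool" and j e
  proof
    have "sat D R j e (Compr1 (\<^bold>\<not> Var 0 \<^bold>\<in> Var 0))" by (rule T) (simp add: T1_def T1_part_def)
    then have c: "\<forall>c\<in>D. \<forall>a\<in>D. \<exists>u\<in>D. \<forall>z\<in>D. R z u \<longleftrightarrow> R z a \<and> \<not> R z z"
      unfolding sat_Compr1 by (simp only: sat.simps tmv.simps nat.case simp_thms)
    have "\<exists>u\<in>D. \<not> R u x" if x: "x \<in> D" for x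
    proof -
      obtain u where "u \<in> D" "\<forall>z\<in>D. R z u \<longleftrightarrow> R z x \<and> \<not> R z z" using bspec[OF bspec[OF c x] x] by blast
      then show ?thesis by blast
    qed
    then show "sat D R j e no_universal" by (auto simp: no_universal_def)
    have "sat D R j e Ax_Pairing" "sat D R j e (Clos1 \<^bold>\<bottom>)" by (rule T, simp add: T1_def T1_part_def)+
    note ax = this[unfolded sat_axioms sat_Clos1]
    have "\<exists>u\<in>D. (\<forall>z\<in>D. R z x \<longrightarrow> R z u) \<and> R y u" if xy: "x \<in> D" "y \<in> D" for x y
    proof -
      obtain c where c: "c \<in> D" "\<forall>z\<in>D. R z c \<longleftrightarrow> z = x \<or> z = y" using bspec[OF bspec[OF ax(1) xy(1)] xy(2)] by blast
      obtain W where W: "W \<in> D" "R c W" "\<forall>x\<in>D. R x W \<longrightarrow> (\<forall>y\<in>D. R y x \<longrightarrow> R y W)" by (rule bexE[OF bspec[OF ax(2) c(1)]]) (elim conjE, rule that)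
      have cx: "R x c" using bspec[OF c(2) xy(1)] by simp
      have cy: "R y c" using bspec[OF c(2) xy(2)] by simp
      note tr = bspec[OF W(3) c(1), rule_format, OF W(2)]
      have xW: "R x W" using tr[OF xy(1) cx] .
      have yW: "R y W" using tr[OF xy(2) cy] .
      have "\<forall>z\<in>D. R z x \<longrightarrow> R z W" using bspec[OF W(3) xy(1), rule_format, OF xW] by simp
      then show ?thesis using yW by (intro bexI[of _ W] conjI W(1))
    qed
    then show "sat D R j e adjoining"
      by (simp add: adjoining_def numeral_3_eq_3 numeral_2_eq_2)
  qed
  have "sentence \<^bold>\<bottom>" by (simp add: sentence_def)
  from completeness[OF T1_sentence consistent_T1[OF assms] this excl]
  obtain R :: "nat \<Rightarrow> nat \<Rightarrow> bool" and j where R: "\<forall>p\<in>T1. \<forall>e. sat UNIV R j e p" by blast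
  have "sat UNIV R j (\<lambda>_. 0) Ax_J_trivial" using R by (simp add: T1_def T1_part_def)
  then have "j = id" by (auto simp: Ax_J_trivial_def fun_eq_iff)
  then have "Vmodel R" using R by (intro Vmodel_intro) blast
  then show ?thesis by blast
qed

section \<open>Collection and Replacement in the ground model\<close>

context Vmodel
begin

lemma collection:
  assumes "dfn (\<lambda>e. Q (e 0) (e (Suc 0)))" "\<And>x. x \<in> elts a \<Longrightarrow> \<exists>y. Q y x"
  shows "\<exists>b. \<forall>x\<in>elts a. \<exists>y\<in>elts b. Q y x"
proof -
  obtain W where W: "a \<in> elts W" "\<forall>x\<in>elts W. elts x \<subseteq> elts W"
    "\<forall>x\<in>elts W. (\<exists>y. Q y x) \<longrightarrow> (\<exists>y\<in>elts W. Q y x)" using closure[OF assms(1), of a] by blast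
  then have "\<forall>x\<in>elts a. \<exists>y\<in>elts W. Q y x" using assms(2) by blast
  then show ?thesis by blast
qed

lemma sm_rel_image:
  assumes d: "dfn (\<lambda>e. Q (e 0) (e (Suc 0)))" and fn: "\<And>x y y'. x \<in> elts a \<Longrightarrow> Q y x \<Longrightarrow> Q y' x \<Longrightarrow> y = y'"
  shows "sm {y. \<exists>x\<in>elts a. Q y x}"
proof -
  obtain W where W: "a \<in> elts W" "\<forall>x\<in>elts W. elts x \<subseteq> elts W"
    "\<forall>x\<in>elts W. (\<exists>y. Q y x) \<longrightarrow> (\<exists>y\<in>elts W. Q y x)" using closure[OF d, of a] by blast
  show ?thesis
  proof (rule sm_Collect_sub[where P = "\<lambda>y. \<exists>x\<in>elts a. Q y x", OF _ sm_elts[of W]])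
    show "dfn (\<lambda>e. \<exists>x\<in>elts a. Q (e 0) x)" by (intro dfns dfn_perm(1)[OF d])
    show "z \<in> elts W" if z: "\<exists>x\<in>elts a. Q z x" for z
    proof -
      obtain x where x: "x \<in> elts a" "Q z x" using z by blast
      then obtain y where "y \<in> elts W" "Q y x" using W by blast
      then show ?thesis using fn[OF x(1), of z y] x(2) by blast
    qed
  qed
qed

lemma sm_image:
  assumes "sm A" "dfn (\<lambda>e. e 0 = F (e (Suc 0)))"
  shows "sm (F ` A)"
proof -
  obtain a where a: "A = elts a" using assms(1) by (auto simp: sm_def)
  have "sm {y. \<exists>x\<in>elts a. y = F x}" by (rule sm_rel_image[OF assms(2)]) simp
  moreover have "{y. \<exists>x\<in>elts a. y = F x} = F ` A" unfolding a by blast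
  ultimately show ?thesis by simp
qed

lemma set_foundation: "sm S \<Longrightarrow> x \<in> S \<Longrightarrow> \<exists>y\<in>S. elts y \<inter> S = {}"
proof -
  assume S: "sm S" "x \<in> S"
  have "dfn (\<lambda>e. e 0 \<in> S)" by (rule sm_dfn[OF S(1)]) (intro dfns)
  from class_foundation[where P = "\<lambda>x. x \<in> S", OF this S(2)] show ?thesis by blast
qed

lemma irrefl: "x \<notin> elts x"
  using set_foundation[OF sm_sing, of x x] by blast

end


section \<open>Universes over non-well-founded atoms\<close>

text \<open>Every element \<open>a = (\<emptyset>, (c, t))\<close> of a set \<open>AT\<close> is turned into an atom with the members
  \<open>{a} \<union> c\<close> by exchanging the roles of \<open>a\<close> and \<open>{a} \<union> c\<close>.\<close>

locale atoms = Vmodel +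
  fixes AT :: nat
  assumes atom_form: "a \<in> elts AT \<Longrightarrow> \<exists>c t. a = pr emp (pr c t) \<and> elts c \<subseteq> elts AT"
begin

definition core :: "nat \<Rightarrow> nat" where
  "core a = (if \<exists>c t. a = pr emp (pr c t) then THE c. \<exists>t. a = pr emp (pr c t) else emp)"

lemma core_pr [simp]: "core (pr emp (pr c t)) = c"
  unfolding core_def by auto

lemma core_iff: "y = core a \<longleftrightarrow> (\<exists>t. a = pr emp (pr y t)) \<or> (\<not> (\<exists>c t. a = pr emp (pr c t)) \<and> y = emp)"
proof (cases "\<exists>c t. a = pr emp (pr c t)")
  case True
  then obtain c t where "a = pr emp (pr c t)" by blast
  then show ?thesis by auto
next
  case False
  then have "core a = emp" unfolding core_def by (rule if_not_P)
  moreover have "\<not> (\<exists>t. a = pr emp (pr y t))" using False by blast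
  ultimately show ?thesis using False by simp
qed

lemma core_dfnf [dfns]: "dfnf f \<Longrightarrow> dfnf (\<lambda>e. core (f e))"
  by (rule dfnf_app1, subst core_iff, intro dfns)

definition ela :: "nat \<Rightarrow> nat" where "ela a = ins a (core a)"

lemma elts_ela [simp]: "elts (ela a) = insert a (elts (core a))"
  by (simp add: ela_def)

lemma ela_dfnf [dfns]: "dfnf f \<Longrightarrow> dfnf (\<lambda>e. ela (f e))"
  unfolding ela_def by (intro dfns)

text \<open>The members of an atom are members of a Kuratowski pair with first component
  \<open>emp\<close> and contain \<open>emp\<close>, whereas the members of an atom are never empty.
  Consequently \<open>ela a\<close>, which contains \<open>a\<close>, is no atom and can be
  exchanged with \<open>a\<close>.\<close>

lemma antichain: "a \<in> elts AT \<Longrightarrow> b \<in> elts AT \<Longrightarrow> b \<notin> elts a"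
proof
  assume "a \<in> elts AT" "b \<in> elts AT" "b \<in> elts a"
  then obtain x y where a: "a = pr emp x" "b = pr emp y" using atom_form by blast
  have "emp \<in> elts b" using \<open>b \<in> elts a\<close> unfolding a(1) pr_def by auto
  then have "emp = up emp emp \<or> emp = up emp y" unfolding a(2) pr_def by simp
  then have "elts emp = elts (up emp emp) \<or> elts emp = elts (up emp y)" by (elim disjE) (rule disjI1, erule arg_cong, rule disjI2, erule arg_cong)
  then show False by simp
qed

lemma ela_not_atom: "a \<in> elts AT \<Longrightarrow> ela a \<notin> elts AT"
  using antichain[of "ela a" a] by auto

text \<open>An atom lies above its core by a fixed number of membership steps through pairs, so two
  atoms in each other's cores would close a cycle and violate foundation.\<close>

lemma core_acyclic: "a \<in> elts AT \<Longrightarrow> b \<in> elts AT \<Longrightarrow> b \<in> elts (core a) \<Longrightarrow> a \<notin> elts (core b)"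
proof
  assume ab: "a \<in> elts AT" "b \<in> elts AT" "b \<in> elts (core a)" "a \<in> elts (core b)"
  obtain c t d s where a: "a = pr emp (pr c t)" and b: "b = pr emp (pr d s)" using ab(1,2) atom_form by blast
  let ?S = "{a, up emp (pr c t), pr c t, up c c, c, b, up emp (pr d s), pr d s, up d d, d}"
  have "sm ?S" by (intro sm_insert sm_empty)
  then obtain y where y: "y \<in> ?S" "elts y \<inter> ?S = {}" using set_foundation[of ?S a] by blast
  have el: "up emp (pr c t) \<in> elts a" "pr c t \<in> elts (up emp (pr c t))" "up c c \<in> elts (pr c t)" "c \<in> elts (up c c)"
    "b \<in> elts c" "up emp (pr d s) \<in> elts b" "pr d s \<in> elts (up emp (pr d s))" "up d d \<in> elts (pr d s)"
    "d \<in> elts (up d d)" "a \<in> elts d"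
    using ab(3,4) unfolding a b core_pr by (simp_all add: pr_def)
  consider "y = a" | "y = up emp (pr c t)" | "y = pr c t" | "y = up c c" | "y = c" | "y = b"
    | "y = up emp (pr d s)" | "y = pr d s" | "y = up d d" | "y = d" using y(1) by blast
  then show False by cases (use y(2) el in blast)+
qed

lemma ela_inj: "a \<in> elts AT \<Longrightarrow> b \<in> elts AT \<Longrightarrow> ela a = ela b \<Longrightarrow> a = b"
proof (rule ccontr)
  assume ab: "a \<in> elts AT" "b \<in> elts AT" "ela a = ela b" "a \<noteq> b"
  then have "insert a (elts (core a)) = insert b (elts (core b))" using elts_ela by metis
  note eq = this
  have "b \<in> insert a (elts (core a))" unfolding eq by simp
  moreover have "a \<in> insert b (elts (core b))" unfolding eq[symmetric] by simp
  ultimately show False using core_acyclic[OF ab(1,2)] ab(4) by simp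
qed

text \<open>The involution of a Rieger-Bernays permutation model: membership in \<open>rho x\<close>
  agrees with membership in \<open>x\<close> except at atoms and their partners
  \<open>ela a\<close>.\<close>

definition rho :: "nat \<Rightarrow> nat" where
  "rho x = (if x \<in> elts AT then ela x else if \<exists>a\<in>elts AT. x = ela a then THE a. a \<in> elts AT \<and> x = ela a else x)"

lemma rho_atom: "a \<in> elts AT \<Longrightarrow> rho a = ela a"
  by (simp add: rho_def)

lemma rho_ela: "a \<in> elts AT \<Longrightarrow> rho (ela a) = a"
proof -
  assume a: "a \<in> elts AT"
  have "(THE b. b \<in> elts AT \<and> ela a = ela b) = a"
    by (rule the_equality) (use a ela_inj in auto)
  moreover have "\<exists>b\<in>elts AT. ela a = ela b" using a by blast
  ultimately show ?thesis using ela_not_atom[OF a] unfolding rho_def by simp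
qed

lemma rho_other: "x \<notin> elts AT \<Longrightarrow> \<not> (\<exists>a\<in>elts AT. x = ela a) \<Longrightarrow> rho x = x"
  unfolding rho_def by simp

lemma rho_cases:
  obtains "x \<in> elts AT" "rho x = ela x" | a where "a \<in> elts AT" "x = ela a" "x \<notin> elts AT" "rho x = a"
  | "x \<notin> elts AT" "\<not> (\<exists>a\<in>elts AT. x = ela a)" "rho x = x"
  using rho_atom[of x] rho_ela rho_other[of x] ela_not_atom by blast

lemma rho_rho [simp]: "rho (rho x) = x"
  by (rule rho_cases[of x]) (use rho_ela rho_atom in auto)

lemma rho_iff: "y = rho x \<longleftrightarrow> (x \<in> elts AT \<and> y = ela x) \<or> (x \<notin> elts AT \<and>
    ((y \<in> elts AT \<and> x = ela y) \<or> (\<not> (\<exists>a\<in>elts AT. x = ela a) \<and> y = x)))"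
proof (rule rho_cases[of x])
  fix a assume "a \<in> elts AT" "x = ela a" "x \<notin> elts AT" "rho x = a"
  moreover have "y = a \<longleftrightarrow> y \<in> elts AT \<and> ela a = ela y" using ela_inj[OF \<open>a \<in> elts AT\<close>, of y] \<open>a \<in> elts AT\<close> by blast
  ultimately show ?thesis by auto
qed auto

lemma rho_dfnf [dfns]: "dfnf f \<Longrightarrow> dfnf (\<lambda>e. rho (f e))"
  by (rule dfnf_app1, subst rho_iff, intro dfns)

definition exts :: "nat \<Rightarrow> nat set" where "exts x = elts (rho x)"

abbreviation es :: "nat \<Rightarrow> nat \<Rightarrow> bool" where "es z x \<equiv> z \<in> exts x"

definition mk :: "nat set \<Rightarrow> nat" where "mk S = rho (st S)"

lemma exts_dfn [dfns]: "dfnf f \<Longrightarrow> dfnf g \<Longrightarrow> dfn (\<lambda>e. f e \<in> exts (g e))"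
  unfolding exts_def by (intro dfns)

lemma exts_mk: "sm S \<Longrightarrow> exts (mk S) = S"
  by (simp add: exts_def mk_def elts_st)

lemma mk_exts [simp]: "mk (exts x) = x"
  by (simp add: exts_def mk_def)

lemma sm_exts [simp, intro!]: "sm (exts x)"
  by (simp add: exts_def)

lemma exts_inj: "exts x = exts y \<Longrightarrow> x = y"
  using mk_exts by metis

lemma exts_atom: "a \<in> elts AT \<Longrightarrow> exts a = insert a (elts (core a))"
  by (simp add: exts_def rho_atom)

lemma atom_iff_exts: "exts x = insert a (elts (core a)) \<Longrightarrow> a \<in> elts AT \<Longrightarrow> x = a"
  using exts_atom exts_inj by metis

text \<open>Foundation of the ground model is applied to \<open>P\<close> at a set together with all
  its members. The strengthening is needed at the partner \<open>ela a\<close>: its new members are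
  the old members of \<open>a\<close>, which lie two steps deep.\<close>

lemma es_induct:
  assumes d: "dfn (\<lambda>e. P (e 0))" and at: "\<And>a. a \<in> elts AT \<Longrightarrow> P a"
    and st: "\<And>x. x \<notin> elts AT \<Longrightarrow> (\<And>z. z \<in> exts x \<Longrightarrow> P z) \<Longrightarrow> P x"
  shows "P x"
proof (rule ccontr)
  assume "\<not> P x"
  let ?Q = "\<lambda>x. P x \<and> (\<forall>u\<in>elts x. P u)"
  have dP: "dfn (\<lambda>e. P (e n))" for n by (rule dfn_app1[OF d dfnf_var])
  have "dfn (\<lambda>e. \<not> (P (e 0) \<and> (\<forall>u\<in>elts (e 0). P u)))" by (intro dfns dP)
  moreover have "\<not> ?Q x" using \<open>\<not> P x\<close> by blast
  ultimately obtain y where y: "\<not> ?Q y" "\<forall>z\<in>elts y. \<not> \<not> ?Q z"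
    using class_foundation[where P = "\<lambda>x. \<not> ?Q x" and x = x] by blast
  have "P y"
  proof (rule rho_cases[of y])
    assume "y \<in> elts AT" then show "P y" by (rule at)
  next
    fix a assume a: "a \<in> elts AT" "y = ela a" "y \<notin> elts AT" "rho y = a"
    have "a \<in> elts y" using a(2) by simp
    then have "\<forall>u\<in>elts a. P u" using y(2) by blast
    then show "P y" using st[OF a(3)] a(4) unfolding exts_def by blast
  next
    assume "y \<notin> elts AT" "rho y = y"
    then show "P y" using st[of y] y(2) unfolding exts_def by simp
  qed
  then show False using y by blast
qed

definition supp :: "nat \<Rightarrow> nat \<Rightarrow> bool" where
  "supp w T \<longleftrightarrow> (\<forall>z\<in>elts T. (z \<in> elts AT \<longrightarrow> z \<in> elts w) \<and> (\<forall>u\<in>exts z. u \<in> elts T))"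

text \<open>The universe built over the atoms of \<open>w\<close>, described by a transitive set of
  the new membership relation that contains \<open>x\<close> and has no atoms outside of
  \<open>w\<close>. This replaces a cumulative hierarchy and ranks.\<close>

definition D :: "nat \<Rightarrow> nat \<Rightarrow> bool" where
  "D w x \<longleftrightarrow> (\<exists>T. x \<in> elts T \<and> supp w T)"

lemma supp_dfn: "dfn (\<lambda>e. supp (e m) (e n))"
  unfolding supp_def by (intro dfns)

lemma D_dfn [dfns]: "dfnf f \<Longrightarrow> dfnf g \<Longrightarrow> dfn (\<lambda>e. D (f e) (g e))"
  by (rule dfn_app2) (unfold D_def, intro dfns supp_dfn)

lemma D_atom_in: "D w a \<Longrightarrow> a \<in> elts AT \<Longrightarrow> a \<in> elts w"
  unfolding D_def supp_def by blast

lemma D_trans: "D w x \<Longrightarrow> z \<in> exts x \<Longrightarrow> D w z"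
  unfolding D_def supp_def by blast

lemma D_mono: "elts w \<subseteq> elts w' \<Longrightarrow> D w x \<Longrightarrow> D w' x"
  unfolding D_def supp_def by blast

text \<open>Collection gathers supports for the members, and adding \<open>x\<close> to their union
  gives a support for \<open>x\<close>. The exception \<open>z = x\<close> is there for atoms and
  other sets that might be members of themselves.\<close>

lemma D_fold:
  assumes "x \<in> elts AT \<Longrightarrow> x \<in> elts w" "\<And>z. z \<in> exts x \<Longrightarrow> z = x \<or> D w z"
  shows "D w x"
proof -
  have d: "dfn (\<lambda>e. e (Suc 0) = x \<or> (e (Suc 0) \<in> elts (e 0) \<and> supp w (e 0)))"
    by (intro dfns dfn_app2[where R = supp, OF supp_dfn])
  have ex: "\<exists>T. z = x \<or> (z \<in> elts T \<and> supp w T)" if "z \<in> elts (rho x)" for z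
    using assms(2)[of z] that unfolding D_def exts_def by blast
  obtain b where b: "\<forall>z\<in>elts (rho x). \<exists>T\<in>elts b. z = x \<or> (z \<in> elts T \<and> supp w T)"
    using collection[where Q = "\<lambda>T z. z = x \<or> (z \<in> elts T \<and> supp w T)" and a = "rho x", OF d ex] by blast
  define S where "S = {z. z = x \<or> (\<exists>T\<in>elts b. z \<in> elts T \<and> supp w T)}"
  have "sm S" unfolding S_def
  proof (rule sm_Collect_sub[OF _ sm_elts[of "ins x (Un1 b)"]])
    show "dfn (\<lambda>e. e 0 = x \<or> (\<exists>T\<in>elts b. e 0 \<in> elts T \<and> supp w T))"
      by (intro dfns dfn_app2[where R = supp, OF supp_dfn])
  qed auto
  then have S: "elts (st S) = S" by (rule elts_st)
  have "supp w (st S)" unfolding supp_def S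
  proof (intro ballI conjI impI)
    fix z assume z: "z \<in> S"
    show "z \<in> elts w" if "z \<in> elts AT" using z that assms(1) unfolding S_def supp_def by blast
    show "u \<in> S" if u: "u \<in> exts z" for u
    proof (cases "z = x")
      case True
      then obtain T where "T \<in> elts b" "u = x \<or> (u \<in> elts T \<and> supp w T)" using b u unfolding exts_def by blast
      then show ?thesis unfolding S_def by blast
    next
      case False
      then show ?thesis using z u unfolding S_def supp_def by blast
    qed
  qed
  then show ?thesis unfolding D_def by (intro exI[of _ "st S"]) (simp add: S, simp add: S_def)
qed

text \<open>Fullness of the universe over \<open>w\<close>: all ground sets of its elements are
  represented in it. An atom cannot slip in this way, since it would be one of its own members and
  hence already belong to \<open>w\<close>.\<close>

lemma D_mk:
  assumes "sm S" "\<And>z. z \<in> S \<Longrightarrow> D w z"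
  shows "D w (mk S)"
proof (rule D_fold)
  have e: "exts (mk S) = S" by (rule exts_mk[OF assms(1)])
  show "mk S \<in> elts w" if a: "mk S \<in> elts AT"
  proof -
    have "mk S \<in> S" using exts_atom[OF a] e by blast
    then show ?thesis using assms(2) D_atom_in a by blast
  qed
  show "z = mk S \<or> D w z" if "z \<in> exts (mk S)" for z using that assms(2) e by blast
qed

end


text \<open>A permutation of the atoms extends to an automorphism of the universe; its graph is the union of
  all set-sized partial isomorphisms.\<close>

locale auto = atoms +
  fixes G :: "nat \<Rightarrow> nat \<Rightarrow> bool"
  assumes G_dfn: "dfn (\<lambda>e. G (e 0) (e (Suc 0)))"
    and G_atom: "G a b \<Longrightarrow> a \<in> elts AT \<and> b \<in> elts AT"
    and G_fun: "G a b \<Longrightarrow> G a b' \<Longrightarrow> b = b'" and G_inj: "G a b \<Longrightarrow> G a' b \<Longrightarrow> a = a'"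
    and G_total: "a \<in> elts AT \<Longrightarrow> \<exists>b. G a b" and G_surj: "b \<in> elts AT \<Longrightarrow> \<exists>a. G a b"
    and G_forth: "G a b \<Longrightarrow> a' \<in> elts (core a) \<Longrightarrow> \<exists>b'\<in>elts (core b). G a' b'"
    and G_back: "G a b \<Longrightarrow> b' \<in> elts (core b) \<Longrightarrow> \<exists>a'\<in>elts (core a). G a' b'"
begin

definition bis :: "nat \<Rightarrow> bool" where
  "bis p \<longleftrightarrow> (\<forall>u v. pr u v \<in> elts p \<longrightarrow> G u v \<or> (u \<notin> elts AT \<and> v \<notin> elts AT \<and>
    (\<forall>u'\<in>exts u. \<exists>v'\<in>exts v. pr u' v' \<in> elts p) \<and> (\<forall>v'\<in>exts v. \<exists>u'\<in>exts u. pr u' v' \<in> elts p)))"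

definition RR :: "nat \<Rightarrow> nat \<Rightarrow> bool" where
  "RR x y \<longleftrightarrow> (\<exists>p. bis p \<and> pr x y \<in> elts p)"

lemma G_dfn' [dfns]: "dfnf f \<Longrightarrow> dfnf g \<Longrightarrow> dfn (\<lambda>e. G (f e) (g e))"
  by (rule dfn_app2[OF G_dfn])

lemma bis_dfn [dfns]: "dfnf f \<Longrightarrow> dfn (\<lambda>e. bis (f e))"
  by (rule dfn_app1) (unfold bis_def, intro dfns)

lemma RR_dfn [dfns]: "dfnf f \<Longrightarrow> dfnf g \<Longrightarrow> dfn (\<lambda>e. RR (f e) (g e))"
  by (rule dfn_app2) (unfold RR_def, intro dfns)

lemma RR_unfold: "RR x y \<Longrightarrow> G x y \<or> (x \<notin> elts AT \<and> y \<notin> elts AT \<and>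
    (\<forall>u\<in>exts x. \<exists>v\<in>exts y. RR u v) \<and> (\<forall>v\<in>exts y. \<exists>u\<in>exts x. RR u v))"
  unfolding RR_def bis_def by blast

lemma RR_atom: "G a b \<Longrightarrow> RR a b"
proof -
  assume "G a b"
  then have "bis (up (pr a b) (pr a b))" unfolding bis_def by simp
  moreover have "pr a b \<in> elts (up (pr a b) (pr a b))" by simp
  ultimately show ?thesis unfolding RR_def by blast
qed

lemma RR_fold:
  assumes "x \<notin> elts AT" "y \<notin> elts AT" "\<And>u. u \<in> exts x \<Longrightarrow> \<exists>v\<in>exts y. RR u v" "\<And>v. v \<in> exts y \<Longrightarrow> \<exists>u\<in>exts x. RR u v"
  shows "RR x y"
proof -
  have d1: "dfn (\<lambda>e. bis (e 0) \<and> (\<exists>v\<in>exts y. pr (e (Suc 0)) v \<in> elts (e 0)))"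
    and d2: "dfn (\<lambda>e. bis (e 0) \<and> (\<exists>u\<in>exts x. pr u (e (Suc 0)) \<in> elts (e 0)))" by (intro dfns)+
  have e1: "\<exists>p. bis p \<and> (\<exists>v\<in>exts y. pr u v \<in> elts p)" if "u \<in> elts (rho x)" for u
    using assms(3)[of u] that unfolding RR_def exts_def by blast
  have e2: "\<exists>p. bis p \<and> (\<exists>u\<in>exts x. pr u v \<in> elts p)" if "v \<in> elts (rho y)" for v
    using assms(4)[of v] that unfolding RR_def exts_def by blast
  obtain b1 where b1: "\<forall>u\<in>elts (rho x). \<exists>p\<in>elts b1. bis p \<and> (\<exists>v\<in>exts y. pr u v \<in> elts p)"
    using collection[where Q = "\<lambda>p u. bis p \<and> (\<exists>v\<in>exts y. pr u v \<in> elts p)", OF d1 e1] by blast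
  obtain b2 where b2: "\<forall>v\<in>elts (rho y). \<exists>p\<in>elts b2. bis p \<and> (\<exists>u\<in>exts x. pr u v \<in> elts p)"
    using collection[where Q = "\<lambda>p v. bis p \<and> (\<exists>u\<in>exts x. pr u v \<in> elts p)", OF d2 e2] by blast
  define S where "S = {z. z = pr x y \<or> (\<exists>p\<in>elts (un b1 b2). bis p \<and> z \<in> elts p)}"
  have "sm S" unfolding S_def
    by (rule sm_Collect_sub[OF _ sm_elts[of "ins (pr x y) (Un1 (un b1 b2))"]]) (intro dfns, auto)
  then have S: "elts (st S) = S" by (rule elts_st)
  have sub: "z \<in> S" if "p \<in> elts (un b1 b2)" "bis p" "z \<in> elts p" for p z using that unfolding S_def by blast
  have "bis (st S)" unfolding bis_def S
  proof (intro allI impI)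
    fix u v assume uv: "pr u v \<in> S"
    show "G u v \<or> (u \<notin> elts AT \<and> v \<notin> elts AT \<and>
      (\<forall>u'\<in>exts u. \<exists>v'\<in>exts v. pr u' v' \<in> S) \<and> (\<forall>v'\<in>exts v. \<exists>u'\<in>exts u. pr u' v' \<in> S))"
    proof (cases "pr u v = pr x y")
      case True
      then have [simp]: "u = x" "v = y" by simp_all
      have "\<exists>v'\<in>exts y. pr u' v' \<in> S" if u': "u' \<in> exts x" for u'
      proof -
        obtain p v' where "p \<in> elts b1" "bis p" "v' \<in> exts y" "pr u' v' \<in> elts p"
          using bspec[OF b1 u'[unfolded exts_def[of x]]] by blast
        then show ?thesis using sub[of p] by auto
      qed
      moreover have "\<exists>u'\<in>exts x. pr u' v' \<in> S" if v': "v' \<in> exts y" for v'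
      proof -
        obtain p u' where "p \<in> elts b2" "bis p" "u' \<in> exts x" "pr u' v' \<in> elts p"
          using bspec[OF b2 v'[unfolded exts_def[of y]]] by blast
        then show ?thesis using sub[of p] by auto
      qed
      ultimately show ?thesis using assms(1,2) by simp
    next
      case False
      then obtain p where p: "p \<in> elts (un b1 b2)" "bis p" "pr u v \<in> elts p" using uv unfolding S_def by blast
      then show ?thesis using sub[OF p(1,2)] unfolding bis_def by blast
    qed
  qed
  moreover have "pr x y \<in> elts (st S)" unfolding S unfolding S_def by blast
  ultimately show ?thesis unfolding RR_def by blast
qed

lemma RR_cases:
  assumes "RR x y"
  obtains "G x y" "x \<in> elts AT" "y \<in> elts AT" | "x \<notin> elts AT" "y \<notin> elts AT"
    "\<forall>u\<in>exts x. \<exists>v\<in>exts y. RR u v" "\<forall>v\<in>exts y. \<exists>u\<in>exts x. RR u v"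
  using RR_unfold[OF assms] G_atom[of x y] by blast

lemma RR_fun: "RR x y \<Longrightarrow> RR x y' \<Longrightarrow> y = y'"
proof -
  let ?P = "\<lambda>x. \<forall>y y'. RR x y \<longrightarrow> RR x y' \<longrightarrow> y = y'"
  have "?P x"
  proof (rule es_induct[where P = ?P])
    show "dfn (\<lambda>e. ?P (e 0))" by (intro dfns)
    show "?P a" if "a \<in> elts AT" for a using that G_fun RR_unfold by blast
  next
    fix x assume x: "x \<notin> elts AT" and IH: "\<And>z. z \<in> exts x \<Longrightarrow> ?P z"
    show "?P x"
    proof (intro allI impI)
      fix y y' assume r: "RR x y" "RR x y'"
      have "\<not> G x y" "\<not> G x y'" using x G_atom by blast+
      then have f: "\<forall>u\<in>exts x. \<exists>v\<in>exts y. RR u v" "\<forall>v\<in>exts y. \<exists>u\<in>exts x. RR u v"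
        "\<forall>u\<in>exts x. \<exists>v\<in>exts y'. RR u v" "\<forall>v\<in>exts y'. \<exists>u\<in>exts x. RR u v"
        using RR_unfold[OF r(1)] RR_unfold[OF r(2)] by blast+
      have "exts y = exts y'"
      proof
        show "exts y \<subseteq> exts y'" using f(2,3) IH by blast
        show "exts y' \<subseteq> exts y" using f(4,1) IH by blast
      qed
      then show "y = y'" by (rule exts_inj)
    qed
  qed
  then show "RR x y \<Longrightarrow> RR x y' \<Longrightarrow> y = y'" by blast
qed

lemma RR_total: "\<exists>y. RR x y"
proof (rule es_induct[where P = "\<lambda>x. \<exists>y. RR x y"])
  show "dfn (\<lambda>e. \<exists>y. RR (e 0) y)" by (intro dfns)
  show "\<exists>y. RR a y" if "a \<in> elts AT" for a using G_total[OF that] RR_atom by blast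
next
  fix x assume x: "x \<notin> elts AT" and IH: "\<And>z. z \<in> exts x \<Longrightarrow> \<exists>y. RR z y"
  define S where "S = {v. \<exists>u\<in>elts (rho x). RR u v}"
  have dd: "dfn (\<lambda>e. RR (e (Suc 0)) (e 0))" by (intro dfns)
  have "sm S" unfolding S_def
    by (rule sm_rel_image[where Q = "\<lambda>v u. RR u v", OF dd]) (rule RR_fun)
  then have e: "exts (mk S) = S" by (rule exts_mk)
  have S: "v \<in> S \<longleftrightarrow> (\<exists>u\<in>exts x. RR u v)" for v unfolding S_def exts_def by blast
  \<comment> \<open>Were the set of images an atom, its preimage under \<open>G\<close> would have
    the same extension as \<open>x\<close>, so that \<open>x\<close> would be an atom by
    extensionality.\<close>
  have "mk S \<notin> elts AT"
  proof
    assume b: "mk S \<in> elts AT"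
    obtain a where a: "G a (mk S)" using G_surj[OF b] by blast
    have aA: "a \<in> elts AT" using G_atom[OF a] by blast
    have inj: "u = a'" if "RR u b'" "G a' b'" for u a' b'
      using RR_unfold[OF that(1)] G_inj[OF _ that(2)] G_atom[OF that(2)] by blast
    have "exts x = insert a (elts (core a))"
    proof (intro equalityI subsetI)
      fix u assume u: "u \<in> exts x"
      then obtain v where v: "RR u v" using IH by blast
      then have "v \<in> exts (mk S)" using u S e by blast
      then have "v = mk S \<or> v \<in> elts (core (mk S))" using exts_atom[OF b] by blast
      then obtain a' where "G a' v" "a' = a \<or> a' \<in> elts (core a)" using G_back[OF a, of v] a by blast
      then show "u \<in> insert a (elts (core a))" using inj[OF v] by blast
    next
      fix a' assume "a' \<in> insert a (elts (core a))"
      then obtain b' where b': "G a' b'" "b' = mk S \<or> b' \<in> elts (core (mk S))"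
        using G_forth[OF a, of a'] a by blast
      then have "b' \<in> S" using exts_atom[OF b] e by blast
      then obtain u where "u \<in> exts x" "RR u b'" using S by blast
      then show "a' \<in> exts x" using inj[OF _ b'(1)] by blast
    qed
    then have "x = a" using atom_iff_exts aA by blast
    then show False using x aA by blast
  qed
  then have "RR x (mk S)"
    by (rule RR_fold[OF x]) (use e S IH in blast)+
  then show "\<exists>y. RR x y" by blast
qed

text \<open>The assumptions are symmetric, so injectivity and surjectivity of \<open>RR\<close>
  reduce to its being functional and total for the inverse permutation.\<close>

lemma auto_conv: "auto E AT (\<lambda>a b. G b a)"
proof
  show "dfn (\<lambda>e. G (e (Suc 0)) (e 0))" by (intro dfns)
qed (use G_atom G_fun G_inj G_total G_surj G_forth G_back in blast)+

lemma RR_conv: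
  assumes "RR x y"
  shows "auto.RR E AT (\<lambda>a b. G b a) y x"
proof -
  interpret C: auto E AT "\<lambda>a b. G b a" by (rule auto_conv)
  obtain p where p: "bis p" "pr x y \<in> elts p" using assms unfolding RR_def by blast
  define S where "S = {z. \<exists>u v. z = pr v u \<and> pr u v \<in> elts p}"
  have "sm S" unfolding S_def
  proof (rule sm_Collect_sub[OF _ sm_prod[OF sm_elts[of "Un1 (Un1 p)"] sm_elts[of "Un1 (Un1 p)"]]])
    show "dfn (\<lambda>e. \<exists>u v. e 0 = pr v u \<and> pr u v \<in> elts p)" by (intro dfns)
    show "z \<in> {pr x y |x y. x \<in> elts (Un1 (Un1 p)) \<and> y \<in> elts (Un1 (Un1 p))}" if "\<exists>u v. z = pr v u \<and> pr u v \<in> elts p" for z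
      using that pr_comps[of _ _ p] by blast
  qed
  then have S: "elts (st S) = S" by (rule elts_st)
  have S': "pr v u \<in> S \<longleftrightarrow> pr u v \<in> elts p" for u v unfolding S_def by auto
  have "C.bis (st S)" unfolding C.bis_def S S' using p(1) unfolding bis_def by blast
  moreover have "pr y x \<in> elts (st S)" unfolding S S' by (rule p(2))
  ultimately show ?thesis unfolding C.RR_def by blast
qed

lemma RR_surj: "\<exists>x. RR x y"
proof -
  interpret C: auto E AT "\<lambda>a b. G b a" by (rule auto_conv)
  show ?thesis using C.RR_total[of y] C.RR_conv by blast
qed

lemma RR_inj: "RR x y \<Longrightarrow> RR x' y \<Longrightarrow> x = x'"
proof -
  interpret C: auto E AT "\<lambda>a b. G b a" by (rule auto_conv)
  show "RR x y \<Longrightarrow> RR x' y \<Longrightarrow> x = x'" using RR_conv C.RR_fun by blast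
qed

lemma RR_es: "RR x y \<Longrightarrow> RR u v \<Longrightarrow> u \<in> exts x \<longleftrightarrow> v \<in> exts y"
proof -
  assume r: "RR x y" "RR u v"
  show ?thesis
  proof (rule RR_cases[OF r(1)])
    assume g: "G x y" and at: "x \<in> elts AT" "y \<in> elts AT"
    show ?thesis
    proof
      assume "u \<in> exts x"
      then have "u = x \<or> u \<in> elts (core x)" using exts_atom[OF at(1)] by blast
      then obtain v' where "G u v'" "v' = y \<or> v' \<in> elts (core y)" using g G_forth[OF g] by blast
      then show "v \<in> exts y" using RR_fun[OF r(2)] RR_atom exts_atom[OF at(2)] by blast
    next
      assume "v \<in> exts y"
      then have "v = y \<or> v \<in> elts (core y)" using exts_atom[OF at(2)] by blast
      then obtain u' where "G u' v" "u' = x \<or> u' \<in> elts (core x)" using g G_back[OF g] by blast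
      then show "u \<in> exts x" using RR_inj[OF r(2)] RR_atom exts_atom[OF at(1)] by blast
    qed
  next
    assume "\<forall>u\<in>exts x. \<exists>v\<in>exts y. RR u v" "\<forall>v\<in>exts y. \<exists>u\<in>exts x. RR u v"
    then show ?thesis using RR_fun[OF r(2)] RR_inj[OF r(2)] by blast
  qed
qed

lemma RR_D:
  assumes w': "elts w' \<subseteq> elts AT" "\<And>a. a \<in> elts w' \<Longrightarrow> elts (core a) \<subseteq> elts w'"
    and ww: "\<And>a b. a \<in> elts w \<Longrightarrow> G a b \<Longrightarrow> b \<in> elts w'"
  shows "RR x y \<Longrightarrow> D w x \<Longrightarrow> D w' y"
proof -
  have atom: "D w' a" if "a \<in> elts w'" for a
    unfolding D_def supp_def
  proof (intro exI[of _ w'] conjI that ballI impI)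
    fix z u assume z: "z \<in> elts w'" "u \<in> exts z"
    have "z \<in> elts AT" using z(1) w'(1) by blast
    then show "u \<in> elts w'" using z w'(2)[OF z(1)] by (auto simp: exts_atom)
  qed
  let ?P = "\<lambda>x. D w x \<longrightarrow> (\<forall>y. RR x y \<longrightarrow> D w' y)"
  have "?P x"
  proof (rule es_induct[where P = ?P])
    show "dfn (\<lambda>e. ?P (e 0))" by (intro dfns)
    show "?P a" if a: "a \<in> elts AT" for a
    proof (intro impI allI)
      fix y assume "D w a" "RR a y"
      then have "a \<in> elts w" "G a y" using D_atom_in a RR_unfold by blast+
      then show "D w' y" using ww atom by blast
    qed
  next
    fix x assume x: "x \<notin> elts AT" and IH: "\<And>z. z \<in> exts x \<Longrightarrow> ?P z"
    show "?P x"
    proof (intro impI allI)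
      fix y assume Dx: "D w x" and r: "RR x y"
      have "\<not> G x y" using x G_atom by blast
      then have f: "y \<notin> elts AT" "\<forall>v\<in>exts y. \<exists>u\<in>exts x. RR u v" using RR_unfold[OF r] by blast+
      show "D w' y"
      proof (rule D_fold)
        show "y \<in> elts AT \<Longrightarrow> y \<in> elts w'" using f(1) by blast
        show "v = y \<or> D w' v" if "v \<in> exts y" for v
          using f(2) that IH D_trans[OF Dx] by blast
      qed
    qed
  qed
  then show "RR x y \<Longrightarrow> D w x \<Longrightarrow> D w' y" by blast
qed

lemma RR_fix:
  assumes "\<And>a. a \<in> elts w \<Longrightarrow> G a a"
  shows "D w x \<Longrightarrow> RR x x"
proof -
  let ?P = "\<lambda>x. D w x \<longrightarrow> RR x x"
  have "?P x"
  proof (rule es_induct[where P = ?P])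
    show "dfn (\<lambda>e. ?P (e 0))" by (intro dfns)
    show "?P a" if a: "a \<in> elts AT" for a using D_atom_in[OF _ a] assms RR_atom by blast
    show "?P x" if x: "x \<notin> elts AT" and IH: "\<And>z. z \<in> exts x \<Longrightarrow> ?P z" for x
      using RR_fold[OF x x] IH D_trans by blast
  qed
  then show "D w x \<Longrightarrow> RR x x" by blast
qed

end

section \<open>Forcing over worlds of atoms and its independence of the world\<close>

locale worlds = atoms +
  fixes WW :: "nat \<Rightarrow> bool"
  assumes WW_dfn: "dfn (\<lambda>e. WW (e 0))"
    and WW_atoms: "WW w \<Longrightarrow> elts w \<subseteq> elts AT"
    and WW_core: "WW w \<Longrightarrow> a \<in> elts w \<Longrightarrow> elts (core a) \<subseteq> elts w"
    and amalgamation: "WW w \<Longrightarrow> WW w1 \<Longrightarrow> WW w2 \<Longrightarrow> elts w \<subseteq> elts w1 \<Longrightarrow> elts w \<subseteq> elts w2 \<Longrightarrow>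
      \<exists>G w3. auto E AT G \<and> (\<forall>v v'. elts v \<subseteq> elts AT \<longrightarrow> elts v' = {b. \<exists>a\<in>elts v. G a b} \<longrightarrow> WW v = WW v') \<and>
        (\<forall>a\<in>elts w. G a a) \<and> WW w3 \<and> elts w2 \<subseteq> elts w3 \<and> (\<forall>a b. a \<in> elts w1 \<longrightarrow> G a b \<longrightarrow> b \<in> elts w3)"
begin

definition le :: "nat \<Rightarrow> nat \<Rightarrow> bool" where
  "le w w' \<longleftrightarrow> WW w \<and> WW w' \<and> elts w \<subseteq> elts w'"

lemma le_trans: "le w w1 \<Longrightarrow> le w1 w2 \<Longrightarrow> le w w2"
  unfolding le_def by blast

lemma le_WW: "le w w' \<Longrightarrow> WW w'" and le_rfl: "WW w \<Longrightarrow> le w w"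
  unfolding le_def by blast+

lemma le_D: "le w w' \<Longrightarrow> D w x \<Longrightarrow> D w' x"
  unfolding le_def using D_mono by blast

lemma le_dfn [dfns]: "dfnf f \<Longrightarrow> dfnf g \<Longrightarrow> dfn (\<lambda>e. le (f e) (g e))"
  unfolding le_def by (intro dfns dfn_app1[where R = WW, OF WW_dfn])

abbreviation tr :: "nat \<Rightarrow> (nat \<Rightarrow> nat) \<Rightarrow> fm \<Rightarrow> bool" where
  "tr \<equiv> ksat le D es id"

text \<open>Forcing of one given formula is definable in the ground model. This is the reason why
  Comprehension of the ground model can be used for it.\<close>

lemma tr_dfn: "dfn (\<lambda>e. tr (e m) (\<lambda>n. e (r n)) p)"
proof (induction p arbitrary: m r)
  have t [dfns]: "dfnf (\<lambda>e. tmv id (\<lambda>n. e (r n)) t)" for t r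
  proof -
    have "\<exists>k. \<forall>e::nat \<Rightarrow> nat. tmv id (\<lambda>n. e (r n)) t = e k" by (induction t) auto
    then obtain k where k: "\<forall>e::nat \<Rightarrow> nat. tmv id (\<lambda>n. e (r n)) t = e k" by blast
    have "(\<lambda>e::nat \<Rightarrow> nat. tmv id (\<lambda>n. e (r n)) t) = (\<lambda>e. e k)"
    proof
      fix e :: "nat \<Rightarrow> nat"
      show "tmv id (\<lambda>n. e (r n)) t = e k" by (rule spec[OF k])
    qed
    then show ?thesis by (simp only: dfnf_var)
  qed
  {
    case (Eq s t)
    show ?case by (simp only: ksat.simps) (intro dfns t)
  next
    case (Mem s t)
    show ?case by (simp only: ksat.simps) (intro dfns t)
  next
    case Bot
    show ?case by (simp only: ksat.simps) (intro dfns)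
  next
    case (Imp p q)
    then show ?case by (simp only: ksat.simps) (intro dfns)
  next
    case (Forall p)
    have eq: "(\<lambda>n. e (case_nat 0 (\<lambda>n. Suc (Suc (r n))) n)) = case_nat (e 0) (\<lambda>n. e (Suc (Suc (r n))))" for e :: "nat \<Rightarrow> nat"
      by (rule HOL.ext) (simp split: nat.split)
    have "dfn (\<lambda>e. tr (e (Suc 0)) (case_nat (e 0) (\<lambda>n. e (Suc (Suc (r n))))) p)"
      using Forall[of "Suc 0" "case_nat 0 (\<lambda>n. Suc (Suc (r n)))"] unfolding eq .
    then show ?case by (simp only: ksat.simps) (intro dfns)
  }
qed

lemma tr_dfn_param: "dfn (\<lambda>e. tr w (case_nat (e 0) c) p)"
proof -
  have "dfn (\<lambda>e. (\<lambda>e. tr (e 0) (\<lambda>n. e (Suc n)) p) (case_nat w (case_nat (e 0) c)))"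
    by (rule dfn_subst[OF tr_dfn]) (auto split: nat.split)
  then show ?thesis by (simp only: nat.case)
qed

text \<open>An automorphism respects the new membership relation and the universes over worlds.
  Quantifiers over larger worlds transfer because images and preimages of worlds are sets of atoms
  and are again worlds by \<open>P\<close>.\<close>

lemma automorphism_invariance:
  assumes G: "auto E AT G"
    and P: "\<And>v v'. elts v \<subseteq> elts AT \<Longrightarrow> elts v' = {b. \<exists>a\<in>elts v. G a b} \<Longrightarrow> WW v = WW v'"
  shows "WW w \<Longrightarrow> elts w' = {b. \<exists>a\<in>elts w. G a b} \<Longrightarrow> (\<And>n. auto.RR E AT G (e n) (e' n)) \<Longrightarrow> tr w e p = tr w' e' p"
proof (induction p arbitrary: w w' e e')
  interpret G: auto E AT G by (rule G)
  interpret C: auto E AT "\<lambda>a b. G b a" by (rule G.auto_conv)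
  have D1: "D w' y" if "WW w'" "elts w' = {b. \<exists>a\<in>elts w. G a b}" "G.RR x y" "D w x" for w w' x y
    by (rule G.RR_D[OF WW_atoms[OF that(1)] WW_core[OF that(1)] _ that(3,4)]) (use that(2) in blast)+
  have D2: "D w x" if "WW w" "elts w' = {b. \<exists>a\<in>elts w. G a b}" "G.RR x y" "D w' y" for w w' x y
    by (rule C.RR_D[OF WW_atoms[OF that(1)] WW_core[OF that(1)] _ G.RR_conv[OF that(3)] that(4)])
      (use that(2) G.G_inj in blast)+
  have tm: "G.RR (tmv id e t) (tmv id e' t)" if "\<And>n. G.RR (e n) (e' n)" for e e' t
    by (induction t) (use that in auto)
  {
    case (Eq s t)
    have "G.RR (tmv id e s) (tmv id e' s)" "G.RR (tmv id e t) (tmv id e' t)" using tm Eq(3) by blast+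
    then show ?case unfolding ksat.simps using G.RR_fun G.RR_inj by metis
  next
    case (Mem s t)
    have "G.RR (tmv id e s) (tmv id e' s)" "G.RR (tmv id e t) (tmv id e' t)" using tm Mem(3) by blast+
    then show ?case unfolding ksat.simps using G.RR_es by blast
  next
    case Bot
    show ?case by simp
  next
    case (Imp p q)
    have "tr w e p = tr w' e' p" by (rule Imp(1)[OF Imp(3,4)]) (rule Imp(5))
    moreover have "tr w e q = tr w' e' q" by (rule Imp(2)[OF Imp(3,4)]) (rule Imp(5))
    ultimately show ?case by (simp only: ksat.simps)
  next
    case (Forall p)
    have w': "WW w'" using P[OF WW_atoms Forall(3)] Forall(2) by blast
    have cn: "G.RR (case_nat x e n) (case_nat x' e' n)" if "G.RR x x'" for x x' n
      using that Forall(4) by (cases n) auto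
    have step: "tr v (case_nat x e) p = tr v' (case_nat x' e') p"
      if "WW v" "elts v' = {b. \<exists>a\<in>elts v. G a b}" "G.RR x x'" for v v' x x'
      by (rule Forall.IH[OF that(1,2)]) (rule cn[OF that(3)])
    show ?case
    proof
      assume l: "tr w e (Forall p)"
      have "tr v' (case_nat x' e') p" if v': "le w' v'" and x': "D v' x'" for v' x'
      proof -
        let ?S = "{a. a \<in> elts AT \<and> (\<exists>b\<in>elts v'. G a b)}"
        have "sm ?S" by (rule sm_Collect_sub[OF _ sm_elts[of AT]]) (intro dfns G.G_dfn', blast)
        then obtain v where v: "elts v = ?S" unfolding sm_def by blast
        have im: "elts v' = {b. \<exists>a\<in>elts v. G a b}"
        proof (intro equalityI subsetI CollectI)
          fix b assume b: "b \<in> elts v'"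
          then obtain a where "G a b" using G.G_surj WW_atoms[OF le_WW[OF v']] by blast
          then show "\<exists>a\<in>elts v. G a b" using b G.G_atom unfolding v by blast
        next
          fix b assume "b \<in> {b. \<exists>a\<in>elts v. G a b}"
          then obtain a b' where "G a b" "G a b'" "b' \<in> elts v'" unfolding v by blast
          then show "b \<in> elts v'" using G.G_fun by blast
        qed
        have vA: "elts v \<subseteq> elts AT" unfolding v by blast
        have WWv: "WW v" using P[OF vA im] le_WW[OF v'] by simp
        have "elts w \<subseteq> elts v"
        proof
          fix a assume a: "a \<in> elts w"
          then have aA: "a \<in> elts AT" using WW_atoms[OF Forall(2)] by blast
          then obtain b where b: "G a b" using G.G_total by blast
          then have "b \<in> elts v'" using a Forall(3) v' unfolding le_def by blast
          then show "a \<in> elts v" using aA b unfolding v by blast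
        qed
        then have lev: "le w v" using WWv Forall(2) unfolding le_def by blast
        obtain x where x: "G.RR x x'" using G.RR_surj by blast
        have "D v x" by (rule D2[OF WWv im x x'])
        then have "tr v (case_nat x e) p" using l lev by simp
        then show ?thesis using step[OF WWv im x] by simp
      qed
      then show "tr w' e' (Forall p)" by simp
    next
      assume r: "tr w' e' (Forall p)"
      have "tr v (case_nat x e) p" if v: "le w v" and x: "D v x" for v x
      proof -
        let ?S = "{b. \<exists>a\<in>elts v. G a b}"
        have "sm ?S" by (rule sm_Collect_sub[OF _ sm_elts[of AT]]) (intro dfns G.G_dfn', use G.G_atom in blast)
        then obtain v' where im: "elts v' = ?S" unfolding sm_def by blast
        have WWv: "WW v" by (rule le_WW[OF v])
        have WWv': "WW v'" using P[OF WW_atoms[OF WWv] im] WWv by simp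
        have "elts w' \<subseteq> elts v'" using v unfolding Forall(3) im le_def by blast
        then have lev: "le w' v'" using WWv' w' unfolding le_def by blast
        obtain x' where x': "G.RR x x'" using G.RR_total by blast
        have "D v' x'" by (rule D1[OF WWv' im x' x])
        then have "tr v' (case_nat x' e') p" using r lev by simp
        then show ?thesis using step[OF WWv im x'] by simp
      qed
      then show "tr w e (Forall p)" by simp
    qed
  }
qed

text \<open>Truth does not change along \<open>le\<close>: a larger world can be moved over the smaller one so that it
  becomes compatible with any other extension.\<close>

lemma world_invariance: "le w w' \<Longrightarrow> (\<And>n. D w (e n)) \<Longrightarrow> tr w' e p = tr w e p"
proof (induction p arbitrary: w w' e)
  case (Forall p)
  show ?case
  proof
    assume "tr w e (Forall p)"
    then show "tr w' e (Forall p)" using le_trans[OF Forall(2)] by simp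
  next
    assume l: "tr w' e (Forall p)"
    have "tr w2 (case_nat x e) p" if w2: "le w w2" and x: "D w2 x" for w2 x
    proof -
      obtain G w3 where G: "auto E AT G"
        and P: "\<And>v v'. elts v \<subseteq> elts AT \<Longrightarrow> elts v' = {b. \<exists>a\<in>elts v. G a b} \<Longrightarrow> WW v = WW v'"
        and fx: "\<And>a. a \<in> elts w \<Longrightarrow> G a a" and w3: "WW w3" "elts w2 \<subseteq> elts w3"
        and sub: "\<And>a b. a \<in> elts w' \<Longrightarrow> G a b \<Longrightarrow> b \<in> elts w3"
        using amalgamation[of w w' w2] Forall(2) w2 unfolding le_def by blast
      interpret G: auto E AT G by (rule G)
      let ?S = "{b. \<exists>a\<in>elts w'. G a b}"
      have "sm ?S" by (rule sm_Collect_sub[OF _ sm_elts[of AT]]) (intro dfns G.G_dfn', use G.G_atom in blast)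
      then obtain w'' where w'': "elts w'' = ?S" unfolding sm_def by blast
      have WWw': "WW w'" by (rule le_WW[OF Forall(2)])
      then have WWw'': "WW w''" using P[OF WW_atoms w''] by simp
      \<comment> \<open>The entries of \<open>e\<close> live over \<open>w\<close>, which
        \<open>G\<close> fixes pointwise, so moving the world \<open>w'\<close> leaves the
        assignment as it is.\<close>
      have "tr w' e (Forall p) = tr w'' e (Forall p)"
        by (rule automorphism_invariance[OF G P WWw' w'']) (use G.RR_fix[OF fx] Forall(3) in blast)+
      then have t: "tr w'' e (Forall p)" using l by simp
      have "le w'' w3" unfolding le_def using WWw'' w3(1) sub w'' by blast
      moreover have l3: "le w2 w3" unfolding le_def using le_WW[OF w2] w3 by blast
      \<comment> \<open>In \<open>w3\<close> the moved copy of \<open>w'\<close> and the element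
        \<open>x\<close> meet. The induction hypothesis for \<open>p\<close> then leads back down to
        \<open>w2\<close>.\<close>
      ultimately have "tr w3 (case_nat x e) p" using t le_D[OF l3 x] by simp
      moreover have "D w2 (case_nat x e n)" for n using x le_D[OF w2 Forall(3)] by (cases n) auto
      ultimately show ?thesis using Forall.IH[OF l3, of "case_nat x e"] by blast
    qed
    then show "tr w e (Forall p)" by simp
  qed
next
  case (Imp p q)
  have "tr w' e p = tr w e p" by (rule Imp(1)[OF Imp(3)]) (rule Imp(4))
  moreover have "tr w' e q = tr w e q" by (rule Imp(2)[OF Imp(3)]) (rule Imp(4))
  ultimately show ?case by (simp only: ksat.simps)
qed simp_all

sublocale kripke le D es id
  by unfold_locales (use le_rfl le_WW le_D world_invariance in auto)

section \<open>The axioms of ZC at every world\<close>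

definition upm :: "nat \<Rightarrow> nat \<Rightarrow> nat" where "upm x y = mk {x, y}"

lemma exts_upm [simp]: "exts (upm x y) = {x, y}"
  unfolding upm_def by (rule exts_mk[OF sm_pair])

lemma upm_iff: "z = upm x y \<longleftrightarrow> exts z = {x, y}"
  using exts_inj[of z "upm x y"] by auto

lemma dfn_upm [dfns]: "dfnf f \<Longrightarrow> dfnf g \<Longrightarrow> dfnf (\<lambda>e. upm (f e) (g e))"
  unfolding upm_def mk_def up_def[symmetric] by (intro dfns)

lemma D_upm: "D w x \<Longrightarrow> D w y \<Longrightarrow> D w (upm x y)"
  unfolding upm_def by (rule D_mk[OF sm_pair]) auto

definition kp :: "nat \<Rightarrow> nat \<Rightarrow> nat" where "kp x y = upm (upm x x) (upm x y)"

lemma kp_inj: "kp x y = kp x' y' \<longleftrightarrow> x = x' \<and> y = y'"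
proof
  assume "kp x y = kp x' y'"
  then have "exts (kp x y) = exts (kp x' y')" by simp
  then have *: "{upm x x, upm x y} = {upm x' x', upm x' y'}" unfolding kp_def by simp
  have up: "upm a b = upm c d \<longleftrightarrow> {a, b} = {c, d}" for a b c d using upm_iff[of "upm a b" c d] by simp
  show "x = x' \<and> y = y'" using * unfolding doubleton_eq_iff up by auto
qed simp

lemma D_kp: "D w x \<Longrightarrow> D w y \<Longrightarrow> D w (kp x y)"
  unfolding kp_def by (intro D_upm)

lemma tr_conn:
  "tr w e (p \<^bold>\<or> q) \<longleftrightarrow> tr w e p \<or> tr w e q"
  "tr w e (p \<^bold>\<and> q) \<longleftrightarrow> tr w e p \<and> tr w e q"
  "tr w e (p \<^bold>\<longleftrightarrow> q) \<longleftrightarrow> (tr w e p \<longleftrightarrow> tr w e q)"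
  "tr w e (Exists p) \<longleftrightarrow> (\<exists>w'. le w w' \<and> (\<exists>x. D w' x \<and> tr w' (case_nat x e) p))"
  by auto

text \<open>The side condition keeps negations folded in rewriting; otherwise existential
  quantifiers and conjunctions, which are built from them, would be destroyed before their own rules
  apply.\<close>

lemma tr_imp: "q \<noteq> \<^bold>\<bottom> \<Longrightarrow> tr w e (p \<^bold>\<longrightarrow> q) \<longleftrightarrow> (tr w e p \<longrightarrow> tr w e q)"
  by simp

lemma tr_upair:
  assumes "WW w" "D w (e p)" "D w (e a)" "D w (e b)"
  shows "tr w e (is_upair p a b) \<longleftrightarrow> e p = upm (e a) (e b)"
proof -
  have "tr w e (is_upair p a b) \<longleftrightarrow> (\<forall>w'. le w w' \<longrightarrow> (\<forall>z. D w' z \<longrightarrow> (z \<in> exts (e p) \<longleftrightarrow> z = e a \<or> z = e b)))"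
    unfolding is_upair_def by (simp add: iff_conv_conj_imp disj_imp)
  also have "\<dots> \<longleftrightarrow> exts (e p) = {e a, e b}" (is "?l \<longleftrightarrow> _")
  proof
    assume ?l
    then have "z \<in> exts (e p) \<longleftrightarrow> z = e a \<or> z = e b" if "D w z" for z using that le_rfl[OF assms(1)] by blast
    then show "exts (e p) = {e a, e b}" using assms D_trans[OF assms(2)] by blast
  qed auto
  finally show ?thesis unfolding upm_iff .
qed

lemma tr_pair:
  assumes "WW w" "D w (e p)" "D w (e a)" "D w (e b)"
  shows "tr w e (is_pair p a b) \<longleftrightarrow> e p = kp (e a) (e b)"
proof -
  have "tr w e (is_pair p a b) \<longleftrightarrow> (\<exists>w1. le w w1 \<and> (\<exists>s. D w1 s \<and> (\<exists>w2. le w1 w2 \<and> (\<exists>t. D w2 t \<and>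
      s = upm (e a) (e a) \<and> t = upm (e a) (e b) \<and> e p = upm s t))))"
  proof -
    have "tr w2 (case_nat t (case_nat s e)) (is_upair 1 (a + 2) (a + 2) \<^bold>\<and> is_upair 0 (a + 2) (b + 2) \<^bold>\<and> is_upair (p + 2) 1 0)
      \<longleftrightarrow> s = upm (e a) (e a) \<and> t = upm (e a) (e b) \<and> e p = upm s t"
      if "le w w1" "D w1 s" "le w1 w2" "D w2 t" for w1 s w2 t
    proof -
      have "D w2 (e p)" "D w2 (e a)" "D w2 (e b)" "D w2 s" "WW w2"
        using that assms le_D le_trans le_WW by blast+
      then show ?thesis unfolding tr_conn using that(4) by (simp add: tr_upair)
    qed
    then show ?thesis unfolding is_pair_def tr_conn(4) by (intro iff_exI conj_cong refl)
  qed
  also have "\<dots> \<longleftrightarrow> e p = kp (e a) (e b)"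
  proof
    assume "e p = kp (e a) (e b)"
    then show "\<exists>w1. le w w1 \<and> (\<exists>s. D w1 s \<and> (\<exists>w2. le w1 w2 \<and> (\<exists>t. D w2 t \<and>
      s = upm (e a) (e a) \<and> t = upm (e a) (e b) \<and> e p = upm s t)))"
      using le_rfl[OF assms(1)] D_upm assms unfolding kp_def
      by (intro exI[of _ w] conjI exI[of _ "upm (e a) (e a)"] exI[of _ "upm (e a) (e b)"]) auto
  qed (auto simp: kp_def)
  finally show ?thesis .
qed

lemma tr_Extensionality: "tr w e Ax_Extensionality"
proof -
  have "x = y" if "le w1 w2" "D w1 x" "D w2 y"
    "\<And>w3 z. le w2 w3 \<Longrightarrow> D w3 z \<Longrightarrow> z \<in> exts x \<longleftrightarrow> z \<in> exts y" for w1 w2 x y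
  proof (rule exts_inj)
    have "z \<in> exts x \<longleftrightarrow> z \<in> exts y" if "D w2 z" for z
      using \<open>\<And>w3 z. le w2 w3 \<Longrightarrow> D w3 z \<Longrightarrow> z \<in> exts x \<longleftrightarrow> z \<in> exts y\<close>[OF le_rfl[OF le_WW[OF \<open>le w1 w2\<close>]] that] .
    then show "exts x = exts y" using D_trans le_D that(1-3) by blast
  qed
  then show ?thesis unfolding Ax_Extensionality_def by (simp add: numeral_2_eq_2) blast
qed

lemma tr_Pairing: "tr w e Ax_Pairing"
proof -
  have "\<exists>w3. le w2 w3 \<and> (\<exists>u. D w3 u \<and> (\<forall>w4. le w3 w4 \<longrightarrow> (\<forall>z. D w4 z \<longrightarrow> (z \<in> exts u \<longleftrightarrow> z = x \<or> z = y))))"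
    if "le w1 w2" "D w1 x" "D w2 y" for w1 w2 x y
    using that le_D[OF that(1,2)] by (intro exI[of _ w2] exI[of _ "upm x y"] conjI D_upm le_rfl le_WW[OF that(1)]) auto
  then show ?thesis unfolding Ax_Pairing_def ksat.simps(5) tr_conn
    by (simp add: numeral_2_eq_2 numeral_3_eq_3 iff_conv_conj_imp disj_imp)
qed

lemma tr_Union: "tr w e Ax_Union"
proof -
  have "\<exists>w2. le w1 w2 \<and> (\<exists>u. D w2 u \<and> (\<forall>w3. le w2 w3 \<longrightarrow> (\<forall>z. D w3 z \<longrightarrow> (z \<in> exts u \<longleftrightarrow>
      (\<exists>w4. le w3 w4 \<and> (\<exists>y. D w4 y \<and> y \<in> exts x \<and> z \<in> exts y))))))"
    if w1: "le w w1" "D w1 x" for w1 x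
  proof -
    let ?S = "{z. \<exists>y\<in>elts (rho x). z \<in> exts y}"
    have d: "dfn (\<lambda>e. e 0 = rho (e (Suc 0)))" by (intro dfns)
    have "sm (rho ` elts (rho x))" by (rule sm_image[OF sm_elts d])
    then obtain r where r: "elts r = rho ` elts (rho x)" unfolding sm_def by blast
    have "?S = elts (Un1 r)" by (auto simp: r exts_def)
    then have sm: "sm ?S" using sm_elts[of "Un1 r"] by (simp only:)
    have e: "z \<in> exts (mk ?S) \<longleftrightarrow> (\<exists>y\<in>exts x. z \<in> exts y)" for z
      unfolding exts_mk[OF sm] by (auto simp: exts_def)
    have Du: "D w1 (mk ?S)"
    proof (rule D_mk[OF sm])
      fix z assume "z \<in> ?S"
      then obtain y where "y \<in> exts x" "z \<in> exts y" unfolding exts_def by blast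
      then show "D w1 z" using D_trans[OF D_trans[OF w1(2)]] by blast
    qed
    show ?thesis
    proof (rule exI[of _ w1], rule conjI[OF le_rfl[OF le_WW[OF w1(1)]]], rule exI[of _ "mk ?S"], rule conjI[OF Du], intro allI impI)
      fix w3 z assume w3: "le w1 w3" "D w3 z"
      show "z \<in> exts (mk ?S) \<longleftrightarrow> (\<exists>w4. le w3 w4 \<and> (\<exists>y. D w4 y \<and> y \<in> exts x \<and> z \<in> exts y))"
        unfolding e using le_rfl[OF le_WW[OF w3(1)]] le_D[OF w3(1)] D_trans[OF w1(2)] by blast
    qed
  qed
  then show ?thesis unfolding Ax_Union_def ksat.simps(5) tr_conn
    by (simp add: numeral_2_eq_2 numeral_3_eq_3 iff_conv_conj_imp disj_imp)
qed

text \<open>A subset of \<open>x\<close> that turns up in a larger world has all its members over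
  the old one and therefore lives there itself, so the power set does not grow with the
  worlds.\<close>

lemma tr_Power_Set: "tr w e Ax_Power_Set"
proof -
  have "\<exists>w2. le w1 w2 \<and> (\<exists>u. D w2 u \<and> (\<forall>w3. le w2 w3 \<longrightarrow> (\<forall>z. D w3 z \<longrightarrow> (z \<in> exts u \<longleftrightarrow>
      (\<forall>w4. le w3 w4 \<longrightarrow> (\<forall>v. D w4 v \<longrightarrow> v \<in> exts z \<longrightarrow> v \<in> exts x))))))"
    if w1: "le w w1" "D w1 x" for w1 x
  proof -
    let ?S = "rho ` elts (Pw (rho x))"
    have d: "dfn (\<lambda>e. e 0 = rho (e (Suc 0)))" by (intro dfns)
    have sm: "sm ?S" by (rule sm_image[OF sm_elts d])
    have S: "z \<in> ?S \<longleftrightarrow> exts z \<subseteq> exts x" for z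
    proof -
      have "z \<in> ?S" if "elts (rho z) \<subseteq> elts (rho x)"
        by (rule image_eqI[of _ _ "rho z"]) (use that in auto)
      then show ?thesis unfolding exts_def by auto
    qed
    have Du: "D w1 (mk ?S)"
    proof (rule D_mk[OF sm])
      fix z assume "z \<in> ?S"
      then have z: "exts z \<subseteq> exts x" unfolding S .
      show "D w1 z"
      proof (rule D_fold)
        show "z \<in> elts w1" if "z \<in> elts AT"
          using D_atom_in[OF _ that] exts_atom[OF that] z D_trans[OF w1(2)] by blast
        show "v = z \<or> D w1 v" if "v \<in> exts z" for v using that z D_trans[OF w1(2)] by blast
      qed
    qed
    show ?thesis
    proof (rule exI[of _ w1], rule conjI[OF le_rfl[OF le_WW[OF w1(1)]]], rule exI[of _ "mk ?S"], rule conjI[OF Du], intro allI impI)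
      fix w3 z assume w3: "le w1 w3" "D w3 z"
      have r: "le w3 w3" by (rule le_rfl[OF le_WW[OF w3(1)]])
      show "z \<in> exts (mk ?S) \<longleftrightarrow> (\<forall>w4. le w3 w4 \<longrightarrow> (\<forall>v. D w4 v \<longrightarrow> v \<in> exts z \<longrightarrow> v \<in> exts x))"
        unfolding exts_mk[OF sm] S using r D_trans[OF w3(2)] by blast
    qed
  qed
  then show ?thesis unfolding Ax_Power_Set_def ksat.simps(5) tr_conn
    by (simp add: numeral_2_eq_2 numeral_3_eq_3 iff_conv_conj_imp disj_imp)
qed

lemma tr_Infinity:
  assumes "WW w"
  shows "tr w e Ax_Infinity"
proof -
  define sc where "sc x = rho (ins x (rho x))" for x
  have exsc: "exts (sc x) = insert x (exts x)" for x by (simp add: sc_def exts_def)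
  have mksc: "sc x = mk (insert x (exts x))" for x unfolding exsc[symmetric] by simp
  have Dsc: "D w (sc x)" if "D w x" for x
    unfolding mksc by (rule D_mk[OF sm_insert[OF sm_exts]]) (use that D_trans in blast)
  have De: "D w (mk {})" by (rule D_mk[OF sm_empty]) simp
  have d: "dfn (\<lambda>e. e 0 = sc (e (Suc 0)))" unfolding sc_def by (intro dfns)
  obtain I where I: "mk {} \<in> elts I" "\<forall>x\<in>elts I. (\<exists>y. y = sc x) \<longrightarrow> (\<exists>y\<in>elts I. y = sc x)"
    using closure[where Q = "\<lambda>y x. y = sc x", OF d, of "mk {}"] by blast
  let ?S = "{x. x \<in> elts I \<and> D w x}"
  have sm: "sm ?S" by (rule sm_Collect_sub[OF _ sm_elts[of I]]) (intro dfns, simp)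
  have DS: "D w (mk ?S)" by (rule D_mk[OF sm]) simp
  have eS: "x \<in> exts (mk ?S) \<longleftrightarrow> x \<in> elts I \<and> D w x" for x unfolding exts_mk[OF sm] by simp
  have "\<exists>w1. le w w1 \<and> (\<exists>x. D w1 x \<and>
      (\<exists>w2. le w1 w2 \<and> (\<exists>n. D w2 n \<and> n \<in> exts x \<and> (\<forall>w3. le w2 w3 \<longrightarrow> (\<forall>z. D w3 z \<longrightarrow> z \<notin> exts n)))) \<and>
      (\<forall>w2. le w1 w2 \<longrightarrow> (\<forall>y. D w2 y \<longrightarrow> y \<in> exts x \<longrightarrow> (\<exists>w3. le w2 w3 \<and> (\<exists>s. D w3 s \<and> s \<in> exts x \<and>
        (\<forall>w4. le w3 w4 \<longrightarrow> (\<forall>v. D w4 v \<longrightarrow> (v \<in> exts s \<longleftrightarrow> v \<in> exts y \<or> v = y))))))))"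
  proof (rule exI[of _ w], rule conjI[OF le_rfl[OF assms]], rule exI[of _ "mk ?S"], rule conjI[OF DS], rule conjI,
      rule exI[of _ w], rule conjI[OF le_rfl[OF assms]], rule exI[of _ "mk {}"], rule conjI[OF De], rule conjI)
    show "mk {} \<in> exts (mk ?S)" unfolding eS using I De by blast
    show "\<forall>w3. le w w3 \<longrightarrow> (\<forall>z. D w3 z \<longrightarrow> z \<notin> exts (mk {}))" by (simp add: exts_mk[OF sm_empty])
  next
    show "\<forall>w2. le w w2 \<longrightarrow> (\<forall>y. D w2 y \<longrightarrow> y \<in> exts (mk ?S) \<longrightarrow> (\<exists>w3. le w2 w3 \<and> (\<exists>s. D w3 s \<and> s \<in> exts (mk ?S) \<and>
        (\<forall>w4. le w3 w4 \<longrightarrow> (\<forall>v. D w4 v \<longrightarrow> (v \<in> exts s \<longleftrightarrow> v \<in> exts y \<or> v = y))))))"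
    proof (intro allI impI)
      fix w2 y assume w2: "le w w2" "D w2 y" "y \<in> exts (mk ?S)"
      then have y: "y \<in> elts I" "D w y" unfolding eS by blast+
      show "\<exists>w3. le w2 w3 \<and> (\<exists>s. D w3 s \<and> s \<in> exts (mk ?S) \<and>
          (\<forall>w4. le w3 w4 \<longrightarrow> (\<forall>v. D w4 v \<longrightarrow> (v \<in> exts s \<longleftrightarrow> v \<in> exts y \<or> v = y))))"
      proof (rule exI[of _ w2], rule conjI[OF le_rfl[OF le_WW[OF w2(1)]]], rule exI[of _ "sc y"], intro conjI allI impI)
        show "D w2 (sc y)" by (rule le_D[OF w2(1) Dsc[OF y(2)]])
        have "sc y \<in> elts I" using I(2) y(1) by blast
        then show "sc y \<in> exts (mk ?S)" unfolding eS using Dsc[OF y(2)] by blast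
        show "v \<in> exts (sc y) \<longleftrightarrow> v \<in> exts y \<or> v = y" for v unfolding exsc by blast
      qed
    qed
  qed
  then show ?thesis unfolding Ax_Infinity_def ksat.simps(5) tr_conn
    by (simp add: numeral_2_eq_2 numeral_3_eq_3 iff_conv_conj_imp disj_imp)
qed

text \<open>The set is separated by truth at \<open>w1\<close>, a definable predicate of the ground
  model. Members of \<open>x\<close> never leave the universe over \<open>w1\<close>, and for them
  invariance makes the answer correct at all later worlds.\<close>

lemma tr_Comprehension:
  assumes "WW w" "\<And>n. D w (e n)"
  shows "tr w e (Comprehension_instance p)"
  unfolding Comprehension_instance_def univ_closure_def
proof (rule ksat_foralls[OF kripke_axioms _ le_rfl[OF assms(1)] assms(2)])
  let ?q = "rename (case_nat 0 (\<lambda>n. n + 2)) p"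
  fix w and e :: "nat \<Rightarrow> nat" assume w: "le w w" and e: "\<And>n. D w (e n)"
  have "\<exists>w2. le w1 w2 \<and> (\<exists>u. D w2 u \<and> (\<forall>w3. le w2 w3 \<longrightarrow> (\<forall>z. D w3 z \<longrightarrow> (z \<in> exts u \<longleftrightarrow>
      z \<in> exts x \<and> tr w3 (case_nat z (case_nat u (case_nat x e))) ?q))))"
    if w1: "le w w1" "D w1 x" for w1 x
  proof -
    have q: "tr w3 (case_nat z (case_nat u (case_nat x e))) ?q = tr w3 (case_nat z (case_nat x e)) p" for w3 z u
    proof -
      have "(\<lambda>n. case_nat z (case_nat u (case_nat x e)) (case_nat 0 (\<lambda>n. n + 2) n)) = case_nat z (case_nat x e)"
        by (rule HOL.ext) (simp split: nat.split)
      then show ?thesis unfolding ksat_rename by simp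
    qed
    let ?S = "{z. z \<in> elts (rho x) \<and> tr w1 (case_nat z (case_nat x e)) p}"
    have sm: "sm ?S" by (rule sm_Collect_sub[OF _ sm_elts[of "rho x"]]) (intro dfns tr_dfn_param, simp)
    have S: "z \<in> exts (mk ?S) \<longleftrightarrow> z \<in> exts x \<and> tr w1 (case_nat z (case_nat x e)) p" for z
      unfolding exts_mk[OF sm] by (simp add: exts_def)
    have Du: "D w1 (mk ?S)" by (rule D_mk[OF sm]) (use D_trans w1(2) in \<open>auto simp: exts_def\<close>)
    show ?thesis
    proof (rule exI[of _ w1], rule conjI[OF le_rfl[OF le_WW[OF w1(1)]]], rule exI[of _ "mk ?S"], rule conjI[OF Du], intro allI impI)
      fix w3 z assume w3: "le w1 w3" "D w3 z"
      have "tr w3 (case_nat z (case_nat x e)) p = tr w1 (case_nat z (case_nat x e)) p" if "z \<in> exts x"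
      proof (rule world_invariance[OF w3(1)])
        fix n show "D w1 (case_nat z (case_nat x e) n)"
          using D_trans[OF w1(2) that] w1(2) le_D[OF w1(1) e] by (simp split: nat.split)
      qed
      then show "z \<in> exts (mk ?S) \<longleftrightarrow> z \<in> exts x \<and> tr w3 (case_nat z (case_nat (mk ?S) (case_nat x e))) ?q"
        unfolding q S by blast
    qed
  qed
  then show "tr w e (Forall (Exists (Forall (Var 0 \<^bold>\<in> Var 1 \<^bold>\<longleftrightarrow> Var 0 \<^bold>\<in> Var 2 \<^bold>\<and> ?q))))"
    unfolding ksat.simps(5) tr_conn(3,4) unfolding tr_conn(2) by (simp add: numeral_2_eq_2)
qed

text \<open>Tagging the members of each \<open>y\<close> with \<open>y\<close> makes the family
  disjoint, as the selector axiom requires.\<close>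

lemma choice_set:
  assumes ne: "\<And>y. y \<in> exts x \<Longrightarrow> exts y \<noteq> {}"
  shows "\<exists>h. dfn (\<lambda>e. h (e 0) (e (Suc 0))) \<and> (\<forall>y\<in>exts x. \<exists>z\<in>exts y. \<forall>w. h y w \<longleftrightarrow> w = z)"
proof -
  define F where "F y = st {pr y z | z. z \<in> exts y}" for y
  have smF: "sm {pr y z | z. z \<in> exts y}" for y
    by (rule sm_sub[OF _ sm_prod[OF sm_sing[of y] sm_exts[of y]]]) (intro dfns, blast)
  have F: "elts (F y) = {pr y z | z. z \<in> exts y}" for y unfolding F_def by (rule elts_st[OF smF])
  have d: "dfn (\<lambda>e. e 0 = F (e (Suc 0)))"
    by (subst eq_iff_elts, unfold F, intro dfns)
  have "sm (F ` exts x)" by (rule sm_image[OF sm_exts d])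
  then obtain P where P: "elts P = F ` exts x" unfolding sm_def by blast
  have 1: "elts q \<noteq> {}" if "q \<in> elts P" for q using that ne unfolding P by (auto simp: F)
  have 2: "q = q'" if "q \<in> elts P" "q' \<in> elts P" "elts q \<inter> elts q' \<noteq> {}" for q q'
    using that unfolding P by (auto simp: F)
  obtain u where u: "\<forall>q\<in>elts P. \<exists>z. elts q \<inter> elts u = {z}" using selector[OF 1 2] by blast
  show ?thesis
  proof (intro exI[of _ "\<lambda>y w. w \<in> exts y \<and> pr y w \<in> elts u"] conjI ballI)
    show "dfn (\<lambda>e. e (Suc 0) \<in> exts (e 0) \<and> pr (e 0) (e (Suc 0)) \<in> elts u)" by (intro dfns)
    fix y assume "y \<in> exts x"
    then have "F y \<in> elts P" unfolding P by blast
    then obtain q where q: "elts (F y) \<inter> elts u = {q}" using bspec[OF u] by blast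
    then obtain z where z: "q = pr y z" "z \<in> exts y" unfolding F by blast
    have "w \<in> exts y \<and> pr y w \<in> elts u \<longleftrightarrow> w = z" for w
    proof -
      have "w \<in> exts y \<and> pr y w \<in> elts u \<longleftrightarrow> pr y w \<in> elts (F y) \<inter> elts u" unfolding F by auto
      then show ?thesis unfolding q z(1) by simp
    qed
    then show "\<exists>z\<in>exts y. \<forall>w. w \<in> exts y \<and> pr y w \<in> elts u \<longleftrightarrow> w = z" using z(2) by blast
  qed
qed

text \<open>By fullness the choice function found in the ground model lives over the world of
  \<open>x\<close>, once it is recoded with the pairs \<open>kp\<close> of the new membership
  relation.\<close>

lemma tr_Choice: "tr w e Ax_Choice"
proof -
  have main: "\<exists>w2. le w1 w2 \<and> (\<exists>f. D w2 f \<and>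
      (\<forall>w3. le w2 w3 \<longrightarrow> (\<forall>p. D w3 p \<longrightarrow> p \<in> exts f \<longrightarrow> (\<exists>w4. le w3 w4 \<and> (\<exists>y. D w4 y \<and> (\<exists>w5. le w4 w5 \<and>
        (\<exists>z. D w5 z \<and> y \<in> exts x \<and> z \<in> exts y \<and> tr w5 (case_nat z (case_nat y (case_nat p (case_nat f (case_nat x e))))) (is_pair 2 1 0))))))) \<and>
      (\<forall>w3. le w2 w3 \<longrightarrow> (\<forall>y. D w3 y \<longrightarrow> y \<in> exts x \<longrightarrow> (\<exists>w4. le w3 w4 \<and> (\<exists>z. D w4 z \<and> (\<forall>w5. le w4 w5 \<longrightarrow> (\<forall>v. D w5 v \<longrightarrow>
        ((\<exists>w6. le w5 w6 \<and> (\<exists>p. D w6 p \<and> p \<in> exts f \<and>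
          tr w6 (case_nat p (case_nat v (case_nat z (case_nat y (case_nat f (case_nat x e)))))) (is_pair 0 3 1))) \<longleftrightarrow> v = z))))))))"
    if w1: "le w w1" "D w1 x" and ne: "\<forall>w2. le w1 w2 \<longrightarrow> (\<forall>y. D w2 y \<longrightarrow> y \<in> exts x \<longrightarrow> (\<exists>w3. le w2 w3 \<and> (\<exists>z. D w3 z \<and> z \<in> exts y)))" for w1 x
  proof -
    have r1: "le w1 w1" by (rule le_rfl[OF le_WW[OF w1(1)]])
    have ne': "exts y \<noteq> {}" if "y \<in> exts x" for y using ne r1 D_trans[OF w1(2) that] that by blast
    obtain h where hd: "dfn (\<lambda>e. h (e 0) (e (Suc 0)))" and h: "\<forall>y\<in>exts x. \<exists>z\<in>exts y. \<forall>w. h y w \<longleftrightarrow> w = z"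
      using choice_set[OF ne'] by blast
    let ?S = "{q. \<exists>y\<in>elts (rho x). \<exists>z. h y z \<and> q = kp y z}"
    have d: "dfn (\<lambda>e. \<exists>z. h (e (Suc 0)) z \<and> e 0 = kp (e (Suc 0)) z)"
      unfolding kp_def by (intro dfns dfn_app2[where R = h, OF hd])
    have sm: "sm ?S"
      by (rule sm_rel_image[where Q = "\<lambda>q y. \<exists>z. h y z \<and> q = kp y z", OF d]) (use h in \<open>auto simp: exts_def\<close>)
    have S: "q \<in> exts (mk ?S) \<longleftrightarrow> (\<exists>y\<in>exts x. \<exists>z. h y z \<and> q = kp y z)" for q
      unfolding exts_mk[OF sm] by (simp add: exts_def)
    have hz: "z \<in> exts y" if yz: "y \<in> exts x" "h y z" for y z
    proof -
      obtain z' where "z' \<in> exts y" "\<forall>w. h y w \<longleftrightarrow> w = z'" using bspec[OF h yz(1)] by blast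
      then show ?thesis using yz(2) by simp
    qed
    have Du: "D w1 (mk ?S)"
    proof (rule D_mk[OF sm])
      fix q assume "q \<in> ?S"
      then obtain y z where y: "y \<in> exts x" "h y z" "q = kp y z" unfolding exts_def by blast
      have "D w1 y" by (rule D_trans[OF w1(2) y(1)])
      then show "D w1 q" unfolding y(3) using D_kp D_trans hz[OF y(1,2)] by blast
    qed
    show ?thesis
    proof (rule exI[of _ w1], rule conjI[OF r1], rule exI[of _ "mk ?S"], rule conjI[OF Du], rule conjI; intro allI impI)
      fix w3 p assume w3: "le w1 w3" "D w3 p" "p \<in> exts (mk ?S)"
      obtain y z where y: "y \<in> exts x" "h y z" "p = kp y z" using w3(3) unfolding S by blast
      have r3: "le w3 w3" "WW w3" using le_rfl le_WW[OF w3(1)] by blast+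
      have Dy: "D w3 y" using le_D[OF w3(1) D_trans[OF w1(2) y(1)]] .
      have Dz: "D w3 z" by (rule D_trans[OF Dy hz[OF y(1,2)]])
      show "\<exists>w4. le w3 w4 \<and> (\<exists>y. D w4 y \<and> (\<exists>w5. le w4 w5 \<and>
        (\<exists>z. D w5 z \<and> y \<in> exts x \<and> z \<in> exts y \<and> tr w5 (case_nat z (case_nat y (case_nat p (case_nat (mk ?S) (case_nat x e))))) (is_pair 2 1 0))))"
      proof (rule exI[of _ w3], rule conjI[OF r3(1)], rule exI[of _ y], rule conjI[OF Dy], rule exI[of _ w3],
          rule conjI[OF r3(1)], rule exI[of _ z], intro conjI Dz y(1) hz[OF y(1,2)])
        show "tr w3 (case_nat z (case_nat y (case_nat p (case_nat (mk ?S) (case_nat x e))))) (is_pair 2 1 0)"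
          by (subst tr_pair[OF r3(2)]) (use Dy Dz w3(2) y(3) in \<open>simp_all add: numeral_2_eq_2\<close>)
      qed
    next
      fix w3 y assume w3: "le w1 w3" "D w3 y" "y \<in> exts x"
      obtain z where z: "z \<in> exts y" "\<forall>w. h y w \<longleftrightarrow> w = z" using bspec[OF h w3(3)] by blast
      have r3: "le w3 w3" using le_rfl le_WW[OF w3(1)] by blast
      have Dz: "D w3 z" by (rule D_trans[OF w3(2) z(1)])
      show "\<exists>w4. le w3 w4 \<and> (\<exists>z. D w4 z \<and> (\<forall>w5. le w4 w5 \<longrightarrow> (\<forall>v. D w5 v \<longrightarrow>
        ((\<exists>w6. le w5 w6 \<and> (\<exists>p. D w6 p \<and> p \<in> exts (mk ?S) \<and>
          tr w6 (case_nat p (case_nat v (case_nat z (case_nat y (case_nat (mk ?S) (case_nat x e)))))) (is_pair 0 3 1))) \<longleftrightarrow> v = z))))"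
      proof (rule exI[of _ w3], rule conjI[OF r3], rule exI[of _ z], rule conjI[OF Dz], intro allI impI)
        fix w5 v assume w5: "le w3 w5" "D w5 v"
        have Dy5: "D w6 y" "D w6 v" if "le w5 w6" for w6 using that w3(2) w5 le_D le_trans by blast+
        have ev: "tr w6 (case_nat p (case_nat v (case_nat z (case_nat y (case_nat (mk ?S) (case_nat x e)))))) (is_pair 0 3 1)
          \<longleftrightarrow> p = kp y v" if "le w5 w6" "D w6 p" for w6 p
          by (subst tr_pair[OF le_WW[OF that(1)]]) (use Dy5[OF that(1)] that(2) in \<open>simp_all add: numeral_3_eq_3\<close>)
        have "(\<exists>w6. le w5 w6 \<and> (\<exists>p. D w6 p \<and> p \<in> exts (mk ?S) \<and>
          tr w6 (case_nat p (case_nat v (case_nat z (case_nat y (case_nat (mk ?S) (case_nat x e)))))) (is_pair 0 3 1)))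
          \<longleftrightarrow> kp y v \<in> exts (mk ?S)"
        proof
          assume "kp y v \<in> exts (mk ?S)"
          moreover have "le w5 w5" by (rule le_rfl[OF le_WW[OF w5(1)]])
          moreover have "D w5 (kp y v)" using D_kp Dy5[OF \<open>le w5 w5\<close>] by blast
          ultimately show "\<exists>w6. le w5 w6 \<and> (\<exists>p. D w6 p \<and> p \<in> exts (mk ?S) \<and>
            tr w6 (case_nat p (case_nat v (case_nat z (case_nat y (case_nat (mk ?S) (case_nat x e)))))) (is_pair 0 3 1))"
            using ev[of w5 "kp y v"] by blast
        qed (use ev in blast)
        also have "\<dots> \<longleftrightarrow> h y v" unfolding S using w3(3) by (auto simp: kp_inj)
        also have "\<dots> \<longleftrightarrow> v = z" using z(2) by blast
        finally show "(\<exists>w6. le w5 w6 \<and> (\<exists>p. D w6 p \<and> p \<in> exts (mk ?S) \<and>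
          tr w6 (case_nat p (case_nat v (case_nat z (case_nat y (case_nat (mk ?S) (case_nat x e)))))) (is_pair 0 3 1))) \<longleftrightarrow> v = z" .
      qed
    qed
  qed
  have four: "(4::nat) = Suc (Suc (Suc (Suc 0)))" by simp
  have ev: "tr w e Ax_Choice \<longleftrightarrow> (\<forall>w1. le w w1 \<longrightarrow> (\<forall>x. D w1 x \<longrightarrow>
    (\<forall>w2. le w1 w2 \<longrightarrow> (\<forall>y. D w2 y \<longrightarrow> y \<in> exts x \<longrightarrow> (\<exists>w3. le w2 w3 \<and> (\<exists>z. D w3 z \<and> z \<in> exts y)))) \<longrightarrow>
    (\<exists>w2. le w1 w2 \<and> (\<exists>f. D w2 f \<and>
      (\<forall>w3. le w2 w3 \<longrightarrow> (\<forall>p. D w3 p \<longrightarrow> p \<in> exts f \<longrightarrow> (\<exists>w4. le w3 w4 \<and> (\<exists>y. D w4 y \<and> (\<exists>w5. le w4 w5 \<and>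
        (\<exists>z. D w5 z \<and> y \<in> exts x \<and> z \<in> exts y \<and> tr w5 (case_nat z (case_nat y (case_nat p (case_nat f (case_nat x e))))) (is_pair 2 1 0))))))) \<and>
      (\<forall>w3. le w2 w3 \<longrightarrow> (\<forall>y. D w3 y \<longrightarrow> y \<in> exts x \<longrightarrow> (\<exists>w4. le w3 w4 \<and> (\<exists>z. D w4 z \<and> (\<forall>w5. le w4 w5 \<longrightarrow> (\<forall>v. D w5 v \<longrightarrow>
        ((\<exists>w6. le w5 w6 \<and> (\<exists>p. D w6 p \<and> p \<in> exts f \<and>
          tr w6 (case_nat p (case_nat v (case_nat z (case_nat y (case_nat f (case_nat x e)))))) (is_pair 0 3 1))) \<longleftrightarrow> v = z)))))))))))"
    unfolding iff_conv_conj_imp[of "\<exists>w6. _ w6" "_ = _"]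
    by (simp only: Ax_Choice_def ksat.simps(1,2,5) tr_conn(2,4) tr_imp fm.distinct simp_thms tmv.simps nat.case One_nat_def numeral_2_eq_2 numeral_3_eq_3 four)
  show ?thesis unfolding ev using main by blast
qed

lemma tr_ZC: "q \<in> ZC \<Longrightarrow> WW w \<Longrightarrow> (\<And>n. D w (e n)) \<Longrightarrow> tr w e q"
  unfolding ZC_def Z_def Comprehension_def
  using tr_Extensionality tr_Pairing tr_Union tr_Power_Set tr_Infinity tr_Choice tr_Comprehension by blast

theorem ZC_sound:
  assumes "provable L ZC q" "WW w" "\<And>n. D w (e n)"
  shows "tr w e q"
  by (rule soundness[OF assms(1) _ le_rfl[OF assms(2)] assms(3)]) (use tr_ZC le_WW in blast)+

end

section \<open>An incompact coherence problem\<close>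

text \<open>\<open>IDX\<close> is the set of indices \<open>x\<close>, \<open>XX x\<close> a set of points of \<open>PT\<close>, and \<open>hi l y\<close> says that the
  point \<open>y\<close> lies above the level \<open>l \<in> LV\<close>. A family of predicates \<open>p x\<close> is coherent if
  \<open>p x\<close> and \<open>p x'\<close> differ or agree on almost all of \<open>XX x \<inter> XX x'\<close>, as prescribed by \<open>PH\<close>.\<close>

locale coherence = Vmodel +
  fixes IDX PT LV :: nat and XX hi PH :: "nat \<Rightarrow> nat \<Rightarrow> bool"
  assumes XX_dfn: "dfn (\<lambda>e. XX (e 0) (e (Suc 0)))"
    and hi_dfn: "dfn (\<lambda>e. hi (e 0) (e (Suc 0)))"
    and PH_dfn: "dfn (\<lambda>e. PH (e 0) (e (Suc 0)))"
    and level: "\<exists>l. l \<in> elts LV"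
    and directed: "l1 \<in> elts LV \<Longrightarrow> l2 \<in> elts LV \<Longrightarrow> \<exists>l\<in>elts LV. \<forall>y. hi l y \<longrightarrow> hi l1 y \<and> hi l2 y"
    and triple: "x1 \<in> elts IDX \<Longrightarrow> x2 \<in> elts IDX \<Longrightarrow> x3 \<in> elts IDX \<Longrightarrow> x1 \<noteq> x2 \<Longrightarrow> x1 \<noteq> x3 \<Longrightarrow> x2 \<noteq> x3 \<Longrightarrow>
      \<exists>l\<in>elts LV. \<forall>y\<in>elts PT. hi l y \<longrightarrow> \<not> (XX x1 y \<and> XX x2 y \<and> XX x3 y)"
    and PH_sym: "PH x x' \<Longrightarrow> PH x' x" and PH_irrefl: "\<not> PH x x"
    and covered: "y \<in> elts PT \<Longrightarrow> \<exists>x\<in>elts IDX. XX x y"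
    and incompact: "dfn (\<lambda>e. p (e 0) (e (Suc 0))) \<Longrightarrow> \<exists>x1\<in>elts IDX. \<exists>x2\<in>elts IDX. \<forall>l\<in>elts LV. \<exists>y\<in>elts PT.
      hi l y \<and> XX x1 y \<and> XX x2 y \<and> \<not> ((p x1 y \<noteq> p x2 y) \<longleftrightarrow> PH x1 x2)"

section \<open>Iterated power sets without internal numerals\<close>

context Vmodel
begin

definition nt :: "nat \<Rightarrow> nat \<Rightarrow> nat" where "nt x y = st (elts x \<inter> elts y)"

lemma elts_nt [simp]: "elts (nt x y) = elts x \<inter> elts y"
proof -
  have "dfn (\<lambda>e. e 0 \<in> elts x \<inter> elts y)" unfolding Int_iff by (intro dfns)
  then have "sm (elts x \<inter> elts y)" by (rule sm_sub[OF _ sm_elts[of x]]) blast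
  then show ?thesis unfolding nt_def by (rule elts_st)
qed

lemma dfnf_nt [dfns]: "dfnf f \<Longrightarrow> dfnf g \<Longrightarrow> dfnf (\<lambda>e. nt (f e) (g e))"
  by (rule dfnf_app2, subst eq_iff_elts, simp, intro dfns)

primrec tg :: "nat \<Rightarrow> nat" where
  "tg 0 = emp"
| "tg (Suc n) = up (tg n) (tg n)"

lemma up_inj: "up x x = up y y \<longleftrightarrow> x = y"
proof
  assume "up x x = up y y"
  then have "elts (up x x) = elts (up y y)" by simp
  then show "x = y" by simp
qed simp

lemma up_emp: "up x x \<noteq> emp"
proof
  assume "up x x = emp"
  then have "elts (up x x) = elts emp" by simp
  then show False by simp
qed

lemma tg_inj [simp]: "tg m = tg n \<longleftrightarrow> m = n"
proof (induction m arbitrary: n)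
  case 0
  then show ?case using up_emp by (cases n) (auto simp: eq_commute[of emp])
next
  case (Suc m)
  then show ?case using up_emp up_inj by (cases n) auto
qed

text \<open>The levels are the pairs obtained from the empty set and \<open>Pw W0\<close> by
  iterating the power set in both components; the least family closed under this step replaces a
  recursion on internal natural numbers. \<open>W0\<close> is transitive and closed under power sets
  so that it contains every first component.\<close>

lemma tower_exists:
  "\<exists>LM W0. (\<forall>x\<in>elts W0. elts x \<subseteq> elts W0) \<and> (\<forall>l\<in>elts LM. \<exists>u b. l = pr u b) \<and>
    (\<forall>u b. pr u b \<in> elts LM \<longrightarrow> u \<in> elts W0) \<and> pr emp (Pw W0) \<in> elts LM \<and> (\<forall>u b. pr u b \<in> elts LM \<longrightarrow> pr (Pw u) (Pw b) \<in> elts LM) \<and>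
    (\<forall>P u b. dfn (\<lambda>e. P (e 0) (e (Suc 0))) \<longrightarrow> P emp (Pw W0) \<longrightarrow>
      (\<forall>u b. pr u b \<in> elts LM \<longrightarrow> P u b \<longrightarrow> P (Pw u) (Pw b)) \<longrightarrow> pr u b \<in> elts LM \<longrightarrow> P u b)"
proof -
  have "dfn (\<lambda>e. e 0 = Pw (e (Suc 0)))" by (intro dfns)
  from closure[where Q = "\<lambda>y x. y = Pw x", OF this, of emp]
  obtain W0 where W0: "emp \<in> elts W0" "\<forall>x\<in>elts W0. elts x \<subseteq> elts W0"
    "\<forall>x\<in>elts W0. (\<exists>y. y = Pw x) \<longrightarrow> (\<exists>y\<in>elts W0. y = Pw x)" by blast
  have W0P: "Pw x \<in> elts W0" if "x \<in> elts W0" for x using W0(3) that by blast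
  let ?l = "pr emp (Pw W0)"
  have "dfn (\<lambda>e. \<exists>u b. e (Suc 0) = pr u b \<and> e 0 = pr (Pw u) (Pw b))" by (intro dfns)
  from closure[where Q = "\<lambda>y x. \<exists>u b. x = pr u b \<and> y = pr (Pw u) (Pw b)", OF this, of ?l]
  obtain W1 where W1: "?l \<in> elts W1" "\<forall>x\<in>elts W1. (\<exists>y u b. x = pr u b \<and> y = pr (Pw u) (Pw b)) \<longrightarrow>
    (\<exists>y\<in>elts W1. \<exists>u b. x = pr u b \<and> y = pr (Pw u) (Pw b))" by blast
  have W1P: "pr (Pw u) (Pw b) \<in> elts W1" if "pr u b \<in> elts W1" for u b using bspec[OF W1(2) that] by auto
  \<comment> \<open>The closed families; the tower is their intersection within one closed set, and
    induction along it is induction over these families.\<close>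
  define cl where "cl F \<longleftrightarrow> ?l \<in> elts F \<and> (\<forall>u b. pr u b \<in> elts F \<longrightarrow> pr (Pw u) (Pw b) \<in> elts F)" for F
  have cl_dfn: "dfn (\<lambda>e. cl (e n))" for n unfolding cl_def by (intro dfns)
  let ?S = "{z. z \<in> elts W1 \<and> (\<forall>F. cl F \<longrightarrow> z \<in> elts F)}"
  have "sm ?S" by (rule sm_Collect_sub[OF _ sm_elts[of W1]]) (intro dfns cl_dfn, simp)
  then obtain LM where LM: "elts LM = ?S" unfolding sm_def by blast
  have base: "?l \<in> elts LM" unfolding LM using W1(1) by (simp add: cl_def)
  have stp: "pr (Pw u) (Pw b) \<in> elts LM" if "pr u b \<in> elts LM" for u b
    using that W1P unfolding LM by (simp add: cl_def)
  have ind: "P u b" if d: "dfn (\<lambda>e. P (e 0) (e (Suc 0)))" and P0: "P emp (Pw W0)"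
    and PS: "\<And>u b. pr u b \<in> elts LM \<Longrightarrow> P u b \<Longrightarrow> P (Pw u) (Pw b)" and ub: "pr u b \<in> elts LM" for P u b
  proof -
    let ?F = "{z. z \<in> elts LM \<and> (\<exists>u b. z = pr u b \<and> P u b)}"
    have "sm ?F" by (rule sm_Collect_sub[OF _ sm_elts[of LM]]) (intro dfns dfn_app2[where R = P, OF d], simp)
    then obtain F where F: "elts F = ?F" unfolding sm_def by blast
    have F': "pr u b \<in> elts F \<longleftrightarrow> pr u b \<in> elts LM \<and> P u b" for u b unfolding F by auto
    have "cl F" unfolding cl_def F' using base P0 stp PS by blast
    then have "pr u b \<in> elts F" using ub unfolding LM by blast
    then show ?thesis unfolding F' by blast
  qed
  have prs: "\<exists>u b. l = pr u b" if "l \<in> elts LM" for l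
  proof -
    let ?F = "{z. z \<in> elts LM \<and> (\<exists>u b. z = pr u b)}"
    have "sm ?F" by (rule sm_Collect_sub[OF _ sm_elts[of LM]]) (intro dfns, simp)
    then obtain F where F: "elts F = ?F" unfolding sm_def by blast
    have "cl F" unfolding cl_def F using base stp by blast
    then have "l \<in> elts F" using that unfolding LM by blast
    then show ?thesis unfolding F by blast
  qed
  have W: "u \<in> elts W0" if "pr u b \<in> elts LM" for u b
  proof (rule ind[where P = "\<lambda>u b. u \<in> elts W0", OF _ W0(1) _ that])
    show "dfn (\<lambda>e. e 0 \<in> elts W0)" by (intro dfns)
  qed (rule W0P)
  show ?thesis
  proof (rule exI[of _ LM], rule exI[of _ W0], intro conjI allI impI ballI)
    show "pr emp (Pw W0) \<in> elts LM" by (rule base)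
    fix u b assume ub: "pr u b \<in> elts LM"
    show "u \<in> elts W0" by (rule W[OF ub])
    show "pr (Pw u) (Pw b) \<in> elts LM" by (rule stp[OF ub])
  next
    fix P :: "nat \<Rightarrow> nat \<Rightarrow> bool" and u b
    assume a: "dfn (\<lambda>e. P (e 0) (e (Suc 0)))" "P emp (Pw W0)"
      "\<forall>u b. pr u b \<in> elts LM \<longrightarrow> P u b \<longrightarrow> P (Pw u) (Pw b)" "pr u b \<in> elts LM"
    show "P u b" by (rule ind[where P = P, OF a(1,2) _ a(4)]) (use a(3) in blast)
  qed (use W0(2) prs in blast)+
qed

end

section \<open>Branches through the tower and the diagonal argument\<close>

locale tower = Vmodel +
  fixes LM W0 :: nat
  assumes W0_trans: "x \<in> elts W0 \<Longrightarrow> elts x \<subseteq> elts W0"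
    and lam_pair: "l \<in> elts LM \<Longrightarrow> \<exists>u b. l = pr u b"
    and lam_W0: "pr u b \<in> elts LM \<Longrightarrow> u \<in> elts W0"
    and lam_base: "pr emp (Pw W0) \<in> elts LM"
    and lam_step: "pr u b \<in> elts LM \<Longrightarrow> pr (Pw u) (Pw b) \<in> elts LM"
    and lam_induct: "dfn (\<lambda>e. P (e 0) (e (Suc 0))) \<Longrightarrow> P emp (Pw W0) \<Longrightarrow>
      (\<And>u b. pr u b \<in> elts LM \<Longrightarrow> P u b \<Longrightarrow> P (Pw u) (Pw b)) \<Longrightarrow> pr u b \<in> elts LM \<Longrightarrow> P u b"
begin

abbreviation lam :: "nat \<Rightarrow> nat \<Rightarrow> bool" where "lam u b \<equiv> pr u b \<in> elts LM"

abbreviation below :: "nat \<Rightarrow> nat \<Rightarrow> nat \<Rightarrow> nat \<Rightarrow> bool" where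
  "below u b u' b' \<equiv> elts u \<subseteq> elts u' \<and> elts b \<subseteq> elts b'"

lemma lam_trans: "lam u b \<Longrightarrow> below u b (Pw u) (Pw b)"
proof (rule lam_induct[where P = "\<lambda>u b. below u b (Pw u) (Pw b)"])
  show "dfn (\<lambda>e. below (e 0) (e (Suc 0)) (Pw (e 0)) (Pw (e (Suc 0))))" by (intro dfns)
  show "below emp (Pw W0) (Pw emp) (Pw (Pw W0))" using W0_trans by auto
  show "below (Pw u) (Pw b) (Pw (Pw u)) (Pw (Pw b))" if "below u b (Pw u) (Pw b)" for u b using that by auto
qed

lemma Pw_mono: "below u b u' b' \<Longrightarrow> below (Pw u) (Pw b) (Pw u') (Pw b')"
  by auto

lemma lam_least: "lam u b \<Longrightarrow> below emp (Pw W0) u b"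
proof (rule lam_induct[where P = "\<lambda>u b. below emp (Pw W0) u b"])
  show "dfn (\<lambda>e. below emp (Pw W0) (e 0) (e (Suc 0)))" by (intro dfns)
  show "below emp (Pw W0) emp (Pw W0)" by simp
  show "below emp (Pw W0) (Pw u) (Pw b)" if "lam u b" "below emp (Pw W0) u b" for u b
    using lam_trans[OF that(1)] that(2) by blast
qed

lemma lam_cases:
  assumes "lam u b"
  shows "(u = emp \<and> b = Pw W0) \<or> (\<exists>u' b'. lam u' b' \<and> u = Pw u' \<and> b = Pw b')"
proof (rule lam_induct[where P = "\<lambda>u b. (u = emp \<and> b = Pw W0) \<or> (\<exists>u' b'. lam u' b' \<and> u = Pw u' \<and> b = Pw b')", OF _ _ _ assms])
  show "dfn (\<lambda>e. (e 0 = emp \<and> e (Suc 0) = Pw W0) \<or> (\<exists>u' b'. lam u' b' \<and> e 0 = Pw u' \<and> e (Suc 0) = Pw b'))"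
    by (intro dfns)
qed blast+

text \<open>The counterpart of \<open>m \<le> n\<close> or \<open>n + 1 \<le> m\<close> for natural
  numbers, by induction on one level and a case distinction on the other.\<close>

lemma lam_linear: "lam u b \<Longrightarrow> lam u' b' \<Longrightarrow> below u' b' u b \<or> below (Pw u) (Pw b) u' b'"
proof -
  let ?P = "\<lambda>u b. \<forall>u' b'. lam u' b' \<longrightarrow> below u' b' u b \<or> below (Pw u) (Pw b) u' b'"
  have "?P u b" if "lam u b"
  proof (rule lam_induct[where P = ?P, OF _ _ _ that])
    show "dfn (\<lambda>e. ?P (e 0) (e (Suc 0)))" by (intro dfns)
  next
    let ?Q = "\<lambda>u' b'. below u' b' emp (Pw W0) \<or> below (Pw emp) (Pw (Pw W0)) u' b'"
    have "?Q u' b'" if "lam u' b'" for u' b'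
    proof (rule lam_induct[where P = ?Q, OF _ _ _ that])
      show "dfn (\<lambda>e. ?Q (e 0) (e (Suc 0)))" by (intro dfns)
      show "?Q emp (Pw W0)" by simp
      fix u b assume ub: "lam u b"
      show "?Q (Pw u) (Pw b)" using Pw_mono[OF lam_least[OF ub(1)]] by (rule disjI2)
    qed
    then show "?P emp (Pw W0)" by blast
  next
    fix u b assume ub: "lam u b" and IH: "?P u b"
    show "?P (Pw u) (Pw b)"
    proof (intro allI impI)
      fix u' b' assume l': "lam u' b'"
      from lam_cases[OF l'] show "below u' b' (Pw u) (Pw b) \<or> below (Pw (Pw u)) (Pw (Pw b)) u' b'"
      proof
        assume "u' = emp \<and> b' = Pw W0"
        then show ?thesis using lam_least[OF lam_step[OF ub]] by blast
      next
        assume "\<exists>v c. lam v c \<and> u' = Pw v \<and> b' = Pw c"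
        then obtain v c where v: "lam v c" "u' = Pw v" "b' = Pw c" by blast
        have "below v c u b \<or> below (Pw u) (Pw b) v c" using IH v(1) by blast
        then show ?thesis unfolding v(2,3) by (rule disj_forward) (erule Pw_mono)+
      qed
    qed
  qed
  then show "lam u b \<Longrightarrow> lam u' b' \<Longrightarrow> below u' b' u b \<or> below (Pw u) (Pw b) u' b'" by blast
qed

lemma lam_directed: "lam u b \<Longrightarrow> lam u' b' \<Longrightarrow> below u' b' u b \<or> below u b u' b'"
  using lam_linear[of u b u' b'] lam_trans[of u b] by blast

lemma lam_unique:
  assumes "lam u b" "lam u b'"
  shows "b = b'"
proof -
  have "u \<in> elts (Pw u)" by simp
  then have "\<not> elts (Pw u) \<subseteq> elts u" using irrefl by blast
  then have "elts b' \<subseteq> elts b" "elts b \<subseteq> elts b'" using lam_linear[of u b u b'] lam_linear[of u b' u b] assms by blast+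
  then show ?thesis by (intro elts_inj) blast
qed

definition U :: nat where "U = st {z. \<exists>u b. lam u b \<and> z \<in> elts u}"

definition B :: nat where "B = st {z. \<exists>u b. lam u b \<and> z \<in> elts b}"

lemma elts_U: "elts U = {z. \<exists>u b. lam u b \<and> z \<in> elts u}"
  and elts_B: "elts B = {z. \<exists>u b. lam u b \<and> z \<in> elts b}"
proof -
  have "sm {z. \<exists>u b. lam u b \<and> z \<in> elts u}"
  proof (rule sm_Collect_sub[OF _ sm_elts[of "Un1 (Un1 (Un1 LM))"]])
    show "dfn (\<lambda>e. \<exists>u b. lam u b \<and> e 0 \<in> elts u)" by (intro dfns)
    show "z \<in> elts (Un1 (Un1 (Un1 LM)))" if "\<exists>u b. lam u b \<and> z \<in> elts u" for z
      using that pr_comps[of _ _ LM] unfolding elts_Un1[of "Un1 (Un1 LM)"] by blast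
  qed
  then show "elts U = {z. \<exists>u b. lam u b \<and> z \<in> elts u}" unfolding U_def by (rule elts_st)
  have "sm {z. \<exists>u b. lam u b \<and> z \<in> elts b}"
  proof (rule sm_Collect_sub[OF _ sm_elts[of "Un1 (Un1 (Un1 LM))"]])
    show "dfn (\<lambda>e. \<exists>u b. lam u b \<and> e 0 \<in> elts b)" by (intro dfns)
    show "z \<in> elts (Un1 (Un1 (Un1 LM)))" if "\<exists>u b. lam u b \<and> z \<in> elts b" for z
      using that pr_comps[of _ _ LM] unfolding elts_Un1[of "Un1 (Un1 LM)"] by blast
  qed
  then show "elts B = {z. \<exists>u b. lam u b \<and> z \<in> elts b}" unfolding B_def by (rule elts_st)
qed

lemma lam_sub: "lam u b \<Longrightarrow> elts u \<subseteq> elts U \<and> elts b \<subseteq> elts B"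
  unfolding elts_U elts_B by blast

lemma pair_in_U:
  assumes "lam u b" "elts s \<subseteq> elts u"
  shows "pr s u \<in> elts U"
proof -
  have "pr s u \<in> elts (Pw (Pw (Pw u)))" by (rule pr_in_Pw) (use assms in auto)
  then show ?thesis using lam_sub[OF lam_step[OF lam_step[OF lam_step[OF assms(1)]]]] by blast
qed

text \<open>The codes mention arbitrary subsets \<open>i\<close> of \<open>U\<close>. These belong
  to the very first second component because \<open>U\<close> is included in \<open>W0\<close>,
  which explains the start at \<open>Pw W0\<close>. Of the five power sets, one places the
  components and each of the two pairings takes two more.\<close>

lemma pair_in_B:
  assumes "lam u b" "elts i \<subseteq> elts U" "elts t \<subseteq> elts b"
  shows "pr (pr i t) u \<in> elts B"
proof -
  have "elts U \<subseteq> elts W0" unfolding elts_U using lam_W0 W0_trans by blast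
  then have "i \<in> elts (Pw W0)" using assms(2) by auto
  then have i: "i \<in> elts (Pw b)" using lam_least[OF assms(1)] lam_trans[OF assms(1)] by blast
  have "u \<in> elts (Pw W0)" using W0_trans[OF lam_W0[OF assms(1)]] by simp
  then have u: "u \<in> elts (Pw b)" using lam_least[OF assms(1)] lam_trans[OF assms(1)] by blast
  have t: "t \<in> elts (Pw b)" using assms(3) by simp
  note s1 = lam_step[OF assms(1)]
  note s2 = lam_step[OF s1]
  note s3 = lam_step[OF s2]
  note s5 = lam_step[OF lam_step[OF s3]]
  have "pr i t \<in> elts (Pw (Pw (Pw b)))" by (rule pr_in_Pw[OF i t])
  moreover have "u \<in> elts (Pw (Pw (Pw b)))" using u lam_trans[OF s1] lam_trans[OF s2] by blast
  ultimately have "pr (pr i t) u \<in> elts (Pw (Pw (Pw (Pw (Pw b)))))" by (rule pr_in_Pw)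
  then show ?thesis using lam_sub[OF s5] by blast
qed

definition pt :: "nat \<Rightarrow> nat \<Rightarrow> nat \<Rightarrow> nat \<Rightarrow> nat" where "pt s t u b = pr (pr s t) (pr u b)"

lemma pt_inj [simp]: "pt s t u b = pt s' t' u' b' \<longleftrightarrow> s = s' \<and> t = t' \<and> u = u' \<and> b = b'"
  by (auto simp: pt_def)

lemma dfnf_pt [dfns]: "dfnf f \<Longrightarrow> dfnf g \<Longrightarrow> dfnf h \<Longrightarrow> dfnf k \<Longrightarrow> dfnf (\<lambda>e. pt (f e) (g e) (h e) (k e))"
  unfolding pt_def by (intro dfns)

definition PT :: nat where "PT = st {y. \<exists>s t u b. y = pt s t u b \<and> lam u b \<and> elts s \<subseteq> elts u \<and> elts t \<subseteq> elts b}"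

lemma elts_PT: "elts PT = {y. \<exists>s t u b. y = pt s t u b \<and> lam u b \<and> elts s \<subseteq> elts u \<and> elts t \<subseteq> elts b}"
proof -
  have sm1: "sm {pr x y |x y. x \<in> elts (Pw U) \<and> y \<in> elts (Pw B)}" by (intro sm_prod sm_elts)
  have "sm {y. \<exists>s t u b. y = pt s t u b \<and> lam u b \<and> elts s \<subseteq> elts u \<and> elts t \<subseteq> elts b}"
  proof (rule sm_Collect_sub[OF _ sm_prod[OF sm1 sm_elts[of LM]]])
    show "dfn (\<lambda>e. \<exists>s t u b. e 0 = pt s t u b \<and> lam u b \<and> elts s \<subseteq> elts u \<and> elts t \<subseteq> elts b)" by (intro dfns)
    fix z assume "\<exists>s t u b. z = pt s t u b \<and> lam u b \<and> elts s \<subseteq> elts u \<and> elts t \<subseteq> elts b"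
    then obtain s t u b where z: "z = pt s t u b" "lam u b" "elts s \<subseteq> elts u" "elts t \<subseteq> elts b" by blast
    have "s \<in> elts (Pw U)" "t \<in> elts (Pw B)" using z(3,4) lam_sub[OF z(2)] by auto
    then show "z \<in> {pr x y |x y. x \<in> {pr x y |x y. x \<in> elts (Pw U) \<and> y \<in> elts (Pw B)} \<and> y \<in> elts LM}"
      using z(1,2) unfolding pt_def by blast
  qed
  then show ?thesis unfolding PT_def by (rule elts_st)
qed

definition IDX :: nat where
  "IDX = st {x. (\<exists>i. x = pr (tg 0) i \<and> elts i \<subseteq> elts U) \<or> (\<exists>k. x = pr (tg (Suc 0)) k \<and> elts k \<subseteq> elts B)}"

lemma elts_IDX:
  "elts IDX = {x. (\<exists>i. x = pr (tg 0) i \<and> elts i \<subseteq> elts U) \<or> (\<exists>k. x = pr (tg (Suc 0)) k \<and> elts k \<subseteq> elts B)}"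
proof -
  have s: "sm ({pr x y |x y. x \<in> {tg 0} \<and> y \<in> elts (Pw U)} \<union> {pr x y |x y. x \<in> {tg (Suc 0)} \<and> y \<in> elts (Pw B)})"
    by (intro sm_Un sm_prod sm_sing sm_elts)
  have "sm {x. (\<exists>i. x = pr (tg 0) i \<and> elts i \<subseteq> elts U) \<or> (\<exists>k. x = pr (tg (Suc 0)) k \<and> elts k \<subseteq> elts B)}"
    by (rule sm_Collect_sub[OF _ s]) (intro dfns, auto simp del: tg.simps)
  then show ?thesis unfolding IDX_def by (rule elts_st)
qed

text \<open>Indices are branches and points are nodes: \<open>i\<close> passes through those with
  \<open>s = nt i u\<close>, and \<open>k\<close> through those with \<open>t = nt k b\<close>.
  Different branches of the same kind split at some level and share no point above it, while an
  \<open>i\<close> and a \<open>k\<close> share exactly one point at each level.\<close>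

definition XX :: "nat \<Rightarrow> nat \<Rightarrow> bool" where
  "XX x y \<longleftrightarrow> (\<exists>s t u b. y = pt s t u b \<and>
    ((\<exists>i. x = pr (tg 0) i \<and> s = nt i u) \<or> (\<exists>k. x = pr (tg (Suc 0)) k \<and> t = nt k b)))"

lemma XX_pt: "XX (pr (tg 0) i) (pt s t u b) \<longleftrightarrow> s = nt i u" "XX (pr (tg (Suc 0)) k) (pt s t u b) \<longleftrightarrow> t = nt k b"
  unfolding XX_def by (auto simp del: tg.simps)

definition hi :: "nat \<Rightarrow> nat \<Rightarrow> bool" where
  "hi l y \<longleftrightarrow> (\<exists>s t u b u0 b0. y = pt s t u b \<and> l = pr u0 b0 \<and> below u0 b0 u b)"

lemma hi_pt: "hi (pr u0 b0) (pt s t u b) \<longleftrightarrow> below u0 b0 u b"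
  unfolding hi_def by auto

text \<open>Tailored to the diagonal argument: the two sides are the values that \<open>i\<close>
  and \<open>k\<close> code for each other at their common points. Where these values eventually
  agree, the prescription demands that they differ, and otherwise that they agree.\<close>

definition ag :: "nat \<Rightarrow> nat \<Rightarrow> bool" where
  "ag i k \<longleftrightarrow> (\<exists>u0 b0. lam u0 b0 \<and> (\<forall>u b. lam u b \<longrightarrow> below u0 b0 u b \<longrightarrow>
    (pr (nt i u) u \<in> elts i \<longleftrightarrow> pr (pr i (nt k b)) u \<in> elts k)))"

definition PH :: "nat \<Rightarrow> nat \<Rightarrow> bool" where
  "PH x x' \<longleftrightarrow> (\<exists>i k. ((x = pr (tg 0) i \<and> x' = pr (tg (Suc 0)) k) \<or> (x' = pr (tg 0) i \<and> x = pr (tg (Suc 0)) k)) \<and> ag i k)"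

lemma PH_pr: "PH (pr (tg 0) i) (pr (tg (Suc 0)) k) \<longleftrightarrow> ag i k"
  unfolding PH_def by (auto simp del: tg.simps)

lemma lam_ge: "lam u0 b0 \<Longrightarrow> lam u1 b1 \<Longrightarrow> \<exists>u b. lam u b \<and> below u0 b0 u b \<and> below u1 b1 u b"
  using lam_directed[of u0 b0 u1 b1] by blast

lemma separate:
  assumes "x \<in> elts IDX" "x' \<in> elts IDX" "x \<noteq> x'" "\<exists>n i i'. x = pr (tg n) i \<and> x' = pr (tg n) i'"
  shows "\<exists>u0 b0. lam u0 b0 \<and> (\<forall>s t u b. below u0 b0 u b \<longrightarrow> \<not> (XX x (pt s t u b) \<and> XX x' (pt s t u b)))"
proof -
  obtain n i i' where n: "x = pr (tg n) i" "x' = pr (tg n) i'" using assms(4) by blast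
  have "elts i \<noteq> elts i'" using assms(3) n elts_inj by auto
  then obtain z where z: "(z \<in> elts i) \<noteq> (z \<in> elts i')" by blast
  consider "n = 0" "elts i \<subseteq> elts U" "elts i' \<subseteq> elts U" | "n = Suc 0" "elts i \<subseteq> elts B" "elts i' \<subseteq> elts B"
    using assms(1,2) unfolding elts_IDX n by (auto simp del: tg.simps)
  then show ?thesis
  proof cases
    case 1
    then obtain u0 b0 where l: "lam u0 b0" "z \<in> elts u0" using z unfolding elts_U by blast
    have "nt i u \<noteq> nt i' u" if "below u0 b0 u b" for u b
    proof
      assume "nt i u = nt i' u"
      then have "elts i \<inter> elts u = elts i' \<inter> elts u" using elts_nt by metis
      then show False using z l(2) that by blast
    qed
    then have "\<forall>s t u b. below u0 b0 u b \<longrightarrow> \<not> (XX x (pt s t u b) \<and> XX x' (pt s t u b))"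
      unfolding n 1(1) XX_pt by blast
    then show ?thesis using l(1) by blast
  next
    case 2
    then obtain u0 b0 where l: "lam u0 b0" "z \<in> elts b0" using z unfolding elts_B by blast
    have "nt i b \<noteq> nt i' b" if "below u0 b0 u b" for u b
    proof
      assume "nt i b = nt i' b"
      then have "elts i \<inter> elts b = elts i' \<inter> elts b" using elts_nt by metis
      then show False using z l(2) that by blast
    qed
    then have "\<forall>s t u b. below u0 b0 u b \<longrightarrow> \<not> (XX x (pt s t u b) \<and> XX x' (pt s t u b))"
      unfolding n 2(1) XX_pt by blast
    then show ?thesis using l(1) by blast
  qed
qed

text \<open>A coherent family \<open>p\<close> on all indices is refuted by diagonalization: \<open>k\<close> codes all \<open>p i\<close>, and then
  \<open>i\<close> codes \<open>p k\<close>.\<close>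

lemma diagonal:
  assumes d: "dfn (\<lambda>e. p (e 0) (e (Suc 0)))"
  shows "\<exists>i k. elts i \<subseteq> elts U \<and> elts k \<subseteq> elts B \<and> (\<forall>u b. lam u b \<longrightarrow>
    (p (pr (tg 0) i) (pt (nt i u) (nt k b) u b) \<longleftrightarrow> pr (pr i (nt k b)) u \<in> elts k) \<and>
    (p (pr (tg (Suc 0)) k) (pt (nt i u) (nt k b) u b) \<longleftrightarrow> pr (nt i u) u \<in> elts i))"
proof -
  note dp = dfn_app2[where R = p, OF d]
  \<comment> \<open>\<open>k\<close> must answer for all \<open>i\<close> at once, so
    \<open>i\<close> is part of the code. The trace of \<open>i\<close> can be recomputed from
    \<open>i\<close>, but the trace of \<open>k\<close> has to be guessed as \<open>t\<close>, since
    \<open>k\<close> is not yet available.\<close>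
  let ?K = "{q. \<exists>i t u b. q = pr (pr i t) u \<and> lam u b \<and> elts i \<subseteq> elts U \<and> elts t \<subseteq> elts b \<and> p (pr (tg 0) i) (pt (nt i u) t u b)}"
  have "sm ?K"
  proof (rule sm_Collect_sub[OF _ sm_elts[of B]])
    show "dfn (\<lambda>e. \<exists>i t u b. e 0 = pr (pr i t) u \<and> lam u b \<and> elts i \<subseteq> elts U \<and> elts t \<subseteq> elts b \<and> p (pr (tg 0) i) (pt (nt i u) t u b))"
      by (intro dfns dp)
  qed (use pair_in_B in blast)
  then obtain k where k: "elts k = ?K" unfolding sm_def by blast
  have kB: "elts k \<subseteq> elts B" unfolding k using pair_in_B by blast
  \<comment> \<open>Now \<open>k\<close> is fixed, and \<open>i\<close> has to answer for this
    single index only; its own trace is guessed as \<open>s\<close>.\<close>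
  let ?I = "{q. \<exists>s u b. q = pr s u \<and> lam u b \<and> elts s \<subseteq> elts u \<and> p (pr (tg (Suc 0)) k) (pt s (nt k b) u b)}"
  have "sm ?I"
  proof (rule sm_Collect_sub[OF _ sm_elts[of U]])
    show "dfn (\<lambda>e. \<exists>s u b. e 0 = pr s u \<and> lam u b \<and> elts s \<subseteq> elts u \<and> p (pr (tg (Suc 0)) k) (pt s (nt k b) u b))"
      by (intro dfns dp)
  qed (use pair_in_U in blast)
  then obtain i where i: "elts i = ?I" unfolding sm_def by blast
  have iU: "elts i \<subseteq> elts U" unfolding i using pair_in_U by blast
  have "p (pr (tg 0) i) (pt (nt i u) (nt k b) u b) \<longleftrightarrow> pr (pr i (nt k b)) u \<in> elts k"
    "p (pr (tg (Suc 0)) k) (pt (nt i u) (nt k b) u b) \<longleftrightarrow> pr (nt i u) u \<in> elts i" if ub: "lam u b" for u b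
  proof -
    show "p (pr (tg 0) i) (pt (nt i u) (nt k b) u b) \<longleftrightarrow> pr (pr i (nt k b)) u \<in> elts k" (is "?l \<longleftrightarrow> ?r")
    proof
      assume ?l
      then show ?r unfolding k
        by (intro CollectI exI[of _ i] exI[of _ "nt k b"] exI[of _ u] exI[of _ b] conjI refl ub iU) auto
    next
      assume "pr (pr i (nt k b)) u \<in> elts k"
      then obtain b' where "lam u b'" "p (pr (tg 0) i) (pt (nt i u) (nt k b) u b')" unfolding k by auto
      then show ?l using lam_unique[OF ub] by blast
    qed
    show "p (pr (tg (Suc 0)) k) (pt (nt i u) (nt k b) u b) \<longleftrightarrow> pr (nt i u) u \<in> elts i" (is "?l \<longleftrightarrow> ?r")
    proof
      assume ?l
      then show ?r unfolding i
        by (intro CollectI exI[of _ "nt i u"] exI[of _ u] exI[of _ b] conjI refl ub) auto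
    next
      assume "pr (nt i u) u \<in> elts i"
      then obtain b' where "lam u b'" "p (pr (tg (Suc 0)) k) (pt (nt i u) (nt k b') u b')" unfolding i by auto
      then show ?l using lam_unique[OF ub] by blast
    qed
  qed
  then show ?thesis using iU kB by blast
qed

lemma coherence: "coherence E IDX PT LM XX hi PH"
proof
  show "dfn (\<lambda>e. XX (e 0) (e (Suc 0)))" unfolding XX_def by (intro dfns)
  show "dfn (\<lambda>e. hi (e 0) (e (Suc 0)))" unfolding hi_def by (intro dfns)
  show "dfn (\<lambda>e. PH (e 0) (e (Suc 0)))" unfolding PH_def ag_def by (intro dfns)
  show "\<exists>l. l \<in> elts LM" using lam_base by blast
next
  have hi_pr: "hi (pr u0 b0) y \<longleftrightarrow> (\<exists>s t u b. y = pt s t u b \<and> below u0 b0 u b)" for u0 b0 y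
    unfolding hi_def by auto
  show "\<exists>l\<in>elts LM. \<forall>y. hi l y \<longrightarrow> hi l1 y \<and> hi l2 y" if l: "l1 \<in> elts LM" "l2 \<in> elts LM" for l1 l2
  proof -
    obtain u1 b1 u2 b2 where p: "l1 = pr u1 b1" "l2 = pr u2 b2" using l lam_pair by blast
    obtain u b where ub: "lam u b" "below u1 b1 u b" "below u2 b2 u b" using lam_ge[of u1 b1 u2 b2] l unfolding p by blast
    have "hi (pr u1 b1) y \<and> hi (pr u2 b2) y" if h: "hi (pr u b) y" for y
    proof -
      obtain s t u' b' where y: "y = pt s t u' b'" "below u b u' b'" using h unfolding hi_pr by blast
      have "below u1 b1 u' b'" "below u2 b2 u' b'" using ub(2,3) y(2) by blast+
      then show ?thesis unfolding y(1) hi_pt by blast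
    qed
    then show ?thesis unfolding p using ub(1) by blast
  qed
  show "\<exists>l\<in>elts LM. \<forall>y\<in>elts PT. hi l y \<longrightarrow> \<not> (XX x1 y \<and> XX x2 y \<and> XX x3 y)"
    if x: "x1 \<in> elts IDX" "x2 \<in> elts IDX" "x3 \<in> elts IDX" "x1 \<noteq> x2" "x1 \<noteq> x3" "x2 \<noteq> x3" for x1 x2 x3
  proof -
    have tag: "\<exists>n<Suc (Suc 0). \<exists>i. x = pr (tg n) i" if "x \<in> elts IDX" for x
      using that unfolding elts_IDX by (auto simp del: tg.simps)
    obtain n1 i1 n2 i2 n3 i3 where n: "n1 < Suc (Suc 0)" "n2 < Suc (Suc 0)" "n3 < Suc (Suc 0)"
      and i: "x1 = pr (tg n1) i1" "x2 = pr (tg n2) i2" "x3 = pr (tg n3) i3" using tag[OF x(1)] tag[OF x(2)] tag[OF x(3)] by blast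
    have sep: "\<exists>l\<in>elts LM. \<forall>y\<in>elts PT. hi l y \<longrightarrow> \<not> (XX x y \<and> XX x' y)"
      if xx: "x \<in> elts IDX" "x' \<in> elts IDX" "x \<noteq> x'" "\<exists>n i i'. x = pr (tg n) i \<and> x' = pr (tg n) i'" for x x'
    proof -
      obtain u0 b0 where u0: "lam u0 b0" "\<forall>s t u b. below u0 b0 u b \<longrightarrow> \<not> (XX x (pt s t u b) \<and> XX x' (pt s t u b))"
        using separate[OF xx] by blast
      have "\<not> (XX x y \<and> XX x' y)" if "hi (pr u0 b0) y" for y using that u0(2) unfolding hi_pr by blast
      then show ?thesis using u0(1) by blast
    qed
    have nn: "n1 = 0 \<or> n1 = Suc 0" "n2 = 0 \<or> n2 = Suc 0" "n3 = 0 \<or> n3 = Suc 0" using n by (simp_all add: less_Suc_eq)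
    \<comment> \<open>There are only two kinds of indices, so two of the three are of the same kind
      and part for good.\<close>
    consider "n1 = n2" | "n1 = n3" | "n2 = n3" using nn by blast
    then show ?thesis
    proof cases
      case 1 then show ?thesis using sep[OF x(1,2,4)] i by blast
    next
      case 2 then show ?thesis using sep[OF x(1,3,5)] i by blast
    next
      case 3 then show ?thesis using sep[OF x(2,3,6)] i by blast
    qed
  qed
  show "PH x x' \<Longrightarrow> PH x' x" for x x' unfolding PH_def by blast
  show "\<not> PH x x" for x unfolding PH_def by (auto simp del: tg.simps)
  show "\<exists>x\<in>elts IDX. XX x y" if "y \<in> elts PT" for y
  proof -
    obtain s t u b where y: "y = pt s t u b" "lam u b" "elts s \<subseteq> elts u" using \<open>y \<in> elts PT\<close> unfolding elts_PT by blast
    have "s = nt s u" by (rule elts_inj) (use y(3) in auto)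
    then have "XX (pr (tg 0) s) y" unfolding y(1) XX_pt .
    moreover have "pr (tg 0) s \<in> elts IDX" unfolding elts_IDX using y(3) lam_sub[OF y(2)] by blast
    ultimately show ?thesis by blast
  qed
  fix p assume d: "dfn (\<lambda>e. p (e 0) (e (Suc 0)))"
  obtain i k where ik: "elts i \<subseteq> elts U" "elts k \<subseteq> elts B" and
    eq: "\<And>u b. lam u b \<Longrightarrow> p (pr (tg 0) i) (pt (nt i u) (nt k b) u b) \<longleftrightarrow> pr (pr i (nt k b)) u \<in> elts k"
    "\<And>u b. lam u b \<Longrightarrow> p (pr (tg (Suc 0)) k) (pt (nt i u) (nt k b) u b) \<longleftrightarrow> pr (nt i u) u \<in> elts i"
    using diagonal[OF d] by blast
  let ?x = "pr (tg 0) i" and ?x' = "pr (tg (Suc 0)) k"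
  have x: "?x \<in> elts IDX" "?x' \<in> elts IDX" using ik unfolding elts_IDX by blast+
  have "\<exists>y\<in>elts PT. hi l y \<and> XX ?x y \<and> XX ?x' y \<and> \<not> ((p ?x y \<noteq> p ?x' y) \<longleftrightarrow> PH ?x ?x')" if l: "l \<in> elts LM" for l
  proof -
    obtain u0 b0 where l0: "l = pr u0 b0" using lam_pair[OF l] by blast
    \<comment> \<open>If the coded values eventually agree, any level high enough will do; if not,
      disagreement recurs above every level. Either way the common point of the two branches
      violates the prescription.\<close>
    have "\<exists>u b. lam u b \<and> below u0 b0 u b \<and> (ag i k \<longleftrightarrow> (pr (nt i u) u \<in> elts i \<longleftrightarrow> pr (pr i (nt k b)) u \<in> elts k))"
    proof (cases "ag i k")
      case True
      then obtain u1 b1 where 1: "lam u1 b1" "\<And>u b. lam u b \<Longrightarrow> below u1 b1 u b \<Longrightarrow>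
        (pr (nt i u) u \<in> elts i \<longleftrightarrow> pr (pr i (nt k b)) u \<in> elts k)" unfolding ag_def by blast
      obtain u b where ub: "lam u b" "below u0 b0 u b" "below u1 b1 u b" using lam_ge[of u0 b0 u1 b1] l 1(1) unfolding l0 by blast
      show ?thesis using ub(1,2) 1(2)[OF ub(1,3)] True by blast
    next
      case False
      then show ?thesis using l unfolding l0 ag_def by blast
    qed
    then obtain u b where ub: "lam u b" "below u0 b0 u b" "ag i k \<longleftrightarrow> (pr (nt i u) u \<in> elts i \<longleftrightarrow> pr (pr i (nt k b)) u \<in> elts k)"
      by blast
    let ?y = "pt (nt i u) (nt k b) u b"
    have yP: "?y \<in> elts PT" unfolding elts_PT using ub(1) by auto
    have h: "hi l ?y" "XX ?x ?y" "XX ?x' ?y" unfolding l0 hi_pt XX_pt using ub(2) by blast+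
    have "\<not> ((p ?x ?y \<noteq> p ?x' ?y) \<longleftrightarrow> PH ?x ?x')" unfolding eq(1)[OF ub(1)] eq(2)[OF ub(1)] PH_pr using ub(3) by blast
    then show ?thesis using yP h by blast
  qed
  then show "\<exists>x1\<in>elts IDX. \<exists>x2\<in>elts IDX. \<forall>l\<in>elts LM. \<exists>y\<in>elts PT.
      hi l y \<and> XX x1 y \<and> XX x2 y \<and> \<not> ((p x1 y \<noteq> p x2 y) \<longleftrightarrow> PH x1 x2)" using x by blast
qed

end

context Vmodel
begin

theorem coherence_exists: "\<exists>IDX PT LV XX hi PH. coherence E IDX PT LV XX hi PH"
proof -
  obtain LM W0 where *: "\<forall>x\<in>elts W0. elts x \<subseteq> elts W0" "\<forall>l\<in>elts LM. \<exists>u b. l = pr u b"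
    "\<forall>u b. pr u b \<in> elts LM \<longrightarrow> u \<in> elts W0" "pr emp (Pw W0) \<in> elts LM"
    "\<forall>u b. pr u b \<in> elts LM \<longrightarrow> pr (Pw u) (Pw b) \<in> elts LM"
    "\<forall>P u b. dfn (\<lambda>e. P (e 0) (e (Suc 0))) \<longrightarrow> P emp (Pw W0) \<longrightarrow>
      (\<forall>u b. pr u b \<in> elts LM \<longrightarrow> P u b \<longrightarrow> P (Pw u) (Pw b)) \<longrightarrow> pr u b \<in> elts LM \<longrightarrow> P u b"
    using tower_exists by (elim exE conjE)
  interpret tower E LM W0
  proof
    fix P :: "nat \<Rightarrow> nat \<Rightarrow> bool" and u b
    assume "dfn (\<lambda>e. P (e 0) (e (Suc 0)))" "P emp (Pw W0)"
      "\<And>u b. pr u b \<in> elts LM \<Longrightarrow> P u b \<Longrightarrow> P (Pw u) (Pw b)" "pr u b \<in> elts LM"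
    then show "P u b" using spec[OF *(6), of P] by blast
  qed (use *(1-5) in blast)+
  show ?thesis using coherence by blast
qed

end

section \<open>Finite sets in the sense of the model\<close>

context Vmodel
begin

declare tg.simps [simp del]

text \<open>Kuratowski finiteness, stated by induction over families of sets. It is definable and
  internal; in a nonstandard model such sets may be infinite from outside.\<close>

definition fin :: "nat \<Rightarrow> bool" where
  "fin M \<longleftrightarrow> (\<forall>F. emp \<in> elts F \<longrightarrow> (\<forall>K\<in>elts F. \<forall>x\<in>elts M. ins x K \<in> elts F) \<longrightarrow> M \<in> elts F)"

lemma fin_dfn [dfns]: "dfnf f \<Longrightarrow> dfn (\<lambda>e. fin (f e))"
  by (rule dfn_app1) (unfold fin_def, intro dfns)

lemma fin_induct:
  assumes d: "dfn (\<lambda>e. P (e 0))" and M: "fin M" and P0: "P emp"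
    and PS: "\<And>K x. elts K \<subseteq> elts M \<Longrightarrow> x \<in> elts M \<Longrightarrow> P K \<Longrightarrow> P (ins x K)"
  shows "P M"
proof -
  let ?S = "{K. K \<in> elts (Pw M) \<and> P K}"
  have "sm ?S" by (rule sm_Collect_sub[OF _ sm_elts[of "Pw M"]]) (intro dfns d, simp)
  then obtain F where F: "elts F = ?S" unfolding sm_def by blast
  have "emp \<in> elts F" unfolding F using P0 by simp
  moreover have "\<forall>K\<in>elts F. \<forall>x\<in>elts M. ins x K \<in> elts F" unfolding F using PS by auto
  ultimately have "M \<in> elts F" using M unfolding fin_def by blast
  then show ?thesis unfolding F by blast
qed

lemma fin_emp: "fin emp"
  unfolding fin_def by blast

lemma fin_ins:
  assumes "fin M"
  shows "fin (ins x M)"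
  unfolding fin_def
proof (intro allI impI)
  fix F assume F: "emp \<in> elts F" "\<forall>K\<in>elts F. \<forall>z\<in>elts (ins x M). ins z K \<in> elts F"
  then have "M \<in> elts F" using assms unfolding fin_def by auto
  then show "ins x M \<in> elts F" using F(2) by auto
qed

lemma un_ins: "un (ins x K) M = ins x (un K M)"
  by (rule elts_inj) simp

lemma un_emp: "un emp M = M"
  by (rule elts_inj) simp

lemma fin_un:
  assumes "fin M" "fin K"
  shows "fin (un M K)"
proof (rule fin_induct[where P = "\<lambda>M. fin (un M K)", OF _ assms(1)])
  show "dfn (\<lambda>e. fin (un (e 0) K))" by (intro dfns)
qed (use assms(2) fin_ins in \<open>auto simp: un_emp un_ins\<close>)

lemma dfn_exbool [dfns]: "dfn (P True) \<Longrightarrow> dfn (P False) \<Longrightarrow> dfn (\<lambda>e. \<exists>b. P b e)"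
  unfolding ex_bool_eq by (rule dfn_disj)

end

section \<open>Coherent families on finite sets of indices\<close>

context coherence
begin

lemmas rel_dfns [dfns] = dfn_app2[where R = XX, OF XX_dfn] dfn_app2[where R = hi, OF hi_dfn] dfn_app2[where R = PH, OF PH_dfn]

text \<open>The filter on \<open>PT\<close> generated by the levels; "almost all" refers to it
  below.\<close>

definition ev :: "(nat \<Rightarrow> bool) \<Rightarrow> bool" where
  "ev P \<longleftrightarrow> (\<exists>l\<in>elts LV. \<forall>y\<in>elts PT. hi l y \<longrightarrow> P y)"

lemma ev_mono: "ev P \<Longrightarrow> (\<And>y. y \<in> elts PT \<Longrightarrow> P y \<Longrightarrow> Q y) \<Longrightarrow> ev Q"
  unfolding ev_def by blast

lemma ev_conj:
  assumes "ev P" "ev Q"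
  shows "ev (\<lambda>y. P y \<and> Q y)"
proof -
  obtain l1 where l1: "l1 \<in> elts LV" "\<forall>y\<in>elts PT. hi l1 y \<longrightarrow> P y" using assms(1) unfolding ev_def by blast
  obtain l2 where l2: "l2 \<in> elts LV" "\<forall>y\<in>elts PT. hi l2 y \<longrightarrow> Q y" using assms(2) unfolding ev_def by blast
  obtain l where "l \<in> elts LV" "\<forall>y. hi l y \<longrightarrow> hi l1 y \<and> hi l2 y" using directed[OF l1(1) l2(1)] by blast
  then show ?thesis unfolding ev_def using l1(2) l2(2) by blast
qed

lemma ev_all: "(\<And>y. y \<in> elts PT \<Longrightarrow> P y) \<Longrightarrow> ev P"
  unfolding ev_def using level by blast

text \<open>Directedness gives intersections of two sets only; internal induction extends this to
  all internally finite intersections, which is why \<open>Q\<close> must be definable.\<close>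

lemma ev_fin:
  assumes M: "fin M" and d: "dfn (\<lambda>e. Q (e 0) (e (Suc 0)))" and Q: "\<And>x. x \<in> elts M \<Longrightarrow> ev (Q x)"
  shows "ev (\<lambda>y. \<forall>x\<in>elts M. Q x y)"
proof (rule fin_induct[where P = "\<lambda>M. ev (\<lambda>y. \<forall>x\<in>elts M. Q x y)", OF _ M])
  show "dfn (\<lambda>e. ev (\<lambda>y. \<forall>x\<in>elts (e 0). Q x y))"
    unfolding ev_def by (intro dfns dfn_app2[where R = Q, OF d])
  show "ev (\<lambda>y. \<forall>x\<in>elts emp. Q x y)" by (rule ev_all) simp
  show "ev (\<lambda>y. \<forall>z\<in>elts (ins x K). Q z y)" if "x \<in> elts M" "ev (\<lambda>y. \<forall>x\<in>elts K. Q x y)" for K x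
    by (rule ev_mono[OF ev_conj[OF Q[OF that(1)] that(2)]]) auto
qed

abbreviation ps :: "nat \<Rightarrow> nat \<Rightarrow> nat \<Rightarrow> bool" where "ps \<psi> x y \<equiv> pr x y \<in> elts \<psi>"

definition coh :: "nat \<Rightarrow> nat \<Rightarrow> bool" where
  "coh M \<psi> \<longleftrightarrow> (\<forall>x\<in>elts M. \<forall>x'\<in>elts M. ev (\<lambda>y. XX x y \<longrightarrow> XX x' y \<longrightarrow> ((ps \<psi> x y \<noteq> ps \<psi> x' y) \<longleftrightarrow> PH x x')))"

lemma coh_dfn [dfns]: "dfnf f \<Longrightarrow> dfnf g \<Longrightarrow> dfn (\<lambda>e. coh (f e) (g e))"
  by (rule dfn_app2) (unfold coh_def ev_def, intro dfns)

lemma family_set: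
  assumes "dfn (\<lambda>e. Q (e 0) (e (Suc 0)))"
  shows "\<exists>\<psi>. \<forall>x y. ps \<psi> x y \<longleftrightarrow> x \<in> elts M \<and> y \<in> elts PT \<and> Q x y"
proof -
  let ?S = "{q. \<exists>x y. q = pr x y \<and> x \<in> elts M \<and> y \<in> elts PT \<and> Q x y}"
  have "sm ?S"
    by (rule sm_Collect_sub[OF _ sm_prod[OF sm_elts[of M] sm_elts[of PT]]])
      (intro dfns dfn_app2[where R = Q, OF assms], blast)
  then obtain \<psi> where "elts \<psi> = ?S" unfolding sm_def by blast
  then have "\<forall>x y. ps \<psi> x y \<longleftrightarrow> x \<in> elts M \<and> y \<in> elts PT \<and> Q x y" by auto
  then show ?thesis by blast
qed

text \<open>By \<open>triple\<close>, almost every common point of \<open>x\<close> and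
  \<open>x'\<close> belongs to no further index in \<open>M\<close>. The value that
  \<open>x'\<close> dictates to \<open>x\<close> there meets no competition, so all demands can be
  satisfied at once.\<close>

lemma extend1:
  assumes M: "fin M" "elts M \<subseteq> elts IDX" "coh M \<psi>" and x: "x \<in> elts IDX" "x \<notin> elts M"
  shows "\<exists>\<psi>'. coh (ins x M) \<psi>' \<and> (\<forall>x'\<in>elts M. \<forall>y\<in>elts PT. ps \<psi>' x' y \<longleftrightarrow> ps \<psi> x' y)"
proof -
  have d: "dfn (\<lambda>e. (e 0 \<in> elts M \<and> ps \<psi> (e 0) (e (Suc 0))) \<or>
    (e 0 = x \<and> (\<exists>x2\<in>elts M. XX x2 (e (Suc 0)) \<and> (ps \<psi> x2 (e (Suc 0)) \<noteq> PH x x2))))" by (intro dfns)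
  obtain \<psi>' where \<psi>': "\<forall>x' y. ps \<psi>' x' y \<longleftrightarrow> x' \<in> elts (ins x M) \<and> y \<in> elts PT \<and> ((x' \<in> elts M \<and> ps \<psi> x' y) \<or>
    (x' = x \<and> (\<exists>x2\<in>elts M. XX x2 y \<and> (ps \<psi> x2 y \<noteq> PH x x2))))"
    using family_set[where M = "ins x M", OF d] by blast
  have old: "ps \<psi>' x' y \<longleftrightarrow> ps \<psi> x' y" if "x' \<in> elts M" "y \<in> elts PT" for x' y using that x(2) unfolding spec[OF spec[OF \<psi>']] by auto
  have new: "ps \<psi>' x y \<longleftrightarrow> (\<exists>x2\<in>elts M. XX x2 y \<and> (ps \<psi> x2 y \<noteq> PH x x2))" if "y \<in> elts PT" for y
    using that x(2) unfolding spec[OF spec[OF \<psi>']] by auto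
  have c: "ev (\<lambda>y. XX x y \<longrightarrow> XX x' y \<longrightarrow> ((ps \<psi>' x y \<noteq> ps \<psi>' x' y) \<longleftrightarrow> PH x x'))" if x': "x' \<in> elts M" for x'
  proof -
    have "ev (\<lambda>y. \<forall>z\<in>elts M. z \<noteq> x' \<longrightarrow> \<not> (XX x y \<and> XX x' y \<and> XX z y))"
    proof (rule ev_fin[OF M(1)])
      show "dfn (\<lambda>e. e 0 \<noteq> x' \<longrightarrow> \<not> (XX x (e (Suc 0)) \<and> XX x' (e (Suc 0)) \<and> XX (e 0) (e (Suc 0))))" by (intro dfns)
      fix z assume z: "z \<in> elts M"
      show "ev (\<lambda>y. z \<noteq> x' \<longrightarrow> \<not> (XX x y \<and> XX x' y \<and> XX z y))"
      proof (cases "z = x'")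
        case True then show ?thesis by (intro ev_all) blast
      next
        case False
        have "x \<noteq> x'" "x \<noteq> z" using x(2) x' z by blast+
        then have "ev (\<lambda>y. \<not> (XX x y \<and> XX x' y \<and> XX z y))"
          unfolding ev_def using triple[of x x' z] x(1) x' z M(2) False by blast
        then show ?thesis by (rule ev_mono) blast
      qed
    qed
    then show ?thesis
    proof (rule ev_mono)
      fix y assume y: "y \<in> elts PT" "\<forall>z\<in>elts M. z \<noteq> x' \<longrightarrow> \<not> (XX x y \<and> XX x' y \<and> XX z y)"
      show "XX x y \<longrightarrow> XX x' y \<longrightarrow> ((ps \<psi>' x y \<noteq> ps \<psi>' x' y) \<longleftrightarrow> PH x x')"
      proof (intro impI)
        assume h: "XX x y" "XX x' y"
        have "(\<exists>x2\<in>elts M. XX x2 y \<and> (ps \<psi> x2 y \<noteq> PH x x2)) \<longleftrightarrow> (ps \<psi> x' y \<noteq> PH x x')" 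
        proof -
          have u: "x2 = x'" if "x2 \<in> elts M" "XX x2 y" for x2 using bspec[OF y(2) that(1)] h that(2) by blast
          have "ps \<psi> x' y \<noteq> PH x x'" if "x2 \<in> elts M" "XX x2 y" "ps \<psi> x2 y \<noteq> PH x x2" for x2
            using u[OF that(1,2)] that(3) by simp
          then show ?thesis using h(2) x' by blast
        qed
        then show "(ps \<psi>' x y \<noteq> ps \<psi>' x' y) \<longleftrightarrow> PH x x'" unfolding new[OF y(1)] old[OF x' y(1)] by blast
      qed
    qed
  qed
  have "coh (ins x M) \<psi>'" unfolding coh_def
  proof (intro ballI)
    fix x1 x2 assume "x1 \<in> elts (ins x M)" "x2 \<in> elts (ins x M)"
    then consider "x1 \<in> elts M" "x2 \<in> elts M" | "x1 = x" "x2 = x" | "x1 = x" "x2 \<in> elts M" | "x1 \<in> elts M" "x2 = x" by auto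
    then show "ev (\<lambda>y. XX x1 y \<longrightarrow> XX x2 y \<longrightarrow> ((ps \<psi>' x1 y \<noteq> ps \<psi>' x2 y) \<longleftrightarrow> PH x1 x2))"
    proof cases
      case 1
      then have "ev (\<lambda>y. XX x1 y \<longrightarrow> XX x2 y \<longrightarrow> ((ps \<psi> x1 y \<noteq> ps \<psi> x2 y) \<longleftrightarrow> PH x1 x2))" using M(3) unfolding coh_def by blast
      then show ?thesis by (rule ev_mono) (simp only: old[OF 1(1)] old[OF 1(2)])
    next
      case 2
      then show ?thesis using PH_irrefl by (intro ev_all) simp
    next
      case 3
      then show ?thesis using c by blast
    next
      case 4
      have s: "PH x1 x \<longleftrightarrow> PH x x1" using PH_sym by blast
      show ?thesis unfolding 4(2) s by (rule ev_mono[OF c[OF 4(1)]]) blast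
    qed
  qed
  then show ?thesis using old by blast
qed

lemma extend:
  assumes J2: "fin J2" "elts J2 \<subseteq> elts IDX" "coh J2 \<psi>2" and J1: "fin J1" "elts J1 \<subseteq> elts IDX"
  shows "\<exists>\<psi>. coh (un J1 J2) \<psi> \<and> (\<forall>x\<in>elts J2. \<forall>y\<in>elts PT. ps \<psi> x y \<longleftrightarrow> ps \<psi>2 x y)"
proof -
  let ?P = "\<lambda>K. fin (un K J2) \<and> elts K \<subseteq> elts IDX \<and> (\<exists>\<psi>. coh (un K J2) \<psi> \<and> (\<forall>x\<in>elts J2. \<forall>y\<in>elts PT. ps \<psi> x y \<longleftrightarrow> ps \<psi>2 x y))"
  have "?P J1"
  proof (rule fin_induct[where P = ?P, OF _ J1(1)])
    show "dfn (\<lambda>e. ?P (e 0))" by (intro dfns)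
    show "?P emp" using J2 by (auto simp: un_emp)
    fix K x assume K: "elts K \<subseteq> elts J1" "x \<in> elts J1" "?P K"
    obtain \<psi> where \<psi>: "coh (un K J2) \<psi>" "\<forall>x\<in>elts J2. \<forall>y\<in>elts PT. ps \<psi> x y \<longleftrightarrow> ps \<psi>2 x y" using K(3) by blast
    have xI: "x \<in> elts IDX" using K(2) J1(2) by blast
    have f: "fin (un (ins x K) J2)" unfolding un_ins using K(3) fin_ins by blast
    have sub: "elts (ins x K) \<subseteq> elts IDX" using K(1,2) J1(2) by auto
    have "\<exists>\<psi>. coh (un (ins x K) J2) \<psi> \<and> (\<forall>x\<in>elts J2. \<forall>y\<in>elts PT. ps \<psi> x y \<longleftrightarrow> ps \<psi>2 x y)"
    proof (cases "x \<in> elts (un K J2)")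
      case True
      have "un (ins x K) J2 = un K J2" unfolding un_ins by (rule elts_inj) (use True in auto)
      then show ?thesis using \<psi> by (intro exI[of _ \<psi>]) simp
    next
      case False
      have s: "elts (un K J2) \<subseteq> elts IDX" using K(3) J2(2) by auto
      obtain \<psi>' where \<psi>': "coh (ins x (un K J2)) \<psi>'" "\<forall>x'\<in>elts (un K J2). \<forall>y\<in>elts PT. ps \<psi>' x' y \<longleftrightarrow> ps \<psi> x' y"
        using extend1[OF conjunct1[OF K(3)] s \<psi>(1) xI False] by blast
      then show ?thesis unfolding un_ins using \<psi>(2) by (intro exI[of _ \<psi>']) simp
    qed
    then show "?P (ins x K)" using f sub by blast
  qed
  then show ?thesis by blast
qed

text \<open>Two coherent families obey the same prescription, so at almost all points their
  difference is the same for all indices and is given by a set \<open>g\<close> of points. Points of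
  \<open>J0\<close> are removed from \<open>g\<close> altogether, and not just almost all of them,
  because the smaller world has to be fixed pointwise.\<close>

lemma glue:
  assumes M: "fin J0" "fin J1" "elts J0 \<subseteq> elts J1" "elts J1 \<subseteq> elts J3" and c: "coh J1 \<psi>1" "coh J3 \<psi>3"
    and agree: "\<And>x. x \<in> elts J0 \<Longrightarrow> ev (\<lambda>y. XX x y \<longrightarrow> (ps \<psi>1 x y \<longleftrightarrow> ps \<psi>3 x y))"
  shows "\<exists>g. elts g \<subseteq> elts PT \<and> (\<forall>x\<in>elts J0. \<forall>y\<in>elts g. \<not> XX x y) \<and>
    (\<forall>x\<in>elts J1. ev (\<lambda>y. XX x y \<longrightarrow> (y \<in> elts g \<longleftrightarrow> ps \<psi>3 x y \<noteq> ps \<psi>1 x y)))"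
proof -
  let ?S = "{y. y \<in> elts PT \<and> (\<exists>x\<in>elts J1. XX x y \<and> ps \<psi>3 x y \<noteq> ps \<psi>1 x y) \<and> \<not> (\<exists>x\<in>elts J0. XX x y)}"
  have "sm ?S" by (rule sm_Collect_sub[OF _ sm_elts[of PT]]) (intro dfns, simp)
  then obtain g where g: "elts g = ?S" unfolding sm_def by blast
  have "ev (\<lambda>y. XX x y \<longrightarrow> (y \<in> elts g \<longleftrightarrow> ps \<psi>3 x y \<noteq> ps \<psi>1 x y))" if x: "x \<in> elts J1" for x
  proof -
    have 1: "ev (\<lambda>y. \<forall>x'\<in>elts J1. XX x y \<longrightarrow> XX x' y \<longrightarrow> ((ps \<psi>1 x y \<noteq> ps \<psi>1 x' y) \<longleftrightarrow> PH x x'))"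
    proof (rule ev_fin[OF M(2)])
      show "dfn (\<lambda>e. XX x (e (Suc 0)) \<longrightarrow> XX (e 0) (e (Suc 0)) \<longrightarrow> ((ps \<psi>1 x (e (Suc 0)) \<noteq> ps \<psi>1 (e 0) (e (Suc 0))) \<longleftrightarrow> PH x (e 0)))"
        by (intro dfns)
    qed (use c(1) x in \<open>simp add: coh_def\<close>)
    have 3: "ev (\<lambda>y. \<forall>x'\<in>elts J1. XX x y \<longrightarrow> XX x' y \<longrightarrow> ((ps \<psi>3 x y \<noteq> ps \<psi>3 x' y) \<longleftrightarrow> PH x x'))"
    proof (rule ev_fin[OF M(2)])
      show "dfn (\<lambda>e. XX x (e (Suc 0)) \<longrightarrow> XX (e 0) (e (Suc 0)) \<longrightarrow> ((ps \<psi>3 x (e (Suc 0)) \<noteq> ps \<psi>3 (e 0) (e (Suc 0))) \<longleftrightarrow> PH x (e 0)))"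
        by (intro dfns)
      show "ev (\<lambda>y. XX x y \<longrightarrow> XX x' y \<longrightarrow> ((ps \<psi>3 x y \<noteq> ps \<psi>3 x' y) \<longleftrightarrow> PH x x'))" if "x' \<in> elts J1" for x'
        using c(2) subsetD[OF M(4) x] subsetD[OF M(4) that] unfolding coh_def by blast
    qed
    have 0: "ev (\<lambda>y. \<forall>x'\<in>elts J0. XX x' y \<longrightarrow> (ps \<psi>1 x' y \<longleftrightarrow> ps \<psi>3 x' y))"
    proof (rule ev_fin[OF M(1)])
      show "dfn (\<lambda>e. XX (e 0) (e (Suc 0)) \<longrightarrow> (ps \<psi>1 (e 0) (e (Suc 0)) \<longleftrightarrow> ps \<psi>3 (e 0) (e (Suc 0))))" by (intro dfns)
    qed (rule agree)
    show ?thesis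
    proof (rule ev_mono[OF ev_conj[OF 0 ev_conj[OF 1 3]]], intro impI)
      fix y assume y: "y \<in> elts PT" "XX x y"
        and h: "(\<forall>x'\<in>elts J0. XX x' y \<longrightarrow> (ps \<psi>1 x' y \<longleftrightarrow> ps \<psi>3 x' y)) \<and>
          (\<forall>x'\<in>elts J1. XX x y \<longrightarrow> XX x' y \<longrightarrow> ((ps \<psi>1 x y \<noteq> ps \<psi>1 x' y) \<longleftrightarrow> PH x x')) \<and>
          (\<forall>x'\<in>elts J1. XX x y \<longrightarrow> XX x' y \<longrightarrow> ((ps \<psi>3 x y \<noteq> ps \<psi>3 x' y) \<longleftrightarrow> PH x x'))"
      have same: "(ps \<psi>3 x y \<noteq> ps \<psi>1 x y) \<longleftrightarrow> (ps \<psi>3 x' y \<noteq> ps \<psi>1 x' y)" if "x' \<in> elts J1" "XX x' y" for x'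
      proof -
        have "(ps \<psi>1 x y \<noteq> ps \<psi>1 x' y) \<longleftrightarrow> PH x x'" "(ps \<psi>3 x y \<noteq> ps \<psi>3 x' y) \<longleftrightarrow> PH x x'" using h that y(2) by blast+
        then show ?thesis by blast
      qed
      show "y \<in> elts g \<longleftrightarrow> ps \<psi>3 x y \<noteq> ps \<psi>1 x y"
      proof (cases "\<exists>x0\<in>elts J0. XX x0 y")
        case True
        then obtain x0 where x0: "x0 \<in> elts J0" "XX x0 y" by blast
        then have "ps \<psi>1 x0 y \<longleftrightarrow> ps \<psi>3 x0 y" using h by blast
        moreover have "(ps \<psi>3 x y \<noteq> ps \<psi>1 x y) \<longleftrightarrow> (ps \<psi>3 x0 y \<noteq> ps \<psi>1 x0 y)" by (rule same) (use x0 M(3) in blast)+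
        moreover have "y \<notin> elts g" unfolding g using True by blast
        ultimately show ?thesis by blast
      next
        case False
        have "y \<in> elts g \<longleftrightarrow> (\<exists>x\<in>elts J1. XX x y \<and> ps \<psi>3 x y \<noteq> ps \<psi>1 x y)" unfolding g using False y(1) by blast
        also have "\<dots> \<longleftrightarrow> ps \<psi>3 x y \<noteq> ps \<psi>1 x y"
        proof
          assume "\<exists>x\<in>elts J1. XX x y \<and> ps \<psi>3 x y \<noteq> ps \<psi>1 x y"
          then obtain x' where "x' \<in> elts J1" "XX x' y" "ps \<psi>3 x' y \<noteq> ps \<psi>1 x' y" by blast
          then show "ps \<psi>3 x y \<noteq> ps \<psi>1 x y" using same by blast
        qed (use x y(2) in blast)
        finally show ?thesis .
      qed
    qed
  qed
  then show ?thesis by (intro exI[of _ g]) (use g in blast)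
qed


text \<open>Atoms: a label for every index and every point, a pair of socks for every point, and for every
  index \<open>x\<close> the goods \<open>gd x f\<close> that choose a sock for each point of \<open>XX x\<close>.\<close>

definition lX :: "nat \<Rightarrow> nat" where "lX x = pr emp (pr emp (pr (tg 0) x))"

definition lY :: "nat \<Rightarrow> nat" where "lY y = pr emp (pr emp (pr (tg 1) y))"

definition sk :: "nat \<Rightarrow> bool \<Rightarrow> nat" where
  "sk y b = pr emp (pr (up (lY y) (lY y)) (pr (tg 2) (pr y (if b then tg 1 else tg 0))))"

definition gc :: "nat \<Rightarrow> nat \<Rightarrow> nat" where
  "gc x f = st {s. s = lX x \<or> (\<exists>y\<in>elts PT. XX x y \<and> s = sk y (y \<in> elts f))}"

definition gd :: "nat \<Rightarrow> nat \<Rightarrow> nat" where "gd x f = pr emp (pr (gc x f) (pr (tg 3) (pr x f)))"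

lemma atom_inj [simp]:
  "lX x = lX x' \<longleftrightarrow> x = x'" "lY y = lY y' \<longleftrightarrow> y = y'" "sk y b = sk y' b' \<longleftrightarrow> y = y' \<and> b = b'"
  "gd x f = gd x' f' \<longleftrightarrow> x = x' \<and> f = f'"
  "lX x \<noteq> lY y" "lX x \<noteq> sk y b" "lX x \<noteq> gd x' f" "lY y \<noteq> sk y' b" "lY y \<noteq> gd x f" "sk y b \<noteq> gd x f"
  "lY y \<noteq> lX x" "sk y b \<noteq> lX x" "gd x' f \<noteq> lX x" "sk y' b \<noteq> lY y" "gd x f \<noteq> lY y" "gd x f \<noteq> sk y b"
  unfolding lX_def lY_def sk_def gd_def by auto

lemma dfnf_labels [dfns]: "dfnf f \<Longrightarrow> dfnf (\<lambda>e. lX (f e))" "dfnf f \<Longrightarrow> dfnf (\<lambda>e. lY (f e))"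
  unfolding lX_def lY_def by (intro dfns; assumption)+

lemma dfnf_sk [dfns]:
  assumes "dfnf f" "dfn P"
  shows "dfnf (\<lambda>e. sk (f e) (P e))"
proof -
  have c: "dfnf (\<lambda>e. sk (f (\<lambda>n. e (Suc n))) b)" for b unfolding sk_def by (intro dfns dfnf_shift[OF assms(1)])
  have "dfn (\<lambda>e. (P (\<lambda>n. e (Suc n)) \<and> e 0 = sk (f (\<lambda>n. e (Suc n))) True) \<or>
    (\<not> P (\<lambda>n. e (Suc n)) \<and> e 0 = sk (f (\<lambda>n. e (Suc n))) False))"
    by (intro dfns c dfn_shift[OF assms(2)])
  then have "dfn (\<lambda>e. e 0 = sk (f (\<lambda>n. e (Suc n))) (P (\<lambda>n. e (Suc n))))"
    by (rule back_subst[of dfn]) (auto simp: fun_eq_iff)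
  then show ?thesis unfolding dfnf_def .
qed

lemma elts_gc: "elts (gc x f) = {s. s = lX x \<or> (\<exists>y\<in>elts PT. XX x y \<and> s = sk y (y \<in> elts f))}"
proof -
  have d: "dfn (\<lambda>e. XX x (e (Suc 0)) \<and> e 0 = sk (e (Suc 0)) (e (Suc 0) \<in> elts f))" by (intro dfns)
  have "sm (insert (lX x) {s. \<exists>y\<in>elts PT. XX x y \<and> s = sk y (y \<in> elts f)})"
    by (rule sm_insert[OF sm_rel_image[where Q = "\<lambda>s y. XX x y \<and> s = sk y (y \<in> elts f)", OF d]]) simp
  moreover have "insert (lX x) {s. \<exists>y\<in>elts PT. XX x y \<and> s = sk y (y \<in> elts f)} =
    {s. s = lX x \<or> (\<exists>y\<in>elts PT. XX x y \<and> s = sk y (y \<in> elts f))}" by blast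
  ultimately show ?thesis unfolding gc_def by (intro elts_st) simp
qed

lemma dfnf_gd [dfns]: "dfnf f \<Longrightarrow> dfnf g \<Longrightarrow> dfnf (\<lambda>e. gd (f e) (g e))"
proof -
  have d: "dfn (\<lambda>e. e 0 = gc (e (Suc 0)) (e (Suc (Suc 0))))" by (subst eq_iff_elts, unfold elts_gc, intro dfns)
  show "dfnf f \<Longrightarrow> dfnf g \<Longrightarrow> dfnf (\<lambda>e. gd (f e) (g e))" unfolding gd_def by (intro dfns dfnf_app2[where F = gc, OF d])
qed

definition lab :: "nat \<Rightarrow> bool" where
  "lab a \<longleftrightarrow> (\<exists>x\<in>elts IDX. a = lX x) \<or> (\<exists>y\<in>elts PT. a = lY y)"

definition gset :: "nat \<Rightarrow> nat \<Rightarrow> bool" where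
  "gset x f \<longleftrightarrow> elts f \<subseteq> elts PT \<and> (\<forall>y\<in>elts f. XX x y)"

lemma lab_dfn [dfns]: "dfnf f \<Longrightarrow> dfn (\<lambda>e. lab (f e))"
  by (rule dfn_app1) (unfold lab_def, intro dfns)

lemma gset_dfn [dfns]: "dfnf f \<Longrightarrow> dfnf g \<Longrightarrow> dfn (\<lambda>e. gset (f e) (g e))"
  by (rule dfn_app2) (unfold gset_def, intro dfns)

lemma lab_simps [simp]: "\<not> lab (sk y b)" "\<not> lab (gd x f)"
  unfolding lab_def by simp_all

definition AT :: nat where
  "AT = st {a. lab a \<or> (\<exists>y\<in>elts PT. \<exists>b. a = sk y b) \<or> (\<exists>x\<in>elts IDX. \<exists>f. gset x f \<and> a = gd x f)}"

lemma elts_AT: "elts AT = {a. lab a \<or> (\<exists>y\<in>elts PT. \<exists>b. a = sk y b) \<or> (\<exists>x\<in>elts IDX. \<exists>f. gset x f \<and> a = gd x f)}"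
proof -
  have d: "dfn (\<lambda>e. e 0 = lX (e (Suc 0)))" "dfn (\<lambda>e. e 0 = lY (e (Suc 0)))" "dfn (\<lambda>e. e 0 = sk (e (Suc 0)) True)"
    "dfn (\<lambda>e. e 0 = sk (e (Suc 0)) False)" "dfn (\<lambda>e. \<exists>x f. e (Suc 0) = pr x f \<and> e 0 = gd x f)" by (intro dfns)+
  let ?P = "{pr x f |x f. x \<in> elts IDX \<and> f \<in> elts (Pw PT)}"
  have "sm ?P" by (intro sm_prod sm_elts)
  then obtain q where q: "elts q = ?P" unfolding sm_def by blast
  have g: "sm {a. \<exists>z\<in>elts q. \<exists>x f. z = pr x f \<and> a = gd x f}"
    by (rule sm_rel_image[where Q = "\<lambda>a z. \<exists>x f. z = pr x f \<and> a = gd x f", OF d(5)]) auto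
  have s: "sm (lX ` elts IDX \<union> (lY ` elts PT \<union> ((\<lambda>y. sk y True) ` elts PT \<union> ((\<lambda>y. sk y False) ` elts PT \<union>
    {a. \<exists>z\<in>elts q. \<exists>x f. z = pr x f \<and> a = gd x f}))))"
    by (intro sm_Un g sm_image[OF sm_elts d(1)] sm_image[OF sm_elts d(2)] sm_image[OF sm_elts d(3)] sm_image[OF sm_elts d(4)])
  have "sm {a. lab a \<or> (\<exists>y\<in>elts PT. \<exists>b. a = sk y b) \<or> (\<exists>x\<in>elts IDX. \<exists>f. gset x f \<and> a = gd x f)}"
  proof (rule sm_Collect_sub[OF _ s])
    show "dfn (\<lambda>e. lab (e 0) \<or> (\<exists>y\<in>elts PT. \<exists>b. e 0 = sk y b) \<or> (\<exists>x\<in>elts IDX. \<exists>f. gset x f \<and> e 0 = gd x f))"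
      by (intro dfns)
    fix z assume "lab z \<or> (\<exists>y\<in>elts PT. \<exists>b. z = sk y b) \<or> (\<exists>x\<in>elts IDX. \<exists>f. gset x f \<and> z = gd x f)"
    then consider "lab z" | y b where "y \<in> elts PT" "z = sk y b" | x f where "x \<in> elts IDX" "gset x f" "z = gd x f" by blast
    then show "z \<in> lX ` elts IDX \<union> (lY ` elts PT \<union> ((\<lambda>y. sk y True) ` elts PT \<union> ((\<lambda>y. sk y False) ` elts PT \<union>
      {a. \<exists>z\<in>elts q. \<exists>x f. z = pr x f \<and> a = gd x f})))"
    proof cases
      case 1 then show ?thesis unfolding lab_def by blast
    next
      case 2 then show ?thesis by (cases b) auto
    next
      case 3
      then have "pr x f \<in> elts q" unfolding q gset_def by auto
      then show ?thesis using 3(3) by blast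
    qed
  qed
  then show ?thesis unfolding AT_def by (rule elts_st)
qed

lemma AT_cases:
  assumes "a \<in> elts AT"
  obtains "lab a" | y b where "y \<in> elts PT" "a = sk y b" | x f where "x \<in> elts IDX" "gset x f" "a = gd x f"
  using assms unfolding elts_AT by blast

lemma AT_intros:
  "lab a \<Longrightarrow> a \<in> elts AT" "y \<in> elts PT \<Longrightarrow> sk y b \<in> elts AT" "x \<in> elts IDX \<Longrightarrow> gset x f \<Longrightarrow> gd x f \<in> elts AT"
  "x \<in> elts IDX \<Longrightarrow> lX x \<in> elts AT" "y \<in> elts PT \<Longrightarrow> lY y \<in> elts AT"
  unfolding elts_AT lab_def by blast+

sublocale atoms E AT
proof
  fix a assume "a \<in> elts AT"
  then show "\<exists>c t. a = pr emp (pr c t) \<and> elts c \<subseteq> elts AT"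
  proof (cases rule: AT_cases)
    case 1
    then have "\<exists>t. a = pr emp (pr emp t)" unfolding lab_def lX_def lY_def by blast
    then show ?thesis by force
  next
    case (2 y b)
    have "elts (up (lY y) (lY y)) \<subseteq> elts AT" using AT_intros(5)[OF 2(1)] by simp
    then show ?thesis unfolding 2(2) sk_def by blast
  next
    case (3 x f)
    have "elts (gc x f) \<subseteq> elts AT" unfolding elts_gc using AT_intros(4)[OF 3(1)] AT_intros(2) by blast
    then show ?thesis unfolding 3(3) gd_def by blast
  qed
qed

lemma core_simps [simp]: "core (lX x) = emp" "core (lY y) = emp" "core (sk y b) = up (lY y) (lY y)" "core (gd x f) = gc x f"
  unfolding lX_def lY_def sk_def gd_def by simp_all

lemma core_lab: "lab a \<Longrightarrow> core a = emp"
  unfolding lab_def by auto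

section \<open>Exchanging socks as an automorphism of the atoms\<close>

definition fl :: "nat \<Rightarrow> nat \<Rightarrow> nat \<Rightarrow> nat" where
  "fl g x f = st {y. y \<in> elts PT \<and> XX x y \<and> (y \<in> elts f) \<noteq> (y \<in> elts g)}"

lemma elts_fl: "elts (fl g x f) = {y. y \<in> elts PT \<and> XX x y \<and> (y \<in> elts f) \<noteq> (y \<in> elts g)}"
proof -
  have "sm {y. y \<in> elts PT \<and> XX x y \<and> (y \<in> elts f) \<noteq> (y \<in> elts g)}"
    by (rule sm_Collect_sub[OF _ sm_elts[of PT]]) (intro dfns, simp)
  then show ?thesis unfolding fl_def by (rule elts_st)
qed

lemma dfnf_fl [dfns]: "dfnf f \<Longrightarrow> dfnf h \<Longrightarrow> dfnf (\<lambda>e. fl g (f e) (h e))"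
  by (rule dfnf_app2, subst eq_iff_elts, unfold elts_fl, intro dfns)

lemma gset_fl: "gset x (fl g x f)"
  unfolding gset_def elts_fl by blast

lemma fl_fl: "gset x f \<Longrightarrow> fl g x (fl g x f) = f"
  unfolding gset_def by (rule elts_inj) (auto simp: elts_fl)

text \<open>The two socks of each point in \<open>g\<close> are exchanged, and the goods move along
  so that they contain the exchanged socks. Labels stay fixed, hence so do the sets of
  labels.\<close>

definition flip :: "nat \<Rightarrow> nat \<Rightarrow> nat \<Rightarrow> bool" where
  "flip g a a' \<longleftrightarrow> (lab a \<and> a' = a) \<or> (\<exists>y\<in>elts PT. \<exists>b. a = sk y b \<and> a' = sk y (b \<noteq> (y \<in> elts g))) \<or>
    (\<exists>x\<in>elts IDX. \<exists>f. gset x f \<and> a = gd x f \<and> a' = gd x (fl g x f))"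

lemma flip_cases:
  assumes "flip g a a'"
  obtains "lab a" "a' = a" | y b where "y \<in> elts PT" "a = sk y b" "a' = sk y (b \<noteq> (y \<in> elts g))"
  | x f where "x \<in> elts IDX" "gset x f" "a = gd x f" "a' = gd x (fl g x f)"
  using assms unfolding flip_def by blast

lemma flip_intros:
  "lab a \<Longrightarrow> flip g a a" "y \<in> elts PT \<Longrightarrow> flip g (sk y b) (sk y (b \<noteq> (y \<in> elts g)))"
  "x \<in> elts IDX \<Longrightarrow> gset x f \<Longrightarrow> flip g (gd x f) (gd x (fl g x f))"
  unfolding flip_def by blast+

lemma flip_sym: "flip g a b \<Longrightarrow> flip g b a"
proof (erule flip_cases)
  assume "lab a" "b = a" then show ?thesis using flip_intros(1) by simp
next
  fix y c assume *: "y \<in> elts PT" "a = sk y c" "b = sk y (c \<noteq> (y \<in> elts g))"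
  have "((c \<noteq> (y \<in> elts g)) \<noteq> (y \<in> elts g)) = c" by blast
  then show ?thesis using flip_intros(2)[OF *(1), of g "c \<noteq> (y \<in> elts g)"] unfolding *(2,3) by simp
next
  fix x f assume *: "x \<in> elts IDX" "gset x f" "a = gd x f" "b = gd x (fl g x f)"
  show ?thesis using flip_intros(3)[OF *(1) gset_fl, of g g f] unfolding *(3,4) fl_fl[OF *(2)] .
qed

lemma flip_fun: "flip g a b \<Longrightarrow> flip g a b' \<Longrightarrow> b = b'"
  by (erule flip_cases; erule flip_cases) auto

lemma flip_atom: "flip g a b \<Longrightarrow> a \<in> elts AT"
  by (erule flip_cases) (auto intro: AT_intros)

lemma flip_total: "a \<in> elts AT \<Longrightarrow> \<exists>b. flip g a b"
  by (erule AT_cases) (blast intro: flip_intros)+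

lemma flip_forth:
  assumes "flip g a b" "a' \<in> elts (core a)"
  shows "\<exists>b'\<in>elts (core b). flip g a' b'"
  using assms(1)
proof (cases rule: flip_cases)
  case 1
  then show ?thesis using assms(2) core_lab by simp
next
  case (2 y c)
  have "lab (lY y)" unfolding lab_def using 2(1) by blast
  then show ?thesis using assms(2) 2 flip_intros(1) by simp
next
  case (3 x f)
  have "a' = lX x \<or> (\<exists>y\<in>elts PT. XX x y \<and> a' = sk y (y \<in> elts f))" using assms(2) unfolding 3(3) core_simps elts_gc by blast
  then show ?thesis
  proof
    assume a': "a' = lX x"
    have "lab (lX x)" unfolding lab_def using 3(1) by blast
    then show ?thesis unfolding a' 3(4) core_simps elts_gc using flip_intros(1) by blast
  next
    assume "\<exists>y\<in>elts PT. XX x y \<and> a' = sk y (y \<in> elts f)"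
    then obtain y where y: "y \<in> elts PT" "XX x y" "a' = sk y (y \<in> elts f)" by blast
    have e: "((y \<in> elts f) \<noteq> (y \<in> elts g)) = (y \<in> elts (fl g x f))" unfolding elts_fl using y by blast
    have "flip g a' (sk y (y \<in> elts (fl g x f)))" unfolding y(3) e[symmetric] by (rule flip_intros(2)[OF y(1)])
    then show ?thesis unfolding 3(4) core_simps elts_gc using y(1,2) by blast
  qed
qed

lemma flip_dfn: "dfn (\<lambda>e. flip g (e 0) (e (Suc 0)))"
  unfolding flip_def by (intro dfns)

lemma flip_auto: "auto E AT (flip g)"
proof
  show "dfn (\<lambda>e. flip g (e 0) (e (Suc 0)))" by (rule flip_dfn)
  show "a \<in> elts AT \<and> b \<in> elts AT" if "flip g a b" for a b using flip_atom that flip_sym by blast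
  show "b = b'" if "flip g a b" "flip g a b'" for a b b' by (rule flip_fun[OF that])
  show "a = a'" if "flip g a b" "flip g a' b" for a a' b by (rule flip_fun[OF flip_sym[OF that(1)] flip_sym[OF that(2)]])
  show "\<exists>b. flip g a b" if "a \<in> elts AT" for a by (rule flip_total[OF that])
  show "\<exists>a. flip g a b" if "b \<in> elts AT" for b using flip_total[OF that] flip_sym by blast
  show "\<exists>b'\<in>elts (core b). flip g a' b'" if "flip g a b" "a' \<in> elts (core a)" for a b a' by (rule flip_forth[OF that])
  show "\<exists>a'\<in>elts (core a). flip g a' b'" if "flip g a b" "b' \<in> elts (core b)" for a b b'
    using flip_forth[OF flip_sym[OF that(1)] that(2)] flip_sym by blast
qed

definition win :: "nat \<Rightarrow> nat \<Rightarrow> nat \<Rightarrow> bool" where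
  "win M \<psi> a \<longleftrightarrow> lab a \<or> (\<exists>y\<in>elts PT. \<exists>b. (\<exists>x\<in>elts M. XX x y) \<and> a = sk y b) \<or>
    (\<exists>x\<in>elts M. \<exists>f. gset x f \<and> ev (\<lambda>y. XX x y \<longrightarrow> (y \<in> elts f \<longleftrightarrow> ps \<psi> x y)) \<and> a = gd x f)"

lemma win_simps:
  "lab a \<Longrightarrow> win M \<psi> a" "win M \<psi> (sk y b) \<longleftrightarrow> y \<in> elts PT \<and> (\<exists>x\<in>elts M. XX x y)"
  "win M \<psi> (gd x f) \<longleftrightarrow> x \<in> elts M \<and> gset x f \<and> ev (\<lambda>y. XX x y \<longrightarrow> (y \<in> elts f \<longleftrightarrow> ps \<psi> x y))"
  unfolding win_def by auto

lemma win_cases: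
  assumes "win M \<psi> a"
  obtains "lab a" | y b x where "y \<in> elts PT" "x \<in> elts M" "XX x y" "a = sk y b"
  | x f where "x \<in> elts M" "gset x f" "ev (\<lambda>y. XX x y \<longrightarrow> (y \<in> elts f \<longleftrightarrow> ps \<psi> x y))" "a = gd x f"
  using assms unfolding win_def by blast

lemma win_dfn: "dfnf f \<Longrightarrow> dfnf g \<Longrightarrow> dfnf h \<Longrightarrow> dfn (\<lambda>e. win (f e) (g e) (h e))"
  by (rule dfn_app3) (unfold win_def ev_def, intro dfns)

lemma win_atom: "elts M \<subseteq> elts IDX \<Longrightarrow> win M \<psi> a \<Longrightarrow> a \<in> elts AT"
  by (erule win_cases) (auto intro: AT_intros)

lemma world_set:
  assumes "elts M \<subseteq> elts IDX"
  shows "\<exists>w. \<forall>a. a \<in> elts w \<longleftrightarrow> win M \<psi> a"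
proof -
  have "sm {a. win M \<psi> a}"
    by (rule sm_Collect_sub[OF _ sm_elts[of AT]]) (intro dfns win_dfn, rule win_atom[OF assms])
  then show ?thesis unfolding sm_def by blast
qed

definition isw :: "nat \<Rightarrow> nat \<Rightarrow> nat \<Rightarrow> bool" where
  "isw w M \<psi> \<longleftrightarrow> fin M \<and> elts M \<subseteq> elts IDX \<and> coh M \<psi> \<and> (\<forall>a. a \<in> elts w \<longleftrightarrow> win M \<psi> a)"

definition WW :: "nat \<Rightarrow> bool" where "WW w \<longleftrightarrow> (\<exists>M \<psi>. isw w M \<psi>)"

lemma win_flip:
  assumes M: "elts M \<subseteq> elts IDX" and ps: "\<And>x y. x \<in> elts M \<Longrightarrow> y \<in> elts PT \<Longrightarrow> ps \<psi>' x y \<longleftrightarrow> (ps \<psi> x y \<noteq> (y \<in> elts g))"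
    and a: "win M \<psi> a" "flip g a b"
  shows "win M \<psi>' b"
  using a(2)
proof (cases rule: flip_cases)
  case 1
  then show ?thesis by (simp add: win_simps(1))
next
  case (2 y c)
  then show ?thesis using a(1) by (simp add: win_simps(2))
next
  case (3 x f)
  then have x: "x \<in> elts M" "ev (\<lambda>y. XX x y \<longrightarrow> (y \<in> elts f \<longleftrightarrow> ps \<psi> x y))" using a(1) by (simp_all add: win_simps(3))
  have "ev (\<lambda>y. XX x y \<longrightarrow> (y \<in> elts (fl g x f) \<longleftrightarrow> ps \<psi>' x y))"
    by (rule ev_mono[OF x(2)]) (auto simp: elts_fl ps[OF x(1)])
  then show ?thesis unfolding 3(4) win_simps using x(1) gset_fl by blast
qed

lemma win_cong:
  assumes "\<And>x y. x \<in> elts M \<Longrightarrow> y \<in> elts PT \<Longrightarrow> ps \<psi>' x y \<longleftrightarrow> ps \<psi> x y" and "win M \<psi> a"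
  shows "win M \<psi>' a"
  using assms(2)
proof (cases rule: win_cases)
  case (3 x f)
  have "ev (\<lambda>y. XX x y \<longrightarrow> (y \<in> elts f \<longleftrightarrow> ps \<psi>' x y))"
    by (rule ev_mono[OF 3(3)]) (simp only: assms(1)[OF 3(1)])
  then show ?thesis using 3 by (simp add: win_simps)
next
  case (2 y b x)
  then show ?thesis by (auto simp: win_simps)
qed (simp add: win_simps(1))

lemma WW_flip:
  assumes w: "WW w" and w': "\<And>b. b \<in> elts w' \<longleftrightarrow> (\<exists>a\<in>elts w. flip g a b)"
  shows "WW w'"
proof -
  obtain M \<psi> where M: "fin M" "elts M \<subseteq> elts IDX" "coh M \<psi>" "\<And>a. a \<in> elts w \<longleftrightarrow> win M \<psi> a" using w unfolding WW_def isw_def by blast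
  have d: "dfn (\<lambda>e. ps \<psi> (e 0) (e (Suc 0)) \<noteq> (e (Suc 0) \<in> elts g))" by (intro dfns)
  obtain \<psi>' where \<psi>': "\<forall>x y. ps \<psi>' x y \<longleftrightarrow> x \<in> elts M \<and> y \<in> elts PT \<and> (ps \<psi> x y \<noteq> (y \<in> elts g))"
    using family_set[where M = M, OF d] by blast
  have p: "ps \<psi>' x y \<longleftrightarrow> (ps \<psi> x y \<noteq> (y \<in> elts g))" if "x \<in> elts M" "y \<in> elts PT" for x y
    using that unfolding spec[OF spec[OF \<psi>']] by blast
  have p': "ps \<psi> x y \<longleftrightarrow> (ps \<psi>' x y \<noteq> (y \<in> elts g))" if "x \<in> elts M" "y \<in> elts PT" for x y
    using p[OF that] by blast
  have "coh M \<psi>'" unfolding coh_def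
  proof (intro ballI)
    fix x x' assume x: "x \<in> elts M" "x' \<in> elts M"
    then have "ev (\<lambda>y. XX x y \<longrightarrow> XX x' y \<longrightarrow> ((ps \<psi> x y \<noteq> ps \<psi> x' y) \<longleftrightarrow> PH x x'))" using M(3) unfolding coh_def by blast
    then show "ev (\<lambda>y. XX x y \<longrightarrow> XX x' y \<longrightarrow> ((ps \<psi>' x y \<noteq> ps \<psi>' x' y) \<longleftrightarrow> PH x x'))"
    proof (rule ev_mono)
      fix y assume y: "y \<in> elts PT" "XX x y \<longrightarrow> XX x' y \<longrightarrow> ((ps \<psi> x y \<noteq> ps \<psi> x' y) \<longleftrightarrow> PH x x')"
      show "XX x y \<longrightarrow> XX x' y \<longrightarrow> ((ps \<psi>' x y \<noteq> ps \<psi>' x' y) \<longleftrightarrow> PH x x')"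
        unfolding p[OF x(1) y(1)] p[OF x(2) y(1)] using y(2) by argo
    qed
  qed
  moreover have "b \<in> elts w' \<longleftrightarrow> win M \<psi>' b" for b
  proof
    assume "b \<in> elts w'"
    then obtain a where a: "win M \<psi> a" "flip g a b" using w' M(4) by blast
    show "win M \<psi>' b" by (rule win_flip[OF M(2) p a])
  next
    assume b: "win M \<psi>' b"
    obtain a where a: "flip g b a" using flip_total win_atom[OF M(2) b] by blast
    have "win M \<psi> a" by (rule win_flip[OF M(2) p' b a])
    then show "b \<in> elts w'" using w' M(4) flip_sym[OF a] by blast
  qed
  ultimately show ?thesis unfolding WW_def isw_def using M(1,2) by blast
qed

lemma WW_flip_iff:
  assumes v: "elts v \<subseteq> elts AT" and v': "elts v' = {b. \<exists>a\<in>elts v. flip g a b}"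
  shows "WW v = WW v'"
proof
  assume "WW v" then show "WW v'" by (rule WW_flip) (use v' in blast)
next
  assume "WW v'"
  then show "WW v"
  proof (rule WW_flip)
    fix a
    show "a \<in> elts v \<longleftrightarrow> (\<exists>b\<in>elts v'. flip g b a)"
    proof
      assume a: "a \<in> elts v"
      then obtain b where "flip g a b" using flip_total v by blast
      then show "\<exists>b\<in>elts v'. flip g b a" using a v' flip_sym by blast
    next
      assume "\<exists>b\<in>elts v'. flip g b a"
      then obtain a' b where "a' \<in> elts v" "flip g a' b" "flip g b a" unfolding v' by blast
      then show "a \<in> elts v" using flip_fun[OF flip_sym[of g a' b], of a] by blast
    qed
  qed
qed

text \<open>The good that copies \<psi> at \<open>x\<close> exactly belongs to the smaller world;
  its presence in the larger one forces the two families to agree almost everywhere on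
  \<open>XX x\<close>.\<close>

lemma win_sub:
  assumes sub: "\<And>a. win M \<psi> a \<Longrightarrow> win M' \<psi>' a" and x: "x \<in> elts M"
  shows "x \<in> elts M'" "ev (\<lambda>y. XX x y \<longrightarrow> (ps \<psi> x y \<longleftrightarrow> ps \<psi>' x y))"
proof -
  have "sm {y. y \<in> elts PT \<and> XX x y \<and> ps \<psi> x y}" by (rule sm_Collect_sub[OF _ sm_elts[of PT]]) (intro dfns, simp)
  then obtain f where f: "elts f = {y. y \<in> elts PT \<and> XX x y \<and> ps \<psi> x y}" unfolding sm_def by blast
  have e: "ev (\<lambda>y. XX x y \<longrightarrow> (y \<in> elts f \<longleftrightarrow> ps \<psi> x y))" by (rule ev_all) (simp add: f)
  have "gset x f" unfolding gset_def f by blast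
  then have "win M \<psi> (gd x f)" unfolding win_simps using x e by blast
  then have "win M' \<psi>' (gd x f)" by (rule sub)
  then have w: "x \<in> elts M'" "ev (\<lambda>y. XX x y \<longrightarrow> (y \<in> elts f \<longleftrightarrow> ps \<psi>' x y))" unfolding win_simps by blast+
  show "x \<in> elts M'" by (rule w(1))
  show "ev (\<lambda>y. XX x y \<longrightarrow> (ps \<psi> x y \<longleftrightarrow> ps \<psi>' x y))" by (rule ev_mono[OF ev_conj[OF e w(2)]]) blast
qed

lemma world_amalgamation:
  assumes WW: "WW w" "WW w1" "WW w2" and sub: "elts w \<subseteq> elts w1" "elts w \<subseteq> elts w2"
  shows "\<exists>G w3. auto E AT G \<and> (\<forall>v v'. elts v \<subseteq> elts AT \<longrightarrow> elts v' = {b. \<exists>a\<in>elts v. G a b} \<longrightarrow> WW v = WW v') \<and>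
        (\<forall>a\<in>elts w. G a a) \<and> WW w3 \<and> elts w2 \<subseteq> elts w3 \<and> (\<forall>a b. a \<in> elts w1 \<longrightarrow> G a b \<longrightarrow> b \<in> elts w3)"
proof -
  obtain M0 \<psi>0 where M0: "fin M0" "elts M0 \<subseteq> elts IDX" "coh M0 \<psi>0" "\<And>a. a \<in> elts w \<longleftrightarrow> win M0 \<psi>0 a" using WW(1) unfolding WW_def isw_def by blast
  obtain M1 \<psi>1 where M1: "fin M1" "elts M1 \<subseteq> elts IDX" "coh M1 \<psi>1" "\<And>a. a \<in> elts w1 \<longleftrightarrow> win M1 \<psi>1 a" using WW(2) unfolding WW_def isw_def by blast
  obtain M2 \<psi>2 where M2: "fin M2" "elts M2 \<subseteq> elts IDX" "coh M2 \<psi>2" "\<And>a. a \<in> elts w2 \<longleftrightarrow> win M2 \<psi>2 a" using WW(3) unfolding WW_def isw_def by blast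
  have s1: "win M1 \<psi>1 a" if "win M0 \<psi>0 a" for a using that sub(1) M0(4) M1(4) by blast
  have s2: "win M2 \<psi>2 a" if "win M0 \<psi>0 a" for a using that sub(2) M0(4) M2(4) by blast
  \<comment> \<open>The indices of \<open>w1\<close> are added to \<open>w2\<close> without regard
    to the goods that \<open>w1\<close> has chosen for them.\<close>
  obtain \<psi>3 where \<psi>3: "coh (un M1 M2) \<psi>3" "\<forall>x\<in>elts M2. \<forall>y\<in>elts PT. ps \<psi>3 x y \<longleftrightarrow> ps \<psi>2 x y"
    using extend[OF M2(1-3) M1(1,2)] by blast
  let ?M3 = "un M1 M2"
  have M3: "fin ?M3" "elts ?M3 \<subseteq> elts IDX" using fin_un[OF M1(1) M2(1)] M1(2) M2(2) by auto
  have sM: "elts M0 \<subseteq> elts M1" "elts M1 \<subseteq> elts ?M3" using win_sub(1)[OF s1] by auto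
  have agree: "ev (\<lambda>y. XX x y \<longrightarrow> (ps \<psi>1 x y \<longleftrightarrow> ps \<psi>3 x y))" if x: "x \<in> elts M0" for x
  proof -
    have x2: "x \<in> elts M2" by (rule win_sub(1)[OF s2 x])
    show ?thesis
    proof (rule ev_mono[OF ev_conj[OF win_sub(2)[OF s1 x] win_sub(2)[OF s2 x]]])
      fix y assume y: "y \<in> elts PT" "(XX x y \<longrightarrow> (ps \<psi>0 x y \<longleftrightarrow> ps \<psi>1 x y)) \<and> (XX x y \<longrightarrow> (ps \<psi>0 x y \<longleftrightarrow> ps \<psi>2 x y))"
      have "ps \<psi>3 x y \<longleftrightarrow> ps \<psi>2 x y" using \<psi>3(2) x2 y(1) by blast
      then show "XX x y \<longrightarrow> (ps \<psi>1 x y \<longleftrightarrow> ps \<psi>3 x y)" using y(2) by blast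
    qed
  qed
  \<comment> \<open>The exchange along \<open>g\<close> corrects this choice: it carries the goods
    of \<open>w1\<close> to those prescribed by \<open>\<psi>3\<close> and leaves \<open>w\<close>
    alone.\<close>
  obtain g where g: "elts g \<subseteq> elts PT" "\<forall>x\<in>elts M0. \<forall>y\<in>elts g. \<not> XX x y"
    "\<forall>x\<in>elts M1. ev (\<lambda>y. XX x y \<longrightarrow> (y \<in> elts g \<longleftrightarrow> ps \<psi>3 x y \<noteq> ps \<psi>1 x y))"
    using glue[OF M0(1) M1(1) sM M1(3) \<psi>3(1) agree] by blast
  obtain w3 where w3: "\<forall>a. a \<in> elts w3 \<longleftrightarrow> win ?M3 \<psi>3 a" using world_set[OF M3(2)] by blast
  have WW3: "WW w3" unfolding WW_def isw_def using M3 \<psi>3(1) w3 by blast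
  have fix0: "flip g a a" if "a \<in> elts w" for a
  proof -
    have "win M0 \<psi>0 a" using that M0(4) by blast
    then show ?thesis
    proof (cases rule: win_cases)
      case 1
      then show ?thesis by (rule flip_intros(1))
    next
      case (2 y b x)
      then have "y \<notin> elts g" using g(2) by blast
      then show ?thesis using flip_intros(2)[OF 2(1), of g b] unfolding 2(4) by simp
    next
      case (3 x f)
      have "y \<notin> elts g" if "XX x y" for y using that g(2) 3(1) by blast
      then have "fl g x f = f" using 3(2) unfolding gset_def by (intro elts_inj) (auto simp: elts_fl)
      then show ?thesis using flip_intros(3)[OF subsetD[OF M0(2) 3(1)] 3(2), of g] unfolding 3(4) by simp
    qed
  qed
  have w23: "a \<in> elts w3" if "a \<in> elts w2" for a
  proof -
    have "win M2 \<psi>2 a" using that M2(4) by blast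
    then have "win M2 \<psi>3 a" by (rule win_cong[rotated]) (use \<psi>3(2) in blast)
    then have "win ?M3 \<psi>3 a"
      by (cases rule: win_cases) (auto simp: win_simps)
    then show ?thesis using w3 by blast
  qed
  have img: "b \<in> elts w3" if "a \<in> elts w1" "flip g a b" for a b
  proof -
    have a: "win M1 \<psi>1 a" using that(1) M1(4) by blast
    from that(2) have "win ?M3 \<psi>3 b"
    proof (cases rule: flip_cases)
      case 1
      then show ?thesis by (simp add: win_simps(1))
    next
      case (2 y c)
      then show ?thesis using a by (auto simp: win_simps)
    next
      case (3 x f)
      then have x: "x \<in> elts M1" "ev (\<lambda>y. XX x y \<longrightarrow> (y \<in> elts f \<longleftrightarrow> ps \<psi>1 x y))" using a by (simp_all add: win_simps(3))
      have "ev (\<lambda>y. XX x y \<longrightarrow> (y \<in> elts (fl g x f) \<longleftrightarrow> ps \<psi>3 x y))"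
        by (rule ev_mono[OF ev_conj[OF x(2) bspec[OF g(3) x(1)]]]) (unfold elts_fl, blast)
      then show ?thesis unfolding 3(4) win_simps using x(1) gset_fl by simp
    qed
    then show ?thesis using w3 by blast
  qed
  show ?thesis
    by (rule exI[of _ "flip g"], rule exI[of _ w3], intro conjI flip_auto allI impI ballI WW3)
      (use WW_flip_iff fix0 w23 img in blast)+
qed

sublocale worlds E AT WW
proof
  show "dfn (\<lambda>e. WW (e 0))" unfolding WW_def isw_def by (intro dfns win_dfn)
  show WA: "elts w \<subseteq> elts AT" if w: "WW w" for w
    using w win_atom unfolding WW_def isw_def by blast
  show "elts (core a) \<subseteq> elts w" if w: "WW w" "a \<in> elts w" for w a
  proof -
    obtain M \<psi> where M: "elts M \<subseteq> elts IDX" "\<And>a. a \<in> elts w \<longleftrightarrow> win M \<psi> a" using w(1) unfolding WW_def isw_def by blast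
    have "win M \<psi> a" using w(2) M(2) by blast
    then have "win M \<psi> c" if "c \<in> elts (core a)" for c
    proof (cases rule: win_cases)
      case 1
      then show ?thesis using that core_lab by simp
    next
      case (2 y b x)
      have "lab (lY y)" unfolding lab_def using 2(1) by blast
      then show ?thesis using that 2 by (simp add: win_simps(1))
    next
      case (3 x f)
      have "lab (lX x)" unfolding lab_def using 3(1) M(1) by blast
      then show ?thesis using that 3 unfolding 3(4) core_simps elts_gc by (auto simp: win_simps)
    qed
    then show ?thesis using M(2) by blast
  qed
qed (rule world_amalgamation)

lemma base_world: "\<exists>w. WW w"
proof -
  obtain w where "\<forall>a. a \<in> elts w \<longleftrightarrow> win emp emp a" using world_set[of emp emp] by auto
  moreover have "coh emp emp" unfolding coh_def by simp
  ultimately show ?thesis unfolding WW_def isw_def using fin_emp by (intro exI[of _ w] exI[of _ emp]) simp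
qed

text \<open>Extending a coherent family by one index always succeeds, so every label receives its
  goods, and every point its socks, in some larger world.\<close>

lemma world_extend:
  assumes "WW w" "x \<in> elts IDX"
  shows "\<exists>w' M \<psi>. elts w \<subseteq> elts w' \<and> isw w' M \<psi> \<and> x \<in> elts M"
proof -
  obtain M \<psi> where M: "fin M" "elts M \<subseteq> elts IDX" "coh M \<psi>" "\<And>a. a \<in> elts w \<longleftrightarrow> win M \<psi> a" using assms(1) unfolding WW_def isw_def by blast
  let ?K = "ins x emp"
  have K: "fin ?K" "elts ?K \<subseteq> elts IDX" using fin_ins[OF fin_emp] assms(2) by auto
  obtain \<psi>' where \<psi>': "coh (un ?K M) \<psi>'" "\<forall>x\<in>elts M. \<forall>y\<in>elts PT. ps \<psi>' x y \<longleftrightarrow> ps \<psi> x y"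
    using extend[OF M(1-3) K] by blast
  have M': "fin (un ?K M)" "elts (un ?K M) \<subseteq> elts IDX" using fin_un[OF K(1) M(1)] K(2) M(2) by auto
  obtain w' where w': "\<forall>a. a \<in> elts w' \<longleftrightarrow> win (un ?K M) \<psi>' a" using world_set[OF M'(2)] by blast
  have "a \<in> elts w'" if "a \<in> elts w" for a
  proof -
    have "win M \<psi> a" using that M(4) by blast
    then have "win M \<psi>' a" by (rule win_cong[rotated]) (use \<psi>'(2) in blast)
    then have "win (un ?K M) \<psi>' a" by (cases rule: win_cases) (auto simp: win_simps)
    then show ?thesis using w' by blast
  qed
  moreover have "isw w' (un ?K M) \<psi>'" unfolding isw_def using M' \<psi>'(1) w' by blast
  ultimately show ?thesis by (intro exI[of _ w'] exI[of _ "un ?K M"] exI[of _ \<psi>']) auto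
qed

end

section \<open>The sentence\<close>

text \<open>An element \<open>o\<close> with \<open>o \<in> o\<close> and \<open>z \<in> o \<noteq> z\<close> is an object labelled by \<open>z\<close>. The sentence
  \<open>Psi\<close> says: there are disjoint sets \<open>I\<close> and \<open>Y\<close> of labels such that every label has a nonempty set of
  objects, a label in \<open>Y\<close> has at most two objects (\<open>socks\<close>), every object of a label in \<open>I\<close> (a \<open>good\<close>)
  contains at most one sock of each label in \<open>Y\<close>, and no relation \<open>R\<close> on \<open>I \<times> Y\<close> records for goods
  \<open>o1, o2\<close> of any labels \<open>x1, x2\<close> at which \<open>y\<close> they contain the same sock. Global choice
  provides such a relation: choose a good of every \<open>x\<close> and a sock of every \<open>y\<close>.\<close>

definition at_fm :: "nat \<Rightarrow> nat \<Rightarrow> fm" where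
  "at_fm z a = (Var a \<^bold>\<in> Var a \<^bold>\<and> Var z \<^bold>\<in> Var a \<^bold>\<and> \<^bold>\<not> Var a \<^bold>= Var z)"

text \<open>Any set \<open>r\<close> counts as a relation between \<open>I\<close> and
  \<open>Y\<close>, through those members that contain both labels. As \<open>I\<close> and
  \<open>Y\<close> are disjoint, unordered pairs already tell the two sides apart.\<close>

definition rel_fm :: "nat \<Rightarrow> nat \<Rightarrow> nat \<Rightarrow> fm" where
  "rel_fm r x y = Exists (Var 0 \<^bold>\<in> Var (Suc r) \<^bold>\<and> Var (Suc x) \<^bold>\<in> Var 0 \<^bold>\<and> Var (Suc y) \<^bold>\<in> Var 0)"

definition objects_fm :: fm where
  "objects_fm = (Var 0 \<^bold>\<in> Var 1 \<^bold>\<longleftrightarrow> at_fm 2 0)"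

definition label_fm :: fm where
  "label_fm = (Var 0 \<^bold>\<in> Var 2 \<^bold>\<or> Var 0 \<^bold>\<in> Var 1)"

definition two_fm :: fm where
  "two_fm = (Var 2 \<^bold>= Var 1 \<^bold>\<or> Var 2 \<^bold>= Var 0 \<^bold>\<or> Var 1 \<^bold>= Var 0)"

text \<open>In the scope of \<open>Psi5\<close>, variable 7 is the relation, 6 and 5 are the labels
  of the two goods, 2 is the label of the socks, and 1 and 0 are the socks found in the two
  goods.\<close>

definition differ_fm :: fm where
  "differ_fm = (\<^bold>\<not> ((rel_fm 7 6 2 \<^bold>\<longleftrightarrow> rel_fm 7 5 2) \<^bold>\<longleftrightarrow> Var 1 \<^bold>= Var 0))"

definition Psi1 :: fm where
  "Psi1 = Forall (Var 0 \<^bold>\<in> Var 2 \<^bold>\<longrightarrow> \<^bold>\<not> Var 0 \<^bold>\<in> Var 1)"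

definition Psi2 :: fm where
  "Psi2 = Forall (label_fm \<^bold>\<longrightarrow> Exists (Exists (Var 0 \<^bold>\<in> Var 1) \<^bold>\<and> Forall objects_fm))"

definition Psi3 :: fm where
  "Psi3 = Forall (Var 0 \<^bold>\<in> Var 1 \<^bold>\<longrightarrow> Forall (Forall (Forall (at_fm 3 2 \<^bold>\<longrightarrow> at_fm 3 1 \<^bold>\<longrightarrow> at_fm 3 0 \<^bold>\<longrightarrow> two_fm))))"

definition Psi4 :: fm where
  "Psi4 = Forall (Var 0 \<^bold>\<in> Var 2 \<^bold>\<longrightarrow> Forall (at_fm 1 0 \<^bold>\<longrightarrow> Forall (Var 0 \<^bold>\<in> Var 3 \<^bold>\<longrightarrow>
    Forall (Forall (Var 1 \<^bold>\<in> Var 3 \<^bold>\<longrightarrow> Var 0 \<^bold>\<in> Var 3 \<^bold>\<longrightarrow> at_fm 2 1 \<^bold>\<longrightarrow> at_fm 2 0 \<^bold>\<longrightarrow> Var 1 \<^bold>= Var 0)))))"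

definition Psi5 :: fm where
  "Psi5 = Forall (Exists (Var 0 \<^bold>\<in> Var 3 \<^bold>\<and> Exists (Var 0 \<^bold>\<in> Var 4 \<^bold>\<and> Forall (Forall (at_fm 3 1 \<^bold>\<longrightarrow> at_fm 2 0 \<^bold>\<longrightarrow>
    Exists (Var 0 \<^bold>\<in> Var 6 \<^bold>\<and> Exists (Exists (Var 1 \<^bold>\<in> Var 4 \<^bold>\<and> Var 0 \<^bold>\<in> Var 3 \<^bold>\<and> at_fm 2 1 \<^bold>\<and> at_fm 2 0 \<^bold>\<and> differ_fm))))))))"

definition Psi :: fm where
  "Psi = Exists (Exists (Psi1 \<^bold>\<and> Psi2 \<^bold>\<and> Psi3 \<^bold>\<and> Psi4 \<^bold>\<and> Psi5))"

lemma Psi_syntax: "jfree Psi" "sentence Psi"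
  by (simp_all add: sentence_def Psi_def Psi1_def Psi2_def Psi3_def Psi4_def Psi5_def at_fm_def rel_fm_def
      objects_fm_def label_fm_def two_fm_def differ_fm_def)

text \<open>The labels of the intended model are atoms too and hence members of themselves;
  \<open>a \<noteq> z\<close> keeps a label from being an object of itself.\<close>

definition obj :: "('a \<Rightarrow> 'a \<Rightarrow> bool) \<Rightarrow> 'a \<Rightarrow> 'a \<Rightarrow> bool" where
  "obj R z a \<longleftrightarrow> R a a \<and> R z a \<and> a \<noteq> z"

context
  fixes le :: "'w \<Rightarrow> 'w \<Rightarrow> bool" and D :: "'w \<Rightarrow> 'a \<Rightarrow> bool" and R :: "'a \<Rightarrow> 'a \<Rightarrow> bool" and j :: "'a \<Rightarrow> 'a"
begin

abbreviation ks :: "'w \<Rightarrow> (nat \<Rightarrow> 'a) \<Rightarrow> fm \<Rightarrow> bool" where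
  "ks \<equiv> ksat le D R j"

definition rel :: "'w \<Rightarrow> 'a \<Rightarrow> 'a \<Rightarrow> 'a \<Rightarrow> bool" where
  "rel w r x y \<longleftrightarrow> (\<exists>w'. le w w' \<and> (\<exists>p. D w' p \<and> R p r \<and> R x p \<and> R y p))"

lemma ks_conn:
  "ks w e (p \<^bold>\<and> q) \<longleftrightarrow> ks w e p \<and> ks w e q"
  "ks w e (Exists p) \<longleftrightarrow> (\<exists>w'. le w w' \<and> (\<exists>x. D w' x \<and> ks w' (case_nat x e) p))"
  "q \<noteq> \<^bold>\<bottom> \<Longrightarrow> ks w e (p \<^bold>\<longrightarrow> q) \<longleftrightarrow> (ks w e p \<longrightarrow> ks w e q)"
  "ks w e (\<^bold>\<not> Var m \<^bold>\<in> Var n) \<longleftrightarrow> \<not> R (e m) (e n)"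
  by auto

lemma fm_not_Bot: "two_fm \<noteq> \<^bold>\<bottom>"
  by (simp add: two_fm_def)

lemma ks_parts:
  "ks w e (at_fm z a) \<longleftrightarrow> obj R (e z) (e a)"
  "ks w e (rel_fm r x y) \<longleftrightarrow> rel w (e r) (e x) (e y)"
  "ks w e objects_fm \<longleftrightarrow> (R (e 0) (e 1) \<longleftrightarrow> obj R (e 2) (e 0))"
  "ks w e label_fm \<longleftrightarrow> R (e 0) (e 2) \<or> R (e 0) (e 1)"
  "ks w e two_fm \<longleftrightarrow> e 2 = e 1 \<or> e 2 = e 0 \<or> e 1 = e 0"
  "ks w e differ_fm \<longleftrightarrow> \<not> ((rel w (e 7) (e 6) (e 2) \<longleftrightarrow> rel w (e 7) (e 5) (e 2)) \<longleftrightarrow> e 1 = e 0)"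
proof -
  show at: "ks w e (at_fm z a) \<longleftrightarrow> obj R (e z) (e a)" for w e z a by (simp add: at_fm_def obj_def)
  show rl: "ks w e (rel_fm r x y) \<longleftrightarrow> rel w (e r) (e x) (e y)" for w e r x y unfolding rel_fm_def rel_def ks_conn(1,2) by simp
  show "ks w e objects_fm \<longleftrightarrow> (R (e 0) (e 1) \<longleftrightarrow> obj R (e 2) (e 0))" by (auto simp: objects_fm_def at)
  show "ks w e label_fm \<longleftrightarrow> R (e 0) (e 2) \<or> R (e 0) (e 1)" by (auto simp: label_fm_def)
  show "ks w e two_fm \<longleftrightarrow> e 2 = e 1 \<or> e 2 = e 0 \<or> e 1 = e 0" by (auto simp: two_fm_def)
  show "ks w e differ_fm \<longleftrightarrow> \<not> ((rel w (e 7) (e 6) (e 2) \<longleftrightarrow> rel w (e 7) (e 5) (e 2)) \<longleftrightarrow> e 1 = e 0)"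
    by (auto simp: differ_fm_def rl)
qed

lemma numerals: "(4::nat) = Suc (Suc (Suc (Suc 0)))" "(5::nat) = Suc (Suc (Suc (Suc (Suc 0))))"
  "(6::nat) = Suc (Suc (Suc (Suc (Suc (Suc 0)))))" "(7::nat) = Suc (Suc (Suc (Suc (Suc (Suc (Suc 0))))))"
  by simp_all

definition Q1 :: "'w \<Rightarrow> 'a \<Rightarrow> 'a \<Rightarrow> bool" where
  "Q1 w I Y \<longleftrightarrow> (\<forall>w3. le w w3 \<longrightarrow> (\<forall>z. D w3 z \<longrightarrow> R z I \<longrightarrow> \<not> R z Y))"

definition Q2 :: "'w \<Rightarrow> 'a \<Rightarrow> 'a \<Rightarrow> bool" where
  "Q2 w I Y \<longleftrightarrow> (\<forall>w3. le w w3 \<longrightarrow> (\<forall>z. D w3 z \<longrightarrow> R z I \<or> R z Y \<longrightarrow> (\<exists>w4. le w3 w4 \<and> (\<exists>A. D w4 A \<and>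
    (\<exists>w5. le w4 w5 \<and> (\<exists>a. D w5 a \<and> R a A)) \<and> (\<forall>w5. le w4 w5 \<longrightarrow> (\<forall>a. D w5 a \<longrightarrow> (R a A \<longleftrightarrow> obj R z a)))))))"

definition Q3 :: "'w \<Rightarrow> 'a \<Rightarrow> bool" where
  "Q3 w Y \<longleftrightarrow> (\<forall>w3. le w w3 \<longrightarrow> (\<forall>y. D w3 y \<longrightarrow> R y Y \<longrightarrow> (\<forall>w4. le w3 w4 \<longrightarrow> (\<forall>s1. D w4 s1 \<longrightarrow>
    (\<forall>w5. le w4 w5 \<longrightarrow> (\<forall>s2. D w5 s2 \<longrightarrow> (\<forall>w6. le w5 w6 \<longrightarrow> (\<forall>s3. D w6 s3 \<longrightarrow>
      obj R y s1 \<longrightarrow> obj R y s2 \<longrightarrow> obj R y s3 \<longrightarrow> s1 = s2 \<or> s1 = s3 \<or> s2 = s3))))))))"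

definition Q4 :: "'w \<Rightarrow> 'a \<Rightarrow> 'a \<Rightarrow> bool" where
  "Q4 w I Y \<longleftrightarrow> (\<forall>w3. le w w3 \<longrightarrow> (\<forall>x. D w3 x \<longrightarrow> R x I \<longrightarrow> (\<forall>w4. le w3 w4 \<longrightarrow> (\<forall>a. D w4 a \<longrightarrow> obj R x a \<longrightarrow>
    (\<forall>w5. le w4 w5 \<longrightarrow> (\<forall>y. D w5 y \<longrightarrow> R y Y \<longrightarrow> (\<forall>w6. le w5 w6 \<longrightarrow> (\<forall>s. D w6 s \<longrightarrow>
      (\<forall>w7. le w6 w7 \<longrightarrow> (\<forall>s'. D w7 s' \<longrightarrow> R s a \<longrightarrow> R s' a \<longrightarrow> obj R y s \<longrightarrow> obj R y s' \<longrightarrow> s = s'))))))))))"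

definition Q5 :: "'w \<Rightarrow> 'a \<Rightarrow> 'a \<Rightarrow> bool" where
  "Q5 w I Y \<longleftrightarrow> (\<forall>w3. le w w3 \<longrightarrow> (\<forall>r. D w3 r \<longrightarrow> (\<exists>w4. le w3 w4 \<and> (\<exists>x1. D w4 x1 \<and> R x1 I \<and>
    (\<exists>w5. le w4 w5 \<and> (\<exists>x2. D w5 x2 \<and> R x2 I \<and> (\<forall>w6. le w5 w6 \<longrightarrow> (\<forall>a1. D w6 a1 \<longrightarrow> (\<forall>w7. le w6 w7 \<longrightarrow> (\<forall>a2. D w7 a2 \<longrightarrow>
      obj R x1 a1 \<longrightarrow> obj R x2 a2 \<longrightarrow> (\<exists>w8. le w7 w8 \<and> (\<exists>y. D w8 y \<and> R y Y \<and> (\<exists>w9. le w8 w9 \<and> (\<exists>s1. D w9 s1 \<and>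
        (\<exists>w10. le w9 w10 \<and> (\<exists>s2. D w10 s2 \<and> R s1 a1 \<and> R s2 a2 \<and> obj R y s1 \<and> obj R y s2 \<and>
          \<not> ((rel w10 r x1 y \<longleftrightarrow> rel w10 r x2 y) \<longleftrightarrow> s1 = s2)))))))))))))))))"

lemma ks_Psi:
  "ks w e Psi \<longleftrightarrow> (\<exists>w1. le w w1 \<and> (\<exists>I. D w1 I \<and> (\<exists>w2. le w1 w2 \<and> (\<exists>Y. D w2 Y \<and>
    Q1 w2 I Y \<and> Q2 w2 I Y \<and> Q3 w2 Y \<and> Q4 w2 I Y \<and> Q5 w2 I Y))))"
  unfolding Q1_def Q2_def Q3_def Q4_def Q5_def
  by (simp only: Psi_def Psi1_def Psi2_def Psi3_def Psi4_def Psi5_def ksat.simps(1,2,5) ks_conn ks_parts fm_not_Bot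
      fm.distinct simp_thms tmv.simps nat.case One_nat_def numeral_2_eq_2 numeral_3_eq_3 numerals)

end

lemma sat_Psi:
  "sat UNIV R j e Psi \<longleftrightarrow> (\<exists>I Y. (\<forall>z. R z I \<longrightarrow> \<not> R z Y) \<and>
    (\<forall>z. R z I \<or> R z Y \<longrightarrow> (\<exists>A. (\<exists>a. R a A) \<and> (\<forall>a. R a A \<longleftrightarrow> obj R z a))) \<and>
    (\<forall>y. R y Y \<longrightarrow> (\<forall>s1 s2 s3. obj R y s1 \<longrightarrow> obj R y s2 \<longrightarrow> obj R y s3 \<longrightarrow> s1 = s2 \<or> s1 = s3 \<or> s2 = s3)) \<and>
    (\<forall>x. R x I \<longrightarrow> (\<forall>a. obj R x a \<longrightarrow> (\<forall>y. R y Y \<longrightarrow> (\<forall>s s'. R s a \<longrightarrow> R s' a \<longrightarrow> obj R y s \<longrightarrow> obj R y s' \<longrightarrow> s = s')))) \<and>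
    (\<forall>r. \<exists>x1. R x1 I \<and> (\<exists>x2. R x2 I \<and> (\<forall>a1 a2. obj R x1 a1 \<longrightarrow> obj R x2 a2 \<longrightarrow> (\<exists>y. R y Y \<and> (\<exists>s1 s2.
      R s1 a1 \<and> R s2 a2 \<and> obj R y s1 \<and> obj R y s2 \<and>
      \<not> (((\<exists>p. R p r \<and> R x1 p \<and> R y p) \<longleftrightarrow> (\<exists>p. R p r \<and> R x2 p \<and> R y p)) \<longleftrightarrow> s1 = s2)))))))"
  unfolding sat_eq_ksat ks_Psi Q1_def Q2_def Q3_def Q4_def Q5_def rel_def by (simp only: UNIV_I simp_thms)


section \<open>Global choice refutes the sentence\<close>

lemma global_choice_refutes:
  assumes "Zmodel E jf" and jf: "\<And>x. (\<exists>y. E y x) \<Longrightarrow> E (jf x) x"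
  shows "\<not> sat UNIV E jf e Psi"
proof
  interpret Zmodel E jf by (rule assms(1))
  assume "sat UNIV E jf e Psi"
  then obtain I Y where c1: "\<forall>z. E z I \<longrightarrow> \<not> E z Y"
    and c2: "\<forall>z. E z I \<or> E z Y \<longrightarrow> (\<exists>A. (\<exists>a. E a A) \<and> (\<forall>a. E a A \<longleftrightarrow> obj E z a))"
    and c3: "\<forall>y. E y Y \<longrightarrow> (\<forall>s1 s2 s3. obj E y s1 \<longrightarrow> obj E y s2 \<longrightarrow> obj E y s3 \<longrightarrow> s1 = s2 \<or> s1 = s3 \<or> s2 = s3)"
    and c4: "\<forall>x. E x I \<longrightarrow> (\<forall>a. obj E x a \<longrightarrow> (\<forall>y. E y Y \<longrightarrow> (\<forall>s s'. E s a \<longrightarrow> E s' a \<longrightarrow> obj E y s \<longrightarrow> obj E y s' \<longrightarrow> s = s')))"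
    and c5: "\<forall>r. \<exists>x1. E x1 I \<and> (\<exists>x2. E x2 I \<and> (\<forall>a1 a2. obj E x1 a1 \<longrightarrow> obj E x2 a2 \<longrightarrow> (\<exists>y. E y Y \<and> (\<exists>s1 s2.
      E s1 a1 \<and> E s2 a2 \<and> obj E y s1 \<and> obj E y s2 \<and>
      \<not> (((\<exists>p. E p r \<and> E x1 p \<and> E y p) \<longleftrightarrow> (\<exists>p. E p r \<and> E x2 p \<and> E y p)) \<longleftrightarrow> s1 = s2)))))"
    unfolding sat_Psi by (elim exE conjE)
  \<comment> \<open>\<open>jf\<close> is applied to the set of objects of a label. Comprehension for
    formulas with \<open>j\<close> enters here, in forming a set from these choices.\<close>
  define ch where "ch z a \<longleftrightarrow> (\<exists>A. (\<forall>a. E a A \<longleftrightarrow> obj E z a) \<and> a = jf A)" for z a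
  have obj_dfn: "dfn (\<lambda>e. obj E (e m) (e n))" for m n unfolding obj_def by (intro dfns)
  have ch_dfn: "dfn (\<lambda>e. ch (e m) (e n))" for m n unfolding ch_def by (intro dfns obj_dfn)
  have ch_ex: "\<exists>a. ch z a \<and> obj E z a" if z: "E z I \<or> E z Y" for z
  proof -
    obtain A where A: "\<exists>a. E a A" "\<forall>a. E a A \<longleftrightarrow> obj E z a" using mp[OF spec[OF c2] z] by blast
    have "E (jf A) A" using jf A(1) by blast
    then show ?thesis unfolding ch_def using A(2) by blast
  qed
  have ch_fun: "a = a'" if "ch z a" "ch z a'" for z a a'
  proof -
    obtain A A' where "\<forall>a. E a A \<longleftrightarrow> obj E z a" "a = jf A" "\<forall>a. E a A' \<longleftrightarrow> obj E z a" "a' = jf A'"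
      using \<open>ch z a\<close> \<open>ch z a'\<close> unfolding ch_def by blast
    moreover then have "A = A'" by (intro extensional) blast
    ultimately show ?thesis by simp
  qed
  \<comment> \<open>The relation holds where the chosen good of \<open>x\<close> contains the chosen
    sock of \<open>y\<close>.\<close>
  let ?P = "\<lambda>p. \<exists>x y. E x I \<and> E y Y \<and> p = up x y \<and> (\<exists>a s. ch x a \<and> ch y s \<and> E s a)"
  have "sm {p. ?P p}"
  proof (rule sm_Collect_sub[OF _ sm_elts[of "Pw (un I Y)"]])
    show "dfn (\<lambda>e. ?P (e 0))" by (intro dfns ch_dfn)
    show "p \<in> elts (Pw (un I Y))" if "?P p" for p using that by (auto simp: elts_def[of I] elts_def[of Y])
  qed
  then obtain r where r: "elts r = {p. ?P p}" unfolding sm_def by blast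
  have rel: "(\<exists>p. E p r \<and> E x p \<and> E y p) \<longleftrightarrow> E s a" if x: "E x I" "E y Y" and c: "ch x a" "ch y s" for x y a s
  proof
    assume "\<exists>p. E p r \<and> E x p \<and> E y p"
    then obtain p where p: "p \<in> elts r" "x \<in> elts p" "y \<in> elts p" unfolding elts_def by blast
    then obtain x' y' a' s' where p': "E x' I" "E y' Y" "p = up x' y'" "ch x' a'" "ch y' s'" "E s' a'" unfolding r by blast
    have "x = x' \<or> x = y'" "y = x' \<or> y = y'" using p(2,3) unfolding p'(3) by simp_all
    moreover have "x \<noteq> y'" "y \<noteq> x'" using c1 x p'(1,2) by blast+
    ultimately have "x = x'" "y = y'" by blast+
    then show "E s a" using ch_fun c p'(4-6) by blast
  next
    assume "E s a"
    then have "up x y \<in> elts r" unfolding r using x c by blast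
    then have "E (up x y) r" by (simp add: elts_def)
    moreover have "x \<in> elts (up x y)" "y \<in> elts (up x y)" by simp_all
    ultimately show "\<exists>p. E p r \<and> E x p \<and> E y p" unfolding elts_def by blast
  qed
  obtain x1 x2 where x: "E x1 I" "E x2 I" and h: "\<forall>a1 a2. obj E x1 a1 \<longrightarrow> obj E x2 a2 \<longrightarrow> (\<exists>y. E y Y \<and> (\<exists>s1 s2.
      E s1 a1 \<and> E s2 a2 \<and> obj E y s1 \<and> obj E y s2 \<and>
      \<not> (((\<exists>p. E p r \<and> E x1 p \<and> E y p) \<longleftrightarrow> (\<exists>p. E p r \<and> E x2 p \<and> E y p)) \<longleftrightarrow> s1 = s2)))"
    using spec[OF c5, of r] by (elim exE conjE)
  obtain a1 where a1: "ch x1 a1" "obj E x1 a1" using ch_ex x(1) by blast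
  obtain a2 where a2: "ch x2 a2" "obj E x2 a2" using ch_ex x(2) by blast
  obtain y s1 s2 where y: "E y Y" "E s1 a1" "E s2 a2" "obj E y s1" "obj E y s2"
    "\<not> (((\<exists>p. E p r \<and> E x1 p \<and> E y p) \<longleftrightarrow> (\<exists>p. E p r \<and> E x2 p \<and> E y p)) \<longleftrightarrow> s1 = s2)"
    using mp[OF mp[OF spec[OF spec[OF h]] a1(2)] a2(2)] by (elim exE conjE)
  obtain s where s: "ch y s" "obj E y s" using ch_ex y(1) by blast
  have one: "s' = s''" if "E x I" "obj E x a" "E s' a" "E s'' a" "obj E y s'" "obj E y s''" for x a s' s''
    using c4 that y(1) by blast
  have "E s a1 \<longleftrightarrow> s = s1" using one[OF x(1) a1(2)] y(2,4) s(2) by blast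
  moreover have "E s a2 \<longleftrightarrow> s = s2" using one[OF x(2) a2(2)] y(3,5) s(2) by blast
  \<comment> \<open>If the socks \<open>s1\<close> and \<open>s2\<close> differ, the chosen sock is
    exactly one of them and lies in exactly one of the two goods; if they coincide, it lies in both
    or in neither.\<close>
  moreover have "s = s1 \<or> s = s2 \<or> s1 = s2" using c3 y(1,4,5) s(2) by blast
  ultimately show False using y(6) unfolding rel[OF x(1) y(1) a1(1) s(1)] rel[OF x(2) y(1) a2(1) s(1)] by blast
qed

lemma ZC_GC_proves: "provable L_mem_j ZC_GC (\<^bold>\<not> Psi)"
proof (rule ccontr)
  assume np: "\<not> provable L_mem_j ZC_GC (\<^bold>\<not> Psi)"
  have sent: "sentence p" if "p \<in> ZC_GC" for p
    using that Z_sentence unfolding ZC_GC_def ZC_def Comprehension_def Comprehension_instance_def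
    by (auto simp: sentence_univ_closure)
      (simp_all add: sentence_def Ax_Choice_def Ax_Global_Choice_def is_pair_def is_upair_def)
  have neg: "sentence (\<^bold>\<not> Psi)" using Psi_syntax(2) by (simp add: sentence_def)
  have excl: "sat D R j e no_universal \<and> sat D R j e adjoining"
    if T: "\<And>p. p \<in> ZC_GC \<Longrightarrow> sat D R j e p" for D and R :: "tm set \<Rightarrow> tm set \<Rightarrow> bool" and j e
    by (rule Z_finite_models_excluded) (rule T, simp add: ZC_GC_def ZC_def)
  obtain R :: "nat \<Rightarrow> nat \<Rightarrow> bool" and j where R: "\<forall>p\<in>ZC_GC. \<forall>e. sat UNIV R j e p" and n: "\<forall>e. \<not> sat UNIV R j e (\<^bold>\<not> Psi)"
    using completeness[OF sent np[unfolded L_mem_j_def] neg excl] by blast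
  have Z: "Zmodel R j"
  proof (rule Zmodel_intro)
    show "sat UNIV R j e p" if "p \<in> {Ax_Extensionality, Ax_Pairing, Ax_Union, Ax_Power_Set}" for p e
    proof -
      have "p \<in> ZC_GC" using that unfolding ZC_GC_def ZC_def Z_def by blast
      then show ?thesis using R by blast
    qed
    show "sat UNIV R j e (Comprehension_instance p)" for p e
    proof -
      have "Comprehension_instance p \<in> ZC_GC" unfolding ZC_GC_def Comprehension_def L_mem_j_def by blast
      then show ?thesis using R by blast
    qed
  qed
  have "sat UNIV R j (\<lambda>_. 0) Ax_Global_Choice" using R unfolding ZC_GC_def by blast
  then have gc: "R (j x) x" if "\<exists>y. R y x" for x using that unfolding Ax_Global_Choice_def by simp
  show False using global_choice_refutes[OF Z gc] n by simp
qed


section \<open>The sentence holds in the universe of socks\<close>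

context coherence
begin

lemma self_member_atom: "x \<in> exts x \<Longrightarrow> x \<in> elts AT"
proof -
  have "x \<notin> exts x \<or> x \<in> elts AT"
  proof (rule es_induct[where P = "\<lambda>x. x \<notin> exts x \<or> x \<in> elts AT"])
    show "dfn (\<lambda>e. e 0 \<notin> exts (e 0) \<or> e 0 \<in> elts AT)" by (intro dfns)
  qed blast+
  then show "x \<in> exts x \<Longrightarrow> x \<in> elts AT" by blast
qed

lemma D_atom: "WW w \<Longrightarrow> a \<in> elts w \<Longrightarrow> D w a"
proof -
  assume w: "WW w" and a: "a \<in> elts w"
  have "u \<in> elts w" if z: "z \<in> elts w" "u \<in> exts z" for z u
  proof -
    have "z \<in> elts AT" using z(1) WW_atoms[OF w] by blast
    then show ?thesis using z WW_core[OF w z(1)] by (auto simp: exts_atom)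
  qed
  then show ?thesis unfolding D_def supp_def using a by blast
qed

lemma obj_atom: "obj es z a \<longleftrightarrow> a \<in> elts AT \<and> z \<in> elts (core a) \<and> a \<noteq> z"
  unfolding obj_def using self_member_atom[of a] exts_atom[of a] by auto

lemma obj_lY: "y \<in> elts PT \<Longrightarrow> obj es (lY y) a \<longleftrightarrow> (\<exists>b. a = sk y b)"
proof
  assume y: "y \<in> elts PT" and "obj es (lY y) a"
  then have a: "a \<in> elts AT" "lY y \<in> elts (core a)" unfolding obj_atom by blast+
  from a(1) show "\<exists>b. a = sk y b"
  proof (cases rule: AT_cases)
    case 1
    then show ?thesis using a(2) core_lab by simp
  next
    case (2 y' b)
    then show ?thesis using a(2) by simp
  next
    case (3 x f)
    then show ?thesis using a(2) by (auto simp: elts_gc)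
  qed
next
  assume "y \<in> elts PT" "\<exists>b. a = sk y b"
  then show "obj es (lY y) a" unfolding obj_atom by (auto simp: AT_intros)
qed

lemma obj_lX: "x \<in> elts IDX \<Longrightarrow> obj es (lX x) a \<longleftrightarrow> (\<exists>f. gset x f \<and> a = gd x f)"
proof
  assume x: "x \<in> elts IDX" and "obj es (lX x) a"
  then have a: "a \<in> elts AT" "lX x \<in> elts (core a)" unfolding obj_atom by blast+
  from a(1) show "\<exists>f. gset x f \<and> a = gd x f"
  proof (cases rule: AT_cases)
    case 1
    then show ?thesis using a(2) core_lab by simp
  next
    case (2 y' b)
    then show ?thesis using a(2) by simp
  next
    case (3 x' f)
    then show ?thesis using a(2) by (auto simp: elts_gc)
  qed
next
  assume "x \<in> elts IDX" "\<exists>f. gset x f \<and> a = gd x f"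
  then show "obj es (lX x) a" unfolding obj_atom by (auto simp: AT_intros elts_gc)
qed

lemma sock_in_good:
  assumes "x \<in> elts IDX" "gset x f" "y \<in> elts PT"
  shows "sk y b \<in> exts (gd x f) \<longleftrightarrow> XX x y \<and> b = (y \<in> elts f)"
  unfolding exts_atom[OF AT_intros(3)[OF assms(1,2)]] using assms(3) by (auto simp: elts_gc)

lemma good_exists:
  assumes "isw w M \<psi>" "x \<in> elts M"
  shows "\<exists>f. gset x f \<and> gd x f \<in> elts w"
proof -
  have "sm {y. y \<in> elts PT \<and> XX x y \<and> ps \<psi> x y}" by (rule sm_Collect_sub[OF _ sm_elts[of PT]]) (intro dfns, simp)
  then obtain f where f: "elts f = {y. y \<in> elts PT \<and> XX x y \<and> ps \<psi> x y}" unfolding sm_def by blast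
  have e: "ev (\<lambda>y. XX x y \<longrightarrow> (y \<in> elts f \<longleftrightarrow> ps \<psi> x y))" by (rule ev_all) (simp add: f)
  have g: "gset x f" unfolding gset_def f by blast
  then have "win M \<psi> (gd x f)" unfolding win_simps using assms(2) e by blast
  then show ?thesis using assms(1) g unfolding isw_def by blast
qed

definition IV :: nat where "IV = mk (lX ` elts IDX)"

definition YV :: nat where "YV = mk (lY ` elts PT)"

lemma exts_IV: "exts IV = lX ` elts IDX" and exts_YV: "exts YV = lY ` elts PT"
proof -
  have d: "dfn (\<lambda>e. e 0 = lX (e (Suc 0)))" "dfn (\<lambda>e. e 0 = lY (e (Suc 0)))" by (intro dfns)+
  show "exts IV = lX ` elts IDX" unfolding IV_def by (rule exts_mk[OF sm_image[OF sm_elts d(1)]])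
  show "exts YV = lY ` elts PT" unfolding YV_def by (rule exts_mk[OF sm_image[OF sm_elts d(2)]])
qed

lemma lab_in_world: "WW w \<Longrightarrow> lab a \<Longrightarrow> D w a"
  using D_atom[of w a] win_simps(1) unfolding WW_def isw_def by blast

lemma D_labels: "WW w \<Longrightarrow> x \<in> elts IDX \<Longrightarrow> D w (lX x)" "WW w \<Longrightarrow> y \<in> elts PT \<Longrightarrow> D w (lY y)"
  using lab_in_world unfolding lab_def by blast+

lemma D_IV_YV:
  assumes "WW w"
  shows "D w IV" "D w YV"
proof -
  have s: "sm (lX ` elts IDX)" "sm (lY ` elts PT)" using sm_exts[of IV] sm_exts[of YV] unfolding exts_IV exts_YV .
  show "D w IV" unfolding IV_def by (rule D_mk[OF s(1)]) (use D_labels[OF assms] in blast)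
  show "D w YV" unfolding YV_def by (rule D_mk[OF s(2)]) (use D_labels[OF assms] in blast)
qed

lemma le_isw: "le w w' \<Longrightarrow> \<exists>M \<psi>. isw w' M \<psi>"
  using le_WW unfolding WW_def by blast

lemma isw_WW: "isw w M \<psi> \<Longrightarrow> WW w"
  unfolding WW_def by blast

text \<open>As soon as a world has a good for \<open>x\<close>, it has all goods almost equal to it,
  and larger worlds admit no others. The goods for \<open>x\<close> therefore form a set that stops
  growing.\<close>

lemma goods_set:
  assumes w: "WW w" and x: "x \<in> elts IDX"
  shows "\<exists>w'. le w w' \<and> (\<exists>A. D w' A \<and> (\<exists>w''. le w' w'' \<and> (\<exists>a. D w'' a \<and> a \<in> exts A)) \<and>
    (\<forall>w''. le w' w'' \<longrightarrow> (\<forall>a. D w'' a \<longrightarrow> (a \<in> exts A \<longleftrightarrow> obj es (lX x) a))))"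
proof -
  obtain w' M \<psi> where w': "elts w \<subseteq> elts w'" "isw w' M \<psi>" "x \<in> elts M" using world_extend[OF w x] by blast
  have WW': "WW w'" by (rule isw_WW[OF w'(2)])
  have l: "le w w'" unfolding le_def using w w'(1) WW' by blast
  let ?S = "{a. a \<in> elts w' \<and> (\<exists>f. gset x f \<and> a = gd x f)}"
  have sm: "sm ?S" by (rule sm_Collect_sub[OF _ sm_elts[of w']]) (intro dfns, simp)
  have e: "a \<in> exts (mk ?S) \<longleftrightarrow> a \<in> elts w' \<and> (\<exists>f. gset x f \<and> a = gd x f)" for a unfolding exts_mk[OF sm] by simp
  have DA: "D w' (mk ?S)" by (rule D_mk[OF sm]) (use D_atom[OF WW'] in blast)
  obtain f where f: "gset x f" "gd x f \<in> elts w'" using good_exists[OF w'(2,3)] by blast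
  have ne: "gd x f \<in> exts (mk ?S)" unfolding e using f by blast
  have "a \<in> exts (mk ?S) \<longleftrightarrow> obj es (lX x) a" if w'': "le w' w''" "D w'' a" for w'' a
  proof
    assume "a \<in> exts (mk ?S)"
    then show "obj es (lX x) a" unfolding e obj_lX[OF x] by blast
  next
    assume "obj es (lX x) a"
    then obtain f where f: "gset x f" "a = gd x f" unfolding obj_lX[OF x] by blast
    obtain M' \<psi>' where i: "isw w'' M' \<psi>'" using le_isw[OF w''(1)] by blast
    have "a \<in> elts w''" using D_atom_in[OF w''(2)] AT_intros(3)[OF x f(1)] f(2) by blast
    then have "win M' \<psi>' (gd x f)" using i f(2) unfolding isw_def by blast
    then have e1: "ev (\<lambda>y. XX x y \<longrightarrow> (y \<in> elts f \<longleftrightarrow> ps \<psi>' x y))" unfolding win_simps by blast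
    have "win M' \<psi>' c" if "win M \<psi> c" for c using that i w'(2) w''(1) unfolding isw_def le_def by blast
    from win_sub(2)[OF this w'(3)] have e2: "ev (\<lambda>y. XX x y \<longrightarrow> (ps \<psi> x y \<longleftrightarrow> ps \<psi>' x y))" .
    have "ev (\<lambda>y. XX x y \<longrightarrow> (y \<in> elts f \<longleftrightarrow> ps \<psi> x y))" by (rule ev_mono[OF ev_conj[OF e1 e2]]) blast
    then have "win M \<psi> a" unfolding f(2) win_simps using w'(3) f(1) by blast
    then show "a \<in> exts (mk ?S)" unfolding e using w'(2) f unfolding isw_def by blast
  qed
  then have all: "\<forall>w''. le w' w'' \<longrightarrow> (\<forall>a. D w'' a \<longrightarrow> (a \<in> exts (mk ?S) \<longleftrightarrow> obj es (lX x) a))" by blast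
  show ?thesis
    by (rule exI[of _ w'], rule conjI[OF l], rule exI[of _ "mk ?S"], rule conjI[OF DA], rule conjI[OF _ all],
      rule exI[of _ w'], rule conjI[OF le_rfl[OF WW']], rule exI[of _ "gd x f"], rule conjI[OF D_trans[OF DA ne] ne])
qed

lemma socks_set:
  assumes w: "WW w" and y: "y \<in> elts PT"
  shows "\<exists>w'. le w w' \<and> (\<exists>A. D w' A \<and> (\<exists>w''. le w' w'' \<and> (\<exists>a. D w'' a \<and> a \<in> exts A)) \<and>
    (\<forall>w''. le w' w'' \<longrightarrow> (\<forall>a. D w'' a \<longrightarrow> (a \<in> exts A \<longleftrightarrow> obj es (lY y) a))))"
proof -
  \<comment> \<open>Socks enter a world only together with an index whose set of points contains
    \<open>y\<close>.\<close>
  obtain x where x: "x \<in> elts IDX" "XX x y" using covered[OF y] by blast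
  obtain w' M \<psi> where w': "elts w \<subseteq> elts w'" "isw w' M \<psi>" "x \<in> elts M" using world_extend[OF w x(1)] by blast
  have WW': "WW w'" by (rule isw_WW[OF w'(2)])
  have l: "le w w'" unfolding le_def using w w'(1) WW' by blast
  have sk: "D w' (sk y b)" for b
  proof -
    have "win M \<psi> (sk y b)" unfolding win_simps using y w'(3) x(2) by blast
    then show ?thesis using D_atom[OF WW'] w'(2) unfolding isw_def by blast
  qed
  let ?A = "upm (sk y True) (sk y False)"
  have DA: "D w' ?A" by (rule D_upm[OF sk sk])
  have "a \<in> exts ?A \<longleftrightarrow> obj es (lY y) a" for a unfolding obj_lY[OF y] ex_bool_eq by simp
  then have all: "\<forall>w''. le w' w'' \<longrightarrow> (\<forall>a. D w'' a \<longrightarrow> (a \<in> exts ?A \<longleftrightarrow> obj es (lY y) a))" by blast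
  have ne: "sk y True \<in> exts ?A" by simp
  show ?thesis
    by (rule exI[of _ w'], rule conjI[OF l], rule exI[of _ ?A], rule conjI[OF DA], rule conjI[OF _ all],
      rule exI[of _ w'], rule conjI[OF le_rfl[OF WW']], rule exI[of _ "sk y True"], rule conjI[OF sk ne])
qed

text \<open>A recording relation would be a definable predicate \<open>p\<close> on all indices, the
  same for all larger worlds, since labels live everywhere. Incompactness yields two indices at
  which \<open>p\<close> breaks the prescription above every level, whereas the goods of any world
  obey it almost everywhere.\<close>

lemma incompact_goods:
  assumes r: "WW w" "D w r"
  shows "\<exists>x1\<in>elts IDX. \<exists>x2\<in>elts IDX. \<forall>w'. le w w' \<longrightarrow> (\<forall>a1 a2. D w' a1 \<longrightarrow> D w' a2 \<longrightarrow> obj es (lX x1) a1 \<longrightarrow> obj es (lX x2) a2 \<longrightarrow>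
    (\<exists>y\<in>elts PT. \<exists>s1 s2. s1 \<in> exts a1 \<and> s2 \<in> exts a2 \<and> obj es (lY y) s1 \<and> obj es (lY y) s2 \<and>
      \<not> ((rel le D es w' r (lX x1) (lY y) \<longleftrightarrow> rel le D es w' r (lX x2) (lY y)) \<longleftrightarrow> s1 = s2)))"
proof -
  define p where "p x y \<longleftrightarrow> (\<exists>q\<in>exts r. lX x \<in> exts q \<and> lY y \<in> exts q)" for x y
  have rel: "rel le D es w' r (lX x) (lY y) \<longleftrightarrow> p x y" if w': "le w w'" for w' x y
  proof -
    have "D w' q" if "q \<in> exts r" for q using le_D[OF w' D_trans[OF r(2) that]] .
    then show ?thesis unfolding rel_def p_def using le_rfl[OF le_WW[OF w']] by blast
  qed
  have d: "dfn (\<lambda>e. p (e 0) (e (Suc 0)))" unfolding p_def by (intro dfns)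
  obtain x1 x2 where x: "x1 \<in> elts IDX" "x2 \<in> elts IDX"
    and h: "\<forall>l\<in>elts LV. \<exists>y\<in>elts PT. hi l y \<and> XX x1 y \<and> XX x2 y \<and> \<not> ((p x1 y \<noteq> p x2 y) \<longleftrightarrow> PH x1 x2)"
    using incompact[OF d] by blast
  have "\<exists>y\<in>elts PT. \<exists>s1 s2. s1 \<in> exts a1 \<and> s2 \<in> exts a2 \<and> obj es (lY y) s1 \<and> obj es (lY y) s2 \<and>
      \<not> ((rel le D es w' r (lX x1) (lY y) \<longleftrightarrow> rel le D es w' r (lX x2) (lY y)) \<longleftrightarrow> s1 = s2)"
    if w': "le w w'" and a: "D w' a1" "D w' a2" "obj es (lX x1) a1" "obj es (lX x2) a2" for w' a1 a2
  proof -
    obtain f1 where f1: "gset x1 f1" "a1 = gd x1 f1" using a(3) unfolding obj_lX[OF x(1)] by blast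
    obtain f2 where f2: "gset x2 f2" "a2 = gd x2 f2" using a(4) unfolding obj_lX[OF x(2)] by blast
    obtain M \<psi> where i: "isw w' M \<psi>" using le_isw[OF w'] by blast
    have "a1 \<in> elts w'" using D_atom_in[OF a(1)] AT_intros(3)[OF x(1) f1(1)] f1(2) by blast
    then have "win M \<psi> (gd x1 f1)" using i f1(2) unfolding isw_def by blast
    then have m1: "x1 \<in> elts M" and e1: "ev (\<lambda>y. XX x1 y \<longrightarrow> (y \<in> elts f1 \<longleftrightarrow> ps \<psi> x1 y))" unfolding win_simps by blast+
    have "a2 \<in> elts w'" using D_atom_in[OF a(2)] AT_intros(3)[OF x(2) f2(1)] f2(2) by blast
    then have "win M \<psi> (gd x2 f2)" using i f2(2) unfolding isw_def by blast
    then have m2: "x2 \<in> elts M" and e2: "ev (\<lambda>y. XX x2 y \<longrightarrow> (y \<in> elts f2 \<longleftrightarrow> ps \<psi> x2 y))" unfolding win_simps by blast+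
    have e3: "ev (\<lambda>y. XX x1 y \<longrightarrow> XX x2 y \<longrightarrow> ((ps \<psi> x1 y \<noteq> ps \<psi> x2 y) \<longleftrightarrow> PH x1 x2))"
      using i m1 m2 unfolding isw_def coh_def by blast
    \<comment> \<open>Above this level both goods follow \<psi>, and \<psi> follows the
      prescription, so the violation by \<open>p\<close> turns into a violation by actual
      socks.\<close>
    obtain l where l: "l \<in> elts LV" "\<forall>y\<in>elts PT. hi l y \<longrightarrow> (XX x1 y \<longrightarrow> (y \<in> elts f1 \<longleftrightarrow> ps \<psi> x1 y)) \<and>
      (XX x2 y \<longrightarrow> (y \<in> elts f2 \<longleftrightarrow> ps \<psi> x2 y)) \<and> (XX x1 y \<longrightarrow> XX x2 y \<longrightarrow> ((ps \<psi> x1 y \<noteq> ps \<psi> x2 y) \<longleftrightarrow> PH x1 x2))"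
      using ev_conj[OF e1 ev_conj[OF e2 e3]] unfolding ev_def by blast
    obtain y where y: "y \<in> elts PT" "hi l y" "XX x1 y" "XX x2 y" "\<not> ((p x1 y \<noteq> p x2 y) \<longleftrightarrow> PH x1 x2)"
      using bspec[OF h l(1)] by blast
    have k: "(y \<in> elts f1 \<longleftrightarrow> ps \<psi> x1 y)" "(y \<in> elts f2 \<longleftrightarrow> ps \<psi> x2 y)" "(ps \<psi> x1 y \<noteq> ps \<psi> x2 y) \<longleftrightarrow> PH x1 x2"
      using bspec[OF l(2) y(1)] y(2-4) by blast+
    let ?s1 = "sk y (y \<in> elts f1)" and ?s2 = "sk y (y \<in> elts f2)"
    have "?s1 \<in> exts a1" "?s2 \<in> exts a2"
      unfolding f1(2) f2(2) using sock_in_good[OF x(1) f1(1) y(1)] sock_in_good[OF x(2) f2(1) y(1)] y(3,4) by blast+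
    moreover have "obj es (lY y) ?s1" "obj es (lY y) ?s2" unfolding obj_lY[OF y(1)] by blast+
    moreover have eq: "?s1 = ?s2 \<longleftrightarrow> \<not> PH x1 x2" unfolding atom_inj k(1,2) using k(3) by blast
    have "\<not> ((p x1 y \<longleftrightarrow> p x2 y) \<longleftrightarrow> ?s1 = ?s2)" unfolding eq using y(5) by blast
    ultimately show ?thesis unfolding rel[OF w'] using y(1) by blast
  qed
  then show ?thesis using x by blast
qed

lemma tr_Psi:
  assumes "WW w"
  shows "tr w e Psi"
proof -
  have I: "z \<in> exts IV \<longleftrightarrow> (\<exists>x\<in>elts IDX. z = lX x)" for z unfolding exts_IV by blast
  have Y: "z \<in> exts YV \<longleftrightarrow> (\<exists>y\<in>elts PT. z = lY y)" for z unfolding exts_YV by blast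
  have "Q1 le D es w IV YV" unfolding Q1_def I Y by auto
  moreover have "Q2 le D es w IV YV" unfolding Q2_def
  proof (intro allI impI)
    fix w3 z assume w3: "le w w3" and z: "z \<in> exts IV \<or> z \<in> exts YV"
    have WW3: "WW w3" by (rule le_WW[OF w3])
    from z show "\<exists>w4. le w3 w4 \<and> (\<exists>A. D w4 A \<and> (\<exists>w5. le w4 w5 \<and> (\<exists>a. D w5 a \<and> a \<in> exts A)) \<and>
      (\<forall>w5. le w4 w5 \<longrightarrow> (\<forall>a. D w5 a \<longrightarrow> (a \<in> exts A \<longleftrightarrow> obj es z a))))"
    proof
      assume "z \<in> exts IV"
      then obtain x where x: "x \<in> elts IDX" "z = lX x" unfolding I by blast
      show ?thesis unfolding x(2) by (rule goods_set[OF WW3 x(1)])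
    next
      assume "z \<in> exts YV"
      then obtain y where y: "y \<in> elts PT" "z = lY y" unfolding Y by blast
      show ?thesis unfolding y(2) by (rule socks_set[OF WW3 y(1)])
    qed
  qed
  moreover have "Q3 le D es w YV" unfolding Q3_def
  proof (intro allI impI)
    fix y s1 s2 s3 assume "y \<in> exts YV" and o: "obj es y s1" "obj es y s2" "obj es y s3"
    then obtain y' where y': "y' \<in> elts PT" "y = lY y'" unfolding Y by blast
    obtain b1 b2 b3 where "s1 = sk y' b1" "s2 = sk y' b2" "s3 = sk y' b3"
      using o unfolding y'(2) obj_lY[OF y'(1)] by blast
    then show "s1 = s2 \<or> s1 = s3 \<or> s2 = s3" by auto
  qed
  moreover have "Q4 le D es w IV YV" unfolding Q4_def
  proof (intro allI impI)
    fix x a y s s' assume "x \<in> exts IV" "obj es x a" "y \<in> exts YV" and s: "s \<in> exts a" "s' \<in> exts a" "obj es y s" "obj es y s'"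
    then obtain x' y' where x': "x' \<in> elts IDX" "x = lX x'" and y': "y' \<in> elts PT" "y = lY y'" unfolding I Y by blast
    obtain f where f: "gset x' f" "a = gd x' f" using \<open>obj es x a\<close> unfolding x'(2) obj_lX[OF x'(1)] by blast
    obtain b b' where b: "s = sk y' b" "s' = sk y' b'" using s(3,4) unfolding y'(2) obj_lY[OF y'(1)] by blast
    show "s = s'" using s(1,2) unfolding b f(2) sock_in_good[OF x'(1) f(1) y'(1)] by simp
  qed
  moreover have "Q5 le D es w IV YV" unfolding Q5_def
  proof (intro allI impI)
    fix w3 r assume w3: "le w w3" "D w3 r"
    have WW3: "WW w3" and r3: "le w3 w3" using le_WW[OF w3(1)] le_rfl by blast+
    obtain x1 x2 where x: "x1 \<in> elts IDX" "x2 \<in> elts IDX"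
      and h: "\<forall>w'. le w3 w' \<longrightarrow> (\<forall>a1 a2. D w' a1 \<longrightarrow> D w' a2 \<longrightarrow> obj es (lX x1) a1 \<longrightarrow> obj es (lX x2) a2 \<longrightarrow>
      (\<exists>y\<in>elts PT. \<exists>s1 s2. s1 \<in> exts a1 \<and> s2 \<in> exts a2 \<and> obj es (lY y) s1 \<and> obj es (lY y) s2 \<and>
      \<not> ((rel le D es w' r (lX x1) (lY y) \<longleftrightarrow> rel le D es w' r (lX x2) (lY y)) \<longleftrightarrow> s1 = s2)))"
      using incompact_goods[OF WW3 w3(2)] by (elim bexE)
    have xI: "lX x1 \<in> exts IV" "lX x2 \<in> exts IV" unfolding I using x by blast+
    show "\<exists>w4. le w3 w4 \<and> (\<exists>x1. D w4 x1 \<and> x1 \<in> exts IV \<and>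
      (\<exists>w5. le w4 w5 \<and> (\<exists>x2. D w5 x2 \<and> x2 \<in> exts IV \<and> (\<forall>w6. le w5 w6 \<longrightarrow> (\<forall>a1. D w6 a1 \<longrightarrow> (\<forall>w7. le w6 w7 \<longrightarrow> (\<forall>a2. D w7 a2 \<longrightarrow>
      obj es x1 a1 \<longrightarrow> obj es x2 a2 \<longrightarrow> (\<exists>w8. le w7 w8 \<and> (\<exists>y. D w8 y \<and> y \<in> exts YV \<and> (\<exists>w9. le w8 w9 \<and> (\<exists>s1. D w9 s1 \<and>
        (\<exists>w10. le w9 w10 \<and> (\<exists>s2. D w10 s2 \<and> s1 \<in> exts a1 \<and> s2 \<in> exts a2 \<and> obj es y s1 \<and> obj es y s2 \<and>
          \<not> ((rel le D es w10 r x1 y \<longleftrightarrow> rel le D es w10 r x2 y) \<longleftrightarrow> s1 = s2))))))))))))))"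
    proof (rule exI[of _ w3], rule conjI[OF r3], rule exI[of _ "lX x1"], rule conjI[OF D_labels(1)[OF WW3 x(1)]],
        rule conjI[OF xI(1)], rule exI[of _ w3], rule conjI[OF r3], rule exI[of _ "lX x2"],
        rule conjI[OF D_labels(1)[OF WW3 x(2)]], rule conjI[OF xI(2)], intro allI impI)
      fix w6 a1 w7 a2 assume a: "le w3 w6" "D w6 a1" "le w6 w7" "D w7 a2" "obj es (lX x1) a1" "obj es (lX x2) a2"
      have l7: "le w3 w7" "le w7 w7" "WW w7" using le_trans[OF a(1,3)] le_WW[OF a(3)] le_rfl by blast+
      have D1: "D w7 a1" by (rule le_D[OF a(3,2)])
      obtain y s1 s2 where y: "y \<in> elts PT" "s1 \<in> exts a1" "s2 \<in> exts a2" "obj es (lY y) s1" "obj es (lY y) s2"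
        "\<not> ((rel le D es w7 r (lX x1) (lY y) \<longleftrightarrow> rel le D es w7 r (lX x2) (lY y)) \<longleftrightarrow> s1 = s2)"
        using mp[OF mp[OF mp[OF mp[OF spec[OF spec[OF mp[OF spec[OF h] l7(1)]]] D1] a(4)] a(5)] a(6)] by (elim bexE exE conjE)
      have yY: "lY y \<in> exts YV" unfolding Y using y(1) by blast
      show "\<exists>w8. le w7 w8 \<and> (\<exists>y. D w8 y \<and> y \<in> exts YV \<and> (\<exists>w9. le w8 w9 \<and> (\<exists>s1. D w9 s1 \<and>
        (\<exists>w10. le w9 w10 \<and> (\<exists>s2. D w10 s2 \<and> s1 \<in> exts a1 \<and> s2 \<in> exts a2 \<and> obj es y s1 \<and> obj es y s2 \<and>
          \<not> ((rel le D es w10 r (lX x1) y \<longleftrightarrow> rel le D es w10 r (lX x2) y) \<longleftrightarrow> s1 = s2))))))"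
        by (rule exI[of _ w7], rule conjI[OF l7(2)], rule exI[of _ "lY y"], rule conjI[OF D_labels(2)[OF l7(3) y(1)]],
          rule conjI[OF yY], rule exI[of _ w7], rule conjI[OF l7(2)], rule exI[of _ s1], rule conjI[OF D_trans[OF D1 y(2)]],
          rule exI[of _ w7], rule conjI[OF l7(2)], rule exI[of _ s2], rule conjI[OF D_trans[OF a(4) y(3)]], intro conjI y(2-6))
    qed
  qed
  ultimately have Q: "Q1 le D es w IV YV \<and> Q2 le D es w IV YV \<and> Q3 le D es w YV \<and> Q4 le D es w IV YV \<and> Q5 le D es w IV YV"
    by (intro conjI)
  note l = le_rfl[OF assms] and D = D_IV_YV[OF assms]
  show ?thesis unfolding ks_Psi
    by (rule exI[of _ w], rule conjI[OF l], rule exI[of _ IV], rule conjI[OF D(1)], rule exI[of _ w], rule conjI[OF l],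
      rule exI[of _ YV], rule conjI[OF D(2) Q])
qed

lemma ZC_does_not_prove: "\<not> provable L ZC (\<^bold>\<not> Psi)"
proof
  assume p: "provable L ZC (\<^bold>\<not> Psi)"
  obtain w where w: "WW w" using base_world by blast
  have "tr w (\<lambda>_. IV) (\<^bold>\<not> Psi)" by (rule ZC_sound[OF p w]) (rule D_IV_YV(1)[OF w])
  then show False using tr_Psi[OF w, of "\<lambda>_. IV"] by (simp only: ksat.simps simp_thms)
qed

end

theorem theorem1:
  assumes "consistent L_mem ZF"
  shows "\<exists>\<phi>. \<phi> \<in> L_mem \<and> sentence \<phi> \<and> provable L_mem_j ZC_GC \<phi> \<and> \<not> provable L_mem ZC \<phi>"
proof -
  obtain E where "Vmodel E" using Vmodel_exists[OF assms] by blast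
  then obtain IDX PT LV XX hi PH where "coherence E IDX PT LV XX hi PH" using Vmodel.coherence_exists by blast
  then have "\<not> provable L_mem ZC (\<^bold>\<not> Psi)" by (rule coherence.ZC_does_not_prove)
  moreover have "(\<^bold>\<not> Psi) \<in> L_mem" "sentence (\<^bold>\<not> Psi)" using Psi_syntax by (simp_all add: L_mem_def sentence_def)
  ultimately show ?thesis using ZC_GC_proves by blast
qed

end
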